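(* Let $\mathcal{E}$ be a regular ($\mathsf{Pos}$-enriched) category and let $F\colon\mathcal{E}\to\mathcal{F}$ be a regular functor with $\mathcal{F}$ an exact ($\mathsf{Pos}$-enriched) category. Then there is a unique (up to isomorphism) regular functor $\overline{F}\colon\mathcal{E}_{ex/reg}\to\mathcal{F}$ such that $\overline{F}\circ\Gamma\cong F$, where $\Gamma\colon\mathcal{E}\to\mathcal{E}_{ex/reg}$ is the canonical functor.
   Context: All categories and functors are enriched over the cartesian closed category $\mathsf{Pos}$ of posets and monotone maps: each hom-set is partially ordered, composition is monotone in each variable, functors preserve the order on morphisms. Limits are weighted ($\mathsf{Pos}$-enriched); in particular the projections of products and pullbacks are jointly order-monomorphic, where a family $(p_i)$ with common domain is jointly order-monomorphic if $p_iu\le p_iv$ for all $i$ implies $u\le v$. A morphism $m\colon X\to Y$ is an $\mathsf{ff}$-morphism if $mf\le mg$ implies $f\le g$ for all $f,g\colon Z\to X$. A morphism $e\colon A\to B$ of a category $\mathcal{C}$ is an $\mathsf{so}$-morphism if for every $\mathsf{ff}$-morphism $m\colon X\to Y$ the canonical square from $\mathcal{C}(B,X)$ to $\mathcal{C}(A,X)$, $\mathcal{C}(B,Y)$ over $\mathcal{C}(A,Y)$ (composing with $e$ and $m$) is a pullback in $\mathsf{Pos}$. The comma object $f/g$ of $f\colon X\to Z$, $g\colon Y\to Z$ is given by jointly order-monomorphic $c_0\colon f/g\to X$, $c_1\colon f/g\to Y$ with $fc_0\le gc_1$, such that any $u_0,u_1$ with $fu_0\le gu_1$ factor as $u_0=c_0u$,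 $u_1=c_1u$. A category is regular if it has all finite weighted limits, every morphism factors as an $\mathsf{so}$-morphism followed by an $\mathsf{ff}$-morphism, and $\mathsf{so}$-morphisms are stable under pullback. A regular functor between regular categories is a functor preserving finite limits and $\mathsf{so}$-morphisms. A relation $R\colon X\looparrowright Y$ in a regular category is a subobject of $X\times Y$ represented by an $\mathsf{ff}$-morphism $\langle r_0,r_1\rangle\colon R\rightarrowtail X\times Y$; relations are ordered by inclusion. For $x\colon A\to X$, $y\colon A\to Y$ write $(x,y)\in_A R$ if $\langle x,y\rangle$ factors through $\langle r_0,r_1\rangle$. The composite $SR\colon X\looparrowright Z$ of $R\colon X\looparrowright Y$ and $S\colon Y\looparrowright Z$ is the $\mathsf{ff}$-part of the $(\mathsf{so},\mathsf{ff})$-factorization of $\langle r_0t_0,s_1t_1\rangle$, where $(T,t_0,t_1)$ is the pullback of $r_1$ and $s_0$. $R$ is weakening-closed if $x'\le x$, $(x,y)\in_A R$, $y\le y'$ imply $(x',y')\in_A R$. $I_X:=1_X/1_X$. For $f\colon X\to Y$, $f_*:=f/1_Y\colon X\looparrowright Y$, i.e. $(x,y)\in_A f_*\iff fx\le y$. A congruence on $X$ is a weakening-closed relation $E\colon X\looparrowright X$ that is reflexive and transitive (equivalently $EE\subseteq E$ and $I_X\subseteq E$). It is effective if $E=f/f$ for some morphism $f\colon X\to Y$. A regular category is exact if every congruence in it is effective. $Q_w(\mathcal{E})$ is the locally posetal bicategory with objects the pairs $(X,E)$, $E$ a congruence on $X\in\mathcal{E}$; morphisms $(X,E)\to(Y,F)$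 the relations $\Phi\colon X\looparrowright Y$ in $\mathcal{E}$ with $F\Phi E=\Phi$, ordered by inclusion; composition that of relations; identity on $(X,E)$ the relation $E$. The category $\mathcal{E}_{ex/reg}$ has the same objects; its morphisms $(X,E)\to(Y,F)$ are the morphisms $R_*\colon(X,E)\to(Y,F)$ of $Q_w(\mathcal{E})$ having a right adjoint, i.e. for which there is $R^*\colon(Y,F)\to(X,E)$ in $Q_w(\mathcal{E})$ with $R^*R_*\supseteq E$ and $R_*R^*\subseteq F$; the order is $R_*\le S_*:\iff R_*\supseteq S_*$. The functor $\Gamma\colon\mathcal{E}\to\mathcal{E}_{ex/reg}$ sends $X$ to $(X,I_X)$ and $f\colon X\to Y$ to $f_*$. (The category $\mathcal{E}_{ex/reg}$ is regular and exact, and $\Gamma$ is a regular functor.) *)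

theory Defs
  imports Main
begin

section \<open>Categories enriched over posets\<close>

definition poset_on :: "'a set \<Rightarrow> ('a \<Rightarrow> 'a \<Rightarrow> bool) \<Rightarrow> bool" where
  "poset_on A le \<longleftrightarrow> partial_order_on A {(x, y). x \<in> A \<and> y \<in> A \<and> le x y}"

definition order_iso_betw ::
    "('a \<Rightarrow> 'b) \<Rightarrow> 'a set \<Rightarrow> ('a \<Rightarrow> 'a \<Rightarrow> bool) \<Rightarrow> 'b set \<Rightarrow> ('b \<Rightarrow> 'b \<Rightarrow> bool) \<Rightarrow> bool" where
  "order_iso_betw f A leA B leB \<longleftrightarrow>
     bij_betw f A B \<and> (\<forall>x\<in>A. \<forall>y\<in>A. leA x y \<longleftrightarrow> leB (f x) (f y))"

text \<open>The order \<open>Le\<close> is only meaningful between parallel arrows, and \<open>Comp\<close> only for composable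
  ones; \<open>g \<cdot> f\<close> is \<open>f\<close> followed by \<open>g\<close>.\<close>

record ('o, 'm) pcat =
  Obj :: "'o set"
  Arr :: "'m set"
  Dom :: "'m \<Rightarrow> 'o"
  Cod :: "'m \<Rightarrow> 'o"
  Ident :: "'o \<Rightarrow> 'm"
  Comp :: "'m \<Rightarrow> 'm \<Rightarrow> 'm"  (infixr "\<cdot>\<index>" 70)
  Le :: "'m \<Rightarrow> 'm \<Rightarrow> bool"  (infix "\<sqsubseteq>\<index>" 50)

definition hom :: "('o, 'm) pcat \<Rightarrow> 'o \<Rightarrow> 'o \<Rightarrow> 'm set" where
  "hom C X Y = {f \<in> Arr C. Dom C f = X \<and> Cod C f = Y}"

locale pos_category =
  fixes C :: "('o, 'm) pcat" (structure)
  assumes dom_obj: "f \<in> Arr C \<Longrightarrow> Dom C f \<in> Obj C"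
    and cod_obj: "f \<in> Arr C \<Longrightarrow> Cod C f \<in> Obj C"
    and ident_hom: "X \<in> Obj C \<Longrightarrow> Ident C X \<in> hom C X X"
    and comp_hom: "\<lbrakk>f \<in> hom C X Y; g \<in> hom C Y Z\<rbrakk> \<Longrightarrow> g \<cdot> f \<in> hom C X Z"
    and comp_ident_right: "f \<in> hom C X Y \<Longrightarrow> f \<cdot> Ident C X = f"
    and comp_ident_left: "f \<in> hom C X Y \<Longrightarrow> Ident C Y \<cdot> f = f"
    and comp_assoc: "\<lbrakk>f \<in> hom C W X; g \<in> hom C X Y; h \<in> hom C Y Z\<rbrakk> \<Longrightarrow> (h \<cdot> g) \<cdot> f = h \<cdot> (g \<cdot> f)"
    and hom_poset: "poset_on (hom C X Y) (Le C)"
    and comp_mono: "\<lbrakk>f \<in> hom C X Y; f' \<in> hom C X Y; g \<in> hom C Y Z; g' \<in> hom C Y Z; f \<sqsubseteq> f'; g \<sqsubseteq> g'\<rbrakk>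
          \<Longrightarrow> g \<cdot> f \<sqsubseteq> g' \<cdot> f'"

record ('o, 'm, 'p, 'n) pfun =
  FObj :: "'o \<Rightarrow> 'p"
  FArr :: "'m \<Rightarrow> 'n"

definition pos_functor :: "('o, 'm) pcat \<Rightarrow> ('p, 'n) pcat \<Rightarrow> ('o, 'm, 'p, 'n) pfun \<Rightarrow> bool" where
  "pos_functor C D F \<longleftrightarrow>
     (\<forall>X\<in>Obj C. FObj F X \<in> Obj D) \<and>
     (\<forall>X Y. \<forall>f\<in>hom C X Y. FArr F f \<in> hom D (FObj F X) (FObj F Y)) \<and>
     (\<forall>X\<in>Obj C. FArr F (Ident C X) = Ident D (FObj F X)) \<and>
     (\<forall>X Y Z. \<forall>f\<in>hom C X Y. \<forall>g\<in>hom C Y Z.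
        FArr F (g \<cdot>\<^bsub>C\<^esub> f) = FArr F g \<cdot>\<^bsub>D\<^esub> FArr F f) \<and>
     (\<forall>X Y. monotone_on (hom C X Y) (Le C) (Le D) (FArr F))"

definition fcomp :: "('p, 'n, 'q, 'k) pfun \<Rightarrow> ('o, 'm, 'p, 'n) pfun \<Rightarrow> ('o, 'm, 'q, 'k) pfun"
    (infixl "\<circ>\<^sub>F" 55) where
  "G \<circ>\<^sub>F F = \<lparr>FObj = FObj G \<circ> FObj F, FArr = FArr G \<circ> FArr F\<rparr>"

definition is_iso :: "('o, 'm) pcat \<Rightarrow> 'm \<Rightarrow> bool" where
  "is_iso C f \<longleftrightarrow> f \<in> Arr C \<and>
     (\<exists>g\<in>hom C (Cod C f) (Dom C f).
        g \<cdot>\<^bsub>C\<^esub> f = Ident C (Dom C f) \<and> f \<cdot>\<^bsub>C\<^esub> g = Ident C (Cod C f))"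

text \<open>Between \<open>Pos\<close>-functors, ordinary naturality is already \<open>Pos\<close>-naturality.\<close>

definition functors_iso ::
    "('o, 'm) pcat \<Rightarrow> ('p, 'n) pcat \<Rightarrow> ('o, 'm, 'p, 'n) pfun \<Rightarrow> ('o, 'm, 'p, 'n) pfun \<Rightarrow> bool" where
  "functors_iso C D F G \<longleftrightarrow>
     (\<exists>\<eta>. (\<forall>X\<in>Obj C. \<eta> X \<in> hom D (FObj F X) (FObj G X) \<and> is_iso D (\<eta> X)) \<and>
          (\<forall>X Y. \<forall>f\<in>hom C X Y. \<eta> Y \<cdot>\<^bsub>D\<^esub> FArr F f = FArr G f \<cdot>\<^bsub>D\<^esub> \<eta> X))"


section \<open>Finite weighted limits\<close>

record ('j, 'k, 'w) weight =
  WEl :: "'j \<Rightarrow> 'w set"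
  WLe :: "'j \<Rightarrow> 'w \<Rightarrow> 'w \<Rightarrow> bool"
  WAct :: "'k \<Rightarrow> 'w \<Rightarrow> 'w"

text \<open>\<open>W\<close> is a \<open>Pos\<close>-functor from \<open>J\<close> to the \<open>Pos\<close>-category of posets.\<close>

definition pos_weight :: "('j, 'k) pcat \<Rightarrow> ('j, 'k, 'w) weight \<Rightarrow> bool" where
  "pos_weight J W \<longleftrightarrow>
     (\<forall>j\<in>Obj J. poset_on (WEl W j) (WLe W j)) \<and>
     (\<forall>i j. \<forall>a\<in>hom J i j. WAct W a ` WEl W i \<subseteq> WEl W j \<and>
        monotone_on (WEl W i) (WLe W i) (WLe W j) (WAct W a)) \<and>
     (\<forall>j\<in>Obj J. \<forall>x\<in>WEl W j. WAct W (Ident J j) x = x) \<and>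
     (\<forall>i j k. \<forall>a\<in>hom J i j. \<forall>b\<in>hom J j k. \<forall>x\<in>WEl W i.
        WAct W (b \<cdot>\<^bsub>J\<^esub> a) x = WAct W b (WAct W a x)) \<and>
     (\<forall>i j. \<forall>a\<in>hom J i j. \<forall>b\<in>hom J i j. \<forall>x\<in>WEl W i.
        a \<sqsubseteq>\<^bsub>J\<^esub> b \<longrightarrow> WLe W j (WAct W a x) (WAct W b x))"

definition finite_weight :: "('j, 'k) pcat \<Rightarrow> ('j, 'k, 'w) weight \<Rightarrow> bool" where
  "finite_weight J W \<longleftrightarrow> pos_category J \<and> pos_weight J W \<and>
     finite (Obj J) \<and> finite (Arr J) \<and> (\<forall>j\<in>Obj J. finite (WEl W j))"

text \<open>A \<open>W\<close>-weighted cylinder with apex \<open>A\<close> is a \<open>Pos\<close>-natural transformation from \<open>W\<close> to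
  \<open>C(A, D -)\<close>.\<close>

definition cylinder :: "('j, 'k) pcat \<Rightarrow> ('j, 'k, 'w) weight \<Rightarrow> ('o, 'm) pcat \<Rightarrow>
    ('j, 'k, 'o, 'm) pfun \<Rightarrow> 'o \<Rightarrow> ('j \<Rightarrow> 'w \<Rightarrow> 'm) \<Rightarrow> bool" where
  "cylinder J W C D A l \<longleftrightarrow> A \<in> Obj C \<and>
     (\<forall>j\<in>Obj J. (\<forall>x\<in>WEl W j. l j x \<in> hom C A (FObj D j)) \<and>
        monotone_on (WEl W j) (WLe W j) (Le C) (l j)) \<and>
     (\<forall>i j. \<forall>a\<in>hom J i j. \<forall>x\<in>WEl W i. FArr D a \<cdot>\<^bsub>C\<^esub> l i x = l j (WAct W a x))"

text \<open>The last two conditions say that \<open>u \<mapsto> (l j x \<cdot> u)\<close> is, for every \<open>A\<close>, an isomorphism of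
  posets from \<open>C(A, L)\<close> to the cylinders with apex \<open>A\<close>.\<close>

definition weighted_limit :: "('j, 'k) pcat \<Rightarrow> ('j, 'k, 'w) weight \<Rightarrow> ('o, 'm) pcat \<Rightarrow>
    ('j, 'k, 'o, 'm) pfun \<Rightarrow> 'o \<Rightarrow> ('j \<Rightarrow> 'w \<Rightarrow> 'm) \<Rightarrow> bool" where
  "weighted_limit J W C D L l \<longleftrightarrow> cylinder J W C D L l \<and>
     (\<forall>A c. cylinder J W C D A c \<longrightarrow>
        (\<exists>u\<in>hom C A L. \<forall>j\<in>Obj J. \<forall>x\<in>WEl W j. l j x \<cdot>\<^bsub>C\<^esub> u = c j x)) \<and>
     (\<forall>A. \<forall>u\<in>hom C A L. \<forall>v\<in>hom C A L.
        (\<forall>j\<in>Obj J. \<forall>x\<in>WEl W j. l j x \<cdot>\<^bsub>C\<^esub> u \<sqsubseteq>\<^bsub>C\<^esub> l j x \<cdot>\<^bsub>C\<^esub> v) \<longrightarrow> u \<sqsubseteq>\<^bsub>C\<^esub> v)"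

text \<open>Every finite weight is isomorphic to one whose objects, arrows and elements are natural
  numbers, so nothing is lost by quantifying over such weights only.\<close>

definition has_finite_limits :: "('o, 'm) pcat \<Rightarrow> bool" where
  "has_finite_limits C \<longleftrightarrow>
     (\<forall>(J :: (nat, nat) pcat) (W :: (nat, nat, nat) weight) D.
        finite_weight J W \<and> pos_functor J C D \<longrightarrow> (\<exists>L l. weighted_limit J W C D L l))"

definition preserves_finite_limits ::
    "('o, 'm) pcat \<Rightarrow> ('p, 'n) pcat \<Rightarrow> ('o, 'm, 'p, 'n) pfun \<Rightarrow> bool" where
  "preserves_finite_limits C C' F \<longleftrightarrow>
     (\<forall>(J :: (nat, nat) pcat) (W :: (nat, nat, nat) weight) D L l.
        finite_weight J W \<and> pos_functor J C D \<and> weighted_limit J W C D L l \<longrightarrow>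
        weighted_limit J W C' (F \<circ>\<^sub>F D) (FObj F L) (\<lambda>j x. FArr F (l j x)))"

definition jointly_order_mono :: "('o, 'm) pcat \<Rightarrow> 'm \<Rightarrow> 'm \<Rightarrow> bool" where
  "jointly_order_mono C p q \<longleftrightarrow>
     (\<forall>A. \<forall>u\<in>hom C A (Dom C p). \<forall>v\<in>hom C A (Dom C p).
        p \<cdot>\<^bsub>C\<^esub> u \<sqsubseteq>\<^bsub>C\<^esub> p \<cdot>\<^bsub>C\<^esub> v \<and> q \<cdot>\<^bsub>C\<^esub> u \<sqsubseteq>\<^bsub>C\<^esub> q \<cdot>\<^bsub>C\<^esub> v \<longrightarrow> u \<sqsubseteq>\<^bsub>C\<^esub> v)"

definition is_product :: "('o, 'm) pcat \<Rightarrow> 'o \<Rightarrow> 'o \<Rightarrow> 'm \<Rightarrow> 'm \<Rightarrow> bool" where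
  "is_product C X Y p q \<longleftrightarrow>
     p \<in> hom C (Dom C p) X \<and> q \<in> hom C (Dom C p) Y \<and> jointly_order_mono C p q \<and>
     (\<forall>A. \<forall>x\<in>hom C A X. \<forall>y\<in>hom C A Y.
        \<exists>u\<in>hom C A (Dom C p). p \<cdot>\<^bsub>C\<^esub> u = x \<and> q \<cdot>\<^bsub>C\<^esub> u = y)"

definition is_pullback :: "('o, 'm) pcat \<Rightarrow> 'm \<Rightarrow> 'm \<Rightarrow> 'm \<Rightarrow> 'm \<Rightarrow> bool" where
  "is_pullback C f g p q \<longleftrightarrow>
     p \<in> hom C (Dom C p) (Dom C f) \<and> q \<in> hom C (Dom C p) (Dom C g) \<and> jointly_order_mono C p q \<and>
     f \<cdot>\<^bsub>C\<^esub> p = g \<cdot>\<^bsub>C\<^esub> q \<and>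
     (\<forall>A. \<forall>x\<in>hom C A (Dom C f). \<forall>y\<in>hom C A (Dom C g). f \<cdot>\<^bsub>C\<^esub> x = g \<cdot>\<^bsub>C\<^esub> y \<longrightarrow>
        (\<exists>u\<in>hom C A (Dom C p). p \<cdot>\<^bsub>C\<^esub> u = x \<and> q \<cdot>\<^bsub>C\<^esub> u = y))"

definition is_comma :: "('o, 'm) pcat \<Rightarrow> 'm \<Rightarrow> 'm \<Rightarrow> 'm \<Rightarrow> 'm \<Rightarrow> bool" where
  "is_comma C f g p q \<longleftrightarrow>
     p \<in> hom C (Dom C p) (Dom C f) \<and> q \<in> hom C (Dom C p) (Dom C g) \<and> jointly_order_mono C p q \<and>
     f \<cdot>\<^bsub>C\<^esub> p \<sqsubseteq>\<^bsub>C\<^esub> g \<cdot>\<^bsub>C\<^esub> q \<and>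
     (\<forall>A. \<forall>x\<in>hom C A (Dom C f). \<forall>y\<in>hom C A (Dom C g). f \<cdot>\<^bsub>C\<^esub> x \<sqsubseteq>\<^bsub>C\<^esub> g \<cdot>\<^bsub>C\<^esub> y \<longrightarrow>
        (\<exists>u\<in>hom C A (Dom C p). p \<cdot>\<^bsub>C\<^esub> u = x \<and> q \<cdot>\<^bsub>C\<^esub> u = y))"


section \<open>Regular categories and regular functors\<close>

definition ff_mor :: "('o, 'm) pcat \<Rightarrow> 'm \<Rightarrow> bool" where
  "ff_mor C m \<longleftrightarrow> m \<in> Arr C \<and>
     (\<forall>Z. \<forall>f\<in>hom C Z (Dom C m). \<forall>g\<in>hom C Z (Dom C m).
        m \<cdot>\<^bsub>C\<^esub> f \<sqsubseteq>\<^bsub>C\<^esub> m \<cdot>\<^bsub>C\<^esub> g \<longrightarrow> f \<sqsubseteq>\<^bsub>C\<^esub> g)"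

text \<open>The canonical map from \<open>C(B, X)\<close> is an isomorphism onto the pullback
  \<open>{(u, v). m \<cdot> u = v \<cdot> e}\<close> in \<open>Pos\<close>, ordered componentwise.\<close>

definition so_mor :: "('o, 'm) pcat \<Rightarrow> 'm \<Rightarrow> bool" where
  "so_mor C e \<longleftrightarrow> e \<in> Arr C \<and>
     (\<forall>m. ff_mor C m \<longrightarrow>
        order_iso_betw (\<lambda>d. (d \<cdot>\<^bsub>C\<^esub> e, m \<cdot>\<^bsub>C\<^esub> d))
          (hom C (Cod C e) (Dom C m)) (Le C)
          {(u, v). u \<in> hom C (Dom C e) (Dom C m) \<and> v \<in> hom C (Cod C e) (Cod C m) \<and>
                   m \<cdot>\<^bsub>C\<^esub> u = v \<cdot>\<^bsub>C\<^esub> e}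
          (\<lambda>(u, v) (u', v'). u \<sqsubseteq>\<^bsub>C\<^esub> u' \<and> v \<sqsubseteq>\<^bsub>C\<^esub> v'))"

definition regular_cat :: "('o, 'm) pcat \<Rightarrow> bool" where
  "regular_cat C \<longleftrightarrow> pos_category C \<and> has_finite_limits C \<and>
     (\<forall>f\<in>Arr C. \<exists>e m. so_mor C e \<and> ff_mor C m \<and> Cod C e = Dom C m \<and> f = m \<cdot>\<^bsub>C\<^esub> e) \<and>
     (\<forall>e f p q. so_mor C e \<and> f \<in> Arr C \<and> Cod C f = Cod C e \<and> is_pullback C e f p q \<longrightarrow> so_mor C q)"

text \<open>Regularity of the two categories is not part of this predicate.\<close>

definition regular_functor ::
    "('o, 'm) pcat \<Rightarrow> ('p, 'n) pcat \<Rightarrow> ('o, 'm, 'p, 'n) pfun \<Rightarrow> bool" where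
  "regular_functor C D F \<longleftrightarrow> pos_functor C D F \<and> preserves_finite_limits C D F \<and>
     (\<forall>e. so_mor C e \<longrightarrow> so_mor D (FArr F e))"


section \<open>Relations\<close>

definition proj :: "('o, 'm) pcat \<Rightarrow> 'o \<Rightarrow> 'o \<Rightarrow> 'm \<times> 'm" where
  "proj C X Y = (SOME (p, q). is_product C X Y p q)"

abbreviation proj0 :: "('o, 'm) pcat \<Rightarrow> 'o \<Rightarrow> 'o \<Rightarrow> 'm" where
  "proj0 C X Y \<equiv> fst (proj C X Y)"

abbreviation proj1 :: "('o, 'm) pcat \<Rightarrow> 'o \<Rightarrow> 'o \<Rightarrow> 'm" where
  "proj1 C X Y \<equiv> snd (proj C X Y)"

definition prod_obj :: "('o, 'm) pcat \<Rightarrow> 'o \<Rightarrow> 'o \<Rightarrow> 'o" where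
  "prod_obj C X Y = Dom C (proj0 C X Y)"

definition pairing :: "('o, 'm) pcat \<Rightarrow> 'm \<Rightarrow> 'm \<Rightarrow> 'm" where
  "pairing C x y = (THE u. u \<in> hom C (Dom C x) (prod_obj C (Cod C x) (Cod C y)) \<and>
     proj0 C (Cod C x) (Cod C y) \<cdot>\<^bsub>C\<^esub> u = x \<and> proj1 C (Cod C x) (Cod C y) \<cdot>\<^bsub>C\<^esub> u = y)"

definition factors_through :: "('o, 'm) pcat \<Rightarrow> 'm \<Rightarrow> 'm \<Rightarrow> bool" where
  "factors_through C n m \<longleftrightarrow> (\<exists>u\<in>hom C (Dom C n) (Dom C m). n = m \<cdot>\<^bsub>C\<^esub> u)"

text \<open>A subobject of \<open>Z\<close> is an equivalence class of \<open>ff\<close>-morphisms into \<open>Z\<close>.\<close>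

definition sub_class :: "('o, 'm) pcat \<Rightarrow> 'm \<Rightarrow> 'm set" where
  "sub_class C m = {n. ff_mor C n \<and> Cod C n = Cod C m \<and>
     factors_through C n m \<and> factors_through C m n}"

definition subobjects :: "('o, 'm) pcat \<Rightarrow> 'o \<Rightarrow> 'm set set" where
  "subobjects C Z = {sub_class C m | m. ff_mor C m \<and> Cod C m = Z}"

definition relations :: "('o, 'm) pcat \<Rightarrow> 'o \<Rightarrow> 'o \<Rightarrow> 'm set set" where
  "relations C X Y = subobjects C (prod_obj C X Y)"

definition rel_incl :: "('o, 'm) pcat \<Rightarrow> 'm set \<Rightarrow> 'm set \<Rightarrow> bool" where
  "rel_incl C R S \<longleftrightarrow> (\<exists>m\<in>R. \<exists>n\<in>S. factors_through C m n)"

definition in_rel :: "('o, 'm) pcat \<Rightarrow> 'm \<Rightarrow> 'm \<Rightarrow> 'm set \<Rightarrow> bool" where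
  "in_rel C x y R \<longleftrightarrow> (\<exists>m\<in>R. factors_through C (pairing C x y) m)"

text \<open>\<open>rel_comp C X Y Z S R\<close> is \<open>SR\<close> for \<open>R\<close> from \<open>X\<close> to \<open>Y\<close> and \<open>S\<close> from \<open>Y\<close> to \<open>Z\<close>. Representatives,
  pullbacks and factorizations are unique up to isomorphism, so ranging over all of them yields
  precisely one equivalence class.\<close>

definition rel_comp :: "('o, 'm) pcat \<Rightarrow> 'o \<Rightarrow> 'o \<Rightarrow> 'o \<Rightarrow> 'm set \<Rightarrow> 'm set \<Rightarrow> 'm set" where
  "rel_comp C X Y Z S R =
     {n. \<exists>r\<in>R. \<exists>s\<in>S. \<exists>t0 t1 e.
        is_pullback C (proj1 C X Y \<cdot>\<^bsub>C\<^esub> r) (proj0 C Y Z \<cdot>\<^bsub>C\<^esub> s) t0 t1 \<and>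
        so_mor C e \<and> ff_mor C n \<and> Cod C e = Dom C n \<and>
        n \<cdot>\<^bsub>C\<^esub> e = pairing C ((proj0 C X Y \<cdot>\<^bsub>C\<^esub> r) \<cdot>\<^bsub>C\<^esub> t0) ((proj1 C Y Z \<cdot>\<^bsub>C\<^esub> s) \<cdot>\<^bsub>C\<^esub> t1)}"

definition weakening_closed :: "('o, 'm) pcat \<Rightarrow> 'o \<Rightarrow> 'o \<Rightarrow> 'm set \<Rightarrow> bool" where
  "weakening_closed C X Y R \<longleftrightarrow>
     (\<forall>A. \<forall>x\<in>hom C A X. \<forall>x'\<in>hom C A X. \<forall>y\<in>hom C A Y. \<forall>y'\<in>hom C A Y.
        x' \<sqsubseteq>\<^bsub>C\<^esub> x \<and> in_rel C x y R \<and> y \<sqsubseteq>\<^bsub>C\<^esub> y' \<longrightarrow> in_rel C x' y' R)"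

text \<open>The comma object \<open>f/g\<close> as a relation; as for \<open>rel_comp\<close>, this is one equivalence class.\<close>

definition comma_rel :: "('o, 'm) pcat \<Rightarrow> 'm \<Rightarrow> 'm \<Rightarrow> 'm set" where
  "comma_rel C f g = {pairing C c0 c1 | c0 c1. is_comma C f g c0 c1}"

definition ident_rel :: "('o, 'm) pcat \<Rightarrow> 'o \<Rightarrow> 'm set" where
  "ident_rel C X = comma_rel C (Ident C X) (Ident C X)"

definition lower_star :: "('o, 'm) pcat \<Rightarrow> 'm \<Rightarrow> 'm set" where
  "lower_star C f = comma_rel C f (Ident C (Cod C f))"

definition congruence :: "('o, 'm) pcat \<Rightarrow> 'o \<Rightarrow> 'm set \<Rightarrow> bool" where
  "congruence C X E \<longleftrightarrow> E \<in> relations C X X \<and> weakening_closed C X X E \<and>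
     rel_incl C (ident_rel C X) E \<and> rel_incl C (rel_comp C X X X E E) E"

definition effective :: "('o, 'm) pcat \<Rightarrow> 'o \<Rightarrow> 'm set \<Rightarrow> bool" where
  "effective C X E \<longleftrightarrow> (\<exists>f\<in>Arr C. Dom C f = X \<and> E = comma_rel C f f)"

definition exact_cat :: "('o, 'm) pcat \<Rightarrow> bool" where
  "exact_cat C \<longleftrightarrow> regular_cat C \<and>
     (\<forall>X\<in>Obj C. \<forall>E. congruence C X E \<longrightarrow> effective C X E)"


section \<open>The exact completion\<close>

text \<open>A locally posetal bicategory is a \<open>Pos\<close>-enriched category. An arrow is a relation together with
  its source and its target.\<close>

type_synonym ('o, 'm) qobj = "'o \<times> 'm set"
type_synonym ('o, 'm) qarr = "('o, 'm) qobj \<times> 'm set \<times> ('o, 'm) qobj"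

definition Qw :: "('o, 'm) pcat \<Rightarrow> (('o, 'm) qobj, ('o, 'm) qarr) pcat" where
  "Qw C =
     \<lparr>Obj = {(X, E). X \<in> Obj C \<and> congruence C X E},
      Arr = {((X, E), \<Phi>, (Y, F)) | X E \<Phi> Y F.
               X \<in> Obj C \<and> congruence C X E \<and> Y \<in> Obj C \<and> congruence C Y F \<and>
               \<Phi> \<in> relations C X Y \<and> rel_comp C X Y Y F (rel_comp C X X Y \<Phi> E) = \<Phi>},
      Dom = (\<lambda>(a, \<Phi>, b). a),
      Cod = (\<lambda>(a, \<Phi>, b). b),
      Ident = (\<lambda>(X, E). ((X, E), E, (X, E))),
      Comp = (\<lambda>(b, \<Psi>, c) (a, \<Phi>, b'). (a, rel_comp C (fst a) (fst b) (fst c) \<Psi> \<Phi>, c)),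
      Le = (\<lambda>(a, \<Phi>, b) (a', \<Psi>, b'). rel_incl C \<Phi> \<Psi>)\<rparr>"

definition right_adjoint :: "('o, 'm) pcat \<Rightarrow> 'm \<Rightarrow> 'm \<Rightarrow> bool" where
  "right_adjoint Q f g \<longleftrightarrow> g \<in> hom Q (Cod Q f) (Dom Q f) \<and>
     Ident Q (Dom Q f) \<sqsubseteq>\<^bsub>Q\<^esub> g \<cdot>\<^bsub>Q\<^esub> f \<and> f \<cdot>\<^bsub>Q\<^esub> g \<sqsubseteq>\<^bsub>Q\<^esub> Ident Q (Cod Q f)"

text \<open>The order on the hom-sets is opposite to inclusion.\<close>

definition exreg :: "('o, 'm) pcat \<Rightarrow> (('o, 'm) qobj, ('o, 'm) qarr) pcat" where
  "exreg C = (Qw C)\<lparr>Arr := {f \<in> Arr (Qw C). \<exists>g. right_adjoint (Qw C) f g},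
                    Le := (\<lambda>f g. g \<sqsubseteq>\<^bsub>Qw C\<^esub> f)\<rparr>"

definition Gam :: "('o, 'm) pcat \<Rightarrow> ('o, 'm, ('o, 'm) qobj, ('o, 'm) qarr) pfun" where
  "Gam C =
     \<lparr>FObj = (\<lambda>X. (X, ident_rel C X)),
      FArr = (\<lambda>f. ((Dom C f, ident_rel C (Dom C f)), lower_star C f,
                   (Cod C f, ident_rel C (Cod C f))))\<rparr>"

end

theory Submission
  imports Defs
begin

text \<open>Relations in a regular category are handled through their generalized elements. An element of a composite \<open>SR\<close>
  is given locally, that is, after precomposition with an \<open>so\<close>-morphism, and \<open>so\<close>-morphisms are quotients of their
  kernels. A morphism \<open>(X, E) \<rightarrow> (Y, G)\<close> of the exact completion is then a relation \<open>R\<close> with a right adjoint \<open>S\<close> such that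
  locally every \<open>x\<close> has a value \<open>y\<close>, with \<open>R x y\<close> and \<open>S y x\<close>, unique up to \<open>G\<close>.

  The functor \<open>F\<close> carries all this to \<open>D\<close>, where \<open>F E\<close> is effective: \<open>(X, E)\<close> goes to the quotient of \<open>F X\<close> by \<open>F E\<close>, and
  \<open>R\<close> to the map that \<open>F R\<close> induces on the quotients. A cylinder in \<open>D\<close> over the image of a finite diagram of the exact
  completion lifts locally to a tuple of elements of the objects \<open>F X\<^sub>j\<close> that solves a finite system of relations coming
  from \<open>C\<close>, so it factors through \<open>F M\<close> for the generic solution \<open>M\<close> in \<open>C\<close>. As \<open>M\<close> is a cylinder in the exact
  completion, it maps to the given limit. An \<open>so\<close>-morphism of the exact completion is a surjective relation, because it
  factors through the object of its values.

  For uniqueness, \<open>(X, I\<^sub>X) \<rightarrow> (X, E)\<close> is an \<open>so\<close>-morphism whose comma object with itself lies in the image of \<open>\<Gamma>\<close>, so the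
  value of a regular functor at \<open>(X, E)\<close> is determined by its restriction along \<open>\<Gamma>\<close>.\<close>

section \<open>Poset-enriched categories\<close>

text \<open>Limits and \<open>so\<close>-morphisms of \<open>exreg C\<close> are handled through
  their universal properties alone, with the objects \<open>(M, ident_rel C M)\<close> as test
  objects. Weak solutions in \<open>C\<close> are then enough: the mediating morphism in
  \<open>D\<close> is first obtained on a cover only, and it descends because the image of the limit
  cone is jointly order-monic, a property expressible by inclusions of relations in
  \<open>C\<close>, which survive \<open>F\<close>. A relation \<open>R\<close> travels with its
  right adjoint \<open>S\<close> because membership in \<open>R\<close> only bounds the value of
  \<open>x\<close> from above; \<open>R\<close> and \<open>S\<close> together pin it down up to the
  congruence of the target. The order of \<open>exreg C\<close> is opposite to inclusion for the
  same reason: a smaller morphism has more upper bounds. Covers appear even for a single morphism,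
  since a value of \<open>x\<close> need not exist at the stage of \<open>x\<close>. Local arguments
  end by removing a cover: \<open>in_rel_local\<close> for membership, \<open>so_order_epi\<close>
  for inequalities, \<open>so_descent\<close> for the construction of morphisms.\<close>

lemma in_hom_iff [simp]: "f \<in> hom C X Y \<longleftrightarrow> f \<in> Arr C \<and> Dom C f = X \<and> Cod C f = Y"
  by (simp add: hom_def)

context pos_category
begin

declare dom_obj [simp] cod_obj [simp]

lemma ident_arr [simp]:
  assumes "X \<in> Obj C"
  shows "Ident C X \<in> Arr C" "Dom C (Ident C X) = X" "Cod C (Ident C X) = X"
  using ident_hom[OF assms] by auto

lemma comp_arr [simp]:
  assumes "f \<in> Arr C" "g \<in> Arr C" "Cod C f = Dom C g"
  shows "g \<cdot> f \<in> Arr C" "Dom C (g \<cdot> f) = Dom C f" "Cod C (g \<cdot> f) = Cod C g"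
  using comp_hom[of f "Dom C f" "Cod C f" g "Cod C g"] assms by auto

lemma comp_ident [simp]:
  assumes "f \<in> Arr C"
  shows "Dom C f = X \<Longrightarrow> f \<cdot> Ident C X = f" "Cod C f = X \<Longrightarrow> Ident C X \<cdot> f = f"
  using comp_ident_right[of f X "Cod C f"] comp_ident_left[of f "Dom C f" X] assms by auto

lemma assoc [simp]:
  assumes "f \<in> Arr C" "g \<in> Arr C" "h \<in> Arr C" "Cod C f = Dom C g" "Cod C g = Dom C h"
  shows "(h \<cdot> g) \<cdot> f = h \<cdot> (g \<cdot> f)"
  using comp_assoc[of f "Dom C f" "Cod C f" g "Cod C g" h "Cod C h"] assms by auto

text \<open>Composites are normalised to the right, so an equation for \<open>g \<cdot> f\<close> no
  longer matches inside a longer composite; this form makes it applicable there.\<close>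

lemma assoc_eq:
  assumes "g \<cdot> f = k" "f \<in> Arr C" "g \<in> Arr C" "h \<in> Arr C" "Cod C f = Dom C g" "Cod C h = Dom C f"
  shows "g \<cdot> (f \<cdot> h) = k \<cdot> h"
  using assoc[of h f g] assms by simp

lemma le_refl [simp]: "f \<in> Arr C \<Longrightarrow> f \<sqsubseteq> f"
  using hom_poset[of "Dom C f" "Cod C f"]
  by (auto simp: poset_on_def partial_order_on_def preorder_on_def refl_on_def)

lemma le_trans:
  assumes "f \<sqsubseteq> g" "g \<sqsubseteq> h" "f \<in> Arr C" "g \<in> Arr C" "h \<in> Arr C"
    "Dom C g = Dom C f" "Cod C g = Cod C f" "Dom C h = Dom C f" "Cod C h = Cod C f"
  shows "f \<sqsubseteq> h"
proof -
  have "trans {(x, y). x \<in> hom C (Dom C f) (Cod C f) \<and> y \<in> hom C (Dom C f) (Cod C f) \<and> x \<sqsubseteq> y}"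
    using hom_poset[of "Dom C f" "Cod C f"]
    unfolding poset_on_def partial_order_on_def preorder_on_def by blast
  from transD[OF this, of f g h] show ?thesis using assms by simp
qed

lemma le_antisym:
  assumes "f \<sqsubseteq> g" "g \<sqsubseteq> f" "f \<in> Arr C" "g \<in> Arr C" "Dom C g = Dom C f" "Cod C g = Cod C f"
  shows "f = g"
proof -
  have "antisym {(x, y). x \<in> hom C (Dom C f) (Cod C f) \<and> y \<in> hom C (Dom C f) (Cod C f) \<and> x \<sqsubseteq> y}"
    using hom_poset[of "Dom C f" "Cod C f"]
    unfolding poset_on_def partial_order_on_def by blast
  from antisymD[OF this, of f g] show ?thesis using assms by simp
qed

lemma comp_mono_right:
  assumes "f \<sqsubseteq> f'" "f \<in> Arr C" "f' \<in> Arr C" "g \<in> Arr C"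
    "Dom C f' = Dom C f" "Cod C f' = Cod C f" "Cod C f = Dom C g"
  shows "g \<cdot> f \<sqsubseteq> g \<cdot> f'"
  using comp_mono[of f "Dom C f" "Cod C f" f' g "Cod C g" g] assms by simp

lemma comp_mono_left:
  assumes "g \<sqsubseteq> g'" "f \<in> Arr C" "g \<in> Arr C" "g' \<in> Arr C"
    "Dom C g' = Dom C g" "Cod C g' = Cod C g" "Cod C f = Dom C g"
  shows "g \<cdot> f \<sqsubseteq> g' \<cdot> f"
  using comp_mono[of f "Dom C f" "Cod C f" f g "Cod C g" g'] assms by simp

lemma is_isoI:
  assumes "f \<in> hom C X Y" "g \<in> hom C Y X" "g \<cdot> f = Ident C X" "f \<cdot> g = Ident C Y"
  shows "is_iso C f"
  using assms unfolding is_iso_def by auto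

lemma is_isoE:
  assumes "is_iso C f"
  obtains g where "g \<in> hom C (Cod C f) (Dom C f)" "g \<cdot> f = Ident C (Dom C f)"
    "f \<cdot> g = Ident C (Cod C f)" "is_iso C g"
proof -
  obtain g where g: "g \<in> hom C (Cod C f) (Dom C f)" "g \<cdot> f = Ident C (Dom C f)"
    "f \<cdot> g = Ident C (Cod C f)" using assms unfolding is_iso_def by auto
  moreover have "is_iso C g"
    using g assms by (intro is_isoI[of g _ _ f]) (auto simp: is_iso_def)
  ultimately show thesis using that by blast
qed

lemma jointly_order_monoD:
  assumes "jointly_order_mono C p q" "p \<cdot> u \<sqsubseteq> p \<cdot> v" "q \<cdot> u \<sqsubseteq> q \<cdot> v"
    "u \<in> hom C A (Dom C p)" "v \<in> hom C A (Dom C p)"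
  shows "u \<sqsubseteq> v"
  using assms unfolding jointly_order_mono_def by blast

lemma jointly_order_mono_eq:
  assumes "jointly_order_mono C p q" "p \<cdot> u = p \<cdot> v" "q \<cdot> u = q \<cdot> v"
    "p \<in> Arr C" "q \<in> Arr C" "Dom C q = Dom C p"
    "u \<in> hom C A (Dom C p)" "v \<in> hom C A (Dom C p)"
  shows "u = v"
proof (rule le_antisym)
  have r: "p \<cdot> v \<sqsubseteq> p \<cdot> v" "q \<cdot> v \<sqsubseteq> q \<cdot> v" using assms by auto
  show "u \<sqsubseteq> v"
    by (rule jointly_order_monoD[OF assms(1)]) (use assms r in auto)
  show "v \<sqsubseteq> u"
    by (rule jointly_order_monoD[OF assms(1)]) (use assms r in auto)
qed (use assms in auto)

lemma is_productE:
  assumes "is_product C X Y p q" "x \<in> hom C A X" "y \<in> hom C A Y"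
  obtains u where "u \<in> hom C A (Dom C p)" "p \<cdot> u = x" "q \<cdot> u = y"
  using assms unfolding is_product_def by blast

lemma is_pullbackE:
  assumes "is_pullback C f g p q" "x \<in> hom C A (Dom C f)" "y \<in> hom C A (Dom C g)" "f \<cdot> x = g \<cdot> y"
  obtains u where "u \<in> hom C A (Dom C p)" "p \<cdot> u = x" "q \<cdot> u = y"
  using assms unfolding is_pullback_def by blast

lemma is_commaE:
  assumes "is_comma C f g p q" "x \<in> hom C A (Dom C f)" "y \<in> hom C A (Dom C g)" "f \<cdot> x \<sqsubseteq> g \<cdot> y"
  obtains u where "u \<in> hom C A (Dom C p)" "p \<cdot> u = x" "q \<cdot> u = y"
  using assms unfolding is_comma_def by blast

section \<open>Closure properties of \<open>ff\<close>- and \<open>so\<close>-morphisms\<close>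

lemma ff_morD:
  assumes "ff_mor C m" "m \<cdot> f \<sqsubseteq> m \<cdot> g" "f \<in> hom C Z (Dom C m)" "g \<in> hom C Z (Dom C m)"
  shows "f \<sqsubseteq> g"
  using assms unfolding ff_mor_def by blast

lemma ff_mor_eq:
  assumes "ff_mor C m" "m \<cdot> f = m \<cdot> g" "f \<in> hom C Z (Dom C m)" "g \<in> hom C Z (Dom C m)"
  shows "f = g"
proof (rule le_antisym)
  have "m \<cdot> g \<in> Arr C" using assms by (auto simp: ff_mor_def)
  then show "f \<sqsubseteq> g" "g \<sqsubseteq> f" using assms ff_morD[OF assms(1), of f g] ff_morD[OF assms(1), of g f] by auto
qed (use assms in auto)

lemma ff_mor_arr: "ff_mor C m \<Longrightarrow> m \<in> Arr C"
  by (simp add: ff_mor_def)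

lemma so_mor_arr: "so_mor C e \<Longrightarrow> e \<in> Arr C"
  by (simp add: so_mor_def)

text \<open>Composition with an \<open>ff\<close>-morphism \<open>m\<close> is injective and
  reflects the order, so the comparison map of \<open>so_mor\<close> is automatically an order
  embedding. What remains is surjectivity, that is, the existence of diagonals.\<close>

lemma so_morI:
  assumes e: "e \<in> Arr C"
    and ex: "\<And>m u v. \<lbrakk>ff_mor C m; u \<in> hom C (Dom C e) (Dom C m); v \<in> hom C (Cod C e) (Cod C m);
        m \<cdot> u = v \<cdot> e\<rbrakk> \<Longrightarrow> \<exists>d\<in>hom C (Cod C e) (Dom C m). d \<cdot> e = u \<and> m \<cdot> d = v"
  shows "so_mor C e"
proof -
  have "order_iso_betw (\<lambda>d. (d \<cdot> e, m \<cdot> d)) (hom C (Cod C e) (Dom C m)) (Le C)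
          {(u, v). u \<in> hom C (Dom C e) (Dom C m) \<and> v \<in> hom C (Cod C e) (Cod C m) \<and> m \<cdot> u = v \<cdot> e}
          (\<lambda>(u, v) (u', v'). u \<sqsubseteq> u' \<and> v \<sqsubseteq> v')"
    (is "order_iso_betw ?f ?H _ ?P ?le")
    if m: "ff_mor C m" for m
  proof -
    have ma: "m \<in> Arr C" using m by (rule ff_mor_arr)
    have "inj_on ?f ?H"
      by (rule inj_onI) (use ff_mor_eq[OF m] in blast)
    moreover have "?f ` ?H \<subseteq> ?P"
      using e ma by (intro image_subsetI) simp
    moreover have "z \<in> ?f ` ?H" if "z \<in> ?P" for z
    proof -
      obtain u v where uv: "z = (u, v)" by (cases z)
      with that have "\<exists>d\<in>?H. d \<cdot> e = u \<and> m \<cdot> d = v"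
        by (intro ex[OF m]) blast+
      then show ?thesis unfolding uv by blast
    qed
    moreover have "d \<sqsubseteq> d' \<longleftrightarrow> ?le (?f d) (?f d')" if "d \<in> ?H" "d' \<in> ?H" for d d'
    proof
      assume le: "d \<sqsubseteq> d'"
      have "d \<cdot> e \<sqsubseteq> d' \<cdot> e" by (rule comp_mono_left[OF le]) (use that e in simp_all)
      moreover have "m \<cdot> d \<sqsubseteq> m \<cdot> d'" by (rule comp_mono_right[OF le]) (use that ma in simp_all)
      ultimately show "?le (?f d) (?f d')" by simp
    next
      assume "?le (?f d) (?f d')"
      then have "m \<cdot> d \<sqsubseteq> m \<cdot> d'" by simp
      then show "d \<sqsubseteq> d'" by (rule ff_morD[OF m _ that])
    qed
    ultimately show ?thesis
      unfolding order_iso_betw_def bij_betw_def by blast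
  qed
  then show ?thesis using e unfolding so_mor_def by blast
qed

lemma so_lift:
  assumes e: "so_mor C e" and m: "ff_mor C m" and "u \<in> hom C (Dom C e) (Dom C m)"
    "v \<in> hom C (Cod C e) (Cod C m)" "m \<cdot> u = v \<cdot> e"
  obtains d where "d \<in> hom C (Cod C e) (Dom C m)" "d \<cdot> e = u" "m \<cdot> d = v"
proof -
  have "(\<lambda>d. (d \<cdot> e, m \<cdot> d)) ` hom C (Cod C e) (Dom C m) =
      {(u, v). u \<in> hom C (Dom C e) (Dom C m) \<and> v \<in> hom C (Cod C e) (Cod C m) \<and> m \<cdot> u = v \<cdot> e}"
    using e m unfolding so_mor_def order_iso_betw_def bij_betw_def by blast
  then have "(u, v) \<in> (\<lambda>d. (d \<cdot> e, m \<cdot> d)) ` hom C (Cod C e) (Dom C m)" using assms by auto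
  then show thesis using that by auto
qed

lemma so_mor_comp:
  assumes e: "so_mor C e" and f: "so_mor C f" and ef: "Cod C e = Dom C f"
  shows "so_mor C (f \<cdot> e)"
proof (rule so_morI)
  note a = so_mor_arr[OF e] so_mor_arr[OF f] ef
  show "f \<cdot> e \<in> Arr C" using a by simp
  fix m u v assume h: "ff_mor C m" "u \<in> hom C (Dom C (f \<cdot> e)) (Dom C m)"
    "v \<in> hom C (Cod C (f \<cdot> e)) (Cod C m)" "m \<cdot> u = v \<cdot> f \<cdot> e"
  obtain d where d: "d \<in> hom C (Cod C e) (Dom C m)" "d \<cdot> e = u" "m \<cdot> d = v \<cdot> f"
    by (rule so_lift[OF e h(1), of u "v \<cdot> f"]) (use h a in auto)
  obtain d' where d': "d' \<in> hom C (Cod C f) (Dom C m)" "d' \<cdot> f = d" "m \<cdot> d' = v"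
    by (rule so_lift[OF f h(1), of d v]) (use h a d in auto)
  have "d' \<cdot> f \<cdot> e = u" using assoc_eq[OF d'(2), of e] d' d a by simp
  then show "\<exists>d\<in>hom C (Cod C (f \<cdot> e)) (Dom C m). d \<cdot> f \<cdot> e = u \<and> m \<cdot> d = v"
    using d' a by (intro bexI[of _ d']) auto
qed

lemma so_mor_iso:
  assumes "is_iso C e"
  shows "so_mor C e"
proof -
  obtain g where g: "g \<in> hom C (Cod C e) (Dom C e)" "g \<cdot> e = Ident C (Dom C e)"
    "e \<cdot> g = Ident C (Cod C e)" using assms by (rule is_isoE)
  have e: "e \<in> Arr C" using assms by (simp add: is_iso_def)
  show ?thesis
  proof (rule so_morI[OF e])
    fix m u v assume h: "ff_mor C m" "u \<in> hom C (Dom C e) (Dom C m)"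
      "v \<in> hom C (Cod C e) (Cod C m)" "m \<cdot> u = v \<cdot> e"
    have ma: "m \<in> Arr C" using h by (simp add: ff_mor_arr)
    have "(u \<cdot> g) \<cdot> e = u" using g e h by simp
    moreover have "m \<cdot> u \<cdot> g = v"
      using assoc_eq[OF h(4), of g] g e h ma by simp
    ultimately show "\<exists>d\<in>hom C (Cod C e) (Dom C m). d \<cdot> e = u \<and> m \<cdot> d = v"
      using g e h by (intro bexI[of _ "u \<cdot> g"]) auto
  qed
qed

lemma so_mor_ident: "X \<in> Obj C \<Longrightarrow> so_mor C (Ident C X)"
  by (rule so_mor_iso, rule is_isoI[of _ X X "Ident C X"]) simp_all

text \<open>A diagonal for the square restricted along \<open>x\<close> already fills the original
  square: its upper triangle commutes after composition with \<open>m\<close>, and \<open>m\<close>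
  is monic.\<close>

lemma so_mor_cancel:
  assumes c: "so_mor C (f \<cdot> x)" and f: "f \<in> Arr C" "x \<in> Arr C" "Cod C x = Dom C f"
  shows "so_mor C f"
proof (rule so_morI[OF f(1)])
  fix m u v assume h: "ff_mor C m" "u \<in> hom C (Dom C f) (Dom C m)"
    "v \<in> hom C (Cod C f) (Cod C m)" "m \<cdot> u = v \<cdot> f"
  have ma: "m \<in> Arr C" using h by (simp add: ff_mor_arr)
  obtain d where d: "d \<in> hom C (Cod C f) (Dom C m)" "d \<cdot> f \<cdot> x = u \<cdot> x" "m \<cdot> d = v"
    by (rule so_lift[OF c h(1), of "u \<cdot> x" v])
      (use f h ma assoc_eq[OF h(4), of x] in auto)
  have "m \<cdot> d \<cdot> f = m \<cdot> u" using assoc_eq[OF d(3), of f] h d f ma by simp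
  then have "d \<cdot> f = u" using ff_mor_eq[OF h(1), of "d \<cdot> f" u] d h f by simp
  then show "\<exists>d\<in>hom C (Cod C f) (Dom C m). d \<cdot> f = u \<and> m \<cdot> d = v"
    using d by (intro bexI[of _ d]) auto
qed

text \<open>The diagonal of \<open>e\<close> against itself, with identities on both sides, is the
  inverse.\<close>

lemma so_ff_iso:
  assumes e: "so_mor C e" and m: "ff_mor C e"
  shows "is_iso C e"
proof -
  have a: "e \<in> Arr C" using e by (rule so_mor_arr)
  obtain d where d: "d \<in> hom C (Cod C e) (Dom C e)" "d \<cdot> e = Ident C (Dom C e)" "e \<cdot> d = Ident C (Cod C e)"
    by (rule so_lift[OF e m, of "Ident C (Dom C e)" "Ident C (Cod C e)"]) (use a in auto)
  then show ?thesis by (intro is_isoI[of e _ _ d]) (use a in auto)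
qed

end


section \<open>Finite limits as weighted limits\<close>

text \<open>The pullback and the comma object of a cospan are its limits for the weights below
  with \<open>k = 0\<close> and \<open>k = 1\<close>: the vertex \<open>2\<close> carries the chain \<open>{0..k}\<close>, and the
  legs \<open>3\<close> and \<open>4\<close> hit its bottom and top element.\<close>

definition cospan_cat :: "(nat, nat) pcat" where
  "cospan_cat = \<lparr>Obj = {0, 1, 2}, Arr = {0, 1, 2, 3, 4},
     Dom = (\<lambda>a. if a = 3 then 0 else if a = 4 then 1 else a),
     Cod = (\<lambda>a. if a < 3 then a else 2),
     Ident = (\<lambda>j. j), Comp = (\<lambda>b a. if b < 3 then a else b), Le = (=)\<rparr>"

definition cospan_weight :: "nat \<Rightarrow> (nat, nat, nat) weight" where
  "cospan_weight k = \<lparr>WEl = (\<lambda>j. if j = 2 then {0..k} else {0}), WLe = (\<lambda>j. (\<le>)),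
     WAct = (\<lambda>a x. if a = 4 then k else x)\<rparr>"

definition cospan_diagram :: "('o, 'm) pcat \<Rightarrow> 'm \<Rightarrow> 'm \<Rightarrow> (nat, nat, 'o, 'm) pfun" where
  "cospan_diagram C f g =
     \<lparr>FObj = (\<lambda>j. if j = 0 then Dom C f else if j = 1 then Dom C g else Cod C f),
      FArr = (\<lambda>a. if a = 0 then Ident C (Dom C f) else if a = 1 then Ident C (Dom C g)
                  else if a = 2 then Ident C (Cod C f) else if a = 3 then f else g)\<rparr>"

definition empty_cat :: "(nat, nat) pcat" where
  "empty_cat = \<lparr>Obj = {}, Arr = {}, Dom = (\<lambda>a. a), Cod = (\<lambda>a. a), Ident = (\<lambda>j. j),
     Comp = (\<lambda>b a. a), Le = (=)\<rparr>"

lemma poset_on_le: "poset_on A ((\<le>) :: nat \<Rightarrow> nat \<Rightarrow> bool)"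
  by (auto simp: poset_on_def partial_order_on_def preorder_on_def refl_on_def trans_def antisym_def)

lemma poset_on_eq: "poset_on A (=)"
  by (auto simp: poset_on_def partial_order_on_def preorder_on_def refl_on_def trans_def antisym_def)

lemma pos_category_cospan: "pos_category cospan_cat"
  by unfold_locales (auto simp: cospan_cat_def poset_on_eq hom_def split: if_splits)

lemma finite_weight_cospan: "finite_weight cospan_cat (cospan_weight k)"
  unfolding finite_weight_def pos_weight_def
  by (auto simp: pos_category_cospan)
    (auto simp: cospan_cat_def cospan_weight_def poset_on_le monotone_on_def split: if_splits)

lemma finite_weight_empty: "finite_weight empty_cat (cospan_weight 0)"
  unfolding finite_weight_def pos_weight_def pos_category_def
  by (auto simp: empty_cat_def cospan_weight_def poset_on_eq)

lemma pos_functor_empty: "pos_functor empty_cat C D"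
  by (auto simp: pos_functor_def empty_cat_def monotone_on_def)

text \<open>Comparability of any two arrows into \<open>T\<close>, used in both orders, yields their
  equality by antisymmetry. This is the form that joint order-monicity takes for the empty
  family.\<close>

definition is_terminal :: "('o, 'm) pcat \<Rightarrow> 'o \<Rightarrow> bool" where
  "is_terminal C T \<longleftrightarrow> T \<in> Obj C \<and>
     (\<forall>A\<in>Obj C. (\<exists>u. u \<in> hom C A T) \<and> (\<forall>u\<in>hom C A T. \<forall>v\<in>hom C A T. Le C u v))"

lemma weighted_limit_empty:
  assumes "pos_category C"
  shows "weighted_limit empty_cat W C D T l \<longleftrightarrow> is_terminal C T"
proof -
  interpret pos_category C by fact
  have "hom empty_cat i j = {}" "Obj empty_cat = {}" for i j
    by (auto simp: empty_cat_def)
  then have "weighted_limit empty_cat W C D T l \<longleftrightarrow> T \<in> Obj C \<and>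
      (\<forall>A. A \<in> Obj C \<longrightarrow> (\<exists>u. u \<in> hom C A T)) \<and> (\<forall>A. \<forall>u\<in>hom C A T. \<forall>v\<in>hom C A T. u \<sqsubseteq>\<^bsub>C\<^esub> v)"
    unfolding weighted_limit_def cylinder_def by simp
  moreover have "A \<in> Obj C" if "u \<in> hom C A T" for A u
    using that by auto
  ultimately show ?thesis
    unfolding is_terminal_def by blast
qed

text \<open>\<open>Q\<close> is equality for pullbacks and the order for comma objects.\<close>

definition is_square_limit ::
    "('m \<Rightarrow> 'm \<Rightarrow> bool) \<Rightarrow> ('o, 'm) pcat \<Rightarrow> 'm \<Rightarrow> 'm \<Rightarrow> 'm \<Rightarrow> 'm \<Rightarrow> bool" where
  "is_square_limit Q C f g p q \<longleftrightarrow>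
     p \<in> hom C (Dom C p) (Dom C f) \<and> q \<in> hom C (Dom C p) (Dom C g) \<and> jointly_order_mono C p q \<and>
     Q (f \<cdot>\<^bsub>C\<^esub> p) (g \<cdot>\<^bsub>C\<^esub> q) \<and>
     (\<forall>A. \<forall>x\<in>hom C A (Dom C f). \<forall>y\<in>hom C A (Dom C g). Q (f \<cdot>\<^bsub>C\<^esub> x) (g \<cdot>\<^bsub>C\<^esub> y) \<longrightarrow>
        (\<exists>u\<in>hom C A (Dom C p). p \<cdot>\<^bsub>C\<^esub> u = x \<and> q \<cdot>\<^bsub>C\<^esub> u = y))"

lemma is_square_limit_iff:
  "is_pullback C = is_square_limit (=) C" "is_comma C = is_square_limit (Le C) C"
  by (simp_all add: fun_eq_iff is_pullback_def is_comma_def is_square_limit_def)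

text \<open>For \<open>k = 0\<close> both legs hit the same weight element, so the two composites
  agree; for \<open>k = 1\<close> they hit the ends of a chain, and monotonicity of the cylinder at
  the vertex only gives an inequality.\<close>

definition cospan_rel :: "nat \<Rightarrow> ('o, 'm) pcat \<Rightarrow> 'm \<Rightarrow> 'm \<Rightarrow> bool" where
  "cospan_rel k C = (if k = 0 then (=) else Le C)"

definition cospan_cone :: "('o, 'm) pcat \<Rightarrow> 'm \<Rightarrow> 'm \<Rightarrow> 'm \<Rightarrow> 'm \<Rightarrow> nat \<Rightarrow> nat \<Rightarrow> 'm" where
  "cospan_cone C f g p q j x =
     (if j = 0 then p else if j = 1 then q else if x = 0 then f \<cdot>\<^bsub>C\<^esub> p else g \<cdot>\<^bsub>C\<^esub> q)"

context pos_category
begin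

lemma pos_functor_cospan:
  assumes "f \<in> Arr C" "g \<in> Arr C" "Cod C f = Cod C g"
  shows "pos_functor cospan_cat C (cospan_diagram C f g)"
  using assms
  by (auto simp: pos_functor_def cospan_cat_def cospan_diagram_def monotone_on_def hom_def
      split: if_splits)

lemma hom_cospan_cat:
  "a \<in> hom cospan_cat i j \<longleftrightarrow> a = i \<and> a = j \<and> a < 3 \<or> a = 3 \<and> i = 0 \<and> j = 2 \<or> a = 4 \<and> i = 1 \<and> j = 2"
  by (auto simp: cospan_cat_def)

text \<open>Naturality along the two legs computes the components at the vertex \<open>2\<close>
  from those at \<open>0\<close> and \<open>1\<close>. Since \<open>k \<le> 1\<close>, the chain has
  no elements besides \<open>0\<close> and \<open>k\<close>, so nothing else is left to
  specify.\<close>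

lemma cylinder_cospan:
  assumes f: "f \<in> Arr C" "g \<in> Arr C" "Cod C f = Cod C g" and k: "k \<le> 1"
  shows "cylinder cospan_cat (cospan_weight k) C (cospan_diagram C f g) A l \<longleftrightarrow>
    l 0 0 \<in> hom C A (Dom C f) \<and> l 1 0 \<in> hom C A (Dom C g) \<and>
    f \<cdot> l 0 0 = l 2 0 \<and> g \<cdot> l 1 0 = l 2 k \<and> cospan_rel k C (f \<cdot> l 0 0) (g \<cdot> l 1 0)"
proof -
  have k01: "k = 0 \<or> k = 1" using k by auto
  show ?thesis (is "_ \<longleftrightarrow> ?R")
  proof
    assume "cylinder cospan_cat (cospan_weight k) C (cospan_diagram C f g) A l"
    then have h: "\<forall>j\<in>{0,1,2}. (\<forall>x\<in>WEl (cospan_weight k) j. l j x \<in> hom C A (FObj (cospan_diagram C f g) j)) \<and>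
        monotone_on (WEl (cospan_weight k) j) (WLe (cospan_weight k) j) (Le C) (l j)"
      and n: "\<And>i j a x. a \<in> hom cospan_cat i j \<Longrightarrow> x \<in> WEl (cospan_weight k) i \<Longrightarrow>
         FArr (cospan_diagram C f g) a \<cdot> l i x = l j (WAct (cospan_weight k) a x)"
      unfolding cylinder_def by (auto simp: cospan_cat_def)
    have "l 0 0 \<in> hom C A (Dom C f)" "l 1 0 \<in> hom C A (Dom C g)"
      using h by (auto simp: cospan_weight_def cospan_diagram_def)
    moreover have "f \<cdot> l 0 0 = l 2 0" "g \<cdot> l 1 0 = l 2 k"
      using n[of 3 0 2 0] n[of 4 1 2 0] unfolding hom_cospan_cat
      by (auto simp: cospan_weight_def cospan_diagram_def)
    moreover have "monotone_on {0..k} (\<le>) (Le C) (l 2)"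
      using h by (auto simp: cospan_weight_def)
    ultimately show ?R using k01 by (auto simp: cospan_rel_def monotone_on_def)
  next
    assume r: ?R
    then have A: "A \<in> Obj C" and a: "l 0 0 \<in> Arr C" "l 1 0 \<in> Arr C" "l 2 0 \<in> Arr C" "l 2 k \<in> Arr C"
      using f comp_arr[of "l 0 0" f] comp_arr[of "l 1 0" g] by auto
    have d: "Dom C (l 2 0) = A" "Cod C (l 2 0) = Cod C f" "Dom C (l 2 k) = A" "Cod C (l 2 k) = Cod C f"
      using r f comp_arr[of "l 0 0" f] comp_arr[of "l 1 0" g] by auto
    have x: "x = 0 \<or> x = k" if "x \<le> k" for x using that k01 by auto
    have mono: "monotone_on (WEl (cospan_weight k) j) (WLe (cospan_weight k) j) (Le C) (l j)" if "j \<in> {0,1,2}" for j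
    proof (intro monotone_onI)
      fix x y assume h: "x \<in> WEl (cospan_weight k) j" "y \<in> WEl (cospan_weight k) j" "WLe (cospan_weight k) j x y"
      show "l j x \<sqsubseteq> l j y"
      proof (cases "x = y")
        case True
        have "l j x \<in> Arr C" using that h(1) a x[of x] by (auto simp: cospan_weight_def)
        with True show ?thesis by simp
      next
        case False
        then have "j = 2" "x = 0" "y = k" "k = 1" using h k by (auto simp: cospan_weight_def split: if_splits)
        then show ?thesis using r by (auto simp: cospan_rel_def)
      qed
    qed
    have hom: "l j x \<in> hom C A (FObj (cospan_diagram C f g) j)"
      if hj: "j \<in> {0,1,2}" and hx: "x \<in> WEl (cospan_weight k) j" for j x
    proof -
      consider "j = 0" "x = 0" | "j = 1" "x = 0" | "j = 2" "x = 0" | "j = 2" "x = k"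
      proof (cases "j = 2")
        case True
        then have "x \<le> k" using hx by (simp add: cospan_weight_def)
        from x[OF this] True that show ?thesis by blast
      next
        case False
        then show ?thesis using hj hx that by (auto simp: cospan_weight_def)
      qed
      then show ?thesis
        using r a d by cases (simp_all add: cospan_diagram_def)
    qed
    have nat: "FArr (cospan_diagram C f g) a \<cdot> l i x = l j (WAct (cospan_weight k) a x)"
      if h: "a \<in> hom cospan_cat i j" "x \<in> WEl (cospan_weight k) i" for a i j x
    proof -
      consider "a = 0" "i = 0" "j = 0" | "a = 1" "i = 1" "j = 1" | "a = 2" "i = 2" "j = 2"
        | "a = 3" "i = 0" "j = 2" | "a = 4" "i = 1" "j = 2"
        using h(1) unfolding hom_cospan_cat by (auto simp: less_Suc_eq numeral_3_eq_3 numeral_2_eq_2)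
      then show ?thesis
      proof cases
        case 3
        then have "x = 0 \<or> x = k" using h(2) x[of x] by (simp add: cospan_weight_def)
        then show ?thesis using 3 a d by (auto simp: cospan_weight_def cospan_diagram_def)
      qed (use h(2) r f a d in \<open>simp_all add: cospan_weight_def cospan_diagram_def\<close>)
    qed
    show "cylinder cospan_cat (cospan_weight k) C (cospan_diagram C f g) A l"
      unfolding cylinder_def using A mono hom nat by (auto simp: cospan_cat_def)
  qed
qed

lemma cospan_cylinder_all:
  assumes "k \<le> 1" "P 0 0" "P 1 0" "P 2 0" "P 2 k"
  shows "\<forall>j\<in>Obj cospan_cat. \<forall>x\<in>WEl (cospan_weight k) j. P j x"
  using assms by (auto simp: cospan_cat_def cospan_weight_def le_Suc_eq)

lemma cospan_cylinder_mem:
  "0 \<in> Obj cospan_cat" "1 \<in> Obj cospan_cat" "2 \<in> Obj cospan_cat"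
  "0 \<in> WEl (cospan_weight k) 0" "0 \<in> WEl (cospan_weight k) 1"
  by (auto simp: cospan_cat_def cospan_weight_def)

lemma weighted_limit_cospan:
  assumes f: "f \<in> Arr C" "g \<in> Arr C" "Cod C f = Cod C g" and k: "k \<le> 1"
    and l: "weighted_limit cospan_cat (cospan_weight k) C (cospan_diagram C f g) L l"
  shows "is_square_limit (cospan_rel k C) C f g (l 0 0) (l 1 0)" "Dom C (l 0 0) = L"
proof -
  note cyl = cylinder_cospan[OF f k]
  have c: "l 0 0 \<in> hom C L (Dom C f)" "l 1 0 \<in> hom C L (Dom C g)"
    "f \<cdot> l 0 0 = l 2 0" "g \<cdot> l 1 0 = l 2 k" "cospan_rel k C (f \<cdot> l 0 0) (g \<cdot> l 1 0)"
    using l unfolding weighted_limit_def cyl by auto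
  then show L: "Dom C (l 0 0) = L" by simp
  have "u \<sqsubseteq> v" if uv: "u \<in> hom C A L" "v \<in> hom C A L" "l 0 0 \<cdot> u \<sqsubseteq> l 0 0 \<cdot> v" "l 1 0 \<cdot> u \<sqsubseteq> l 1 0 \<cdot> v" for A u v
  proof -
    have e: "l 2 0 \<cdot> w = f \<cdot> l 0 0 \<cdot> w" "l 2 k \<cdot> w = g \<cdot> l 1 0 \<cdot> w" if "w \<in> hom C A L" for w
      using that c f assoc[of w "l 0 0" f] assoc[of w "l 1 0" g] by auto
    have "l 2 0 \<cdot> u \<sqsubseteq> l 2 0 \<cdot> v" "l 2 k \<cdot> u \<sqsubseteq> l 2 k \<cdot> v"
      unfolding e[OF uv(1)] e[OF uv(2)] using uv f c by (auto intro!: comp_mono_right)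
    then have "\<forall>j\<in>Obj cospan_cat. \<forall>x\<in>WEl (cospan_weight k) j. l j x \<cdot> u \<sqsubseteq> l j x \<cdot> v"
      using uv k by (intro cospan_cylinder_all) auto
    then show ?thesis using l uv unfolding weighted_limit_def by blast
  qed
  then have "jointly_order_mono C (l 0 0) (l 1 0)"
    unfolding jointly_order_mono_def L by blast
  moreover have "\<exists>u\<in>hom C A L. l 0 0 \<cdot> u = x \<and> l 1 0 \<cdot> u = y"
    if xy: "x \<in> hom C A (Dom C f)" "y \<in> hom C A (Dom C g)" "cospan_rel k C (f \<cdot> x) (g \<cdot> y)" for A x y
  proof -
    have "cylinder cospan_cat (cospan_weight k) C (cospan_diagram C f g) A (cospan_cone C f g x y)"
      unfolding cyl using xy k by (cases "k = 0") (auto simp: cospan_cone_def cospan_rel_def)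
    then obtain u where u: "u \<in> hom C A L"
      "\<And>j x'. j \<in> Obj cospan_cat \<Longrightarrow> x' \<in> WEl (cospan_weight k) j \<Longrightarrow> l j x' \<cdot> u = cospan_cone C f g x y j x'"
      using l unfolding weighted_limit_def by blast
    have "l 0 0 \<cdot> u = x" "l 1 0 \<cdot> u = y"
      using u(2)[of 0 0] u(2)[of 1 0] cospan_cylinder_mem by (auto simp: cospan_cone_def)
    then show ?thesis using u(1) by blast
  qed
  ultimately show "is_square_limit (cospan_rel k C) C f g (l 0 0) (l 1 0)"
    unfolding is_square_limit_def L using c by auto
qed

lemma cospan_weighted_limit:
  assumes f: "f \<in> Arr C" "g \<in> Arr C" "Cod C f = Cod C g" and k: "k \<le> 1"
    and pq: "is_square_limit (cospan_rel k C) C f g p q"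
  shows "weighted_limit cospan_cat (cospan_weight k) C (cospan_diagram C f g) (Dom C p) (cospan_cone C f g p q)"
proof -
  note cyl = cylinder_cospan[OF f k]
  have c: "p \<in> hom C (Dom C p) (Dom C f)" "q \<in> hom C (Dom C p) (Dom C g)" "jointly_order_mono C p q"
    "cospan_rel k C (f \<cdot> p) (g \<cdot> q)"
    and ex: "\<And>A x y. x \<in> hom C A (Dom C f) \<Longrightarrow> y \<in> hom C A (Dom C g) \<Longrightarrow>
       cospan_rel k C (f \<cdot> x) (g \<cdot> y) \<Longrightarrow> \<exists>u\<in>hom C A (Dom C p). p \<cdot> u = x \<and> q \<cdot> u = y"
    using pq unfolding is_square_limit_def by auto
  have "cylinder cospan_cat (cospan_weight k) C (cospan_diagram C f g) (Dom C p) (cospan_cone C f g p q)"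
    unfolding cyl using c k by (cases "k = 0") (auto simp: cospan_cone_def cospan_rel_def)
  moreover have "\<exists>u\<in>hom C A (Dom C p). \<forall>j\<in>Obj cospan_cat. \<forall>x\<in>WEl (cospan_weight k) j. cospan_cone C f g p q j x \<cdot> u = d j x"
    if d: "cylinder cospan_cat (cospan_weight k) C (cospan_diagram C f g) A d" for A d
  proof -
    have d': "d 0 0 \<in> hom C A (Dom C f)" "d 1 0 \<in> hom C A (Dom C g)"
      "f \<cdot> d 0 0 = d 2 0" "g \<cdot> d 1 0 = d 2 k" "cospan_rel k C (f \<cdot> d 0 0) (g \<cdot> d 1 0)"
      using d unfolding cyl by auto
    obtain u where u: "u \<in> hom C A (Dom C p)" "p \<cdot> u = d 0 0" "q \<cdot> u = d 1 0"
      using ex[OF d'(1,2,5)] by blast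
    have f0: "(f \<cdot> p) \<cdot> u = d 2 0" "(g \<cdot> q) \<cdot> u = d 2 k"
      using u c f d' by auto
    have "\<forall>j\<in>Obj cospan_cat. \<forall>x\<in>WEl (cospan_weight k) j. cospan_cone C f g p q j x \<cdot> u = d j x"
      using u f0 k by (intro cospan_cylinder_all; cases "k = 0") (simp_all add: cospan_cone_def del: assoc)
    then show ?thesis using u(1) by blast
  qed
  moreover have "u \<sqsubseteq> v" if uv: "u \<in> hom C A (Dom C p)" "v \<in> hom C A (Dom C p)"
    "\<forall>j\<in>Obj cospan_cat. \<forall>x\<in>WEl (cospan_weight k) j. cospan_cone C f g p q j x \<cdot> u \<sqsubseteq> cospan_cone C f g p q j x \<cdot> v" for A u v
  proof (rule jointly_order_monoD[OF c(3) _ _ uv(1,2)])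
    show "p \<cdot> u \<sqsubseteq> p \<cdot> v" "q \<cdot> u \<sqsubseteq> q \<cdot> v"
      using bspec[OF bspec[OF uv(3), of 0], of 0] bspec[OF bspec[OF uv(3), of 1], of 0] cospan_cylinder_mem
      by (auto simp: cospan_cone_def)
  qed
  ultimately show ?thesis unfolding weighted_limit_def by blast
qed

lemma square_limit_exists:
  assumes "has_finite_limits C" "f \<in> Arr C" "g \<in> Arr C" "Cod C f = Cod C g"
  shows "\<exists>p q. is_pullback C f g p q" "\<exists>p q. is_comma C f g p q"
proof -
  have "\<exists>L l. weighted_limit cospan_cat (cospan_weight k) C (cospan_diagram C f g) L l" for k
    by (rule assms(1)[unfolded has_finite_limits_def, rule_format])
      (simp add: finite_weight_cospan pos_functor_cospan[OF assms(2-4)])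
  from this[of 0] this[of 1] show "\<exists>p q. is_pullback C f g p q" "\<exists>p q. is_comma C f g p q"
    using weighted_limit_cospan(1)[OF assms(2-4), of 0] weighted_limit_cospan(1)[OF assms(2-4), of 1]
    unfolding is_square_limit_iff cospan_rel_def by (auto, blast+)
qed

lemma terminal_exists:
  assumes "has_finite_limits C"
  obtains T where "is_terminal C T"
proof -
  have "\<exists>L l. weighted_limit empty_cat (cospan_weight 0) C undefined L l"
    by (rule assms[unfolded has_finite_limits_def, rule_format])
      (simp add: finite_weight_empty pos_functor_empty)
  then show thesis
    unfolding weighted_limit_empty[OF pos_category_axioms] using that by blast
qed

text \<open>Any two parallel arrows into \<open>T\<close> agree, so the commutativity condition of
  the pullback is vacuous. Binary products thereby reduce to the cospan weight and the empty weight,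
  both for existence and for preservation.\<close>

lemma is_product_iff_pullback:
  assumes T: "is_terminal C T" and f: "f \<in> hom C X T" "g \<in> hom C Y T"
  shows "is_product C X Y p q \<longleftrightarrow> is_pullback C f g p q"
proof -
  have eq: "u = v" if "u \<in> hom C A T" "v \<in> hom C A T" for u v A
  proof (rule le_antisym)
    have "A \<in> Obj C" using that by auto
    then show "u \<sqsubseteq> v" "v \<sqsubseteq> u" using T that unfolding is_terminal_def by blast+
  qed (use that in auto)
  have "f \<cdot> x = g \<cdot> y" if "x \<in> hom C A X" "y \<in> hom C A Y" for x y A
    using that f by (intro eq) auto
  then show ?thesis
    using f unfolding is_product_def is_pullback_def by auto
qed

lemma product_exists:
  assumes "has_finite_limits C" "X \<in> Obj C" "Y \<in> Obj C"
  shows "\<exists>p q. is_product C X Y p q"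
proof -
  obtain T where T: "is_terminal C T" using terminal_exists[OF assms(1)] .
  then obtain f g where "f \<in> hom C X T" "g \<in> hom C Y T"
    using assms unfolding is_terminal_def by blast
  then have "\<exists>p q. is_pullback C f g p q"
    by (intro square_limit_exists(1)[OF assms(1)]) auto
  then show ?thesis
    unfolding is_product_iff_pullback[OF T \<open>f \<in> hom C X T\<close> \<open>g \<in> hom C Y T\<close>] .
qed

end

section \<open>Functors and the limits that they preserve\<close>

lemma pos_functor_simps:
  assumes "pos_functor C D F"
  shows "X \<in> Obj C \<Longrightarrow> FObj F X \<in> Obj D"
    and "f \<in> Arr C \<Longrightarrow> FArr F f \<in> Arr D"
    and "f \<in> Arr C \<Longrightarrow> Dom D (FArr F f) = FObj F (Dom C f)"
    and "f \<in> Arr C \<Longrightarrow> Cod D (FArr F f) = FObj F (Cod C f)"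
    and "X \<in> Obj C \<Longrightarrow> FArr F (Ident C X) = Ident D (FObj F X)"
    and "\<lbrakk>f \<in> Arr C; g \<in> Arr C; Cod C f = Dom C g\<rbrakk> \<Longrightarrow> FArr F (g \<cdot>\<^bsub>C\<^esub> f) = FArr F g \<cdot>\<^bsub>D\<^esub> FArr F f"
    and "\<lbrakk>f \<in> Arr C; g \<in> Arr C; Dom C g = Dom C f; Cod C g = Cod C f; f \<sqsubseteq>\<^bsub>C\<^esub> g\<rbrakk>
      \<Longrightarrow> FArr F f \<sqsubseteq>\<^bsub>D\<^esub> FArr F g"
proof -
  note A = assms[unfolded pos_functor_def]
  note hm = A[THEN conjunct2, THEN conjunct1, rule_format]
  note cm = A[THEN conjunct2, THEN conjunct2, THEN conjunct2, THEN conjunct1, rule_format]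
  note mn = A[THEN conjunct2, THEN conjunct2, THEN conjunct2, THEN conjunct2, rule_format]
  have h: "f \<in> hom C (Dom C f) (Cod C f)" if "f \<in> Arr C" for f using that by simp
  show "f \<in> Arr C \<Longrightarrow> FArr F f \<in> Arr D"
    "f \<in> Arr C \<Longrightarrow> Dom D (FArr F f) = FObj F (Dom C f)"
    "f \<in> Arr C \<Longrightarrow> Cod D (FArr F f) = FObj F (Cod C f)"
    using hm[OF h, of f] by simp_all
  show "X \<in> Obj C \<Longrightarrow> FObj F X \<in> Obj D"
    by (rule A[THEN conjunct1, rule_format])
  show "X \<in> Obj C \<Longrightarrow> FArr F (Ident C X) = Ident D (FObj F X)"
    by (rule A[THEN conjunct2, THEN conjunct2, THEN conjunct1, rule_format])
  show "FArr F (g \<cdot>\<^bsub>C\<^esub> f) = FArr F g \<cdot>\<^bsub>D\<^esub> FArr F f"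
    if "f \<in> Arr C" "g \<in> Arr C" "Cod C f = Dom C g"
    by (rule cm[of f "Dom C f" "Cod C f" g "Cod C g"]) (use that in simp_all)
  show "FArr F f \<sqsubseteq>\<^bsub>D\<^esub> FArr F g"
    if "f \<in> Arr C" "g \<in> Arr C" "Dom C g = Dom C f" "Cod C g = Cod C f" "f \<sqsubseteq>\<^bsub>C\<^esub> g"
    by (rule monotone_onD[OF mn[of "Dom C f" "Cod C f"]]) (use that in simp_all)
qed

lemma preserves_cospan:
  assumes C: "pos_category C" and D: "pos_category D"
    and F: "pos_functor C D F" "preserves_finite_limits C D F"
    and f: "f \<in> Arr C" "g \<in> Arr C" "Cod C f = Cod C g" and k: "k \<le> 1"
    and pq: "is_square_limit (cospan_rel k C) C f g p q"
  shows "is_square_limit (cospan_rel k D) D (FArr F f) (FArr F g) (FArr F p) (FArr F q)"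
proof -
  interpret C: pos_category C by fact
  interpret D: pos_category D by fact
  note Fs = pos_functor_simps[OF F(1)]
  \<comment> \<open>This is an equality of records, not just agreement on the index category: both
    sides use the same defaults at every other number, so the weighted limit can be transported by
    rewriting.\<close>
  have d: "F \<circ>\<^sub>F cospan_diagram C f g = cospan_diagram D (FArr F f) (FArr F g)"
    using f by (simp add: fcomp_def cospan_diagram_def fun_eq_iff Fs)
  have "weighted_limit cospan_cat (cospan_weight k) D (F \<circ>\<^sub>F cospan_diagram C f g) (FObj F (Dom C p))
     (\<lambda>j x. FArr F (cospan_cone C f g p q j x))"
    by (rule F(2)[unfolded preserves_finite_limits_def, rule_format])
      (simp add: finite_weight_cospan C.pos_functor_cospan[OF f] C.cospan_weighted_limit[OF f k pq])
  then have "weighted_limit cospan_cat (cospan_weight k) D (cospan_diagram D (FArr F f) (FArr F g)) (FObj F (Dom C p))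
     (\<lambda>j x. FArr F (cospan_cone C f g p q j x))" unfolding d .
  from D.weighted_limit_cospan(1)[OF _ _ _ k this]
  show ?thesis using f by (simp add: cospan_cone_def Fs)
qed

lemma preserves_pullback:
  assumes "pos_category C" "pos_category D" "pos_functor C D F" "preserves_finite_limits C D F"
    "f \<in> Arr C" "g \<in> Arr C" "Cod C f = Cod C g" "is_pullback C f g p q"
  shows "is_pullback D (FArr F f) (FArr F g) (FArr F p) (FArr F q)"
  using preserves_cospan[OF assms(1-7), of 0 p q] assms(8)
  by (simp add: is_square_limit_iff cospan_rel_def)

lemma preserves_comma:
  assumes "pos_category C" "pos_category D" "pos_functor C D F" "preserves_finite_limits C D F"
    "f \<in> Arr C" "g \<in> Arr C" "Cod C f = Cod C g" "is_comma C f g p q"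
  shows "is_comma D (FArr F f) (FArr F g) (FArr F p) (FArr F q)"
  using preserves_cospan[OF assms(1-7), of 1 p q] assms(8)
  by (simp add: is_square_limit_iff cospan_rel_def)

lemma preserves_terminal:
  assumes "pos_category C" "pos_category D" "preserves_finite_limits C D F" "is_terminal C T"
  shows "is_terminal D (FObj F T)"
proof -
  \<comment> \<open>Diagram and cone may be arbitrary, since the index category is empty.\<close>
  have "weighted_limit empty_cat (cospan_weight 0) C (undefined :: (nat, nat, _, _) pfun) T (\<lambda>_ _. undefined)"
    unfolding weighted_limit_empty[OF assms(1)] by (rule assms(4))
  then have "weighted_limit empty_cat (cospan_weight 0) D (F \<circ>\<^sub>F undefined) (FObj F T) (\<lambda>j x. FArr F undefined)"
    by (intro assms(3)[unfolded preserves_finite_limits_def, rule_format])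
      (simp add: finite_weight_empty pos_functor_empty)
  then show ?thesis unfolding weighted_limit_empty[OF assms(2)] .
qed

lemma preserves_product:
  assumes "pos_category C" "pos_category D" "pos_functor C D F" "preserves_finite_limits C D F"
    "has_finite_limits C" "X \<in> Obj C" "Y \<in> Obj C" "is_product C X Y p q"
  shows "is_product D (FObj F X) (FObj F Y) (FArr F p) (FArr F q)"
proof -
  interpret C: pos_category C by fact
  interpret D: pos_category D by fact
  obtain T where T: "is_terminal C T" using C.terminal_exists[OF assms(5)] .
  then obtain f g where fg: "f \<in> hom C X T" "g \<in> hom C Y T"
    using assms(6,7) unfolding is_terminal_def by blast
  have "is_pullback D (FArr F f) (FArr F g) (FArr F p) (FArr F q)"
    using fg assms(8) unfolding C.is_product_iff_pullback[OF T fg]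
    by (intro preserves_pullback[OF assms(1-4)]) simp_all
  moreover have "FArr F f \<in> hom D (FObj F X) (FObj F T)" "FArr F g \<in> hom D (FObj F Y) (FObj F T)"
    using fg by (simp_all add: pos_functor_simps[OF assms(3)])
  ultimately show ?thesis
    using D.is_product_iff_pullback[OF preserves_terminal[OF assms(1,2,4) T]] by blast
qed

lemma functor_cylinder:
  assumes C: "pos_category C" and J: "pos_category J" and F: "pos_functor C D F" and G: "pos_functor J C G"
    and c: "cylinder J W C G A c"
  shows "cylinder J W D (F \<circ>\<^sub>F G) (FObj F A) (\<lambda>j x. FArr F (c j x))"
proof -
  note Fs = pos_functor_simps[OF F] and Gs = pos_functor_simps[OF G]
  have A: "A \<in> Obj C" and h: "\<And>j x. j \<in> Obj J \<Longrightarrow> x \<in> WEl W j \<Longrightarrow> c j x \<in> hom C A (FObj G j)"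
    and m: "\<And>j. j \<in> Obj J \<Longrightarrow> monotone_on (WEl W j) (WLe W j) (Le C) (c j)"
    and n: "\<And>i j a x. a \<in> hom J i j \<Longrightarrow> x \<in> WEl W i \<Longrightarrow> FArr G a \<cdot>\<^bsub>C\<^esub> c i x = c j (WAct W a x)"
    using c unfolding cylinder_def by blast+
  have o: "FObj (F \<circ>\<^sub>F G) j = FObj F (FObj G j)" "FArr (F \<circ>\<^sub>F G) a = FArr F (FArr G a)" for j a
    by (simp_all add: fcomp_def)
  show ?thesis
    unfolding cylinder_def o
  proof (intro conjI ballI allI)
    show "FObj F A \<in> Obj D" by (rule Fs(1)[OF A])
    show "FArr F (c j x) \<in> hom D (FObj F A) (FObj F (FObj G j))" if "j \<in> Obj J" "x \<in> WEl W j" for j x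
      using h[OF that] by (simp add: Fs)
    show "monotone_on (WEl W j) (WLe W j) (Le D) (\<lambda>x. FArr F (c j x))" if j: "j \<in> Obj J" for j
    proof (rule monotone_onI)
      fix x y assume x: "x \<in> WEl W j" "y \<in> WEl W j" "WLe W j x y"
      have "c j x \<sqsubseteq>\<^bsub>C\<^esub> c j y" by (rule monotone_onD[OF m[OF j] x])
      then show "FArr F (c j x) \<sqsubseteq>\<^bsub>D\<^esub> FArr F (c j y)"
        using h[OF j x(1)] h[OF j x(2)] by (intro Fs(7)) simp_all
    qed
    show "FArr F (FArr G a) \<cdot>\<^bsub>D\<^esub> FArr F (c i x) = FArr F (c j (WAct W a x))"
      if a: "a \<in> hom J i j" and x: "x \<in> WEl W i" for i j a x
    proof -
      have i: "i \<in> Obj J" using a pos_category.dom_obj[OF J] by auto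
      show ?thesis unfolding n[OF a x, symmetric] using Fs(6)[of "c i x" "FArr G a"] h[OF i x] a by (simp add: Gs)
    qed
  qed
qed


section \<open>Regular categories\<close>

locale regular_category = pos_category +
  assumes regular: "regular_cat C"
begin

lemma finite_limits: "has_finite_limits C"
  using regular by (simp add: regular_cat_def)

lemma so_ff_factor:
  assumes "f \<in> Arr C"
  obtains e m where "so_mor C e" "ff_mor C m" "Cod C e = Dom C m" "f = m \<cdot> e"
    "Dom C e = Dom C f" "Cod C m = Cod C f"
proof -
  obtain e m where em: "so_mor C e" "ff_mor C m" "Cod C e = Dom C m" "f = m \<cdot> e"
    using regular assms unfolding regular_cat_def by metis
  then show thesis using that so_mor_arr ff_mor_arr by simp
qed

lemma pullback_ex:
  assumes "f \<in> Arr C" "g \<in> Arr C" "Cod C f = Cod C g"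
  obtains p q where "is_pullback C f g p q" "p \<in> hom C (Dom C p) (Dom C f)"
    "q \<in> hom C (Dom C p) (Dom C g)" "jointly_order_mono C p q" "f \<cdot> p = g \<cdot> q"
proof -
  obtain p q where h: "is_pullback C f g p q"
    using square_limit_exists(1)[OF finite_limits assms] by blast
  then show thesis using that[OF h] unfolding is_pullback_def by blast
qed

lemma comma_ex:
  assumes "f \<in> Arr C" "g \<in> Arr C" "Cod C f = Cod C g"
  obtains p q where "is_comma C f g p q" "p \<in> hom C (Dom C p) (Dom C f)"
    "q \<in> hom C (Dom C p) (Dom C g)" "jointly_order_mono C p q" "f \<cdot> p \<sqsubseteq> g \<cdot> q"
proof -
  obtain p q where h: "is_comma C f g p q"
    using square_limit_exists(2)[OF finite_limits assms] by blast
  then show thesis using that[OF h] unfolding is_comma_def by blast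
qed

text \<open>Pullback stability in elementwise form: an \<open>so\<close>-morphism is locally
  surjective, in that an element of its codomain acquires a preimage after passing to a cover of its
  stage.\<close>

lemma so_pullback_lift:
  assumes e: "so_mor C e" and x: "x \<in> hom C A (Cod C e)"
  obtains A' e' y where "so_mor C e'" "e' \<in> hom C A' A" "y \<in> hom C A' (Dom C e)" "e \<cdot> y = x \<cdot> e'"
proof -
  have xe: "e \<in> Arr C" "x \<in> Arr C" "Cod C e = Cod C x" "Dom C x = A"
    using so_mor_arr[OF e] x by simp_all
  obtain p q where p: "is_pullback C e x p q" "p \<in> hom C (Dom C p) (Dom C e)"
    "q \<in> hom C (Dom C p) (Dom C x)" "e \<cdot> p = x \<cdot> q" using pullback_ex[OF xe(1-3)] by metis
  have "so_mor C q" using regular e xe p(1) unfolding regular_cat_def by metis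
  then show thesis using that[of q "Dom C p" p] p xe by simp
qed

section \<open>Chosen binary products and pairings\<close>

lemma is_product_proj:
  assumes "X \<in> Obj C" "Y \<in> Obj C"
  shows "is_product C X Y (proj0 C X Y) (proj1 C X Y)"
proof -
  have "\<exists>z. case z of (p, q) \<Rightarrow> is_product C X Y p q"
    using product_exists[OF finite_limits assms] by simp
  from someI_ex[OF this] show ?thesis
    unfolding proj_def case_prod_unfold .
qed

lemma proj_arr [simp]:
  assumes "X \<in> Obj C" "Y \<in> Obj C"
  shows "proj0 C X Y \<in> Arr C" "proj1 C X Y \<in> Arr C"
    "Dom C (proj0 C X Y) = prod_obj C X Y" "Dom C (proj1 C X Y) = prod_obj C X Y"
    "Cod C (proj0 C X Y) = X" "Cod C (proj1 C X Y) = Y" "prod_obj C X Y \<in> Obj C"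
  using is_product_proj[OF assms] dom_obj[of "proj0 C X Y"]
  unfolding is_product_def prod_obj_def by simp_all

lemma proj_mono:
  assumes "X \<in> Obj C" "Y \<in> Obj C" "u \<in> hom C A (prod_obj C X Y)" "v \<in> hom C A (prod_obj C X Y)"
    "proj0 C X Y \<cdot> u \<sqsubseteq> proj0 C X Y \<cdot> v" "proj1 C X Y \<cdot> u \<sqsubseteq> proj1 C X Y \<cdot> v"
  shows "u \<sqsubseteq> v"
proof -
  have "jointly_order_mono C (proj0 C X Y) (proj1 C X Y)"
    using is_product_proj[OF assms(1,2)] by (simp add: is_product_def)
  from jointly_order_monoD[OF this assms(5,6)] assms(1-4) show ?thesis by simp
qed

lemma proj_eq:
  assumes "X \<in> Obj C" "Y \<in> Obj C" "u \<in> hom C A (prod_obj C X Y)" "v \<in> hom C A (prod_obj C X Y)"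
    "proj0 C X Y \<cdot> u = proj0 C X Y \<cdot> v" "proj1 C X Y \<cdot> u = proj1 C X Y \<cdot> v"
  shows "u = v"
proof (rule le_antisym)
  have "proj0 C X Y \<cdot> v \<in> Arr C" "proj1 C X Y \<cdot> v \<in> Arr C" using assms(1-4) by simp_all
  then show "u \<sqsubseteq> v" "v \<sqsubseteq> u"
    using proj_mono[OF assms(1-4)] proj_mono[OF assms(1,2,4,3)] assms(5,6) by simp_all
qed (use assms in simp_all)

lemma pairing:
  assumes "x \<in> hom C A X" "y \<in> hom C A Y"
  shows "pairing C x y \<in> hom C A (prod_obj C X Y)"
    "proj0 C X Y \<cdot> pairing C x y = x" "proj1 C X Y \<cdot> pairing C x y = y"
proof -
  have o: "X \<in> Obj C" "Y \<in> Obj C" using assms by auto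
  obtain u where u: "u \<in> hom C A (prod_obj C X Y)" "proj0 C X Y \<cdot> u = x" "proj1 C X Y \<cdot> u = y"
    using is_productE[OF is_product_proj[OF o] assms] unfolding prod_obj_def by metis
  have "\<exists>!u. u \<in> hom C A (prod_obj C X Y) \<and> proj0 C X Y \<cdot> u = x \<and> proj1 C X Y \<cdot> u = y"
    using u proj_eq[OF o] by metis
  moreover have "pairing C x y = (THE u. u \<in> hom C A (prod_obj C X Y) \<and> proj0 C X Y \<cdot> u = x \<and> proj1 C X Y \<cdot> u = y)"
    unfolding pairing_def using assms by simp
  ultimately have "pairing C x y \<in> hom C A (prod_obj C X Y) \<and>
      proj0 C X Y \<cdot> pairing C x y = x \<and> proj1 C X Y \<cdot> pairing C x y = y"
    using theI'[of "\<lambda>u. u \<in> hom C A (prod_obj C X Y) \<and> proj0 C X Y \<cdot> u = x \<and> proj1 C X Y \<cdot> u = y"] by simp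
  then show "pairing C x y \<in> hom C A (prod_obj C X Y)"
    "proj0 C X Y \<cdot> pairing C x y = x" "proj1 C X Y \<cdot> pairing C x y = y" by blast+
qed

lemma pairing_unique:
  assumes "x \<in> hom C A X" "y \<in> hom C A Y" "u \<in> hom C A (prod_obj C X Y)"
    "proj0 C X Y \<cdot> u = x" "proj1 C X Y \<cdot> u = y"
  shows "pairing C x y = u"
proof -
  have "X \<in> Obj C" "Y \<in> Obj C" using assms(1,2) by auto
  then show ?thesis by (rule proj_eq[OF _ _ pairing(1)[OF assms(1,2)] assms(3)])
      (simp_all only: pairing(2,3)[OF assms(1,2)] assms(4,5))
qed

lemma ff_mor_pairing:
  assumes x: "x \<in> hom C A X" and y: "y \<in> hom C A Y" and j: "jointly_order_mono C x y"
  shows "ff_mor C (pairing C x y)"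
  unfolding ff_mor_def
proof (intro conjI allI ballI impI)
  note p = pairing[OF x y]
  have o: "X \<in> Obj C" "Y \<in> Obj C" using assms by auto
  show pa: "pairing C x y \<in> Arr C" using p by simp
  fix Z u v
  assume u: "u \<in> hom C Z (Dom C (pairing C x y))" and v: "v \<in> hom C Z (Dom C (pairing C x y))"
    and le: "pairing C x y \<cdot> u \<sqsubseteq> pairing C x y \<cdot> v"
  have "proj0 C X Y \<cdot> pairing C x y \<cdot> u \<sqsubseteq> proj0 C X Y \<cdot> pairing C x y \<cdot> v"
    "proj1 C X Y \<cdot> pairing C x y \<cdot> u \<sqsubseteq> proj1 C X Y \<cdot> pairing C x y \<cdot> v"
    using u v p o by (auto intro!: comp_mono_right le)
  then have "x \<cdot> u \<sqsubseteq> x \<cdot> v" "y \<cdot> u \<sqsubseteq> y \<cdot> v"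
    using u v p o assoc_eq[OF p(2)] assoc_eq[OF p(3)] by simp_all
  then show "u \<sqsubseteq> v" by (rule jointly_order_monoD[OF j]) (use u v p x in simp_all)
qed

lemma ff_mor_jointly_order_mono:
  assumes m: "ff_mor C m" "Cod C m = prod_obj C X Y" and o: "X \<in> Obj C" "Y \<in> Obj C"
  shows "jointly_order_mono C (proj0 C X Y \<cdot> m) (proj1 C X Y \<cdot> m)"
  unfolding jointly_order_mono_def
proof (intro allI ballI impI, elim conjE)
  have ma: "m \<in> Arr C" using m(1) by (rule ff_mor_arr)
  fix A u v assume u: "u \<in> hom C A (Dom C (proj0 C X Y \<cdot> m))" and v: "v \<in> hom C A (Dom C (proj0 C X Y \<cdot> m))"
    and le: "(proj0 C X Y \<cdot> m) \<cdot> u \<sqsubseteq> (proj0 C X Y \<cdot> m) \<cdot> v" "(proj1 C X Y \<cdot> m) \<cdot> u \<sqsubseteq> (proj1 C X Y \<cdot> m) \<cdot> v"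
  have uv: "u \<in> hom C A (Dom C m)" "v \<in> hom C A (Dom C m)" using u v ma m o by simp_all
  have "m \<cdot> u \<sqsubseteq> m \<cdot> v"
    by (rule proj_mono[OF o, of _ A]) (use uv ma m o le in simp_all)
  then show "u \<sqsubseteq> v" by (rule ff_morD[OF m(1) _ uv])
qed

text \<open>The morphism \<open>e\<close> factors through the inserter of \<open>f\<close> and \<open>g\<close>, obtained by pulling back their comma
  object along the diagonal; so the inserter splits.\<close>

lemma so_order_epi:
  assumes e: "so_mor C e" and f: "f \<in> hom C (Cod C e) Z" and g: "g \<in> hom C (Cod C e) Z"
    and le: "f \<cdot> e \<sqsubseteq> g \<cdot> e"
  shows "f \<sqsubseteq> g"
proof -
  let ?B = "Cod C e"
  have ea: "e \<in> Arr C" using e by (rule so_mor_arr)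
  then have B: "?B \<in> Obj C" by simp
  have fg: "f \<in> Arr C" "g \<in> Arr C" "Cod C f = Cod C g" "Dom C f = ?B" "Dom C g = ?B" using f g by simp_all
  obtain c0 c1 where cm: "is_comma C f g c0 c1" "c0 \<in> hom C (Dom C c0) ?B"
    "c1 \<in> hom C (Dom C c0) ?B" "jointly_order_mono C c0 c1" "f \<cdot> c0 \<sqsubseteq> g \<cdot> c1"
    using comma_ex[OF fg(1-3)] fg(4,5) by metis
  have i: "Ident C ?B \<in> hom C ?B ?B" using B by simp
  let ?\<delta> = "pairing C (Ident C ?B) (Ident C ?B)" and ?c = "pairing C c0 c1"
  note \<delta> = pairing[OF i i] and c = pairing[OF cm(2,3)]
  have "?\<delta> \<in> Arr C" "?c \<in> Arr C" "Cod C ?\<delta> = Cod C ?c" using \<delta>(1) c(1) by simp_all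
  then obtain s t where st: "is_pullback C ?\<delta> ?c s t" "s \<in> hom C (Dom C s) (Dom C ?\<delta>)"
    "t \<in> hom C (Dom C s) (Dom C ?c)" "jointly_order_mono C s t" "?\<delta> \<cdot> s = ?c \<cdot> t"
    by (rule pullback_ex)
  have s: "s \<in> hom C (Dom C s) ?B" and t: "t \<in> hom C (Dom C s) (Dom C c0)" using st \<delta>(1) c(1) by simp_all
  have c0: "c0 \<cdot> t = s"
  proof -
    have "c0 \<cdot> t = proj0 C ?B ?B \<cdot> ?c \<cdot> t"
      using assoc_eq[OF c(2), of t] c t B by simp
    also have "\<dots> = proj0 C ?B ?B \<cdot> ?\<delta> \<cdot> s" by (simp only: st(5))
    also have "\<dots> = s" using assoc_eq[OF \<delta>(2), of s] \<delta> s B by simp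
    finally show ?thesis .
  qed
  have c1: "c1 \<cdot> t = s"
  proof -
    have "c1 \<cdot> t = proj1 C ?B ?B \<cdot> ?c \<cdot> t"
      using assoc_eq[OF c(3), of t] c t B by simp
    also have "\<dots> = proj1 C ?B ?B \<cdot> ?\<delta> \<cdot> s" by (simp only: st(5))
    also have "\<dots> = s" using assoc_eq[OF \<delta>(3), of s] \<delta> s B by simp
    finally show ?thesis .
  qed
  \<comment> \<open>Both composites of \<open>t\<close> with the legs of the comma object equal
    \<open>s\<close>, so an inequality after \<open>s\<close> gives one after \<open>t\<close>, and
    the projections of the pullback are jointly order-monic.\<close>
  have ff: "ff_mor C s"
    unfolding ff_mor_def
  proof (intro conjI allI ballI impI)
    show "s \<in> Arr C" using s by simp
    fix W u v assume u: "u \<in> hom C W (Dom C s)" and v: "v \<in> hom C W (Dom C s)" and le: "s \<cdot> u \<sqsubseteq> s \<cdot> v"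
    have "t \<cdot> u \<sqsubseteq> t \<cdot> v"
      by (rule jointly_order_monoD[OF cm(4), of _ _ W])
        (use u v t s le cm(2,3) assoc_eq[OF c0] assoc_eq[OF c1] in simp_all)
    then show "u \<sqsubseteq> v" by (rule jointly_order_monoD[OF st(4) le _ u v])
  qed
  have "e \<in> hom C (Dom C e) (Dom C f)" "e \<in> hom C (Dom C e) (Dom C g)" using ea fg by simp_all
  then obtain h where h: "h \<in> hom C (Dom C e) (Dom C c0)" "c0 \<cdot> h = e" "c1 \<cdot> h = e"
    using is_commaE[OF cm(1) _ _ le] by metis
  have "?\<delta> \<cdot> e = ?c \<cdot> h"
    by (rule proj_eq[OF B B, of _ "Dom C e"])
      (use \<delta> c ea h B assoc_eq[OF \<delta>(2)] assoc_eq[OF \<delta>(3)] assoc_eq[OF c(2)] assoc_eq[OF c(3)] in simp_all)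
  then obtain w where w: "w \<in> hom C (Dom C e) (Dom C s)" "s \<cdot> w = e"
    using is_pullbackE[OF st(1), of e "Dom C e" h] \<delta>(1) c(1) ea h by auto
  obtain d where d: "d \<in> hom C ?B (Dom C s)" "s \<cdot> d = Ident C ?B"
    by (rule so_lift[OF e ff, of w "Ident C ?B"]) (use w s ea B in simp_all)
  have "f \<cdot> c0 \<cdot> t \<cdot> d \<sqsubseteq> g \<cdot> c1 \<cdot> t \<cdot> d"
  proof -
    have "(f \<cdot> c0) \<cdot> (t \<cdot> d) \<sqsubseteq> (g \<cdot> c1) \<cdot> (t \<cdot> d)"
      by (rule comp_mono_left[OF cm(5)]) (use fg cm(2,3) t d in simp_all)
    then show ?thesis using fg cm(2,3) t d by simp
  qed
  moreover have "c0 \<cdot> t \<cdot> d = Ident C ?B" "c1 \<cdot> t \<cdot> d = Ident C ?B"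
    using assoc_eq[OF c0, of d] assoc_eq[OF c1, of d] d t cm(2,3) by simp_all
  ultimately show ?thesis using fg by simp
qed

lemma so_epi:
  assumes e: "so_mor C e" and f: "f \<in> hom C (Cod C e) Z" and g: "g \<in> hom C (Cod C e) Z"
    and eq: "f \<cdot> e = g \<cdot> e"
  shows "f = g"
proof (rule le_antisym)
  have "g \<cdot> e \<in> Arr C" using g so_mor_arr[OF e] by simp
  then show "f \<sqsubseteq> g" "g \<sqsubseteq> f"
    using so_order_epi[OF e f g] so_order_epi[OF e g f] eq by simp_all
qed (use f g in simp_all)

text \<open>The first projection of the image of \<open>\<langle>e, f\<rangle>\<close> is both \<open>so\<close> and \<open>ff\<close>.\<close>

lemma so_descent:
  assumes e: "so_mor C e" and f: "f \<in> hom C (Dom C e) Z"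
    and ker: "\<And>A s t. \<lbrakk>s \<in> hom C A (Dom C e); t \<in> hom C A (Dom C e); e \<cdot> s \<sqsubseteq> e \<cdot> t\<rbrakk> \<Longrightarrow> f \<cdot> s \<sqsubseteq> f \<cdot> t"
  obtains g where "g \<in> hom C (Cod C e) Z" "g \<cdot> e = f"
proof -
  let ?A = "Dom C e" and ?B = "Cod C e"
  have ea: "e \<in> hom C ?A ?B" using so_mor_arr[OF e] by simp
  have o: "?B \<in> Obj C" "Z \<in> Obj C" using ea f by auto
  note p = pairing[OF ea f]
  have "pairing C e f \<in> Arr C" using p(1) by simp
  then obtain e' m where em: "so_mor C e'" "ff_mor C m" "Cod C e' = Dom C m" "pairing C e f = m \<cdot> e'"
    "Dom C e' = ?A" "Cod C m = prod_obj C ?B Z" using so_ff_factor p(1) by (metis in_hom_iff)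
  have ma: "m \<in> Arr C" "e' \<in> Arr C" using em by (simp_all add: ff_mor_arr so_mor_arr)
  let ?m0 = "proj0 C ?B Z \<cdot> m" and ?m1 = "proj1 C ?B Z \<cdot> m"
  have m0: "?m0 \<in> hom C (Dom C m) ?B" and m1: "?m1 \<in> hom C (Dom C m) Z" using ma em o by simp_all
  have m0e: "?m0 \<cdot> e' = e" and m1e: "?m1 \<cdot> e' = f" using p(2,3) ma em o by simp_all
  have so: "so_mor C ?m0"
    by (rule so_mor_cancel[of _ e']) (use m0e e m0 ma em in simp_all)
  \<comment> \<open>Two elements of the image lift along \<open>e'\<close> on a common cover. There
    \<open>ker\<close> turns a comparison of first coordinates into one of second coordinates, and
    \<open>so_order_epi\<close> removes the cover.\<close>
  have ff: "ff_mor C ?m0"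
    unfolding ff_mor_def
  proof (intro conjI allI ballI impI)
    show "?m0 \<in> Arr C" using m0 by simp
    fix T u v assume u: "u \<in> hom C T (Dom C ?m0)" and v: "v \<in> hom C T (Dom C ?m0)" and le: "?m0 \<cdot> u \<sqsubseteq> ?m0 \<cdot> v"
    have uv: "u \<in> hom C T (Cod C e')" "v \<in> hom C T (Cod C e')" using u v m0 em by simp_all
    obtain T1 t1 s1 where t1: "so_mor C t1" "t1 \<in> hom C T1 T" "s1 \<in> hom C T1 (Dom C e')" "e' \<cdot> s1 = u \<cdot> t1"
      by (rule so_pullback_lift[OF em(1) uv(1)])
    have "v \<cdot> t1 \<in> hom C T1 (Cod C e')" using uv t1 by simp
    then obtain T2 t2 s2 where t2: "so_mor C t2" "t2 \<in> hom C T2 T1" "s2 \<in> hom C T2 (Dom C e')" "e' \<cdot> s2 = (v \<cdot> t1) \<cdot> t2"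
      by (rule so_pullback_lift[OF em(1)])
    let ?t = "t1 \<cdot> t2" and ?s = "s1 \<cdot> t2"
    have t: "?t \<in> hom C T2 T" "so_mor C ?t" using t1 t2 so_mor_comp[of t2 t1] by simp_all
    have s: "?s \<in> hom C T2 ?A" "s2 \<in> hom C T2 ?A" using t1 t2 em by simp_all
    have es: "e' \<cdot> ?s = u \<cdot> ?t" "e' \<cdot> s2 = v \<cdot> ?t"
      using assoc_eq[OF t1(4), of t2] t1 t2 uv ma by simp_all
    have "e \<cdot> ?s = ?m0 \<cdot> u \<cdot> ?t" "e \<cdot> s2 = ?m0 \<cdot> v \<cdot> ?t"
      using assoc_eq[OF m0e, of ?s] assoc_eq[OF m0e, of s2] s t ma m0 em by (simp_all del: assoc add: es)
    moreover have "(?m0 \<cdot> u) \<cdot> ?t \<sqsubseteq> (?m0 \<cdot> v) \<cdot> ?t"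
      by (rule comp_mono_left[OF le]) (use u v m0 t in \<open>simp_all del: assoc\<close>)
    ultimately have "e \<cdot> ?s \<sqsubseteq> e \<cdot> s2"
      using u v m0 t by simp
    then have "f \<cdot> ?s \<sqsubseteq> f \<cdot> s2" by (rule ker[OF s])
    moreover have "f \<cdot> ?s = ?m1 \<cdot> u \<cdot> ?t" "f \<cdot> s2 = ?m1 \<cdot> v \<cdot> ?t"
      using assoc_eq[OF m1e, of ?s] assoc_eq[OF m1e, of s2] s t ma m1 em by (simp_all del: assoc add: es)
    ultimately have fle: "(?m1 \<cdot> u) \<cdot> ?t \<sqsubseteq> (?m1 \<cdot> v) \<cdot> ?t"
      using u v m0 m1 t by simp
    have um: "u \<in> hom C T (Dom C m)" "v \<in> hom C T (Dom C m)" using uv em by simp_all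
    have tT: "Cod C ?t = T" using t(1) by simp
    have "?m1 \<cdot> u \<sqsubseteq> ?m1 \<cdot> v"
      by (rule so_order_epi[OF t(2) _ _ fle, of Z, unfolded tT]) (use um m1 in \<open>simp_all del: assoc\<close>)
    with le have "m \<cdot> u \<sqsubseteq> m \<cdot> v"
      by - (rule proj_mono[OF o, of _ T], use um ma o em(6) in simp_all)
    then show "u \<sqsubseteq> v" by (rule ff_morD[OF em(2) _ um])
  qed
  obtain k where k: "k \<in> hom C ?B (Dom C m)" "k \<cdot> ?m0 = Ident C (Dom C m)"
    using is_isoE[OF so_ff_iso[OF so ff]] m0 by (metis in_hom_iff)
  have "k \<cdot> ?m0 \<cdot> e' = e'" using assoc_eq[OF k(2), of e'] k m0 ma em by simp
  then have "k \<cdot> e = e'" using m0e by simp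
  then have "(?m1 \<cdot> k) \<cdot> e = f"
    using k m1 ea m1e by (simp del: assoc add: assoc[of e k ?m1])
  then show thesis using that[of "?m1 \<cdot> k"] k m1 by simp
qed


section \<open>Generalized elements of relations\<close>

definition is_rel :: "'a \<Rightarrow> 'a \<Rightarrow> 'b set \<Rightarrow> bool" where
  "is_rel X Y R \<longleftrightarrow> X \<in> Obj C \<and> Y \<in> Obj C \<and> R \<in> relations C X Y"

lemma is_rel_obj: "is_rel X Y R \<Longrightarrow> X \<in> Obj C" "is_rel X Y R \<Longrightarrow> Y \<in> Obj C"
  by (simp_all add: is_rel_def)

lemma factors_through_refl: "m \<in> Arr C \<Longrightarrow> factors_through C m m"
  unfolding factors_through_def by (intro bexI[of _ "Ident C (Dom C m)"]) simp_all

lemma factors_through_trans: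
  assumes "factors_through C l m" "factors_through C m n" "n \<in> Arr C"
  shows "factors_through C l n"
proof -
  obtain u v where u: "u \<in> hom C (Dom C l) (Dom C m)" "l = m \<cdot> u"
    and v: "v \<in> hom C (Dom C m) (Dom C n)" "m = n \<cdot> v"
    using assms(1,2) unfolding factors_through_def by blast
  have "l = n \<cdot> v \<cdot> u" using u v assms(3) by (metis assoc in_hom_iff)
  moreover have "v \<cdot> u \<in> hom C (Dom C l) (Dom C n)" using u(1) v(1) by simp
  ultimately show ?thesis unfolding factors_through_def by blast
qed

lemma sub_class_self: "ff_mor C m \<Longrightarrow> m \<in> sub_class C m"
  by (simp add: sub_class_def factors_through_refl ff_mor_arr)

lemma is_relE:
  assumes "is_rel X Y R"
  obtains m where "ff_mor C m" "Cod C m = prod_obj C X Y" "R = sub_class C m"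
  using assms unfolding is_rel_def relations_def subobjects_def by blast

lemma is_relI:
  assumes "ff_mor C m" "Cod C m = prod_obj C X Y" "X \<in> Obj C" "Y \<in> Obj C"
  shows "is_rel X Y (sub_class C m)"
  using assms unfolding is_rel_def relations_def subobjects_def by blast

text \<open>Representatives of one subobject factor through each other, so the existential over
  \<open>R\<close> in \<open>in_rel\<close> can be read at any chosen representative.\<close>

lemma in_rel_factors:
  assumes R: "is_rel X Y R" and r: "r \<in> R"
  shows "in_rel C x y R \<longleftrightarrow> factors_through C (pairing C x y) r"
proof -
  obtain m where m: "ff_mor C m" "R = sub_class C m" using R by (rule is_relE)
  have ma: "m \<in> Arr C" "r \<in> Arr C" using m r by (simp_all add: ff_mor_arr sub_class_def)
  have rm: "factors_through C r m" "factors_through C m r" using m(2) r by (simp_all add: sub_class_def)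
  have "factors_through C k n \<longleftrightarrow> factors_through C k r" if "n \<in> R" for k n
  proof -
    have n: "n \<in> Arr C" "factors_through C n m" "factors_through C m n"
      using m(2) that by (simp_all add: sub_class_def ff_mor_arr)
    show ?thesis
      using factors_through_trans[OF factors_through_trans[OF _ n(2) ma(1)] rm(2) ma(2), of k]
        factors_through_trans[OF factors_through_trans[OF _ rm(1) ma(1)] n(3) n(1), of k] by blast
  qed
  then show ?thesis unfolding in_rel_def using r by blast
qed

lemma rel_memD:
  assumes "is_rel X Y R" "r \<in> R"
  shows "r \<in> Arr C" "ff_mor C r" "Cod C r = prod_obj C X Y"
proof -
  obtain m where "Cod C m = prod_obj C X Y" "R = sub_class C m" using assms(1) by (rule is_relE)
  then show "r \<in> Arr C" "ff_mor C r" "Cod C r = prod_obj C X Y"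
    using assms(2) by (simp_all add: sub_class_def ff_mor_arr)
qed

lemma factors_through_pairing_iff:
  assumes o: "X \<in> Obj C" "Y \<in> Obj C" and r: "r \<in> Arr C" "Cod C r = prod_obj C X Y"
    and x: "x \<in> hom C A X" and y: "y \<in> hom C A Y"
  shows "factors_through C (pairing C x y) r \<longleftrightarrow>
    (\<exists>u\<in>hom C A (Dom C r). proj0 C X Y \<cdot> r \<cdot> u = x \<and> proj1 C X Y \<cdot> r \<cdot> u = y)"
proof -
  note p = pairing[OF x y]
  have "pairing C x y = r \<cdot> u \<longleftrightarrow> proj0 C X Y \<cdot> r \<cdot> u = x \<and> proj1 C X Y \<cdot> r \<cdot> u = y"
    if "u \<in> hom C A (Dom C r)" for u
  proof
    assume "pairing C x y = r \<cdot> u"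
    then show "proj0 C X Y \<cdot> r \<cdot> u = x \<and> proj1 C X Y \<cdot> r \<cdot> u = y" using p(2,3) by simp
  next
    assume "proj0 C X Y \<cdot> r \<cdot> u = x \<and> proj1 C X Y \<cdot> r \<cdot> u = y"
    then show "pairing C x y = r \<cdot> u" by (intro pairing_unique[OF x y]) (use that r in simp_all)
  qed
  moreover have "Dom C (pairing C x y) = A" using p(1) by simp
  ultimately show ?thesis unfolding factors_through_def by blast
qed

lemma in_rel_iff:
  assumes R: "is_rel X Y R" and r: "r \<in> R" and x: "x \<in> hom C A X" and y: "y \<in> hom C A Y"
  shows "in_rel C x y R \<longleftrightarrow>
    (\<exists>u\<in>hom C A (Dom C r). proj0 C X Y \<cdot> r \<cdot> u = x \<and> proj1 C X Y \<cdot> r \<cdot> u = y)"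
  unfolding in_rel_factors[OF R r]
  by (rule factors_through_pairing_iff[OF is_rel_obj[OF R] _ _ x y]) (use rel_memD[OF R r] in simp_all)

lemma in_rel_legs:
  assumes R: "is_rel X Y R" and r: "r \<in> R" and u: "u \<in> hom C A (Dom C r)"
  shows "in_rel C (proj0 C X Y \<cdot> r \<cdot> u) (proj1 C X Y \<cdot> r \<cdot> u) R"
proof (subst in_rel_iff[OF R r, of _ A])
  show "\<exists>v\<in>hom C A (Dom C r). proj0 C X Y \<cdot> r \<cdot> v = proj0 C X Y \<cdot> r \<cdot> u \<and> proj1 C X Y \<cdot> r \<cdot> v = proj1 C X Y \<cdot> r \<cdot> u"
    using u by blast
qed (use u rel_memD[OF R r] is_rel_obj[OF R] in simp_all)

text \<open>Passing from a representative to its two legs lets later arguments speak of jointly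
  order-monic spans and avoid the chosen product.\<close>

lemma rel_span:
  assumes R: "is_rel X Y R"
  obtains T r0 r1 where "r0 \<in> hom C T X" "r1 \<in> hom C T Y" "jointly_order_mono C r0 r1"
    "\<And>A x y. \<lbrakk>x \<in> hom C A X; y \<in> hom C A Y\<rbrakk> \<Longrightarrow>
       in_rel C x y R \<longleftrightarrow> (\<exists>u\<in>hom C A T. r0 \<cdot> u = x \<and> r1 \<cdot> u = y)"
proof -
  obtain m where m: "ff_mor C m" "Cod C m = prod_obj C X Y" "R = sub_class C m" using R by (rule is_relE)
  have r: "m \<in> R" unfolding m(3) by (rule sub_class_self[OF m(1)])
  note o = is_rel_obj[OF R] and ma = ff_mor_arr[OF m(1)]
  show thesis
  proof (rule that[of "proj0 C X Y \<cdot> m" "Dom C m" "proj1 C X Y \<cdot> m"])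
    show "jointly_order_mono C (proj0 C X Y \<cdot> m) (proj1 C X Y \<cdot> m)"
      by (rule ff_mor_jointly_order_mono[OF m(1,2) o])
    fix A x y assume xy: "x \<in> hom C A X" "y \<in> hom C A Y"
    show "in_rel C x y R \<longleftrightarrow> (\<exists>u\<in>hom C A (Dom C m). (proj0 C X Y \<cdot> m) \<cdot> u = x \<and> (proj1 C X Y \<cdot> m) \<cdot> u = y)"
      unfolding in_rel_iff[OF R r xy] using ma m(2) o by (intro bex_cong) simp_all
  qed (use ma m(2) o in simp_all)
qed

lemma span_rel:
  assumes r: "r0 \<in> hom C T X" "r1 \<in> hom C T Y" "jointly_order_mono C r0 r1"
  obtains R where "is_rel X Y R" "pairing C r0 r1 \<in> R"
    "\<And>A x y. \<lbrakk>x \<in> hom C A X; y \<in> hom C A Y\<rbrakk> \<Longrightarrow>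
       in_rel C x y R \<longleftrightarrow> (\<exists>u\<in>hom C A T. r0 \<cdot> u = x \<and> r1 \<cdot> u = y)"
proof -
  let ?m = "pairing C r0 r1" and ?R = "sub_class C (pairing C r0 r1)"
  note p = pairing[OF r(1,2)] and ff = ff_mor_pairing[OF r]
  have o: "X \<in> Obj C" "Y \<in> Obj C" using r by auto
  have R: "is_rel X Y ?R" by (rule is_relI[OF ff _ o]) (use p in simp)
  show thesis
  proof (rule that[OF R sub_class_self[OF ff]])
    fix A x y assume xy: "x \<in> hom C A X" "y \<in> hom C A Y"
    have "Dom C ?m = T" using p by simp
    moreover have "proj0 C X Y \<cdot> ?m \<cdot> u = r0 \<cdot> u" "proj1 C X Y \<cdot> ?m \<cdot> u = r1 \<cdot> u" if "u \<in> hom C A T" for u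
      using that assoc_eq[OF p(2), of u] assoc_eq[OF p(3), of u] p o by simp_all
    ultimately show "in_rel C x y ?R \<longleftrightarrow> (\<exists>u\<in>hom C A T. r0 \<cdot> u = x \<and> r1 \<cdot> u = y)"
      unfolding in_rel_iff[OF R sub_class_self[OF ff] xy] by (intro bex_cong) simp_all
  qed
qed

lemma in_rel_comp:
  assumes R: "is_rel X Y R" and x: "x \<in> hom C A X" and y: "y \<in> hom C A Y" and u: "u \<in> hom C B A"
    and xy: "in_rel C x y R"
  shows "in_rel C (x \<cdot> u) (y \<cdot> u) R"
proof -
  obtain T r0 r1 where r: "r0 \<in> hom C T X" "r1 \<in> hom C T Y"
    and i: "\<And>A x y. \<lbrakk>x \<in> hom C A X; y \<in> hom C A Y\<rbrakk> \<Longrightarrow>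
       in_rel C x y R \<longleftrightarrow> (\<exists>u\<in>hom C A T. r0 \<cdot> u = x \<and> r1 \<cdot> u = y)" using rel_span[OF R] by metis
  obtain w where w: "w \<in> hom C A T" "r0 \<cdot> w = x" "r1 \<cdot> w = y" using xy i[OF x y] by blast
  have "r0 \<cdot> w \<cdot> u = x \<cdot> u" "r1 \<cdot> w \<cdot> u = y \<cdot> u" "w \<cdot> u \<in> hom C B T"
    using assoc_eq[OF w(2), of u] assoc_eq[OF w(3), of u] w r u by simp_all
  moreover have "x \<cdot> u \<in> hom C B X" "y \<cdot> u \<in> hom C B Y" using x y u by simp_all
  ultimately show ?thesis using i[of "x \<cdot> u" B "y \<cdot> u"] by blast
qed

text \<open>The representing morphism is \<open>ff\<close> and the cover is \<open>so\<close>, so a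
  factorization of the restricted pair extends along the cover as a diagonal.\<close>

lemma in_rel_local:
  assumes R: "is_rel X Y R" and x: "x \<in> hom C A X" and y: "y \<in> hom C A Y"
    and e: "so_mor C e" "e \<in> hom C B A" and xy: "in_rel C (x \<cdot> e) (y \<cdot> e) R"
  shows "in_rel C x y R"
proof -
  obtain m where m: "ff_mor C m" "Cod C m = prod_obj C X Y" "R = sub_class C m" using R by (rule is_relE)
  have r: "m \<in> R" unfolding m(3) by (rule sub_class_self[OF m(1)])
  note o = is_rel_obj[OF R] and ma = ff_mor_arr[OF m(1)] and p = pairing[OF x y]
  have xe: "x \<cdot> e \<in> hom C B X" "y \<cdot> e \<in> hom C B Y" using x y e by simp_all
  obtain u where u: "u \<in> hom C B (Dom C m)" "proj0 C X Y \<cdot> m \<cdot> u = x \<cdot> e" "proj1 C X Y \<cdot> m \<cdot> u = y \<cdot> e"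
    using xy unfolding in_rel_iff[OF R r xe] by blast
  have "m \<cdot> u = pairing C x y \<cdot> e"
    by (rule proj_eq[OF o, of _ B])
      (use u p e ma m(2) o assoc_eq[OF p(2), of e] assoc_eq[OF p(3), of e] in simp_all)
  then obtain d where d: "d \<in> hom C A (Dom C m)" "m \<cdot> d = pairing C x y"
    using so_lift[OF e(1) m(1), of u "pairing C x y"] u(1) p(1) e(2) m(2) by (metis in_hom_iff)
  then show ?thesis unfolding in_rel_factors[OF R r] factors_through_def using p(1) by (metis in_hom_iff)
qed

text \<open>The legs of a representative of \<open>R\<close> form its generic element; membership of
  this one pair in \<open>S\<close> is exactly the factorization required by
  \<open>rel_incl\<close>.\<close>

lemma rel_incl_iff:
  assumes R: "is_rel X Y R" and S: "is_rel X Y S"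
  shows "rel_incl C R S \<longleftrightarrow>
    (\<forall>A. \<forall>x\<in>hom C A X. \<forall>y\<in>hom C A Y. in_rel C x y R \<longrightarrow> in_rel C x y S)"
proof
  assume "rel_incl C R S"
  then obtain m n where mn: "m \<in> R" "n \<in> S" "factors_through C m n" unfolding rel_incl_def by blast
  have "factors_through C k n" if "factors_through C k m" for k
    using factors_through_trans[OF that mn(3)] rel_memD[OF S mn(2)] by simp
  then show "\<forall>A. \<forall>x\<in>hom C A X. \<forall>y\<in>hom C A Y. in_rel C x y R \<longrightarrow> in_rel C x y S"
    unfolding in_rel_factors[OF R mn(1)] in_rel_factors[OF S mn(2)] by blast
next
  assume h: "\<forall>A. \<forall>x\<in>hom C A X. \<forall>y\<in>hom C A Y. in_rel C x y R \<longrightarrow> in_rel C x y S"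
  obtain m where m: "ff_mor C m" "R = sub_class C m" using R by (rule is_relE)
  obtain n where n: "ff_mor C n" "S = sub_class C n" using S by (rule is_relE)
  have mR: "m \<in> R" and nS: "n \<in> S" unfolding m n by (rule sub_class_self[OF m(1)], rule sub_class_self[OF n(1)])
  note o = is_rel_obj[OF R] and ma = rel_memD[OF R mR]
  let ?x = "proj0 C X Y \<cdot> m" and ?y = "proj1 C X Y \<cdot> m"
  have xy: "?x \<in> hom C (Dom C m) X" "?y \<in> hom C (Dom C m) Y" using o ma by simp_all
  have p: "pairing C ?x ?y = m" by (rule pairing_unique[OF xy]) (use ma in simp_all)
  have "in_rel C ?x ?y R" unfolding in_rel_factors[OF R mR] p by (rule factors_through_refl[OF ma(1)])
  then have "in_rel C ?x ?y S" using h xy by blast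
  then have "factors_through C m n" unfolding in_rel_factors[OF S nS] p .
  then show "rel_incl C R S" unfolding rel_incl_def using mR nS by blast
qed

lemma rel_inclD:
  assumes "rel_incl C R S" "is_rel X Y R" "is_rel X Y S" "x \<in> hom C A X" "y \<in> hom C A Y" "in_rel C x y R"
  shows "in_rel C x y S"
  using assms(1,4-6) unfolding rel_incl_iff[OF assms(2,3)] by blast

lemma sub_class_eq_iff:
  assumes m: "ff_mor C m" and n: "ff_mor C n" and mn: "Cod C m = Cod C n"
  shows "sub_class C m = sub_class C n \<longleftrightarrow> factors_through C m n \<and> factors_through C n m"
proof
  assume "sub_class C m = sub_class C n"
  then have "m \<in> sub_class C n" using sub_class_self[OF m] by simp
  then show "factors_through C m n \<and> factors_through C n m" by (simp add: sub_class_def)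
next
  have a: "m \<in> Arr C" "n \<in> Arr C" using m n by (simp_all add: ff_mor_arr)
  assume h: "factors_through C m n \<and> factors_through C n m"
  then have h1: "factors_through C m n" and h2: "factors_through C n m" by blast+
  have "factors_through C k m \<longleftrightarrow> factors_through C k n" for k
    using factors_through_trans[OF _ h1 a(2), of k] factors_through_trans[OF _ h2 a(1), of k] by blast
  moreover have "factors_through C m k \<longleftrightarrow> factors_through C n k" if "ff_mor C k" for k
    using factors_through_trans[OF h1 _ ff_mor_arr[OF that]] factors_through_trans[OF h2 _ ff_mor_arr[OF that]] by blast
  ultimately show "sub_class C m = sub_class C n" unfolding sub_class_def mn by blast
qed

text \<open>Relations are whole equivalence classes of \<open>ff\<close>-morphisms, so mutual
  inclusion gives equality of sets and not merely an isomorphism of representatives.\<close>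

lemma rel_eqI:
  assumes R: "is_rel X Y R" and S: "is_rel X Y S"
    and h: "\<And>A x y. \<lbrakk>x \<in> hom C A X; y \<in> hom C A Y\<rbrakk> \<Longrightarrow> in_rel C x y R \<longleftrightarrow> in_rel C x y S"
  shows "R = S"
proof -
  obtain m where m: "ff_mor C m" "Cod C m = prod_obj C X Y" "R = sub_class C m" using R by (rule is_relE)
  obtain n where n: "ff_mor C n" "Cod C n = prod_obj C X Y" "S = sub_class C n" using S by (rule is_relE)
  have "rel_incl C R S" "rel_incl C S R" using h unfolding rel_incl_iff[OF R S] rel_incl_iff[OF S R] by blast+
  then obtain m1 n1 m2 n2 where 1: "m1 \<in> R" "n1 \<in> S" "factors_through C m1 n1"
    and 2: "m2 \<in> R" "n2 \<in> S" "factors_through C n2 m2" unfolding rel_incl_def by blast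
  have a: "m \<in> Arr C" "n \<in> Arr C" "m1 \<in> Arr C" "n1 \<in> Arr C" "m2 \<in> Arr C" "n2 \<in> Arr C"
    using m n rel_memD[OF R] rel_memD[OF S] 1 2 by (simp_all add: ff_mor_arr)
  have f: "factors_through C m m1" "factors_through C m2 m" "factors_through C n1 n" "factors_through C n n2"
    using 1 2 m n by (simp_all add: sub_class_def)
  have "factors_through C m n"
    using factors_through_trans[OF factors_through_trans[OF f(1) 1(3)] f(3)] a by blast
  moreover have "factors_through C n m"
    using factors_through_trans[OF factors_through_trans[OF f(4) 2(3)] f(2)] a by blast
  ultimately show ?thesis unfolding m(3) n(3) using sub_class_eq_iff[OF m(1) n(1)] m(2) n(2) by simp
qed

text \<open>The inverse image of \<open>R\<close> along the product map of \<open>f\<close> and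
  \<open>g\<close>: a representative of \<open>R\<close> is pulled back along the pairing of
  \<open>f \<cdot> ?p0\<close> and \<open>g \<cdot> ?p1\<close>, and \<open>ff\<close>-morphisms are
  stable under pullback.\<close>

lemma rel_pull:
  assumes R: "is_rel X Y R" and f: "f \<in> hom C X' X" and g: "g \<in> hom C Y' Y"
  obtains S where "is_rel X' Y' S"
    "\<And>A x y. \<lbrakk>x \<in> hom C A X'; y \<in> hom C A Y'\<rbrakk> \<Longrightarrow> in_rel C x y S \<longleftrightarrow> in_rel C (f \<cdot> x) (g \<cdot> y) R"
proof -
  obtain T r0 r1 where r: "r0 \<in> hom C T X" "r1 \<in> hom C T Y" "jointly_order_mono C r0 r1"
    and i: "\<And>A x y. \<lbrakk>x \<in> hom C A X; y \<in> hom C A Y\<rbrakk> \<Longrightarrow>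
       in_rel C x y R \<longleftrightarrow> (\<exists>u\<in>hom C A T. r0 \<cdot> u = x \<and> r1 \<cdot> u = y)" by (rule rel_span[OF R]) blast
  have o: "X' \<in> Obj C" "Y' \<in> Obj C" "X \<in> Obj C" "Y \<in> Obj C" using f g by auto
  let ?m = "pairing C r0 r1" and ?p0 = "proj0 C X' Y'" and ?p1 = "proj1 C X' Y'"
  let ?f = "f \<cdot> ?p0" and ?g = "g \<cdot> ?p1"
  have fg: "?f \<in> hom C (prod_obj C X' Y') X" "?g \<in> hom C (prod_obj C X' Y') Y" using f g o by simp_all
  let ?h = "pairing C ?f ?g"
  note m = pairing[OF r(1,2)] and h = pairing[OF fg] and ff = ff_mor_pairing[OF r]
  have "?m \<in> Arr C" "?h \<in> Arr C" "Cod C ?m = Cod C ?h" using m(1) h(1) by simp_all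
  then obtain p q where pq: "is_pullback C ?m ?h p q" "p \<in> hom C (Dom C p) (Dom C ?m)"
    "q \<in> hom C (Dom C p) (Dom C ?h)" "jointly_order_mono C p q" "?m \<cdot> p = ?h \<cdot> q" by (rule pullback_ex)
  let ?P = "Dom C p"
  have p: "p \<in> hom C ?P T" and q: "q \<in> hom C ?P (prod_obj C X' Y')" using pq(2,3) m(1) h(1) by simp_all
  have mw: "proj0 C X Y \<cdot> ?m \<cdot> w = r0 \<cdot> w" "proj1 C X Y \<cdot> ?m \<cdot> w = r1 \<cdot> w" if "w \<in> hom C A T" for w A
    using that assoc_eq[OF m(2), of w] assoc_eq[OF m(3), of w] m o by simp_all
  have hw: "proj0 C X Y \<cdot> ?h \<cdot> w = f \<cdot> ?p0 \<cdot> w" "proj1 C X Y \<cdot> ?h \<cdot> w = g \<cdot> ?p1 \<cdot> w"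
    if "w \<in> hom C A (prod_obj C X' Y')" for w A
    using that assoc_eq[OF h(2), of w] assoc_eq[OF h(3), of w] h o f g by simp_all
  have c: "r0 \<cdot> p = f \<cdot> ?p0 \<cdot> q" "r1 \<cdot> p = g \<cdot> ?p1 \<cdot> q"
    using mw[OF p] hw[OF q] pq(5) by simp_all
  have qff: "ff_mor C q"
    unfolding ff_mor_def
  proof (intro conjI allI ballI impI)
    show "q \<in> Arr C" using q by simp
    fix Z u v assume u: "u \<in> hom C Z (Dom C q)" and v: "v \<in> hom C Z (Dom C q)" and le: "q \<cdot> u \<sqsubseteq> q \<cdot> v"
    have uv: "u \<in> hom C Z ?P" "v \<in> hom C Z ?P" using u v q by simp_all
    have "?m \<cdot> p \<cdot> u = ?h \<cdot> q \<cdot> u" "?m \<cdot> p \<cdot> v = ?h \<cdot> q \<cdot> v"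
      using assoc_eq[OF pq(5), of u] assoc_eq[OF pq(5), of v] p q uv m(1) h(1) by simp_all
    moreover have "?h \<cdot> q \<cdot> u \<sqsubseteq> ?h \<cdot> q \<cdot> v"
      by (rule comp_mono_right[OF le]) (use q uv h(1) in simp_all)
    ultimately have "?m \<cdot> p \<cdot> u \<sqsubseteq> ?m \<cdot> p \<cdot> v" by simp
    then have "p \<cdot> u \<sqsubseteq> p \<cdot> v" by (rule ff_morD[OF ff, of _ _ Z]) (use p uv m(1) in simp_all)
    then show "u \<sqsubseteq> v" by (rule jointly_order_monoD[OF pq(4) _ le uv])
  qed
  have s: "?p0 \<cdot> q \<in> hom C ?P X'" "?p1 \<cdot> q \<in> hom C ?P Y'" using q o by simp_all
  have sj: "jointly_order_mono C (?p0 \<cdot> q) (?p1 \<cdot> q)"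
    by (rule ff_mor_jointly_order_mono[OF qff _ o(1,2)]) (use q in simp)
  obtain S where S: "is_rel X' Y' S" "\<And>A x y. \<lbrakk>x \<in> hom C A X'; y \<in> hom C A Y'\<rbrakk> \<Longrightarrow>
       in_rel C x y S \<longleftrightarrow> (\<exists>u\<in>hom C A ?P. (?p0 \<cdot> q) \<cdot> u = x \<and> (?p1 \<cdot> q) \<cdot> u = y)"
    by (rule span_rel[OF s sj]) blast
  show thesis
  proof (rule that[OF S(1)])
    fix A x y assume x: "x \<in> hom C A X'" and y: "y \<in> hom C A Y'"
    have fx: "f \<cdot> x \<in> hom C A X" "g \<cdot> y \<in> hom C A Y" using x y f g by simp_all
    show "in_rel C x y S \<longleftrightarrow> in_rel C (f \<cdot> x) (g \<cdot> y) R"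
    proof
      assume "in_rel C x y S"
      then obtain u where u: "u \<in> hom C A ?P" "?p0 \<cdot> q \<cdot> u = x" "?p1 \<cdot> q \<cdot> u = y"
        using S(2)[OF x y] q o by auto
      have "r0 \<cdot> p \<cdot> u = f \<cdot> x" "r1 \<cdot> p \<cdot> u = g \<cdot> y" "p \<cdot> u \<in> hom C A T"
        using assoc_eq[OF c(1), of u] assoc_eq[OF c(2), of u] u p q r f g o by simp_all
      then show "in_rel C (f \<cdot> x) (g \<cdot> y) R" unfolding i[OF fx] by blast
    next
      assume "in_rel C (f \<cdot> x) (g \<cdot> y) R"
      then obtain w where w: "w \<in> hom C A T" "r0 \<cdot> w = f \<cdot> x" "r1 \<cdot> w = g \<cdot> y" unfolding i[OF fx] by blast
      note xy = pairing[OF x y]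
      have "?m \<cdot> w = ?h \<cdot> pairing C x y"
        by (rule proj_eq[OF o(3,4), of _ A])
          (use w xy m(1) h(1) mw[OF w(1)] hw[OF xy(1)] in simp_all)
      then obtain u where u: "u \<in> hom C A ?P" "p \<cdot> u = w" "q \<cdot> u = pairing C x y"
        using is_pullbackE[OF pq(1), of w A "pairing C x y"] w(1) xy(1) m(1) h(1) by (metis in_hom_iff)
      have "(?p0 \<cdot> q) \<cdot> u = x" "(?p1 \<cdot> q) \<cdot> u = y"
        using u xy q o by simp_all
      then show "in_rel C x y S" unfolding S(2)[OF x y] using u(1) by blast
    qed
  qed
qed

lemma rel_inter:
  assumes R: "is_rel X Y R" and S: "is_rel X Y S"
  obtains Q where "is_rel X Y Q"
    "\<And>A x y. \<lbrakk>x \<in> hom C A X; y \<in> hom C A Y\<rbrakk> \<Longrightarrow> in_rel C x y Q \<longleftrightarrow> in_rel C x y R \<and> in_rel C x y S"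
proof -
  obtain m where m: "ff_mor C m" "Cod C m = prod_obj C X Y" "R = sub_class C m" using R by (rule is_relE)
  obtain n where n: "ff_mor C n" "Cod C n = prod_obj C X Y" "S = sub_class C n" using S by (rule is_relE)
  have mR: "m \<in> R" and nS: "n \<in> S" unfolding m n by (rule sub_class_self[OF m(1)], rule sub_class_self[OF n(1)])
  note o = is_rel_obj[OF R] and a = ff_mor_arr[OF m(1)] ff_mor_arr[OF n(1)]
  have "Cod C m = Cod C n" using m n by simp
  then obtain p q where pq: "is_pullback C m n p q" "p \<in> hom C (Dom C p) (Dom C m)"
    "q \<in> hom C (Dom C p) (Dom C n)" "jointly_order_mono C p q" "m \<cdot> p = n \<cdot> q" by (rule pullback_ex[OF a])
  let ?k = "m \<cdot> p"
  have k: "?k \<in> Arr C" "Cod C ?k = prod_obj C X Y" "Dom C ?k = Dom C p"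
    using pq(2) a m(2) by simp_all
  have ff: "ff_mor C ?k"
    unfolding ff_mor_def
  proof (intro conjI allI ballI impI)
    fix Z u v assume u: "u \<in> hom C Z (Dom C ?k)" and v: "v \<in> hom C Z (Dom C ?k)" and le: "?k \<cdot> u \<sqsubseteq> ?k \<cdot> v"
    have uv: "u \<in> hom C Z (Dom C p)" "v \<in> hom C Z (Dom C p)" using u v k by simp_all
    have "m \<cdot> p \<cdot> u \<sqsubseteq> m \<cdot> p \<cdot> v" using le uv pq(2) a by simp
    then have 1: "p \<cdot> u \<sqsubseteq> p \<cdot> v" by (rule ff_morD[OF m(1), of _ _ Z]) (use uv pq(2) in simp_all)
    have "n \<cdot> q \<cdot> u \<sqsubseteq> n \<cdot> q \<cdot> v" using le[unfolded pq(5)] uv pq(3) a by simp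
    then have 2: "q \<cdot> u \<sqsubseteq> q \<cdot> v" by (rule ff_morD[OF n(1), of _ _ Z]) (use uv pq(3) in simp_all)
    show "u \<sqsubseteq> v" by (rule jointly_order_monoD[OF pq(4) 1 2 uv])
  qed (rule k)
  have Q: "is_rel X Y (sub_class C ?k)" by (rule is_relI[OF ff k(2) o])
  show thesis
  proof (rule that[OF Q])
    fix A x y assume x: "x \<in> hom C A X" and y: "y \<in> hom C A Y"
    note xy = pairing[OF x y]
    have "factors_through C (pairing C x y) ?k \<longleftrightarrow>
        factors_through C (pairing C x y) m \<and> factors_through C (pairing C x y) n"
    proof
      assume "factors_through C (pairing C x y) ?k"
      moreover have "factors_through C ?k m" unfolding factors_through_def
        by (intro bexI[of _ p]) (use pq(2) k in simp_all)
      moreover have "factors_through C ?k n" unfolding factors_through_def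
        by (intro bexI[of _ q]) (use pq(3,5) k in simp_all)
      ultimately show "factors_through C (pairing C x y) m \<and> factors_through C (pairing C x y) n"
        using factors_through_trans a by blast
    next
      assume "factors_through C (pairing C x y) m \<and> factors_through C (pairing C x y) n"
      then obtain u v where u: "u \<in> hom C A (Dom C m)" "pairing C x y = m \<cdot> u"
        and v: "v \<in> hom C A (Dom C n)" "pairing C x y = n \<cdot> v"
        unfolding factors_through_def using xy(1) by (metis in_hom_iff)
      obtain w where w: "w \<in> hom C A (Dom C p)" "p \<cdot> w = u"
        using is_pullbackE[OF pq(1) u(1) v(1)] u(2) v(2) by metis
      have "pairing C x y = ?k \<cdot> w" using u(2) w pq(2) a by simp
      then show "factors_through C (pairing C x y) ?k"
        unfolding factors_through_def using w(1) xy(1) k by (intro bexI[of _ w]) simp_all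
    qed
    then show "in_rel C x y (sub_class C ?k) \<longleftrightarrow> in_rel C x y R \<and> in_rel C x y S"
      unfolding in_rel_factors[OF Q sub_class_self[OF ff]] in_rel_factors[OF R mR] in_rel_factors[OF S nS] .
  qed
qed


section \<open>Composition of relations and comma relations\<close>

text \<open>An element of the image \<open>n\<close> lifts along \<open>e\<close> to the pullback
  only on a cover, which yields the intermediate \<open>y\<close>; conversely a local
  \<open>y\<close> gives a map into the pullback, and a diagonal removes the cover. All data stay
  arbitrary so that two different choices of them can be compared in
  \<open>rel_comp\<close>.\<close>

lemma rel_comp_char:
  assumes R: "is_rel X Y R" and S: "is_rel Y Z S"
    and rs: "r \<in> R" "s \<in> S" and pb: "is_pullback C (proj1 C X Y \<cdot> r) (proj0 C Y Z \<cdot> s) t0 t1"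
    and e: "so_mor C e" and n: "ff_mor C n" and en: "Cod C e = Dom C n"
    and ne: "n \<cdot> e = pairing C ((proj0 C X Y \<cdot> r) \<cdot> t0) ((proj1 C Y Z \<cdot> s) \<cdot> t1)"
  shows "Cod C n = prod_obj C X Z"
    and "\<lbrakk>x \<in> hom C A X; z \<in> hom C A Z\<rbrakk> \<Longrightarrow> factors_through C (pairing C x z) n \<longleftrightarrow>
      (\<exists>B e' y. so_mor C e' \<and> e' \<in> hom C B A \<and> y \<in> hom C B Y \<and>
         in_rel C (x \<cdot> e') y R \<and> in_rel C y (z \<cdot> e') S)"
proof -
  note o = is_rel_obj[OF R] is_rel_obj[OF S] and r = rel_memD[OF R rs(1)] and s = rel_memD[OF S rs(2)]
  have ea: "e \<in> Arr C" and na: "n \<in> Arr C" using e n by (simp_all add: so_mor_arr ff_mor_arr)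
  let ?r0 = "proj0 C X Y \<cdot> r" and ?r1 = "proj1 C X Y \<cdot> r" and ?s0 = "proj0 C Y Z \<cdot> s" and ?s1 = "proj1 C Y Z \<cdot> s"
  have t: "t0 \<in> hom C (Dom C t0) (Dom C r)" "t1 \<in> hom C (Dom C t0) (Dom C s)" and rt: "?r1 \<cdot> t0 = ?s0 \<cdot> t1"
    using pb r s o unfolding is_pullback_def by simp_all
  have x0: "?r0 \<cdot> t0 \<in> hom C (Dom C t0) X" and z0: "?s1 \<cdot> t1 \<in> hom C (Dom C t0) Z" using t r s o by simp_all
  note p = pairing[OF x0 z0]
  have "n \<cdot> e \<in> hom C (Dom C t0) (prod_obj C X Z)" unfolding ne by (rule p(1))
  then show nc: "Cod C n = prod_obj C X Z" using ea na en by simp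
  from \<open>n \<cdot> e \<in> hom C (Dom C t0) (prod_obj C X Z)\<close> have de: "Dom C e = Dom C t0" using ea na en by simp
  have q: "proj0 C X Z \<cdot> n \<cdot> e = proj0 C X Y \<cdot> r \<cdot> t0" "proj1 C X Z \<cdot> n \<cdot> e = proj1 C Y Z \<cdot> s \<cdot> t1"
    using p(2,3) t r s o unfolding ne by simp_all
  assume x: "x \<in> hom C A X" and z: "z \<in> hom C A Z"
  note xz = pairing[OF x z]
  note fac = factors_through_pairing_iff[OF o(1,4) na nc x z]
  show "factors_through C (pairing C x z) n \<longleftrightarrow>
      (\<exists>B e' y. so_mor C e' \<and> e' \<in> hom C B A \<and> y \<in> hom C B Y \<and>
         in_rel C (x \<cdot> e') y R \<and> in_rel C y (z \<cdot> e') S)"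
  proof
    assume "factors_through C (pairing C x z) n"
    then obtain u where u: "u \<in> hom C A (Dom C n)" "proj0 C X Z \<cdot> n \<cdot> u = x" "proj1 C X Z \<cdot> n \<cdot> u = z"
      unfolding fac by blast
    obtain B e' w where w: "so_mor C e'" "e' \<in> hom C B A" "w \<in> hom C B (Dom C e)" "e \<cdot> w = u \<cdot> e'"
      by (rule so_pullback_lift[OF e, of u A]) (use u en in simp_all)
    have wt: "w \<in> hom C B (Dom C t0)" using w(3) de by simp
    have tw: "t0 \<cdot> w \<in> hom C B (Dom C r)" "t1 \<cdot> w \<in> hom C B (Dom C s)" using wt t by simp_all
    have "proj0 C X Z \<cdot> n \<cdot> e \<cdot> w = x \<cdot> e'" "proj1 C X Z \<cdot> n \<cdot> e \<cdot> w = z \<cdot> e'"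
      using assoc_eq[OF u(2), of e'] assoc_eq[OF u(3), of e'] w u na nc o by simp_all
    moreover have "proj0 C X Z \<cdot> n \<cdot> e \<cdot> w = proj0 C X Y \<cdot> r \<cdot> t0 \<cdot> w"
      "proj1 C X Z \<cdot> n \<cdot> e \<cdot> w = proj1 C Y Z \<cdot> s \<cdot> t1 \<cdot> w"
      using assoc_eq[OF q(1), of w] assoc_eq[OF q(2), of w] w(3) wt t r s o ea na nc en de by simp_all
    ultimately have xz': "x \<cdot> e' = proj0 C X Y \<cdot> r \<cdot> t0 \<cdot> w" "z \<cdot> e' = proj1 C Y Z \<cdot> s \<cdot> t1 \<cdot> w" by simp_all
    let ?y = "proj1 C X Y \<cdot> r \<cdot> t0 \<cdot> w"
    have y2: "?y = proj0 C Y Z \<cdot> s \<cdot> t1 \<cdot> w"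
      using assoc_eq[OF rt, of w] wt t r s o by simp
    have "in_rel C (x \<cdot> e') ?y R" unfolding xz' by (rule in_rel_legs[OF R rs(1) tw(1)])
    moreover have "in_rel C ?y (z \<cdot> e') S" unfolding xz' y2 by (rule in_rel_legs[OF S rs(2) tw(2)])
    moreover have "?y \<in> hom C B Y" using tw r o by simp
    ultimately show "\<exists>B e' y. so_mor C e' \<and> e' \<in> hom C B A \<and> y \<in> hom C B Y \<and>
         in_rel C (x \<cdot> e') y R \<and> in_rel C y (z \<cdot> e') S" using w(1,2) by blast
  next
    assume "\<exists>B e' y. so_mor C e' \<and> e' \<in> hom C B A \<and> y \<in> hom C B Y \<and>
         in_rel C (x \<cdot> e') y R \<and> in_rel C y (z \<cdot> e') S"
    then obtain B e' y where h: "so_mor C e'" "e' \<in> hom C B A" "y \<in> hom C B Y"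
      "in_rel C (x \<cdot> e') y R" "in_rel C y (z \<cdot> e') S" by blast
    have xe: "x \<cdot> e' \<in> hom C B X" "z \<cdot> e' \<in> hom C B Z" using h(2) x z by simp_all
    obtain a where a: "a \<in> hom C B (Dom C r)" "proj0 C X Y \<cdot> r \<cdot> a = x \<cdot> e'" "proj1 C X Y \<cdot> r \<cdot> a = y"
      using h(4) unfolding in_rel_iff[OF R rs(1) xe(1) h(3)] by blast
    obtain b where b: "b \<in> hom C B (Dom C s)" "proj0 C Y Z \<cdot> s \<cdot> b = y" "proj1 C Y Z \<cdot> s \<cdot> b = z \<cdot> e'"
      using h(5) unfolding in_rel_iff[OF S rs(2) h(3) xe(2)] by blast
    have ab: "a \<in> hom C B (Dom C ?r1)" "b \<in> hom C B (Dom C ?s0)" "?r1 \<cdot> a = ?s0 \<cdot> b"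
      using a b r s o by simp_all
    obtain w where w: "w \<in> hom C B (Dom C t0)" "t0 \<cdot> w = a" "t1 \<cdot> w = b"
      by (rule is_pullbackE[OF pb ab])
    have we: "w \<in> hom C B (Dom C e)" using w(1) de by simp
    have "proj0 C X Z \<cdot> n \<cdot> e \<cdot> w = x \<cdot> e'" "proj1 C X Z \<cdot> n \<cdot> e \<cdot> w = z \<cdot> e'"
      using assoc_eq[OF q(1), of w] assoc_eq[OF q(2), of w] a(2) b(3) w we t r s o ea na nc en de by simp_all
    then have "n \<cdot> e \<cdot> w = pairing C x z \<cdot> e'"
      by - (rule proj_eq[OF o(1,4), of _ B],
        use xz h(2) we ea na nc en assoc_eq[OF xz(2), of e'] assoc_eq[OF xz(3), of e'] o in simp_all)
    then obtain d where d: "d \<in> hom C (Cod C e') (Dom C n)" "n \<cdot> d = pairing C x z"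
      by - (rule so_lift[OF h(1) n, of "e \<cdot> w" "pairing C x z"],
        use h(2) we ea en xz(1) nc in simp_all)
    then show "factors_through C (pairing C x z) n"
      unfolding factors_through_def using xz(1) h(2) by (intro bexI[of _ d]) simp_all
  qed
qed

lemma rel_comp:
  assumes R: "is_rel X Y R" and S: "is_rel Y Z S"
  shows is_rel_comp: "is_rel X Z (rel_comp C X Y Z S R)"
    and in_rel_comp_iff: "\<lbrakk>x \<in> hom C A X; z \<in> hom C A Z\<rbrakk> \<Longrightarrow> in_rel C x z (rel_comp C X Y Z S R) \<longleftrightarrow>
      (\<exists>B e y. so_mor C e \<and> e \<in> hom C B A \<and> y \<in> hom C B Y \<and> in_rel C (x \<cdot> e) y R \<and> in_rel C y (z \<cdot> e) S)"
proof -
  note o = is_rel_obj[OF R] is_rel_obj[OF S]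
  obtain r where r: "ff_mor C r" "R = sub_class C r" using R by (rule is_relE)
  obtain s where s: "ff_mor C s" "S = sub_class C s" using S by (rule is_relE)
  have rs: "r \<in> R" "s \<in> S" unfolding r s by (rule sub_class_self[OF r(1)], rule sub_class_self[OF s(1)])
  note rm = rel_memD[OF R rs(1)] and sm = rel_memD[OF S rs(2)]
  let ?f = "proj1 C X Y \<cdot> r" and ?g = "proj0 C Y Z \<cdot> s"
  have "?f \<in> Arr C" "?g \<in> Arr C" "Cod C ?f = Cod C ?g" using rm sm o by simp_all
  then obtain t0 t1 where t: "is_pullback C ?f ?g t0 t1" "t0 \<in> hom C (Dom C t0) (Dom C ?f)"
    "t1 \<in> hom C (Dom C t0) (Dom C ?g)" by (rule pullback_ex)
  have "(proj0 C X Y \<cdot> r) \<cdot> t0 \<in> hom C (Dom C t0) X" "(proj1 C Y Z \<cdot> s) \<cdot> t1 \<in> hom C (Dom C t0) Z"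
    using t(2,3) rm sm o by simp_all
  from pairing(1)[OF this] obtain e n where en: "so_mor C e" "ff_mor C n" "Cod C e = Dom C n"
    "pairing C ((proj0 C X Y \<cdot> r) \<cdot> t0) ((proj1 C Y Z \<cdot> s) \<cdot> t1) = n \<cdot> e"
    using so_ff_factor by (metis in_hom_iff)
  note char = rel_comp_char[OF R S rs t(1) en(1-3) en(4)[symmetric]]
  have na: "n \<in> Arr C" and ea: "e \<in> Arr C" using en by (simp_all add: ff_mor_arr so_mor_arr)
  have nT: "is_rel X Z (sub_class C n)" by (rule is_relI[OF en(2) char(1) o(1,4)])
  have eq: "rel_comp C X Y Z S R = sub_class C n"
  proof (intro set_eqI iffI)
    fix k assume "k \<in> rel_comp C X Y Z S R"
    then obtain r' s' t0' t1' e' where k: "r' \<in> R" "s' \<in> S"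
      "is_pullback C (proj1 C X Y \<cdot> r') (proj0 C Y Z \<cdot> s') t0' t1'" "so_mor C e'" "ff_mor C k" "Cod C e' = Dom C k"
      "k \<cdot> e' = pairing C ((proj0 C X Y \<cdot> r') \<cdot> t0') ((proj1 C Y Z \<cdot> s') \<cdot> t1')"
      unfolding rel_comp_def by blast
    note char' = rel_comp_char[OF R S k]
    have ka: "k \<in> Arr C" using k by (simp add: ff_mor_arr)
    have f: "factors_through C l k \<longleftrightarrow> factors_through C l n" if l: "l \<in> Arr C" "Cod C l = prod_obj C X Z" for l
    proof -
      let ?x = "proj0 C X Z \<cdot> l" and ?z = "proj1 C X Z \<cdot> l"
      have xz: "?x \<in> hom C (Dom C l) X" "?z \<in> hom C (Dom C l) Z" using l o by simp_all
      have "pairing C ?x ?z = l" by (rule pairing_unique[OF xz]) (use l in simp_all)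
      then show ?thesis using char(2)[OF xz] char'(2)[OF xz] by simp
    qed
    show "k \<in> sub_class C n"
      using f[OF ka char'(1)] f[OF na char(1)] factors_through_refl[OF ka] factors_through_refl[OF na]
        k(5) char(1) char'(1) by (simp add: sub_class_def)
  next
    fix k assume k: "k \<in> sub_class C n"
    then have kf: "ff_mor C k" and kc: "Cod C k = Cod C n" by (simp_all add: sub_class_def)
    then have ka: "k \<in> Arr C" by (simp add: ff_mor_arr)
    \<comment> \<open>Another representative \<open>k\<close> differs from \<open>n\<close> by an
      isomorphism \<open>i\<close>, and \<open>i \<cdot> e\<close> is then the
      \<open>so\<close>-part belonging to \<open>k\<close>; so every member of the class occurs in
      \<open>rel_comp\<close>.\<close>
    obtain i where i: "i \<in> hom C (Dom C n) (Dom C k)" "n = k \<cdot> i"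
      using k unfolding sub_class_def factors_through_def by blast
    obtain j where j: "j \<in> hom C (Dom C k) (Dom C n)" "k = n \<cdot> j"
      using k unfolding sub_class_def factors_through_def by blast
    have "n \<cdot> j \<cdot> i = n \<cdot> Ident C (Dom C n)" using i j na by (metis assoc comp_ident(1) in_hom_iff)
    then have ji: "j \<cdot> i = Ident C (Dom C n)"
      by (rule ff_mor_eq[OF en(2), of _ _ "Dom C n"]) (use i(1) j(1) na in simp_all)
    have "k \<cdot> i \<cdot> j = k \<cdot> Ident C (Dom C k)" using i j ka by (metis assoc comp_ident(1) in_hom_iff)
    then have ij: "i \<cdot> j = Ident C (Dom C k)"
      by (rule ff_mor_eq[OF kf, of _ _ "Dom C k"]) (use i(1) j(1) ka in simp_all)
    have "so_mor C i" by (rule so_mor_iso[OF is_isoI[OF i(1) j(1) ji ij]])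
    then have "so_mor C (i \<cdot> e)" using so_mor_comp[OF en(1)] i(1) en(3) by simp
    moreover have "k \<cdot> i \<cdot> e = n \<cdot> e" using assoc_eq[OF i(2)[symmetric], of e] i(1) ka ea en(3) by simp
    moreover have "Cod C (i \<cdot> e) = Dom C k" using i(1) ea en(3) by simp
    ultimately show "k \<in> rel_comp C X Y Z S R"
      unfolding rel_comp_def using rs t(1) kf en(4) by (metis (mono_tags, lifting) mem_Collect_eq)
  qed
  show "is_rel X Z (rel_comp C X Y Z S R)" unfolding eq by (rule nT)
  show "in_rel C x z (rel_comp C X Y Z S R) \<longleftrightarrow>
      (\<exists>B e y. so_mor C e \<and> e \<in> hom C B A \<and> y \<in> hom C B Y \<and> in_rel C (x \<cdot> e) y R \<and> in_rel C y (z \<cdot> e) S)"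
    if "x \<in> hom C A X" "z \<in> hom C A Z"
    unfolding eq in_rel_factors[OF nT sub_class_self[OF en(2)]] by (rule char(2)[OF that])
qed

lemma in_rel_compI:
  assumes R: "is_rel X Y R" and S: "is_rel Y Z S" and x: "x \<in> hom C A X" and z: "z \<in> hom C A Z"
    and e: "so_mor C e" "e \<in> hom C B A" and y: "y \<in> hom C B Y" "in_rel C (x \<cdot> e) y R" "in_rel C y (z \<cdot> e) S"
  shows "in_rel C x z (rel_comp C X Y Z S R)"
  unfolding in_rel_comp_iff[OF R S x z] using e y by blast

lemma in_rel_compI':
  assumes R: "is_rel X Y R" and S: "is_rel Y Z S" and x: "x \<in> hom C A X" and z: "z \<in> hom C A Z"
    and y: "y \<in> hom C A Y" "in_rel C x y R" "in_rel C y z S"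
  shows "in_rel C x z (rel_comp C X Y Z S R)"
proof (rule in_rel_compI[OF R S x z])
  show "so_mor C (Ident C A)" by (rule so_mor_ident) (use x in auto)
  show "Ident C A \<in> hom C A A" using x by auto
qed (use assms in auto)

lemma in_rel_compE:
  assumes "in_rel C x z (rel_comp C X Y Z S R)" "is_rel X Y R" "is_rel Y Z S" "x \<in> hom C A X" "z \<in> hom C A Z"
  obtains B e y where "so_mor C e" "e \<in> hom C B A" "y \<in> hom C B Y"
    "in_rel C (x \<cdot> e) y R" "in_rel C y (z \<cdot> e) S"
  using assms(1) unfolding in_rel_comp_iff[OF assms(2-5)] by blast

lemma comma_rel:
  assumes f: "f \<in> hom C X Z" and g: "g \<in> hom C Y Z"
  shows is_rel_comma: "is_rel X Y (comma_rel C f g)"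
    and in_comma_rel: "\<lbrakk>x \<in> hom C A X; y \<in> hom C A Y\<rbrakk> \<Longrightarrow> in_rel C x y (comma_rel C f g) \<longleftrightarrow> f \<cdot> x \<sqsubseteq> g \<cdot> y"
proof -
  have o: "X \<in> Obj C" "Y \<in> Obj C" using f g by auto
  have "f \<in> Arr C" "g \<in> Arr C" "Cod C f = Cod C g" using f g by simp_all
  then obtain c0 c1 where c: "is_comma C f g c0 c1" "c0 \<in> hom C (Dom C c0) (Dom C f)"
    "c1 \<in> hom C (Dom C c0) (Dom C g)" "jointly_order_mono C c0 c1" "f \<cdot> c0 \<sqsubseteq> g \<cdot> c1" by (rule comma_ex)
  have c01: "c0 \<in> hom C (Dom C c0) X" "c1 \<in> hom C (Dom C c0) Y" using c f g by simp_all
  obtain R where R: "is_rel X Y R" "pairing C c0 c1 \<in> R" "\<And>A x y. \<lbrakk>x \<in> hom C A X; y \<in> hom C A Y\<rbrakk> \<Longrightarrow>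
       in_rel C x y R \<longleftrightarrow> (\<exists>u\<in>hom C A (Dom C c0). c0 \<cdot> u = x \<and> c1 \<cdot> u = y)"
    by (rule span_rel[OF c01 c(4)]) blast
  have comma_iff: "f \<cdot> x \<sqsubseteq> g \<cdot> y \<longleftrightarrow> (\<exists>u\<in>hom C A (Dom C d0). d0 \<cdot> u = x \<and> d1 \<cdot> u = y)"
    if d: "is_comma C f g d0 d1" and x: "x \<in> hom C A X" and y: "y \<in> hom C A Y" for d0 d1 x y A
  proof
    assume "f \<cdot> x \<sqsubseteq> g \<cdot> y"
    then show "\<exists>u\<in>hom C A (Dom C d0). d0 \<cdot> u = x \<and> d1 \<cdot> u = y"
      using d x y f g unfolding is_comma_def by simp
  next
    assume "\<exists>u\<in>hom C A (Dom C d0). d0 \<cdot> u = x \<and> d1 \<cdot> u = y"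
    then obtain u where u: "u \<in> hom C A (Dom C d0)" "d0 \<cdot> u = x" "d1 \<cdot> u = y" by blast
    have dd: "d0 \<in> hom C (Dom C d0) X" "d1 \<in> hom C (Dom C d0) Y" "f \<cdot> d0 \<sqsubseteq> g \<cdot> d1"
      using d f g unfolding is_comma_def by simp_all
    have "(f \<cdot> d0) \<cdot> u \<sqsubseteq> (g \<cdot> d1) \<cdot> u" by (rule comp_mono_left[OF dd(3)]) (use dd u f g in simp_all)
    then show "f \<cdot> x \<sqsubseteq> g \<cdot> y" using u dd f g by simp
  qed
  have in_R: "in_rel C x y R \<longleftrightarrow> f \<cdot> x \<sqsubseteq> g \<cdot> y" if "x \<in> hom C A X" "y \<in> hom C A Y" for A x y
    unfolding R(3)[OF that] comma_iff[OF c(1) that] ..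
  have eq: "comma_rel C f g = R"
  proof (intro set_eqI iffI)
    fix k assume "k \<in> comma_rel C f g"
    then obtain d0 d1 where d: "is_comma C f g d0 d1" "k = pairing C d0 d1" unfolding comma_rel_def by blast
    have d01: "d0 \<in> hom C (Dom C d0) X" "d1 \<in> hom C (Dom C d0) Y" "jointly_order_mono C d0 d1"
      using d f g unfolding is_comma_def by simp_all
    obtain R' where R': "is_rel X Y R'" "pairing C d0 d1 \<in> R'" "\<And>A x y. \<lbrakk>x \<in> hom C A X; y \<in> hom C A Y\<rbrakk> \<Longrightarrow>
       in_rel C x y R' \<longleftrightarrow> (\<exists>u\<in>hom C A (Dom C d0). d0 \<cdot> u = x \<and> d1 \<cdot> u = y)"
      by (rule span_rel[OF d01]) blast
    have "R' = R"
      by (rule rel_eqI[OF R'(1) R(1)]) (simp only: R'(3) in_R comma_iff[OF d(1)])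
    then show "k \<in> R" using R'(2) d(2) by simp
  next
    \<comment> \<open>Every representative of \<open>R\<close> is the pairing of its own legs, and
      these legs satisfy the universal property of the comma object again.\<close>
    fix k assume k: "k \<in> R"
    note km = rel_memD[OF R(1) k]
    let ?d0 = "proj0 C X Y \<cdot> k" and ?d1 = "proj1 C X Y \<cdot> k"
    have d: "?d0 \<in> hom C (Dom C k) X" "?d1 \<in> hom C (Dom C k) Y" using km o by simp_all
    have kp: "pairing C ?d0 ?d1 = k" by (rule pairing_unique[OF d]) (use km in simp_all)
    have ii: "in_rel C x y R \<longleftrightarrow> (\<exists>u\<in>hom C A (Dom C k). ?d0 \<cdot> u = x \<and> ?d1 \<cdot> u = y)"
      if "x \<in> hom C A X" "y \<in> hom C A Y" for A x y
      unfolding in_rel_iff[OF R(1) k that] using km o by (intro bex_cong) simp_all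
    have "in_rel C ?d0 ?d1 R"
      unfolding in_rel_factors[OF R(1) k] kp by (rule factors_through_refl[OF km(1)])
    then have le: "f \<cdot> ?d0 \<sqsubseteq> g \<cdot> ?d1" using in_R[OF d] by blast
    have "is_comma C f g ?d0 ?d1"
      unfolding is_comma_def
    proof (intro conjI allI ballI impI)
      show "jointly_order_mono C ?d0 ?d1" by (rule ff_mor_jointly_order_mono[OF km(2,3) o])
      fix A x y assume "x \<in> hom C A (Dom C f)" "y \<in> hom C A (Dom C g)" and fg: "f \<cdot> x \<sqsubseteq> g \<cdot> y"
      then have xy: "x \<in> hom C A X" "y \<in> hom C A Y" using f g by simp_all
      have "in_rel C x y R" using fg in_R[OF xy] by blast
      then show "\<exists>u\<in>hom C A (Dom C ?d0). ?d0 \<cdot> u = x \<and> ?d1 \<cdot> u = y"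
        unfolding ii[OF xy] using km o by simp
    qed (use d f g le in simp_all)
    then show "k \<in> comma_rel C f g"
      unfolding comma_rel_def using kp[symmetric] by (intro CollectI exI conjI)
  qed
  show "is_rel X Y (comma_rel C f g)" unfolding eq by (rule R(1))
  show "in_rel C x y (comma_rel C f g) \<longleftrightarrow> f \<cdot> x \<sqsubseteq> g \<cdot> y" if "x \<in> hom C A X" "y \<in> hom C A Y"
    unfolding eq by (rule in_R[OF that])
qed


section \<open>Morphisms of the exact completion by elements\<close>

definition cong :: "'a \<Rightarrow> 'b set \<Rightarrow> bool" where
  "cong X E \<longleftrightarrow> X \<in> Obj C \<and> congruence C X E"

lemma ident_rel:
  assumes "X \<in> Obj C"
  shows "is_rel X X (ident_rel C X)"
    and "\<lbrakk>x \<in> hom C A X; x' \<in> hom C A X\<rbrakk> \<Longrightarrow> in_rel C x x' (ident_rel C X) \<longleftrightarrow> x \<sqsubseteq> x'"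
proof -
  have i: "Ident C X \<in> hom C X X" using assms by simp
  show "is_rel X X (ident_rel C X)" unfolding ident_rel_def by (rule is_rel_comma[OF i i])
  show "in_rel C x x' (ident_rel C X) \<longleftrightarrow> x \<sqsubseteq> x'" if "x \<in> hom C A X" "x' \<in> hom C A X"
    unfolding ident_rel_def in_comma_rel[OF i i that] using that by simp
qed

lemma cong_rel: "cong X E \<Longrightarrow> is_rel X X E"
  by (simp add: cong_def congruence_def is_rel_def)

lemma cong_obj: "cong X E \<Longrightarrow> X \<in> Obj C"
  by (simp add: cong_def)

lemma cong_le:
  assumes E: "cong X E" and x: "x \<in> hom C A X" "x' \<in> hom C A X" "x \<sqsubseteq> x'"
  shows "in_rel C x x' E"
proof -
  have "rel_incl C (ident_rel C X) E" using E by (simp add: cong_def congruence_def)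
  from rel_inclD[OF this ident_rel(1)[OF cong_obj[OF E]] cong_rel[OF E] x(1,2)]
  show ?thesis using ident_rel(2)[OF cong_obj[OF E] x(1,2)] x(3) by blast
qed

lemma cong_refl: "\<lbrakk>cong X E; x \<in> hom C A X\<rbrakk> \<Longrightarrow> in_rel C x x E"
  by (rule cong_le) simp_all

lemma cong_trans:
  assumes E: "cong X E" and x: "x \<in> hom C A X" "x' \<in> hom C A X" "x'' \<in> hom C A X"
    and i: "in_rel C x x' E" "in_rel C x' x'' E"
  shows "in_rel C x x'' E"
proof -
  note r = cong_rel[OF E]
  have "rel_incl C (rel_comp C X X X E E) E" using E by (simp add: cong_def congruence_def)
  from rel_inclD[OF this is_rel_comp[OF r r] r x(1,3)] in_rel_compI'[OF r r x(1,3,2) i]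
  show ?thesis by blast
qed

text \<open>Weakening closure is transitivity applied twice, with \<open>x' \<sqsubseteq> x\<close>
  and \<open>y \<sqsubseteq> y'\<close> turned into members of \<open>E\<close>. Transitivity for
  elements suffices for \<open>EE \<subseteq> E\<close>, because the cover hidden in the composite
  can be removed at the end.\<close>

lemma congI:
  assumes E: "is_rel X X E"
    and le: "\<And>A x x'. \<lbrakk>x \<in> hom C A X; x' \<in> hom C A X; x \<sqsubseteq> x'\<rbrakk> \<Longrightarrow> in_rel C x x' E"
    and trans: "\<And>A x x' x''. \<lbrakk>x \<in> hom C A X; x' \<in> hom C A X; x'' \<in> hom C A X;
      in_rel C x x' E; in_rel C x' x'' E\<rbrakk> \<Longrightarrow> in_rel C x x'' E"
  shows "cong X E"
proof -
  have X: "X \<in> Obj C" by (rule is_rel_obj(1)[OF E])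
  have "weakening_closed C X X E"
    unfolding weakening_closed_def
  proof (intro allI ballI impI, elim conjE)
    fix A x x' y y' assume h: "x \<in> hom C A X" "x' \<in> hom C A X" "y \<in> hom C A X" "y' \<in> hom C A X"
      "x' \<sqsubseteq> x" "in_rel C x y E" "y \<sqsubseteq> y'"
    show "in_rel C x' y' E"
      by (rule trans[OF h(2,1,4) le[OF h(2,1,5)] trans[OF h(1,3,4,6) le[OF h(3,4,7)]]])
  qed
  moreover have "rel_incl C (ident_rel C X) E"
    unfolding rel_incl_iff[OF ident_rel(1)[OF X] E] using le ident_rel(2)[OF X] by blast
  moreover have "rel_incl C (rel_comp C X X X E E) E"
    unfolding rel_incl_iff[OF is_rel_comp[OF E E] E]
  proof (intro allI ballI impI)
    fix A x z assume x: "x \<in> hom C A X" and z: "z \<in> hom C A X" and "in_rel C x z (rel_comp C X X X E E)"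
    then obtain B e y where e: "so_mor C e" "e \<in> hom C B A" "y \<in> hom C B X" "in_rel C (x \<cdot> e) y E" "in_rel C y (z \<cdot> e) E"
      using in_rel_compE[OF _ E E x z] by metis
    have "in_rel C (x \<cdot> e) (z \<cdot> e) E"
      by (rule trans[of _ B y]) (use x z e in simp_all)
    then show "in_rel C x z E" by (rule in_rel_local[OF E x z e(1,2)])
  qed
  ultimately show ?thesis using E X unfolding cong_def congruence_def is_rel_def by blast
qed

lemma cong_ident_rel:
  assumes X: "X \<in> Obj C"
  shows "cong X (ident_rel C X)"
proof (rule congI[OF ident_rel(1)[OF X]])
  fix A x x' x'' assume x: "x \<in> hom C A X" "x' \<in> hom C A X" "x'' \<in> hom C A X"
    and "in_rel C x x' (ident_rel C X)" "in_rel C x' x'' (ident_rel C X)"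
  then have "x \<sqsubseteq> x'" "x' \<sqsubseteq> x''" using ident_rel(2)[OF X x(1,2)] ident_rel(2)[OF X x(2,3)] by blast+
  then have "x \<sqsubseteq> x''" by (rule le_trans) (use x in simp_all)
  then show "in_rel C x x'' (ident_rel C X)" using ident_rel(2)[OF X x(1,3)] by blast
qed (use ident_rel(2)[OF X] in blast)

text \<open>The elementwise content of \<open>F R E = R\<close>. The two closure clauses give one
  inclusion; the other holds by reflexivity of \<open>E\<close> and \<open>F\<close>.\<close>

definition bimod :: "'a \<Rightarrow> 'b set \<Rightarrow> 'a \<Rightarrow> 'b set \<Rightarrow> 'b set \<Rightarrow> bool" where
  "bimod X E Y F R \<longleftrightarrow> cong X E \<and> cong Y F \<and> is_rel X Y R \<and>
     (\<forall>A. \<forall>x\<in>hom C A X. \<forall>x'\<in>hom C A X. \<forall>y\<in>hom C A Y. in_rel C x x' E \<longrightarrow> in_rel C x' y R \<longrightarrow> in_rel C x y R) \<and>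
     (\<forall>A. \<forall>x\<in>hom C A X. \<forall>y\<in>hom C A Y. \<forall>y'\<in>hom C A Y. in_rel C x y R \<longrightarrow> in_rel C y y' F \<longrightarrow> in_rel C x y' R)"

lemma bimod_left:
  assumes "bimod X E Y F R" "x \<in> hom C A X" "x' \<in> hom C A X" "y \<in> hom C A Y" "in_rel C x x' E" "in_rel C x' y R"
  shows "in_rel C x y R"
  using assms unfolding bimod_def by blast

lemma bimod_right:
  assumes "bimod X E Y F R" "x \<in> hom C A X" "y \<in> hom C A Y" "y' \<in> hom C A Y" "in_rel C x y R" "in_rel C y y' F"
  shows "in_rel C x y' R"
  using assms unfolding bimod_def by blast

lemma bimod_rel: "bimod X E Y F R \<Longrightarrow> is_rel X Y R"
  and bimod_cong: "bimod X E Y F R \<Longrightarrow> cong X E" "bimod X E Y F R \<Longrightarrow> cong Y F"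
  by (simp_all add: bimod_def)

text \<open>\<open>adj X E Y F R S\<close> says that \<open>R: (X, E) \<rightarrow> (Y, F)\<close> in \<open>Q\<^sub>w\<close> has the right adjoint \<open>S\<close>. Thinking of \<open>R x y\<close> as
  \<open>\<phi> x \<le> y\<close> and of \<open>S y x\<close> as \<open>y \<le> \<phi> x\<close>, the two final clauses say that locally \<open>\<phi> x\<close> exists and that it is unique.\<close>

definition adj :: "'a \<Rightarrow> 'b set \<Rightarrow> 'a \<Rightarrow> 'b set \<Rightarrow> 'b set \<Rightarrow> 'b set \<Rightarrow> bool" where
  "adj X E Y F R S \<longleftrightarrow> bimod X E Y F R \<and> bimod Y F X E S \<and>
     (\<forall>A. \<forall>x\<in>hom C A X. \<exists>B e y. so_mor C e \<and> e \<in> hom C B A \<and> y \<in> hom C B Y \<and>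
        in_rel C (x \<cdot> e) y R \<and> in_rel C y (x \<cdot> e) S) \<and>
     (\<forall>A. \<forall>x\<in>hom C A X. \<forall>y\<in>hom C A Y. \<forall>y'\<in>hom C A Y. in_rel C y x S \<longrightarrow> in_rel C x y' R \<longrightarrow> in_rel C y y' F)"

lemma adj_bimod: "adj X E Y F R S \<Longrightarrow> bimod X E Y F R" "adj X E Y F R S \<Longrightarrow> bimod Y F X E S"
  by (simp_all add: adj_def)

lemma adj_rel: "adj X E Y F R S \<Longrightarrow> is_rel X Y R" "adj X E Y F R S \<Longrightarrow> is_rel Y X S"
  by (simp_all add: adj_def bimod_def)

lemma adj_cong: "adj X E Y F R S \<Longrightarrow> cong X E" "adj X E Y F R S \<Longrightarrow> cong Y F"
  by (simp_all add: adj_def bimod_def)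

lemma adj_total:
  assumes "adj X E Y F R S" "x \<in> hom C A X"
  obtains B e y where "so_mor C e" "e \<in> hom C B A" "y \<in> hom C B Y"
    "in_rel C (x \<cdot> e) y R" "in_rel C y (x \<cdot> e) S"
  using assms unfolding adj_def by blast

lemma adj_counit:
  assumes "adj X E Y F R S" "x \<in> hom C A X" "y \<in> hom C A Y" "y' \<in> hom C A Y" "in_rel C y x S" "in_rel C x y' R"
  shows "in_rel C y y' F"
  using assms unfolding adj_def by blast

lemma adjI:
  assumes "bimod X E Y F R" "bimod Y F X E S"
    and "\<And>A x. x \<in> hom C A X \<Longrightarrow> \<exists>B e y. so_mor C e \<and> e \<in> hom C B A \<and> y \<in> hom C B Y \<and>
        in_rel C (x \<cdot> e) y R \<and> in_rel C y (x \<cdot> e) S"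
    and "\<And>A x y y'. \<lbrakk>x \<in> hom C A X; y \<in> hom C A Y; y' \<in> hom C A Y; in_rel C y x S; in_rel C x y' R\<rbrakk> \<Longrightarrow> in_rel C y y' F"
  shows "adj X E Y F R S"
  using assms unfolding adj_def by blast

lemma bimodI:
  assumes "cong X E" "cong Y F" "is_rel X Y R"
    and "\<And>A x x' y. \<lbrakk>x \<in> hom C A X; x' \<in> hom C A X; y \<in> hom C A Y; in_rel C x x' E; in_rel C x' y R\<rbrakk> \<Longrightarrow> in_rel C x y R"
    and "\<And>A x y y'. \<lbrakk>x \<in> hom C A X; y \<in> hom C A Y; y' \<in> hom C A Y; in_rel C x y R; in_rel C y y' F\<rbrakk> \<Longrightarrow> in_rel C x y' R"
  shows "bimod X E Y F R"
  using assms unfolding bimod_def by blast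

lemma Qw_arr_iff: "((X, E), R, (Y, F)) \<in> Arr (Qw C) \<longleftrightarrow> bimod X E Y F R"
proof -
  have 1: "((X, E), R, (Y, F)) \<in> Arr (Qw C) \<longleftrightarrow> cong X E \<and> cong Y F \<and> is_rel X Y R \<and>
      rel_comp C X Y Y F (rel_comp C X X Y R E) = R"
    by (auto simp: Qw_def cong_def is_rel_def)
  have "rel_comp C X Y Y F (rel_comp C X X Y R E) = R \<longleftrightarrow> bimod X E Y F R"
    if E: "cong X E" and F: "cong Y F" and R: "is_rel X Y R"
  proof -
    note e = cong_rel[OF E] and f = cong_rel[OF F]
    note re = is_rel_comp[OF e R]
    note fre = is_rel_comp[OF re f]
    show ?thesis
    proof
      assume eq: "rel_comp C X Y Y F (rel_comp C X X Y R E) = R"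
      have *: "in_rel C x y' R" if "x \<in> hom C A X" "x' \<in> hom C A X" "y \<in> hom C A Y" "y' \<in> hom C A Y"
        "in_rel C x x' E" "in_rel C x' y R" "in_rel C y y' F" for A x x' y y'
        using in_rel_compI'[OF re f that(1,4,3) in_rel_compI'[OF e R that(1,3,2,5,6)] that(7)] eq by simp
      show "bimod X E Y F R"
        by (rule bimodI[OF E F R]) (use * cong_refl[OF E] cong_refl[OF F] in blast)+
    next
      assume b: "bimod X E Y F R"
      show "rel_comp C X Y Y F (rel_comp C X X Y R E) = R"
      proof (rule rel_eqI[OF fre R])
        fix A x y assume x: "x \<in> hom C A X" and y: "y \<in> hom C A Y"
        show "in_rel C x y (rel_comp C X Y Y F (rel_comp C X X Y R E)) \<longleftrightarrow> in_rel C x y R"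
        proof
          assume "in_rel C x y (rel_comp C X Y Y F (rel_comp C X X Y R E))"
          then obtain B e1 y1 where 1: "so_mor C e1" "e1 \<in> hom C B A" "y1 \<in> hom C B Y"
            "in_rel C (x \<cdot> e1) y1 (rel_comp C X X Y R E)" "in_rel C y1 (y \<cdot> e1) F"
            by (rule in_rel_compE[OF _ re f x y])
          have xe: "x \<cdot> e1 \<in> hom C B X" "y \<cdot> e1 \<in> hom C B Y" using x y 1 by simp_all
          obtain B' e2 x2 where 2: "so_mor C e2" "e2 \<in> hom C B' B" "x2 \<in> hom C B' X"
            "in_rel C ((x \<cdot> e1) \<cdot> e2) x2 E" "in_rel C x2 (y1 \<cdot> e2) R"
            by (rule in_rel_compE[OF 1(4) e R xe(1) 1(3)])
          have "in_rel C ((x \<cdot> e1) \<cdot> e2) (y1 \<cdot> e2) R"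
            by (rule bimod_left[OF b _ 2(3) _ 2(4,5)]) (use xe(1) 1(3) 2(2) in \<open>simp_all del: assoc\<close>)
          then have "in_rel C (x \<cdot> e1) y1 R" by (rule in_rel_local[OF R xe(1) 1(3) 2(1,2)])
          then have "in_rel C (x \<cdot> e1) (y \<cdot> e1) R" by (rule bimod_right[OF b xe(1) 1(3) xe(2) _ 1(5)])
          then show "in_rel C x y R" by (rule in_rel_local[OF R x y 1(1,2)])
        next
          assume "in_rel C x y R"
          then show "in_rel C x y (rel_comp C X Y Y F (rel_comp C X X Y R E))"
            by (intro in_rel_compI'[OF re f x y y in_rel_compI'[OF e R x y x]] cong_refl[OF E x] cong_refl[OF F y])
        qed
      qed
    qed
  qed
  then show ?thesis unfolding 1 by (auto dest: bimod_rel bimod_cong)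
qed

text \<open>The unit, evaluated at a reflexive pair \<open>(x, x)\<close>, is the local existence of
  a value; it extends to all pairs of \<open>E\<close> because \<open>S\<close> absorbs
  \<open>E\<close>. The counit is uniqueness of values, once the cover from the composite
  \<open>R S\<close> is removed.\<close>

lemma right_adjoint_Qw_iff:
  "((X, E), R, (Y, F)) \<in> Arr (Qw C) \<and> right_adjoint (Qw C) ((X, E), R, (Y, F)) g \<longleftrightarrow>
    (\<exists>S. g = ((Y, F), S, (X, E)) \<and> adj X E Y F R S)"
proof -
  have dc: "Dom (Qw C) (a, \<Phi>, b) = a" "Cod (Qw C) (a, \<Phi>, b) = b" for a \<Phi> b by (simp_all add: Qw_def)
  have *: "right_adjoint (Qw C) ((X, E), R, (Y, F)) ((Y, F), S, (X, E)) \<longleftrightarrow>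
      bimod Y F X E S \<and> rel_incl C E (rel_comp C X Y X S R) \<and> rel_incl C (rel_comp C Y X Y R S) F" for S
    unfolding right_adjoint_def in_hom_iff dc Qw_arr_iff by (simp add: Qw_def)
  have **: "bimod X E Y F R \<and> bimod Y F X E S \<and> rel_incl C E (rel_comp C X Y X S R) \<and>
      rel_incl C (rel_comp C Y X Y R S) F \<longleftrightarrow> adj X E Y F R S" for S
  proof (cases "bimod X E Y F R \<and> bimod Y F X E S")
    case True
    then have b: "bimod X E Y F R" and b': "bimod Y F X E S" by blast+
    note R = bimod_rel[OF b] and S = bimod_rel[OF b'] and E = bimod_cong(1)[OF b] and F = bimod_cong(2)[OF b]
    note SR = is_rel_comp[OF R S] and RS = is_rel_comp[OF S R] and e = cong_rel[OF E] and f = cong_rel[OF F]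
    show ?thesis
    proof
      assume h: "bimod X E Y F R \<and> bimod Y F X E S \<and> rel_incl C E (rel_comp C X Y X S R) \<and>
        rel_incl C (rel_comp C Y X Y R S) F"
      then have h1: "rel_incl C E (rel_comp C X Y X S R)" and h2: "rel_incl C (rel_comp C Y X Y R S) F" by blast+
      show "adj X E Y F R S"
      proof (rule adjI[OF b b'])
        fix A x assume x: "x \<in> hom C A X"
        show "\<exists>B e y. so_mor C e \<and> e \<in> hom C B A \<and> y \<in> hom C B Y \<and>
            in_rel C (x \<cdot> e) y R \<and> in_rel C y (x \<cdot> e) S"
          using rel_inclD[OF h1 e SR x x cong_refl[OF E x]] unfolding in_rel_comp_iff[OF R S x x] .
      next
        fix A x y y' assume x: "x \<in> hom C A X" "y \<in> hom C A Y" "y' \<in> hom C A Y" "in_rel C y x S" "in_rel C x y' R"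
        show "in_rel C y y' F"
          by (rule rel_inclD[OF h2 RS f x(2,3) in_rel_compI'[OF S R x(2,3,1,4,5)]])
      qed
    next
      assume a: "adj X E Y F R S"
      have "rel_incl C E (rel_comp C X Y X S R)"
        unfolding rel_incl_iff[OF e SR]
      proof (intro allI ballI impI)
        fix A x x' assume x: "x \<in> hom C A X" "x' \<in> hom C A X" and xx: "in_rel C x x' E"
        obtain B d y where d: "so_mor C d" "d \<in> hom C B A" "y \<in> hom C B Y"
          "in_rel C (x \<cdot> d) y R" "in_rel C y (x \<cdot> d) S" by (rule adj_total[OF a x(1)])
        have "in_rel C (x \<cdot> d) (x' \<cdot> d) E" by (rule in_rel_comp[OF e x d(2) xx])
        moreover have "x \<cdot> d \<in> hom C B X" "x' \<cdot> d \<in> hom C B X" using x d by simp_all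
        ultimately have "in_rel C y (x' \<cdot> d) S"
          using bimod_right[OF b' d(3) _ _ d(5)] by blast
        then show "in_rel C x x' (rel_comp C X Y X S R)" by (rule in_rel_compI[OF R S x d(1,2,3,4)])
      qed
      moreover have "rel_incl C (rel_comp C Y X Y R S) F"
        unfolding rel_incl_iff[OF RS f]
      proof (intro allI ballI impI)
        fix A y y' assume y: "y \<in> hom C A Y" "y' \<in> hom C A Y" and yy: "in_rel C y y' (rel_comp C Y X Y R S)"
        obtain B d x where d: "so_mor C d" "d \<in> hom C B A" "x \<in> hom C B X"
          "in_rel C (y \<cdot> d) x S" "in_rel C x (y' \<cdot> d) R" by (rule in_rel_compE[OF yy S R y])
        have "in_rel C (y \<cdot> d) (y' \<cdot> d) F"
          by (rule adj_counit[OF a d(3) _ _ d(4,5)]) (use y d in simp_all)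
        then show "in_rel C y y' F" by (rule in_rel_local[OF f y d(1,2)])
      qed
      ultimately show "bimod X E Y F R \<and> bimod Y F X E S \<and> rel_incl C E (rel_comp C X Y X S R) \<and>
        rel_incl C (rel_comp C Y X Y R S) F" using b b' by blast
    qed
  next
    case False
    then show ?thesis unfolding adj_def by blast
  qed
  have g: "\<exists>S. g = ((Y, F), S, (X, E))" if "right_adjoint (Qw C) ((X, E), R, (Y, F)) g"
    using that unfolding right_adjoint_def in_hom_iff dc by (cases g) (auto simp: dc)
  show ?thesis unfolding Qw_arr_iff using g * ** by metis
qed

lemma exreg_simps:
  "Obj (exreg C) = {(X, E). cong X E}"
  "Dom (exreg C) (a, \<Phi>, b) = a" "Cod (exreg C) (a, \<Phi>, b) = b"
  "Ident (exreg C) (X, E) = ((X, E), E, (X, E))"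
  "(((Y, F), \<Psi>, c) \<cdot>\<^bsub>exreg C\<^esub> ((X, E), \<Phi>, b)) = ((X, E), rel_comp C X Y (fst c) \<Psi> \<Phi>, c)"
  "((a, \<Phi>, b) \<sqsubseteq>\<^bsub>exreg C\<^esub> (a', \<Psi>, b')) \<longleftrightarrow> rel_incl C \<Psi> \<Phi>"
  by (simp_all add: exreg_def Qw_def cong_def)

lemma exreg_hom_iff:
  "f \<in> hom (exreg C) (X, E) (Y, F) \<longleftrightarrow> (\<exists>R S. f = ((X, E), R, (Y, F)) \<and> adj X E Y F R S)"
proof -
  obtain a R b where f: "f = (a, R, b)" by (cases f)
  have "f \<in> hom (exreg C) (X, E) (Y, F) \<longleftrightarrow>
      f = ((X, E), R, (Y, F)) \<and> f \<in> Arr (Qw C) \<and> (\<exists>g. right_adjoint (Qw C) f g)"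
    unfolding in_hom_iff f exreg_simps
    by (simp add: exreg_def del: split_paired_Ex) blast
  also have "\<dots> \<longleftrightarrow> f = ((X, E), R, (Y, F)) \<and> (\<exists>S. adj X E Y F R S)"
    using right_adjoint_Qw_iff[of X E R Y F] by blast
  finally show ?thesis unfolding f by blast
qed

lemma exreg_homE:
  assumes "f \<in> hom (exreg C) a b"
  obtains X E Y F R S where "a = (X, E)" "b = (Y, F)" "f = ((X, E), R, (Y, F))" "adj X E Y F R S"
proof -
  have "f \<in> hom (exreg C) (fst a, snd a) (fst b, snd b)" using assms by simp
  then obtain R S where "f = ((fst a, snd a), R, (fst b, snd b))" "adj (fst a) (snd a) (fst b) (snd b) R S"
    unfolding exreg_hom_iff by blast
  then show thesis by (intro that[of "fst a" "snd a" "fst b" "snd b"]) simp_all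
qed

text \<open>Values are computed in two stages on successive covers. For uniqueness, the two
  intermediate points are first compared in \<open>F\<close>; \<open>R'\<close> absorbs this
  comparison, and the counit of the second pair finishes.\<close>

lemma adj_comp:
  assumes a: "adj X E Y F R S" and a': "adj Y F Z G R' S'"
  shows "adj X E Z G (rel_comp C X Y Z R' R) (rel_comp C Z Y X S S')"
proof -
  note R = adj_rel(1)[OF a] and S = adj_rel(2)[OF a] and R' = adj_rel(1)[OF a'] and S' = adj_rel(2)[OF a']
  note E = adj_cong(1)[OF a] and F = adj_cong(2)[OF a] and G = adj_cong(2)[OF a']
  note RR = is_rel_comp[OF R R'] and SS = is_rel_comp[OF S' S]
  note e = cong_rel[OF E] and g = cong_rel[OF G]
  show ?thesis
  proof (rule adjI)
    show "bimod X E Z G (rel_comp C X Y Z R' R)"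
    proof (rule bimodI[OF E G RR])
      fix A x x' y assume h: "x \<in> hom C A X" "x' \<in> hom C A X" "y \<in> hom C A Z" "in_rel C x x' E"
        "in_rel C x' y (rel_comp C X Y Z R' R)"
      obtain B d w where d: "so_mor C d" "d \<in> hom C B A" "w \<in> hom C B Y" "in_rel C (x' \<cdot> d) w R" "in_rel C w (y \<cdot> d) R'"
        by (rule in_rel_compE[OF h(5) R R' h(2,3)])
      have "in_rel C (x \<cdot> d) w R"
        by (rule bimod_left[OF adj_bimod(1)[OF a] _ _ d(3) in_rel_comp[OF e h(1,2) d(2) h(4)] d(4)]) (use h d in simp_all)
      then show "in_rel C x y (rel_comp C X Y Z R' R)" by (rule in_rel_compI[OF R R' h(1,3) d(1-3) _ d(5)])
    next
      fix A x y y' assume h: "x \<in> hom C A X" "y \<in> hom C A Z" "y' \<in> hom C A Z"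
        "in_rel C x y (rel_comp C X Y Z R' R)" "in_rel C y y' G"
      obtain B d w where d: "so_mor C d" "d \<in> hom C B A" "w \<in> hom C B Y" "in_rel C (x \<cdot> d) w R" "in_rel C w (y \<cdot> d) R'"
        by (rule in_rel_compE[OF h(4) R R' h(1,2)])
      have "in_rel C w (y' \<cdot> d) R'"
        by (rule bimod_right[OF adj_bimod(1)[OF a'] d(3) _ _ d(5) in_rel_comp[OF g h(2,3) d(2) h(5)]]) (use h d in simp_all)
      then show "in_rel C x y' (rel_comp C X Y Z R' R)" by (rule in_rel_compI[OF R R' h(1,3) d(1-4)])
    qed
    show "bimod Z G X E (rel_comp C Z Y X S S')"
    proof (rule bimodI[OF G E SS])
      fix A x x' y assume h: "x \<in> hom C A Z" "x' \<in> hom C A Z" "y \<in> hom C A X" "in_rel C x x' G"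
        "in_rel C x' y (rel_comp C Z Y X S S')"
      obtain B d w where d: "so_mor C d" "d \<in> hom C B A" "w \<in> hom C B Y" "in_rel C (x' \<cdot> d) w S'" "in_rel C w (y \<cdot> d) S"
        by (rule in_rel_compE[OF h(5) S' S h(2,3)])
      have "in_rel C (x \<cdot> d) w S'"
        by (rule bimod_left[OF adj_bimod(2)[OF a'] _ _ d(3) in_rel_comp[OF g h(1,2) d(2) h(4)] d(4)]) (use h d in simp_all)
      then show "in_rel C x y (rel_comp C Z Y X S S')" by (rule in_rel_compI[OF S' S h(1,3) d(1-3) _ d(5)])
    next
      fix A x y y' assume h: "x \<in> hom C A Z" "y \<in> hom C A X" "y' \<in> hom C A X"
        "in_rel C x y (rel_comp C Z Y X S S')" "in_rel C y y' E"
      obtain B d w where d: "so_mor C d" "d \<in> hom C B A" "w \<in> hom C B Y" "in_rel C (x \<cdot> d) w S'" "in_rel C w (y \<cdot> d) S"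
        by (rule in_rel_compE[OF h(4) S' S h(1,2)])
      have "in_rel C w (y' \<cdot> d) S"
        by (rule bimod_right[OF adj_bimod(2)[OF a] d(3) _ _ d(5) in_rel_comp[OF e h(2,3) d(2) h(5)]]) (use h d in simp_all)
      then show "in_rel C x y' (rel_comp C Z Y X S S')" by (rule in_rel_compI[OF S' S h(1,3) d(1-4)])
    qed
  next
    fix A x assume x: "x \<in> hom C A X"
    obtain B d y where d: "so_mor C d" "d \<in> hom C B A" "y \<in> hom C B Y"
      "in_rel C (x \<cdot> d) y R" "in_rel C y (x \<cdot> d) S" by (rule adj_total[OF a x])
    obtain B' d' z where d': "so_mor C d'" "d' \<in> hom C B' B" "z \<in> hom C B' Z"
      "in_rel C (y \<cdot> d') z R'" "in_rel C z (y \<cdot> d') S'" by (rule adj_total[OF a' d(3)])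
    have xd: "x \<cdot> d \<in> hom C B X" and dd: "so_mor C (d \<cdot> d')" "d \<cdot> d' \<in> hom C B' A"
      using x d d' so_mor_comp[of d' d] by simp_all
    have eq: "x \<cdot> (d \<cdot> d') = (x \<cdot> d) \<cdot> d'" using x d d' by simp
    have yd: "y \<cdot> d' \<in> hom C B' Y" "x \<cdot> d \<cdot> d' \<in> hom C B' X" using d d' x by simp_all
    have "in_rel C (x \<cdot> d \<cdot> d') z (rel_comp C X Y Z R' R)"
      by (rule in_rel_compI'[OF R R' yd(2) d'(3) yd(1) _ d'(4)])
        (unfold eq, rule in_rel_comp[OF R xd d(3) d'(2) d(4)])
    moreover have "in_rel C z (x \<cdot> d \<cdot> d') (rel_comp C Z Y X S S')"
      by (rule in_rel_compI'[OF S' S d'(3) yd(2) yd(1) d'(5)])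
        (unfold eq, rule in_rel_comp[OF S d(3) xd d'(2) d(5)])
    ultimately show "\<exists>B e y. so_mor C e \<and> e \<in> hom C B A \<and> y \<in> hom C B Z \<and>
        in_rel C (x \<cdot> e) y (rel_comp C X Y Z R' R) \<and> in_rel C y (x \<cdot> e) (rel_comp C Z Y X S S')"
      using dd d'(3) by blast
  next
    fix A x z z' assume h: "x \<in> hom C A X" "z \<in> hom C A Z" "z' \<in> hom C A Z"
      "in_rel C z x (rel_comp C Z Y X S S')" "in_rel C x z' (rel_comp C X Y Z R' R)"
    obtain B d y where d: "so_mor C d" "d \<in> hom C B A" "y \<in> hom C B Y" "in_rel C (z \<cdot> d) y S'" "in_rel C y (x \<cdot> d) S"
      by (rule in_rel_compE[OF h(4) S' S h(2,1)])
    have hd: "x \<cdot> d \<in> hom C B X" "z \<cdot> d \<in> hom C B Z" "z' \<cdot> d \<in> hom C B Z" using h d by simp_all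
    have "in_rel C (x \<cdot> d) (z' \<cdot> d) (rel_comp C X Y Z R' R)" by (rule in_rel_comp[OF RR h(1,3) d(2) h(5)])
    then obtain B' d' y' where d': "so_mor C d'" "d' \<in> hom C B' B" "y' \<in> hom C B' Y"
      "in_rel C ((x \<cdot> d) \<cdot> d') y' R" "in_rel C y' ((z' \<cdot> d) \<cdot> d') R'"
      by (rule in_rel_compE[OF _ R R' hd(1,3)])
    have hdd: "(x \<cdot> d) \<cdot> d' \<in> hom C B' X" "(z \<cdot> d) \<cdot> d' \<in> hom C B' Z" "(z' \<cdot> d) \<cdot> d' \<in> hom C B' Z"
      "y \<cdot> d' \<in> hom C B' Y"
      using hd d(3) d'(2) by (simp_all del: assoc)
    have "in_rel C (y \<cdot> d') y' F"
      by (rule adj_counit[OF a hdd(1,4) d'(3) in_rel_comp[OF S d(3) hd(1) d'(2) d(5)] d'(4)])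
    then have "in_rel C (y \<cdot> d') ((z' \<cdot> d) \<cdot> d') R'"
      by (rule bimod_left[OF adj_bimod(1)[OF a'] hdd(4) d'(3) hdd(3) _ d'(5)])
    then have "in_rel C ((z \<cdot> d) \<cdot> d') ((z' \<cdot> d) \<cdot> d') G"
      by (rule adj_counit[OF a' hdd(4,2,3) in_rel_comp[OF S' hd(2) d(3) d'(2) d(4)]])
    then have "in_rel C (z \<cdot> d) (z' \<cdot> d) G" by (rule in_rel_local[OF g hd(2,3) d'(1,2)])
    then show "in_rel C z z' G" by (rule in_rel_local[OF g h(2,3) d(1,2)])
  qed
qed

lemma adj_ident:
  assumes E: "cong X E"
  shows "adj X E X E E E"
proof -
  note e = cong_rel[OF E]
  have b: "bimod X E X E E" by (rule bimodI[OF E E e]) (use cong_trans[OF E] in blast)+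
  show ?thesis
  proof (rule adjI[OF b b])
    fix A x assume x: "x \<in> hom C A X"
    then have "A \<in> Obj C" by auto
    then have "so_mor C (Ident C A)" "Ident C A \<in> hom C A A" by (simp_all add: so_mor_ident)
    moreover have "in_rel C (x \<cdot> Ident C A) x E" "in_rel C x (x \<cdot> Ident C A) E"
      using cong_refl[OF E x] x by simp_all
    ultimately show "\<exists>B e y. so_mor C e \<and> e \<in> hom C B A \<and> y \<in> hom C B X \<and> in_rel C (x \<cdot> e) y E \<and> in_rel C y (x \<cdot> e) E"
      using x by blast
  qed (use cong_trans[OF E] in blast)
qed

text \<open>A value \<open>y\<close> of \<open>x\<close> represents both relations at
  \<open>x\<close>: \<open>R\<close> becomes the up-set of \<open>y\<close> and \<open>S\<close> its
  down-set, each by the counit in one direction and absorption of \<open>F\<close> in the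
  other.\<close>

lemma adj_val_iff:
  assumes a: "adj X E Y F R S" and h: "x \<in> hom C A X" "y \<in> hom C A Y" "y' \<in> hom C A Y"
    and v: "in_rel C x y R" "in_rel C y x S"
  shows "in_rel C x y' R \<longleftrightarrow> in_rel C y y' F" "in_rel C y' x S \<longleftrightarrow> in_rel C y' y F"
proof -
  show "in_rel C x y' R \<longleftrightarrow> in_rel C y y' F"
    using adj_counit[OF a h v(2)] bimod_right[OF adj_bimod(1)[OF a] h v(1)] by blast
  show "in_rel C y' x S \<longleftrightarrow> in_rel C y' y F"
    using adj_counit[OF a h(1,3,2) _ v(1)] bimod_left[OF adj_bimod(2)[OF a] h(3,2,1) _ v(2)] by blast
qed

text \<open>Right adjoints reverse inclusion. If \<open>z\<close> is a local value of
  \<open>x\<close> for the primed pair, then \<open>R\<close> also bounds \<open>x\<close> by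
  \<open>z\<close>, so \<open>y\<close> lies below \<open>z\<close>, and \<open>S'\<close> absorbs
  this. Applied twice, this shows that \<open>S\<close> is determined by \<open>R\<close>.\<close>

lemma adj_antimono:
  assumes a: "adj X E Y F R S" and a': "adj X E Y F R' S'" and le: "rel_incl C R' R"
    and h: "x \<in> hom C A X" "y \<in> hom C A Y" "in_rel C y x S"
  shows "in_rel C y x S'"
proof -
  obtain B d z where d: "so_mor C d" "d \<in> hom C B A" "z \<in> hom C B Y"
    "in_rel C (x \<cdot> d) z R'" "in_rel C z (x \<cdot> d) S'" by (rule adj_total[OF a' h(1)])
  have hd: "x \<cdot> d \<in> hom C B X" "y \<cdot> d \<in> hom C B Y" using h d by simp_all
  have "in_rel C (y \<cdot> d) z F"
    by (rule adj_counit[OF a hd d(3) in_rel_comp[OF adj_rel(2)[OF a] h(2,1) d(2) h(3)]])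
      (rule rel_inclD[OF le adj_rel(1)[OF a'] adj_rel(1)[OF a] hd(1) d(3,4)])
  then have "in_rel C (y \<cdot> d) (x \<cdot> d) S'"
    by (rule bimod_left[OF adj_bimod(2)[OF a'] hd(2) d(3) hd(1) _ d(5)])
  then show ?thesis by (rule in_rel_local[OF adj_rel(2)[OF a'] h(2,1) d(1,2)])
qed

lemma rel_incl_refl: "is_rel X Y R \<Longrightarrow> rel_incl C R R"
  by (simp add: rel_incl_iff)

lemma adj_unique:
  assumes a: "adj X E Y F R S" and a': "adj X E Y F R S'"
  shows "S = S'"
  by (rule rel_eqI[OF adj_rel(2)[OF a] adj_rel(2)[OF a']])
    (use adj_antimono[OF a a' rel_incl_refl[OF adj_rel(1)[OF a]]]
      adj_antimono[OF a' a rel_incl_refl[OF adj_rel(1)[OF a]]] in blast)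


section \<open>The exact completion as a poset-enriched category\<close>

lemma bimod_comp_ident:
  assumes b: "bimod X E Y F R"
  shows "rel_comp C X X Y R E = R" "rel_comp C X Y Y F R = R"
proof -
  note R = bimod_rel[OF b] and E = bimod_cong(1)[OF b] and F = bimod_cong(2)[OF b]
  note e = cong_rel[OF E] and f = cong_rel[OF F]
  show "rel_comp C X X Y R E = R"
  proof (rule rel_eqI[OF is_rel_comp[OF e R] R])
    fix A x y assume x: "x \<in> hom C A X" and y: "y \<in> hom C A Y"
    show "in_rel C x y (rel_comp C X X Y R E) \<longleftrightarrow> in_rel C x y R"
    proof
      assume "in_rel C x y (rel_comp C X X Y R E)"
      then obtain B d w where d: "so_mor C d" "d \<in> hom C B A" "w \<in> hom C B X" "in_rel C (x \<cdot> d) w E" "in_rel C w (y \<cdot> d) R"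
        by (rule in_rel_compE[OF _ e R x y])
      have "in_rel C (x \<cdot> d) (y \<cdot> d) R"
        by (rule bimod_left[OF b _ d(3) _ d(4,5)]) (use x y d in simp_all)
      then show "in_rel C x y R" by (rule in_rel_local[OF R x y d(1,2)])
    next
      assume "in_rel C x y R"
      then show "in_rel C x y (rel_comp C X X Y R E)"
        by (rule in_rel_compI'[OF e R x y x cong_refl[OF E x]])
    qed
  qed
  show "rel_comp C X Y Y F R = R"
  proof (rule rel_eqI[OF is_rel_comp[OF R f] R])
    fix A x y assume x: "x \<in> hom C A X" and y: "y \<in> hom C A Y"
    show "in_rel C x y (rel_comp C X Y Y F R) \<longleftrightarrow> in_rel C x y R"
    proof
      assume "in_rel C x y (rel_comp C X Y Y F R)"
      then obtain B d w where d: "so_mor C d" "d \<in> hom C B A" "w \<in> hom C B Y" "in_rel C (x \<cdot> d) w R" "in_rel C w (y \<cdot> d) F"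
        by (rule in_rel_compE[OF _ R f x y])
      have "in_rel C (x \<cdot> d) (y \<cdot> d) R"
        by (rule bimod_right[OF b _ d(3) _ d(4,5)]) (use x y d in simp_all)
      then show "in_rel C x y R" by (rule in_rel_local[OF R x y d(1,2)])
    next
      assume "in_rel C x y R"
      then show "in_rel C x y (rel_comp C X Y Y F R)"
        by (rule in_rel_compI'[OF R f x y y _ cong_refl[OF F y]])
    qed
  qed
qed

text \<open>Both sides assert the existence of two intermediate points on a cover; the two nested
  covers are removed one after the other.\<close>

lemma rel_comp_assoc:
  assumes R: "is_rel W X R" and S: "is_rel X Y S" and T: "is_rel Y Z T"
  shows "rel_comp C W X Z (rel_comp C X Y Z T S) R = rel_comp C W Y Z T (rel_comp C W X Y S R)"
proof (rule rel_eqI[OF is_rel_comp[OF R is_rel_comp[OF S T]] is_rel_comp[OF is_rel_comp[OF R S] T]])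
  note SR = is_rel_comp[OF R S] and TS = is_rel_comp[OF S T]
  fix A x z assume x: "x \<in> hom C A W" and z: "z \<in> hom C A Z"
  show "in_rel C x z (rel_comp C W X Z (rel_comp C X Y Z T S) R) \<longleftrightarrow>
    in_rel C x z (rel_comp C W Y Z T (rel_comp C W X Y S R))"
  proof
    assume "in_rel C x z (rel_comp C W X Z (rel_comp C X Y Z T S) R)"
    then obtain B d w where d: "so_mor C d" "d \<in> hom C B A" "w \<in> hom C B X" "in_rel C (x \<cdot> d) w R"
      "in_rel C w (z \<cdot> d) (rel_comp C X Y Z T S)" by (rule in_rel_compE[OF _ R TS x z])
    have xd: "x \<cdot> d \<in> hom C B W" "z \<cdot> d \<in> hom C B Z" using x z d by simp_all
    obtain B' d' y where d': "so_mor C d'" "d' \<in> hom C B' B" "y \<in> hom C B' Y" "in_rel C (w \<cdot> d') y S"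
      "in_rel C y ((z \<cdot> d) \<cdot> d') T" by (rule in_rel_compE[OF d(5) S T d(3) xd(2)])
    have h: "(x \<cdot> d) \<cdot> d' \<in> hom C B' W" "w \<cdot> d' \<in> hom C B' X" using xd d(3) d'(2) by (simp_all del: assoc)
    have "in_rel C ((x \<cdot> d) \<cdot> d') y (rel_comp C W X Y S R)"
      by (rule in_rel_compI'[OF R S h(1) d'(3) h(2) in_rel_comp[OF R xd(1) d(3) d'(2) d(4)] d'(4)])
    then have "in_rel C (x \<cdot> d) (z \<cdot> d) (rel_comp C W Y Z T (rel_comp C W X Y S R))"
      by (rule in_rel_compI[OF SR T xd d'(1-3) _ d'(5)])
    then show "in_rel C x z (rel_comp C W Y Z T (rel_comp C W X Y S R))"
      by (rule in_rel_local[OF is_rel_comp[OF SR T] x z d(1,2)])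
  next
    assume "in_rel C x z (rel_comp C W Y Z T (rel_comp C W X Y S R))"
    then obtain B d w where d: "so_mor C d" "d \<in> hom C B A" "w \<in> hom C B Y" "in_rel C (x \<cdot> d) w (rel_comp C W X Y S R)"
      "in_rel C w (z \<cdot> d) T" by (rule in_rel_compE[OF _ SR T x z])
    have xd: "x \<cdot> d \<in> hom C B W" "z \<cdot> d \<in> hom C B Z" using x z d by simp_all
    obtain B' d' y where d': "so_mor C d'" "d' \<in> hom C B' B" "y \<in> hom C B' X" "in_rel C ((x \<cdot> d) \<cdot> d') y R"
      "in_rel C y (w \<cdot> d') S" by (rule in_rel_compE[OF d(4) R S xd(1) d(3)])
    have h: "(z \<cdot> d) \<cdot> d' \<in> hom C B' Z" "w \<cdot> d' \<in> hom C B' Y" using xd d(3) d'(2) by (simp_all del: assoc)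
    have "in_rel C y ((z \<cdot> d) \<cdot> d') (rel_comp C X Y Z T S)"
      by (rule in_rel_compI'[OF S T d'(3) h(1) h(2) d'(5) in_rel_comp[OF T d(3) xd(2) d'(2) d(5)]])
    then have "in_rel C (x \<cdot> d) (z \<cdot> d) (rel_comp C W X Z (rel_comp C X Y Z T S) R)"
      by (rule in_rel_compI[OF R TS xd d'(1-4)])
    then show "in_rel C x z (rel_comp C W X Z (rel_comp C X Y Z T S) R)"
      by (rule in_rel_local[OF is_rel_comp[OF R TS] x z d(1,2)])
  qed
qed

lemma pos_category_exreg: "pos_category (exreg C)"
proof
  fix f assume "f \<in> Arr (exreg C)"
  then have f: "f \<in> hom (exreg C) (Dom (exreg C) f) (Cod (exreg C) f)" by simp
  then obtain X E Y F R S where "Dom (exreg C) f = (X, E)" "Cod (exreg C) f = (Y, F)" "adj X E Y F R S"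
    by (rule exreg_homE)
  then show "Dom (exreg C) f \<in> Obj (exreg C)" "Cod (exreg C) f \<in> Obj (exreg C)"
    by (simp_all add: exreg_simps adj_cong)
next
  fix a assume "a \<in> Obj (exreg C)"
  then show "Ident (exreg C) a \<in> hom (exreg C) a a"
    by (cases a) (use adj_ident in \<open>auto simp: exreg_simps exreg_hom_iff simp del: in_hom_iff\<close>)
next
  fix f g a b c assume f: "f \<in> hom (exreg C) a b" and g: "g \<in> hom (exreg C) b c"
  obtain X E Y F R S where F: "a = (X, E)" "b = (Y, F)" "f = ((X, E), R, (Y, F))" "adj X E Y F R S"
    using f by (rule exreg_homE)
  obtain Y' F' Z G R' S' where G: "b = (Y', F')" "c = (Z, G)" "g = ((Y', F'), R', (Z, G))" "adj Y' F' Z G R' S'"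
    using g by (rule exreg_homE)
  have "Y' = Y" "F' = F" using F G by simp_all
  then have "adj X E Z G (rel_comp C X Y Z R' R) (rel_comp C Z Y X S S')" using adj_comp F(4) G(4) by simp
  then show "g \<cdot>\<^bsub>exreg C\<^esub> f \<in> hom (exreg C) a c"
    unfolding F(1,3) G(2,3) \<open>Y' = Y\<close> \<open>F' = F\<close> exreg_simps fst_conv exreg_hom_iff by blast
next
  fix f a b assume f: "f \<in> hom (exreg C) a b"
  obtain X E Y F R S where F: "a = (X, E)" "b = (Y, F)" "f = ((X, E), R, (Y, F))" "adj X E Y F R S"
    using f by (rule exreg_homE)
  show "f \<cdot>\<^bsub>exreg C\<^esub> Ident (exreg C) a = f" "Ident (exreg C) b \<cdot>\<^bsub>exreg C\<^esub> f = f"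
    unfolding F(1-3) exreg_simps using bimod_comp_ident[OF adj_bimod(1)[OF F(4)]] by simp_all
next
  fix f g h a b c d assume f: "f \<in> hom (exreg C) a b" and g: "g \<in> hom (exreg C) b c" and h: "h \<in> hom (exreg C) c d"
  obtain X E Y F R S where F: "a = (X, E)" "b = (Y, F)" "f = ((X, E), R, (Y, F))" "adj X E Y F R S"
    using f by (rule exreg_homE)
  obtain Y' F' Z G R' S' where G: "b = (Y', F')" "c = (Z, G)" "g = ((Y', F'), R', (Z, G))" "adj Y' F' Z G R' S'"
    using g by (rule exreg_homE)
  obtain Z' G' V H R'' S'' where H: "c = (Z', G')" "d = (V, H)" "h = ((Z', G'), R'', (V, H))" "adj Z' G' V H R'' S''"
    using h by (rule exreg_homE)
  have eq: "Y' = Y" "F' = F" "Z' = Z" "G' = G" using F G H by simp_all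
  show "(h \<cdot>\<^bsub>exreg C\<^esub> g) \<cdot>\<^bsub>exreg C\<^esub> f = h \<cdot>\<^bsub>exreg C\<^esub> (g \<cdot>\<^bsub>exreg C\<^esub> f)"
    using rel_comp_assoc[OF adj_rel(1)[OF F(4)] adj_rel(1)[OF G(4)[unfolded eq]] adj_rel(1)[OF H(4)[unfolded eq]]]
    unfolding F(3) G(3) H(3) eq exreg_simps by (simp add: exreg_simps)
next
  fix a b :: "'a \<times> 'b set"
  obtain X E Y F where ab: "a = (X, E)" "b = (Y, F)" by (cases a, cases b)
  have h: "\<exists>R. f = (a, R, b) \<and> is_rel X Y R" if f: "f \<in> hom (exreg C) a b" for f
  proof -
    obtain R S where "f = ((X, E), R, (Y, F))" "adj X E Y F R S"
      using f unfolding ab exreg_hom_iff by blast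
    then show ?thesis using adj_rel(1)[of X E Y F R S] ab by blast
  qed
  show "poset_on (hom (exreg C) a b) (Le (exreg C))"
    unfolding poset_on_def partial_order_on_def preorder_on_def
  proof (intro conjI)
    show "refl_on (hom (exreg C) a b) {(x, y). x \<in> hom (exreg C) a b \<and> y \<in> hom (exreg C) a b \<and> x \<sqsubseteq>\<^bsub>exreg C\<^esub> y}"
    proof -
      have "f \<sqsubseteq>\<^bsub>exreg C\<^esub> f" if f: "f \<in> hom (exreg C) a b" for f
      proof -
        obtain R where R: "f = (a, R, b)" "is_rel X Y R" using h[OF f] by blast
        show ?thesis unfolding R(1) exreg_simps by (rule rel_incl_refl[OF R(2)])
      qed
      then show ?thesis unfolding refl_on_def by blast
    qed
    show "trans {(x, y). x \<in> hom (exreg C) a b \<and> y \<in> hom (exreg C) a b \<and> x \<sqsubseteq>\<^bsub>exreg C\<^esub> y}"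
    proof -
      have "f \<sqsubseteq>\<^bsub>exreg C\<^esub> k" if f: "f \<in> hom (exreg C) a b" "g \<in> hom (exreg C) a b" "k \<in> hom (exreg C) a b"
        and le: "f \<sqsubseteq>\<^bsub>exreg C\<^esub> g" "g \<sqsubseteq>\<^bsub>exreg C\<^esub> k" for f g k
      proof -
        obtain R S T where R: "f = (a, R, b)" "is_rel X Y R" and S: "g = (a, S, b)" "is_rel X Y S"
          and T: "k = (a, T, b)" "is_rel X Y T" using h[OF f(1)] h[OF f(2)] h[OF f(3)] by blast
        show ?thesis using le unfolding R(1) S(1) T(1) exreg_simps
            rel_incl_iff[OF S(2) R(2)] rel_incl_iff[OF T(2) S(2)] rel_incl_iff[OF T(2) R(2)] by blast
      qed
      then show ?thesis unfolding trans_def by blast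
    qed
    show "antisym {(x, y). x \<in> hom (exreg C) a b \<and> y \<in> hom (exreg C) a b \<and> x \<sqsubseteq>\<^bsub>exreg C\<^esub> y}"
    proof -
      have "f = g" if f: "f \<in> hom (exreg C) a b" "g \<in> hom (exreg C) a b"
        and le: "f \<sqsubseteq>\<^bsub>exreg C\<^esub> g" "g \<sqsubseteq>\<^bsub>exreg C\<^esub> f" for f g
      proof -
        obtain R S where R: "f = (a, R, b)" "is_rel X Y R" and S: "g = (a, S, b)" "is_rel X Y S"
          using h[OF f(1)] h[OF f(2)] by blast
        have "R = S" using le unfolding R(1) S(1) exreg_simps
            rel_incl_iff[OF S(2) R(2)] rel_incl_iff[OF R(2) S(2)] by (intro rel_eqI[OF R(2) S(2)]) blast
        then show ?thesis using R S by simp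
      qed
      then show ?thesis unfolding antisym_def by blast
    qed
    show "{(x, y). x \<in> hom (exreg C) a b \<and> y \<in> hom (exreg C) a b \<and> x \<sqsubseteq>\<^bsub>exreg C\<^esub> y}
      \<subseteq> hom (exreg C) a b \<times> hom (exreg C) a b" by blast
  qed
next
  fix f f' g g' a b c assume f: "f \<in> hom (exreg C) a b" "f' \<in> hom (exreg C) a b"
    and g: "g \<in> hom (exreg C) b c" "g' \<in> hom (exreg C) b c"
    and le: "f \<sqsubseteq>\<^bsub>exreg C\<^esub> f'" "g \<sqsubseteq>\<^bsub>exreg C\<^esub> g'"
  obtain X E Y F Z G where ab: "a = (X, E)" "b = (Y, F)" "c = (Z, G)" by (cases a, cases b, cases c)
  obtain R R' S S' where R: "f = ((X, E), R, (Y, F))" "is_rel X Y R" and R': "f' = ((X, E), R', (Y, F))" "is_rel X Y R'"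
    and S: "g = ((Y, F), S, (Z, G))" "is_rel Y Z S" and S': "g' = ((Y, F), S', (Z, G))" "is_rel Y Z S'"
  proof -
    obtain R1 S1 R2 S2 R3 S3 R4 S4 where "f = ((X, E), R1, (Y, F))" "adj X E Y F R1 S1"
      "f' = ((X, E), R2, (Y, F))" "adj X E Y F R2 S2" "g = ((Y, F), R3, (Z, G))" "adj Y F Z G R3 S3"
      "g' = ((Y, F), R4, (Z, G))" "adj Y F Z G R4 S4"
      using f g unfolding ab exreg_hom_iff by metis
    then show thesis using that[of R1 R2 R3 R4] by (simp add: adj_rel(1))
  qed
  have h1: "rel_incl C R' R" "rel_incl C S' S" using le unfolding R(1) R'(1) S(1) S'(1) exreg_simps .
  have "rel_incl C (rel_comp C X Y Z S' R') (rel_comp C X Y Z S R)"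
    unfolding rel_incl_iff[OF is_rel_comp[OF R'(2) S'(2)] is_rel_comp[OF R(2) S(2)]]
  proof (intro allI ballI impI)
    fix A x z assume x: "x \<in> hom C A X" and z: "z \<in> hom C A Z" and xz: "in_rel C x z (rel_comp C X Y Z S' R')"
    obtain B d y where d: "so_mor C d" "d \<in> hom C B A" "y \<in> hom C B Y" "in_rel C (x \<cdot> d) y R'" "in_rel C y (z \<cdot> d) S'"
      by (rule in_rel_compE[OF xz R'(2) S'(2) x z])
    have xd: "x \<cdot> d \<in> hom C B X" "z \<cdot> d \<in> hom C B Z" using x z d by simp_all
    show "in_rel C x z (rel_comp C X Y Z S R)"
      by (rule in_rel_compI[OF R(2) S(2) x z d(1-3) rel_inclD[OF h1(1) R'(2) R(2) xd(1) d(3,4)]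
            rel_inclD[OF h1(2) S'(2) S(2) d(3) xd(2) d(5)]])
  qed
  then show "g \<cdot>\<^bsub>exreg C\<^esub> f \<sqsubseteq>\<^bsub>exreg C\<^esub> g' \<cdot>\<^bsub>exreg C\<^esub> f'"
    unfolding R(1) R'(1) S(1) S'(1) exreg_simps fst_conv .
qed

text \<open>Reading \<open>R x y\<close> as \<open>\<phi> x \<le> y\<close>, the hypothesis is a
  local chain \<open>\<phi> x \<le> y \<le> y' \<le> \<phi>' x\<close>, so every upper bound of
  \<open>\<phi>' x\<close> is one of \<open>\<phi> x\<close>.\<close>

lemma adj_leI:
  assumes a: "adj X E Y F R S" and a': "adj X E Y F R' S'"
    and loc: "\<And>A x. x \<in> hom C A X \<Longrightarrow> \<exists>B e y y'. so_mor C e \<and> e \<in> hom C B A \<and> y \<in> hom C B Y \<and> y' \<in> hom C B Y \<and>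
       in_rel C (x \<cdot> e) y R \<and> in_rel C y' (x \<cdot> e) S' \<and> in_rel C y y' F"
  shows "rel_incl C R' R"
  unfolding rel_incl_iff[OF adj_rel(1)[OF a'] adj_rel(1)[OF a]]
proof (intro allI ballI impI)
  fix A x z assume x: "x \<in> hom C A X" and z: "z \<in> hom C A Y" and xz: "in_rel C x z R'"
  obtain B e y y' where h: "so_mor C e" "e \<in> hom C B A" "y \<in> hom C B Y" "y' \<in> hom C B Y"
       "in_rel C (x \<cdot> e) y R" "in_rel C y' (x \<cdot> e) S'" "in_rel C y y' F" using loc[OF x] by blast
  have xe: "x \<cdot> e \<in> hom C B X" "z \<cdot> e \<in> hom C B Y" using x z h by simp_all
  have "in_rel C y' (z \<cdot> e) F"
    by (rule adj_counit[OF a' xe(1) h(4) xe(2) h(6) in_rel_comp[OF adj_rel(1)[OF a'] x z h(2) xz]])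
  then have "in_rel C y (z \<cdot> e) F" by (rule cong_trans[OF adj_cong(2)[OF a] h(3,4) xe(2) h(7)])
  then have "in_rel C (x \<cdot> e) (z \<cdot> e) R" by (rule bimod_right[OF adj_bimod(1)[OF a] xe(1) h(3) xe(2) h(5)])
  then show "in_rel C x z R" by (rule in_rel_local[OF adj_rel(1)[OF a] x z h(1,2)])
qed

lemma adj_eqI:
  assumes a: "adj X E Y F R S" and a': "adj X E Y F R' S'"
    and loc: "\<And>A x. x \<in> hom C A X \<Longrightarrow> \<exists>B e y. so_mor C e \<and> e \<in> hom C B A \<and> y \<in> hom C B Y \<and>
       in_rel C (x \<cdot> e) y R \<and> in_rel C y (x \<cdot> e) S \<and> in_rel C (x \<cdot> e) y R' \<and> in_rel C y (x \<cdot> e) S'"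
  shows "R = R'"
proof -
  have "rel_incl C R' R"
    by (rule adj_leI[OF a a']) (use loc cong_refl[OF adj_cong(2)[OF a]] in blast)
  moreover have "rel_incl C R R'"
    by (rule adj_leI[OF a' a]) (use loc cong_refl[OF adj_cong(2)[OF a]] in blast)
  ultimately show ?thesis
    unfolding rel_incl_iff[OF adj_rel(1)[OF a] adj_rel(1)[OF a']] rel_incl_iff[OF adj_rel(1)[OF a'] adj_rel(1)[OF a]]
    by (intro rel_eqI[OF adj_rel(1)[OF a] adj_rel(1)[OF a']]) blast
qed

section \<open>Morphisms of the exact completion that are induced by arrows of the base\<close>

definition graph :: "'b \<Rightarrow> 'b set \<Rightarrow> 'b set" where
  "graph f F = (SOME R. is_rel (Dom C f) (Cod C f) R \<and>
     (\<forall>A. \<forall>x\<in>hom C A (Dom C f). \<forall>y\<in>hom C A (Cod C f). in_rel C x y R \<longleftrightarrow> in_rel C (f \<cdot> x) y F))"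

text \<open>The right adjoint of \<open>graph f F\<close>: lower instead of upper bounds of
  \<open>f \<cdot> x\<close>. The choice operator in both definitions stands for an inverse image
  whose existence is \<open>rel_pull\<close> and whose uniqueness is \<open>rel_eqI\<close>.\<close>

definition cograph :: "'b \<Rightarrow> 'b set \<Rightarrow> 'b set" where
  "cograph f F = (SOME S. is_rel (Cod C f) (Dom C f) S \<and>
     (\<forall>A. \<forall>x\<in>hom C A (Dom C f). \<forall>y\<in>hom C A (Cod C f). in_rel C y x S \<longleftrightarrow> in_rel C y (f \<cdot> x) F))"

lemma graph:
  assumes F: "is_rel Y Y F" and f: "f \<in> hom C X Y"
  shows "is_rel X Y (graph f F)"
    and "\<lbrakk>x \<in> hom C A X; y \<in> hom C A Y\<rbrakk> \<Longrightarrow> in_rel C x y (graph f F) \<longleftrightarrow> in_rel C (f \<cdot> x) y F"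
proof -
  have i: "Ident C Y \<in> hom C Y Y" using f by auto
  obtain R where R: "is_rel X Y R" "\<And>A x y. \<lbrakk>x \<in> hom C A X; y \<in> hom C A Y\<rbrakk> \<Longrightarrow>
      in_rel C x y R \<longleftrightarrow> in_rel C (f \<cdot> x) (Ident C Y \<cdot> y) F" by (rule rel_pull[OF F f i]) blast
  have d: "Dom C f = X" "Cod C f = Y" using f by simp_all
  have "is_rel X Y R \<and> (\<forall>A. \<forall>x\<in>hom C A X. \<forall>y\<in>hom C A Y. in_rel C x y R \<longleftrightarrow> in_rel C (f \<cdot> x) y F)"
    using R by simp
  then have "is_rel X Y (graph f F) \<and> (\<forall>A. \<forall>x\<in>hom C A X. \<forall>y\<in>hom C A Y.
      in_rel C x y (graph f F) \<longleftrightarrow> in_rel C (f \<cdot> x) y F)"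
    unfolding graph_def d by (rule someI)
  then show "is_rel X Y (graph f F)" "\<lbrakk>x \<in> hom C A X; y \<in> hom C A Y\<rbrakk> \<Longrightarrow> in_rel C x y (graph f F) \<longleftrightarrow> in_rel C (f \<cdot> x) y F"
    by blast+
qed

lemma cograph:
  assumes F: "is_rel Y Y F" and f: "f \<in> hom C X Y"
  shows "is_rel Y X (cograph f F)"
    and "\<lbrakk>x \<in> hom C A X; y \<in> hom C A Y\<rbrakk> \<Longrightarrow> in_rel C y x (cograph f F) \<longleftrightarrow> in_rel C y (f \<cdot> x) F"
proof -
  have i: "Ident C Y \<in> hom C Y Y" using f by auto
  obtain R where R: "is_rel Y X R" "\<And>A y x. \<lbrakk>y \<in> hom C A Y; x \<in> hom C A X\<rbrakk> \<Longrightarrow>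
      in_rel C y x R \<longleftrightarrow> in_rel C (Ident C Y \<cdot> y) (f \<cdot> x) F" by (rule rel_pull[OF F i f]) blast
  have d: "Dom C f = X" "Cod C f = Y" using f by simp_all
  have "is_rel Y X R \<and> (\<forall>A. \<forall>x\<in>hom C A X. \<forall>y\<in>hom C A Y. in_rel C y x R \<longleftrightarrow> in_rel C y (f \<cdot> x) F)"
    using R by simp
  then have "is_rel Y X (cograph f F) \<and> (\<forall>A. \<forall>x\<in>hom C A X. \<forall>y\<in>hom C A Y.
      in_rel C y x (cograph f F) \<longleftrightarrow> in_rel C y (f \<cdot> x) F)"
    unfolding cograph_def d by (rule someI)
  then show "is_rel Y X (cograph f F)" "\<lbrakk>x \<in> hom C A X; y \<in> hom C A Y\<rbrakk> \<Longrightarrow> in_rel C y x (cograph f F) \<longleftrightarrow> in_rel C y (f \<cdot> x) F"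
    by blast+
qed

lemma adj_total_at:
  assumes "x \<in> hom C A X" "y \<in> hom C A Y" "in_rel C x y R" "in_rel C y x S"
  shows "\<exists>B e y. so_mor C e \<and> e \<in> hom C B A \<and> y \<in> hom C B Y \<and> in_rel C (x \<cdot> e) y R \<and> in_rel C y (x \<cdot> e) S"
proof -
  have "A \<in> Obj C" using assms(1) by auto
  then have "so_mor C (Ident C A)" "Ident C A \<in> hom C A A" "x \<cdot> Ident C A = x"
    using assms(1) by (simp_all add: so_mor_ident)
  then show ?thesis using assms(2-4) by metis
qed

text \<open>Here values exist without a cover: reflexivity of \<open>F\<close> makes
  \<open>f \<cdot> x\<close> a value of \<open>x\<close>. The hypothesis on \<open>K\<close> is what
  makes the two relations absorb \<open>K\<close>.\<close>

lemma adj_graph: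
  assumes K: "cong X K" and F: "cong Y F" and f: "f \<in> hom C X Y"
    and KF: "\<And>A x x'. \<lbrakk>x \<in> hom C A X; x' \<in> hom C A X; in_rel C x x' K\<rbrakk> \<Longrightarrow> in_rel C (f \<cdot> x) (f \<cdot> x') F"
  shows "adj X K Y F (graph f F) (cograph f F)"
proof -
  note g = graph[OF cong_rel[OF F] f] and cg = cograph[OF cong_rel[OF F] f]
  have fx: "f \<cdot> x \<in> hom C A Y" if "x \<in> hom C A X" for x A using f that by simp
  show ?thesis
  proof (rule adjI)
    show "bimod X K Y F (graph f F)"
    proof (rule bimodI[OF K F g(1)])
      fix A x x' y assume h: "x \<in> hom C A X" "x' \<in> hom C A X" "y \<in> hom C A Y" "in_rel C x x' K" "in_rel C x' y (graph f F)"
      have "in_rel C (f \<cdot> x') y F" using g(2)[OF h(2,3)] h(5) by blast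
      then show "in_rel C x y (graph f F)"
        unfolding g(2)[OF h(1,3)] by (rule cong_trans[OF F fx[OF h(1)] fx[OF h(2)] h(3) KF[OF h(1,2,4)]])
    next
      fix A x y y' assume h: "x \<in> hom C A X" "y \<in> hom C A Y" "y' \<in> hom C A Y" "in_rel C x y (graph f F)" "in_rel C y y' F"
      have "in_rel C (f \<cdot> x) y F" using g(2)[OF h(1,2)] h(4) by blast
      then show "in_rel C x y' (graph f F)"
        unfolding g(2)[OF h(1,3)] by (rule cong_trans[OF F fx[OF h(1)] h(2,3) _ h(5)])
    qed
    show "bimod Y F X K (cograph f F)"
    proof (rule bimodI[OF F K cg(1)])
      fix A y y' x assume h: "y \<in> hom C A Y" "y' \<in> hom C A Y" "x \<in> hom C A X" "in_rel C y y' F" "in_rel C y' x (cograph f F)"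
      have "in_rel C y' (f \<cdot> x) F" using cg(2)[OF h(3,2)] h(5) by blast
      then show "in_rel C y x (cograph f F)"
        unfolding cg(2)[OF h(3,1)] by (rule cong_trans[OF F h(1,2) fx[OF h(3)] h(4)])
    next
      fix A y x x' assume h: "y \<in> hom C A Y" "x \<in> hom C A X" "x' \<in> hom C A X" "in_rel C y x (cograph f F)" "in_rel C x x' K"
      have "in_rel C y (f \<cdot> x) F" using cg(2)[OF h(2,1)] h(4) by blast
      then show "in_rel C y x' (cograph f F)"
        unfolding cg(2)[OF h(3,1)] by (rule cong_trans[OF F h(1) fx[OF h(2)] fx[OF h(3)] _ KF[OF h(2,3,5)]])
    qed
  next
    fix A x assume x: "x \<in> hom C A X"
    show "\<exists>B e y. so_mor C e \<and> e \<in> hom C B A \<and> y \<in> hom C B Y \<and> in_rel C (x \<cdot> e) y (graph f F) \<and> in_rel C y (x \<cdot> e) (cograph f F)"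
      by (rule adj_total_at[OF x fx[OF x]]) (simp_all only: g(2)[OF x fx[OF x]] cg(2)[OF x fx[OF x]] cong_refl[OF F fx[OF x]])
  next
    fix A x y y' assume h: "x \<in> hom C A X" "y \<in> hom C A Y" "y' \<in> hom C A Y" "in_rel C y x (cograph f F)" "in_rel C x y' (graph f F)"
    have "in_rel C y (f \<cdot> x) F" "in_rel C (f \<cdot> x) y' F" using g(2)[OF h(1,3)] cg(2)[OF h(1,2)] h(4,5) by blast+
    then show "in_rel C y y' F" by (rule cong_trans[OF F h(2) fx[OF h(1)] h(3)])
  qed
qed

text \<open>The source congruence is only recorded and does not enter the relation. Accordingly
  \<open>hat\<close> yields a morphism when \<open>f\<close> carries the source congruence into the
  target one, which is automatic for the source \<open>ident_rel\<close>.\<close>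

definition hat :: "'a \<times> 'b set \<Rightarrow> 'a \<times> 'b set \<Rightarrow> 'b \<Rightarrow> ('a, 'b) qarr" where
  "hat a b f = (a, graph f (snd b), b)"

lemma adj_graph_ident:
  assumes F: "cong Y F" and f: "f \<in> hom C X Y"
  shows "adj X (ident_rel C X) Y F (graph f F) (cograph f F)"
proof -
  have X: "X \<in> Obj C" using f by auto
  show ?thesis
  proof (rule adj_graph[OF cong_ident_rel[OF X] F f])
    fix A x x' assume x: "x \<in> hom C A X" "x' \<in> hom C A X" and "in_rel C x x' (ident_rel C X)"
    then have "x \<sqsubseteq> x'" using ident_rel(2)[OF X x] by blast
    then have "f \<cdot> x \<sqsubseteq> f \<cdot> x'" by (rule comp_mono_right) (use x f in simp_all)
    then show "in_rel C (f \<cdot> x) (f \<cdot> x') F" by (rule cong_le[OF F, of _ A, rotated 2]) (use x f in simp_all)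
  qed
qed

lemma hat_ident_hom:
  "\<lbrakk>cong Y F; f \<in> hom C X Y\<rbrakk> \<Longrightarrow> hat (X, ident_rel C X) (Y, F) f \<in> hom (exreg C) (X, ident_rel C X) (Y, F)"
  unfolding hat_def exreg_hom_iff snd_conv using adj_graph_ident by blast

text \<open>Substitution: \<open>f \<cdot> x\<close> itself can serve as intermediate point, and any
  other intermediate point lies above it in \<open>F\<close>, which \<open>R\<close>
  absorbs.\<close>

lemma in_comp_graph:
  assumes b: "bimod Y F Z G R" and f: "f \<in> hom C X Y" and x: "x \<in> hom C A X" and z: "z \<in> hom C A Z"
  shows "in_rel C x z (rel_comp C X Y Z R (graph f F)) \<longleftrightarrow> in_rel C (f \<cdot> x) z R"
proof -
  note R = bimod_rel[OF b] and F = bimod_cong(1)[OF b]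
  note g = graph[OF cong_rel[OF F] f]
  have fx: "f \<cdot> x \<in> hom C A Y" using f x by simp
  show ?thesis
  proof
    assume "in_rel C x z (rel_comp C X Y Z R (graph f F))"
    then obtain B d y where d: "so_mor C d" "d \<in> hom C B A" "y \<in> hom C B Y" "in_rel C (x \<cdot> d) y (graph f F)"
      "in_rel C y (z \<cdot> d) R" by (rule in_rel_compE[OF _ g(1) R x z])
    have xd: "x \<cdot> d \<in> hom C B X" "z \<cdot> d \<in> hom C B Z" "(f \<cdot> x) \<cdot> d \<in> hom C B Y" using x z d f by (simp_all del: assoc)
    have "in_rel C ((f \<cdot> x) \<cdot> d) y F" using g(2)[OF xd(1) d(3)] d(2,4) x f by simp
    then have "in_rel C ((f \<cdot> x) \<cdot> d) (z \<cdot> d) R" by (rule bimod_left[OF b xd(3) d(3) xd(2) _ d(5)])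
    then show "in_rel C (f \<cdot> x) z R" by (rule in_rel_local[OF R fx z d(1,2)])
  next
    assume "in_rel C (f \<cdot> x) z R"
    moreover have "in_rel C x (f \<cdot> x) (graph f F)" using g(2)[OF x fx] cong_refl[OF F fx] by blast
    ultimately show "in_rel C x z (rel_comp C X Y Z R (graph f F))"
      by (rule in_rel_compI'[OF g(1) R x z fx, rotated])
  qed
qed

text \<open>Both relations hold between \<open>x\<close> and \<open>y\<close> exactly when
  \<open>f \<cdot> x \<sqsubseteq> y\<close>. In this form the calculus of \<open>hat\<close>
  applies to the canonical functor.\<close>

lemma Gam_hat: "f \<in> hom C X Y \<Longrightarrow> FArr (Gam C) f = hat (X, ident_rel C X) (Y, ident_rel C Y) f"
proof -
  assume f: "f \<in> hom C X Y"
  then have o: "Y \<in> Obj C" by auto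
  then have i: "Ident C Y \<in> hom C Y Y" by simp
  note r = ident_rel[OF o]
  have "lower_star C f = graph f (ident_rel C Y)"
  proof (rule rel_eqI[of X Y])
    show "is_rel X Y (lower_star C f)" unfolding lower_star_def using f is_rel_comma[OF f i] by simp
    fix A x y assume x: "x \<in> hom C A X" and y: "y \<in> hom C A Y"
    have "f \<cdot> x \<in> hom C A Y" using x f by simp
    then show "in_rel C x y (lower_star C f) \<longleftrightarrow> in_rel C x y (graph f (ident_rel C Y))"
      unfolding graph(2)[OF r(1) f x y] lower_star_def using f in_comma_rel[OF f i x y] r(2) y by simp
  qed (rule graph(1)[OF r(1) f])
  then show "FArr (Gam C) f = hat (X, ident_rel C X) (Y, ident_rel C Y) f"
    using f by (simp add: Gam_def hat_def)
qed


section \<open>Quotient morphisms and \<open>so\<close>-morphisms of the exact completion\<close>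

lemma rel_opp:
  assumes R: "is_rel X Y R"
  obtains S where "is_rel Y X S"
    "\<And>A x y. \<lbrakk>x \<in> hom C A X; y \<in> hom C A Y\<rbrakk> \<Longrightarrow> in_rel C y x S \<longleftrightarrow> in_rel C x y R"
proof -
  obtain T r0 r1 where r: "r0 \<in> hom C T X" "r1 \<in> hom C T Y" "jointly_order_mono C r0 r1"
    and i: "\<And>A x y. \<lbrakk>x \<in> hom C A X; y \<in> hom C A Y\<rbrakk> \<Longrightarrow>
       in_rel C x y R \<longleftrightarrow> (\<exists>u\<in>hom C A T. r0 \<cdot> u = x \<and> r1 \<cdot> u = y)" by (rule rel_span[OF R]) blast
  have "Dom C r0 = T" "Dom C r1 = T" using r by simp_all
  then have j: "jointly_order_mono C r1 r0" using r(3) unfolding jointly_order_mono_def by simp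
  obtain S where S: "is_rel Y X S" "\<And>A y x. \<lbrakk>y \<in> hom C A Y; x \<in> hom C A X\<rbrakk> \<Longrightarrow>
       in_rel C y x S \<longleftrightarrow> (\<exists>u\<in>hom C A T. r1 \<cdot> u = y \<and> r0 \<cdot> u = x)"
    by (rule span_rel[OF r(2,1) j]) blast
  show thesis by (rule that[OF S(1)]) (use S(2) i in blast)
qed

lemma rel_generic_span:
  assumes R: "is_rel X Y R"
  obtains T r0 r1 where "r0 \<in> hom C T X" "r1 \<in> hom C T Y" "jointly_order_mono C r0 r1" "in_rel C r0 r1 R"
    "\<And>A x y. \<lbrakk>x \<in> hom C A X; y \<in> hom C A Y; in_rel C x y R\<rbrakk> \<Longrightarrow> \<exists>u\<in>hom C A T. r0 \<cdot> u = x \<and> r1 \<cdot> u = y"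
proof -
  obtain T r0 r1 where r: "r0 \<in> hom C T X" "r1 \<in> hom C T Y" "jointly_order_mono C r0 r1"
    and i: "\<And>A x y. \<lbrakk>x \<in> hom C A X; y \<in> hom C A Y\<rbrakk> \<Longrightarrow>
       in_rel C x y R \<longleftrightarrow> (\<exists>u\<in>hom C A T. r0 \<cdot> u = x \<and> r1 \<cdot> u = y)" by (rule rel_span[OF R]) blast
  have "T \<in> Obj C" using r by auto
  then have "Ident C T \<in> hom C T T" "r0 \<cdot> Ident C T = r0" "r1 \<cdot> Ident C T = r1" using r by simp_all
  then have "in_rel C r0 r1 R" unfolding i[OF r(1,2)] by blast
  then show thesis by (rule that[OF r]) (use i in blast)
qed

text \<open>The span of values represents the intersection of \<open>R\<close> with the opposite of
  \<open>S\<close>. Its first leg is \<open>so\<close> because the generic element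
  \<open>Ident C X\<close> has a value on some cover, and that cover factors through the
  leg.\<close>

lemma adj_val_span:
  assumes a: "adj X E Y F R S"
  obtains T v0 v1 where "v0 \<in> hom C T X" "v1 \<in> hom C T Y" "in_rel C v0 v1 R" "in_rel C v1 v0 S" "so_mor C v0"
    "\<And>A x y. \<lbrakk>x \<in> hom C A X; y \<in> hom C A Y; in_rel C x y R; in_rel C y x S\<rbrakk> \<Longrightarrow> \<exists>u\<in>hom C A T. v0 \<cdot> u = x \<and> v1 \<cdot> u = y"
proof -
  note R = adj_rel(1)[OF a] and S = adj_rel(2)[OF a]
  obtain S' where S': "is_rel X Y S'" "\<And>A y x. \<lbrakk>y \<in> hom C A Y; x \<in> hom C A X\<rbrakk> \<Longrightarrow> in_rel C x y S' \<longleftrightarrow> in_rel C y x S"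
    by (rule rel_opp[OF S]) blast
  obtain V where V: "is_rel X Y V"
    "\<And>A x y. \<lbrakk>x \<in> hom C A X; y \<in> hom C A Y\<rbrakk> \<Longrightarrow> in_rel C x y V \<longleftrightarrow> in_rel C x y R \<and> in_rel C x y S'"
    by (rule rel_inter[OF R S'(1)]) blast
  obtain T v0 v1 where v: "v0 \<in> hom C T X" "v1 \<in> hom C T Y" "in_rel C v0 v1 V"
    and u: "\<And>A x y. \<lbrakk>x \<in> hom C A X; y \<in> hom C A Y; in_rel C x y V\<rbrakk> \<Longrightarrow> \<exists>u\<in>hom C A T. v0 \<cdot> u = x \<and> v1 \<cdot> u = y"
    by (rule rel_generic_span[OF V(1)]) blast
  have v': "in_rel C v0 v1 R" "in_rel C v1 v0 S" using v(3) V(2)[OF v(1,2)] S'(2)[OF v(2,1)] by blast+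
  have u': "\<exists>u\<in>hom C A T. v0 \<cdot> u = x \<and> v1 \<cdot> u = y"
    if "x \<in> hom C A X" "y \<in> hom C A Y" "in_rel C x y R" "in_rel C y x S" for A x y
    using u[OF that(1,2)] V(2)[OF that(1,2)] S'(2)[OF that(2,1)] that(3,4) by blast
  have X: "X \<in> Obj C" by (rule cong_obj[OF adj_cong(1)[OF a]])
  then have "Ident C X \<in> hom C X X" by simp
  then obtain B d y where d: "so_mor C d" "d \<in> hom C B X" "y \<in> hom C B Y"
    "in_rel C (Ident C X \<cdot> d) y R" "in_rel C y (Ident C X \<cdot> d) S" by (rule adj_total[OF a])
  then obtain w where w: "w \<in> hom C B T" "v0 \<cdot> w = d" using u'[of d B y] by auto
  have "so_mor C v0" by (rule so_mor_cancel[of _ w]) (use w d v in simp_all)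
  with v(1,2) v' show thesis using that u' by blast
qed

lemma so_cover_comp:
  assumes "so_mor C d" "d \<in> hom C B A" "so_mor C e" "e \<in> hom C D B"
  shows "so_mor C (d \<cdot> e)" "d \<cdot> e \<in> hom C D A"
  using assms so_mor_comp[of e d] by simp_all

lemma pull_cong:
  assumes F: "cong Y F" and f: "f \<in> hom C X Y"
  obtains K where "cong X K"
    "\<And>A x x'. \<lbrakk>x \<in> hom C A X; x' \<in> hom C A X\<rbrakk> \<Longrightarrow> in_rel C x x' K \<longleftrightarrow> in_rel C (f \<cdot> x) (f \<cdot> x') F"
proof -
  obtain K where K: "is_rel X X K"
    "\<And>A x x'. \<lbrakk>x \<in> hom C A X; x' \<in> hom C A X\<rbrakk> \<Longrightarrow> in_rel C x x' K \<longleftrightarrow> in_rel C (f \<cdot> x) (f \<cdot> x') F"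
    by (rule rel_pull[OF cong_rel[OF F] f f]) blast
  have fx: "f \<cdot> x \<in> hom C A Y" if "x \<in> hom C A X" for A x using that f by simp
  have "cong X K"
  proof (rule congI[OF K(1)])
    fix A x x' assume x: "x \<in> hom C A X" "x' \<in> hom C A X" "x \<sqsubseteq> x'"
    have "f \<cdot> x \<sqsubseteq> f \<cdot> x'" by (rule comp_mono_right[OF x(3)]) (use x f in simp_all)
    then show "in_rel C x x' K" unfolding K(2)[OF x(1,2)] by (rule cong_le[OF F fx[OF x(1)] fx[OF x(2)]])
  next
    fix A x x' x'' assume x: "x \<in> hom C A X" "x' \<in> hom C A X" "x'' \<in> hom C A X"
      and i: "in_rel C x x' K" "in_rel C x' x'' K"
    show "in_rel C x x'' K" unfolding K(2)[OF x(1,3)]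
      by (rule cong_trans[OF F fx[OF x(1)] fx[OF x(2)] fx[OF x(3)]
            i(1)[unfolded K(2)[OF x(1,2)]] i(2)[unfolded K(2)[OF x(2,3)]]])
  qed
  then show thesis using that K(2) by blast
qed

text \<open>Testing the inclusion of the graphs at the generic element \<open>Ident C T\<close>
  gives the membership in \<open>K\<close>; conversely transitivity of \<open>K\<close> gives the
  inclusion.\<close>

lemma hat_le_iff:
  assumes K: "cong Z K" and z: "z \<in> hom C T Z" "z' \<in> hom C T Z"
  shows "hat a (Z, K) z \<sqsubseteq>\<^bsub>exreg C\<^esub> hat a (Z, K) z' \<longleftrightarrow> in_rel C z z' K"
proof -
  note g = graph[OF cong_rel[OF K] z(1)] and g' = graph[OF cong_rel[OF K] z(2)]
  have T: "T \<in> Obj C" using z by auto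
  show ?thesis
    unfolding hat_def exreg_simps snd_conv rel_incl_iff[OF g'(1) g(1)]
  proof
    assume h: "\<forall>A. \<forall>x\<in>hom C A T. \<forall>y\<in>hom C A Z. in_rel C x y (graph z' K) \<longrightarrow> in_rel C x y (graph z K)"
    have i: "Ident C T \<in> hom C T T" using T by simp
    have "in_rel C (Ident C T) z' (graph z' K)" unfolding g'(2)[OF i z(2)] using z cong_refl[OF K z(2)] by simp
    then have "in_rel C (Ident C T) z' (graph z K)" using h i z by blast
    then show "in_rel C z z' K" unfolding g(2)[OF i z(2)] using z by simp
  next
    assume h: "in_rel C z z' K"
    show "\<forall>A. \<forall>x\<in>hom C A T. \<forall>y\<in>hom C A Z. in_rel C x y (graph z' K) \<longrightarrow> in_rel C x y (graph z K)"
    proof (intro allI ballI impI)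
      fix A x y assume x: "x \<in> hom C A T" and y: "y \<in> hom C A Z" and i: "in_rel C x y (graph z' K)"
      have "z \<cdot> x \<in> hom C A Z" "z' \<cdot> x \<in> hom C A Z" using x z by simp_all
      then show "in_rel C x y (graph z K)" unfolding g(2)[OF x y]
        by (rule cong_trans[OF K _ _ y in_rel_comp[OF cong_rel[OF K] z x h] i[unfolded g'(2)[OF x y]]])
    qed
  qed
qed

text \<open>\<open>rel_comp C Z Y Z S R\<close> is the order kernel of the morphism
  \<open>R\<close>: its intermediate point \<open>w\<close> says that the value of \<open>z\<close>
  is below \<open>w\<close> and \<open>w\<close> is below the value of \<open>z'\<close>.\<close>

lemma comp_hat_le:
  assumes a: "adj Z K Y F R S" and z: "z \<in> hom C T Z" "z' \<in> hom C T Z"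
    and N: "in_rel C z z' (rel_comp C Z Y Z S R)"
  shows "((Z, K), R, (Y, F)) \<cdot>\<^bsub>exreg C\<^esub> hat (T, L) (Z, K) z \<sqsubseteq>\<^bsub>exreg C\<^esub>
    ((Z, K), R, (Y, F)) \<cdot>\<^bsub>exreg C\<^esub> hat (T, L) (Z, K) z'"
proof -
  note R = adj_rel(1)[OF a] and S = adj_rel(2)[OF a] and b = adj_bimod(1)[OF a]
  note K = cong_rel[OF adj_cong(1)[OF a]]
  have T: "T \<in> Obj C" using z by auto
  show ?thesis
    unfolding hat_def exreg_simps snd_conv fst_conv
      rel_incl_iff[OF is_rel_comp[OF graph(1)[OF K z(2)] R] is_rel_comp[OF graph(1)[OF K z(1)] R]]
  proof (intro allI ballI impI)
    fix A x y assume x: "x \<in> hom C A T" and y: "y \<in> hom C A Y" and i: "in_rel C x y (rel_comp C T Z Y R (graph z' K))"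
    have zx: "z \<cdot> x \<in> hom C A Z" "z' \<cdot> x \<in> hom C A Z" using x z by simp_all
    have r: "in_rel C (z' \<cdot> x) y R" using i unfolding in_comp_graph[OF b z(2) x y] .
    have "in_rel C (z \<cdot> x) (z' \<cdot> x) (rel_comp C Z Y Z S R)" by (rule in_rel_comp[OF is_rel_comp[OF R S] z x N])
    then obtain B d w where d: "so_mor C d" "d \<in> hom C B A" "w \<in> hom C B Y" "in_rel C ((z \<cdot> x) \<cdot> d) w R"
      "in_rel C w ((z' \<cdot> x) \<cdot> d) S" by (rule in_rel_compE[OF _ R S zx])
    have h: "(z \<cdot> x) \<cdot> d \<in> hom C B Z" "(z' \<cdot> x) \<cdot> d \<in> hom C B Z" "y \<cdot> d \<in> hom C B Y"
      using zx d(2) y by (simp_all del: assoc)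
    have "in_rel C w (y \<cdot> d) F" by (rule adj_counit[OF a h(2) d(3) h(3) d(5) in_rel_comp[OF R zx(2) y d(2) r]])
    then have "in_rel C ((z \<cdot> x) \<cdot> d) (y \<cdot> d) R" by (rule bimod_right[OF b h(1) d(3) h(3) d(4)])
    then have "in_rel C (z \<cdot> x) y R" by (rule in_rel_local[OF R zx(1) y d(1,2)])
    then show "in_rel C x y (rel_comp C T Z Y R (graph z K))" unfolding in_comp_graph[OF b z(1) x y] .
  qed
qed

text \<open>The generalized elements \<open>z\<close> and \<open>z'\<close> name two arrows out of
  \<open>(T, ident_rel C T)\<close>. The \<open>ff\<close>-morphism reflects the inequality between
  them, and \<open>hat_le_iff\<close> translates it back into \<open>K\<close>.\<close>

lemma exreg_ff_kernel:
  assumes ff: "ff_mor (exreg C) ((Z, K), R, (Y, F))" and a: "adj Z K Y F R S"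
    and z: "z \<in> hom C T Z" "z' \<in> hom C T Z" and N: "in_rel C z z' (rel_comp C Z Y Z S R)"
  shows "in_rel C z z' K"
proof -
  have K: "cong Z K" by (rule adj_cong(1)[OF a])
  have "hat (T, ident_rel C T) (Z, K) z \<sqsubseteq>\<^bsub>exreg C\<^esub> hat (T, ident_rel C T) (Z, K) z'"
    by (rule pos_category.ff_morD[OF pos_category_exreg ff comp_hat_le[OF a z N], where Z = "(T, ident_rel C T)"])
      (unfold exreg_simps, rule hat_ident_hom[OF K z(1)], rule hat_ident_hom[OF K z(2)])
  then show ?thesis unfolding hat_le_iff[OF K z] .
qed

text \<open>A morphism of \<open>exreg C\<close> factors through the object of its values, with the congruence pulled back
  from the codomain; the inclusion of that object is \<open>ff\<close>, so it splits if the morphism is \<open>so\<close>.\<close>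

lemma exreg_so_surj:
  assumes so: "so_mor (exreg C) ((X, E), R, (Y, F))" and a: "adj X E Y F R S" and y: "y \<in> hom C A Y"
  shows "\<exists>B e x. so_mor C e \<and> e \<in> hom C B A \<and> x \<in> hom C B X \<and> in_rel C x (y \<cdot> e) R \<and> in_rel C (y \<cdot> e) x S"
proof -
  note ex = pos_category_exreg
  note R = adj_rel(1)[OF a] and S = adj_rel(2)[OF a] and E = adj_cong(1)[OF a] and F = adj_cong(2)[OF a]
  note bR = adj_bimod(1)[OF a] and bS = adj_bimod(2)[OF a]
  have iX: "Ident C X \<in> hom C X X" using cong_obj[OF E] by simp
  obtain T v0 v1 where v: "v0 \<in> hom C T X" "v1 \<in> hom C T Y" "in_rel C v0 v1 R" "in_rel C v1 v0 S"
    and u: "\<And>A x y. \<lbrakk>x \<in> hom C A X; y \<in> hom C A Y; in_rel C x y R; in_rel C y x S\<rbrakk> \<Longrightarrow> \<exists>u\<in>hom C A T. v0 \<cdot> u = x \<and> v1 \<cdot> u = y"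
    by (rule adj_val_span[OF a]) blast
  have v1t: "v1 \<cdot> t \<in> hom C B Y" if "t \<in> hom C B T" for t B using v(2) that by simp
  obtain K where K: "cong T K"
    "\<And>A x x'. \<lbrakk>x \<in> hom C A T; x' \<in> hom C A T\<rbrakk> \<Longrightarrow> in_rel C x x' K \<longleftrightarrow> in_rel C (v1 \<cdot> x) (v1 \<cdot> x') F"
    by (rule pull_cong[OF F v(2)]) blast
  have am: "adj T K Y F (graph v1 F) (cograph v1 F)"
    by (rule adj_graph[OF K(1) F v(2)]) (use K(2) in blast)
  note gm = graph[OF cong_rel[OF F] v(2)]
  let ?m = "((T, K), graph v1 F, (Y, F))"
  have mh: "?m \<in> hom (exreg C) (T, K) (Y, F)" unfolding exreg_hom_iff using am by blast
  have ff: "ff_mor (exreg C) ?m"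
    unfolding ff_mor_def exreg_simps
  proof (intro conjI allI ballI impI)
    show "?m \<in> Arr (exreg C)" using mh by simp
    fix c f g assume fg: "f \<in> hom (exreg C) c (T, K)" "g \<in> hom (exreg C) c (T, K)"
      and le: "?m \<cdot>\<^bsub>exreg C\<^esub> f \<sqsubseteq>\<^bsub>exreg C\<^esub> ?m \<cdot>\<^bsub>exreg C\<^esub> g"
    obtain Z L where c: "c = (Z, L)" by (cases c)
    obtain Rf Sf Rg Sg where f: "f = ((Z, L), Rf, (T, K))" "adj Z L T K Rf Sf"
      and g: "g = ((Z, L), Rg, (T, K))" "adj Z L T K Rg Sg"
      using fg unfolding c exreg_hom_iff by blast
    note rf = adj_rel(1)[OF f(2)] and rg = adj_rel(1)[OF g(2)]
    have le': "rel_incl C (rel_comp C Z T Y (graph v1 F) Rg) (rel_comp C Z T Y (graph v1 F) Rf)"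
      using le unfolding f(1) g(1) exreg_simps fst_conv .
    show "f \<sqsubseteq>\<^bsub>exreg C\<^esub> g"
      unfolding f(1) g(1) exreg_simps rel_incl_iff[OF rg rf]
    proof (intro allI ballI impI)
      fix A z t assume z: "z \<in> hom C A Z" and t: "t \<in> hom C A T" and i: "in_rel C z t Rg"
      have "in_rel C t (v1 \<cdot> t) (graph v1 F)" unfolding gm(2)[OF t v1t[OF t]] by (rule cong_refl[OF F v1t[OF t]])
      then have "in_rel C z (v1 \<cdot> t) (rel_comp C Z T Y (graph v1 F) Rg)"
        by (rule in_rel_compI'[OF rg gm(1) z v1t[OF t] t i])
      then have "in_rel C z (v1 \<cdot> t) (rel_comp C Z T Y (graph v1 F) Rf)"
        by (rule rel_inclD[OF le' is_rel_comp[OF rg gm(1)] is_rel_comp[OF rf gm(1)] z v1t[OF t]])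
      then obtain B d w where d: "so_mor C d" "d \<in> hom C B A" "w \<in> hom C B T" "in_rel C (z \<cdot> d) w Rf"
        "in_rel C w ((v1 \<cdot> t) \<cdot> d) (graph v1 F)" by (rule in_rel_compE[OF _ rf gm(1) z v1t[OF t]])
      have h: "t \<cdot> d \<in> hom C B T" "z \<cdot> d \<in> hom C B Z" "(v1 \<cdot> t) \<cdot> d = v1 \<cdot> (t \<cdot> d)" using t z d v by simp_all
      have "in_rel C w (t \<cdot> d) K" unfolding K(2)[OF d(3) h(1)]
        using d(5) gm(2)[OF d(3) v1t[OF h(1)]] unfolding h(3) by blast
      then have "in_rel C (z \<cdot> d) (t \<cdot> d) Rf" by (rule bimod_right[OF adj_bimod(1)[OF f(2)] h(2) d(3) h(1) d(4)])
      then show "in_rel C z t Rf" by (rule in_rel_local[OF rf z t d(1,2)])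
    qed
  qed
  \<comment> \<open>Since \<open>K\<close> is pulled back along \<open>v1\<close>, a point
    \<open>t\<close> counts only through \<open>v1 \<cdot> t\<close>. So the first factor has to
    relate \<open>x\<close> to \<open>t\<close> exactly when \<open>R\<close> relates
    \<open>x\<close> to \<open>v1 \<cdot> t\<close>.\<close>
  obtain Ru where Ru: "is_rel X T Ru" "\<And>A x t. \<lbrakk>x \<in> hom C A X; t \<in> hom C A T\<rbrakk> \<Longrightarrow>
      in_rel C x t Ru \<longleftrightarrow> in_rel C (Ident C X \<cdot> x) (v1 \<cdot> t) R" by (rule rel_pull[OF R iX v(2)]) blast
  obtain Su where Su: "is_rel T X Su" "\<And>A t x. \<lbrakk>t \<in> hom C A T; x \<in> hom C A X\<rbrakk> \<Longrightarrow>
      in_rel C t x Su \<longleftrightarrow> in_rel C (v1 \<cdot> t) (Ident C X \<cdot> x) S" by (rule rel_pull[OF S v(2) iX]) blast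
  have iRu: "in_rel C x t Ru \<longleftrightarrow> in_rel C x (v1 \<cdot> t) R" and iSu: "in_rel C t x Su \<longleftrightarrow> in_rel C (v1 \<cdot> t) x S"
    if "x \<in> hom C A X" "t \<in> hom C A T" for x t A
    using Ru(2)[OF that] Su(2)[OF that(2,1)] that(1) by simp_all
  have au: "adj X E T K Ru Su"
  proof (rule adjI)
    show "bimod X E T K Ru"
    proof (rule bimodI[OF E K(1) Ru(1)])
      fix A x x' t assume h: "x \<in> hom C A X" "x' \<in> hom C A X" "t \<in> hom C A T" "in_rel C x x' E" "in_rel C x' t Ru"
      show "in_rel C x t Ru" unfolding iRu[OF h(1,3)]
        by (rule bimod_left[OF bR h(1,2) v1t[OF h(3)] h(4) h(5)[unfolded iRu[OF h(2,3)]]])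
    next
      fix A x t t' assume h: "x \<in> hom C A X" "t \<in> hom C A T" "t' \<in> hom C A T" "in_rel C x t Ru" "in_rel C t t' K"
      show "in_rel C x t' Ru" unfolding iRu[OF h(1,3)]
        by (rule bimod_right[OF bR h(1) v1t[OF h(2)] v1t[OF h(3)] h(4)[unfolded iRu[OF h(1,2)]] h(5)[unfolded K(2)[OF h(2,3)]]])
    qed
    show "bimod T K X E Su"
    proof (rule bimodI[OF K(1) E Su(1)])
      fix A t t' x assume h: "t \<in> hom C A T" "t' \<in> hom C A T" "x \<in> hom C A X" "in_rel C t t' K" "in_rel C t' x Su"
      show "in_rel C t x Su" unfolding iSu[OF h(3,1)]
        by (rule bimod_left[OF bS v1t[OF h(1)] v1t[OF h(2)] h(3) h(4)[unfolded K(2)[OF h(1,2)]] h(5)[unfolded iSu[OF h(3,2)]]])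
    next
      fix A t x x' assume h: "t \<in> hom C A T" "x \<in> hom C A X" "x' \<in> hom C A X" "in_rel C t x Su" "in_rel C x x' E"
      show "in_rel C t x' Su" unfolding iSu[OF h(3,1)]
        by (rule bimod_right[OF bS v1t[OF h(1)] h(2,3) h(4)[unfolded iSu[OF h(2,1)]] h(5)])
    qed
  next
    fix A x assume x: "x \<in> hom C A X"
    obtain B d y where d: "so_mor C d" "d \<in> hom C B A" "y \<in> hom C B Y"
      "in_rel C (x \<cdot> d) y R" "in_rel C y (x \<cdot> d) S" by (rule adj_total[OF a x])
    have xd: "x \<cdot> d \<in> hom C B X" using x d by simp
    obtain t where t: "t \<in> hom C B T" "v1 \<cdot> t = y" using u[OF xd d(3,4,5)] by blast
    have "in_rel C (x \<cdot> d) t Ru" "in_rel C t (x \<cdot> d) Su" unfolding iRu[OF xd t(1)] iSu[OF xd t(1)] t(2) by (rule d)+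
    then show "\<exists>B e y. so_mor C e \<and> e \<in> hom C B A \<and> y \<in> hom C B T \<and> in_rel C (x \<cdot> e) y Ru \<and> in_rel C y (x \<cdot> e) Su"
      using d(1,2) t(1) by blast
  next
    fix A x t t' assume h: "x \<in> hom C A X" "t \<in> hom C A T" "t' \<in> hom C A T" "in_rel C t x Su" "in_rel C x t' Ru"
    show "in_rel C t t' K" unfolding K(2)[OF h(2,3)]
      by (rule adj_counit[OF a h(1) v1t[OF h(2)] v1t[OF h(3)] h(4)[unfolded iSu[OF h(1,2)]] h(5)[unfolded iRu[OF h(1,3)]]])
  qed
  let ?u = "((X, E), Ru, (T, K))" and ?f = "((X, E), R, (Y, F))"
  have uh: "?u \<in> hom (exreg C) (X, E) (T, K)" unfolding exreg_hom_iff using au by blast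
  have mu: "rel_comp C X T Y (graph v1 F) Ru = R"
  proof (rule adj_eqI[OF adj_comp[OF au am] a])
    fix A x assume x: "x \<in> hom C A X"
    obtain B d y where d: "so_mor C d" "d \<in> hom C B A" "y \<in> hom C B Y"
      "in_rel C (x \<cdot> d) y R" "in_rel C y (x \<cdot> d) S" by (rule adj_total[OF a x])
    have xd: "x \<cdot> d \<in> hom C B X" using x d by simp
    obtain t where t: "t \<in> hom C B T" "v1 \<cdot> t = y" using u[OF xd d(3,4,5)] by blast
    have 1: "in_rel C (x \<cdot> d) t Ru" "in_rel C t (x \<cdot> d) Su" unfolding iRu[OF xd t(1)] iSu[OF xd t(1)] t(2) by (rule d)+
    have 2: "in_rel C t y (graph v1 F)" "in_rel C y t (cograph v1 F)"
      unfolding gm(2)[OF t(1) d(3)] cograph(2)[OF cong_rel[OF F] v(2) t(1) d(3)] t(2) by (rule cong_refl[OF F d(3)])+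
    have "in_rel C (x \<cdot> d) y (rel_comp C X T Y (graph v1 F) Ru)"
      by (rule in_rel_compI'[OF Ru(1) gm(1) xd d(3) t(1) 1(1) 2(1)])
    moreover have "in_rel C y (x \<cdot> d) (rel_comp C Y T X Su (cograph v1 F))"
      by (rule in_rel_compI'[OF adj_rel(2)[OF am] Su(1) d(3) xd t(1) 2(2) 1(2)])
    ultimately show "\<exists>B e y. so_mor C e \<and> e \<in> hom C B A \<and> y \<in> hom C B Y \<and>
       in_rel C (x \<cdot> e) y (rel_comp C X T Y (graph v1 F) Ru) \<and> in_rel C y (x \<cdot> e) (rel_comp C Y T X Su (cograph v1 F)) \<and>
       in_rel C (x \<cdot> e) y R \<and> in_rel C y (x \<cdot> e) S" using d by blast
  qed
  have fR: "rel_comp C X Y Y F R = R" by (rule bimod_comp_ident(2)[OF bR])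
  \<comment> \<open>Lifting against a square whose lower edge is the identity of
    \<open>(Y, F)\<close> produces a section of \<open>?m\<close>.\<close>
  let ?i = "((Y, F), F, (Y, F))"
  have eq: "?m \<cdot>\<^bsub>exreg C\<^esub> ?u = ?i \<cdot>\<^bsub>exreg C\<^esub> ?f"
    unfolding exreg_simps fst_conv mu fR ..
  have "?i \<in> hom (exreg C) (Y, F) (Y, F)"
    unfolding exreg_hom_iff using adj_ident[OF F] by blast
  then have ih: "?i \<in> hom (exreg C) (Cod (exreg C) ?f) (Cod (exreg C) ?m)" unfolding exreg_simps .
  have uh': "?u \<in> hom (exreg C) (Dom (exreg C) ?f) (Dom (exreg C) ?m)" using uh unfolding exreg_simps .
  obtain d where "d \<in> hom (exreg C) (Cod (exreg C) ?f) (Dom (exreg C) ?m)" and dm: "?m \<cdot>\<^bsub>exreg C\<^esub> d = ?i"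
    by (rule pos_category.so_lift[OF ex so ff uh' ih eq])
  then have d: "d \<in> hom (exreg C) (Y, F) (T, K)" "?m \<cdot>\<^bsub>exreg C\<^esub> d = ?i" unfolding exreg_simps .
  obtain Rd Sd where D: "d = ((Y, F), Rd, (T, K))" "adj Y F T K Rd Sd" using d(1) unfolding exreg_hom_iff by blast
  note rd = adj_rel[OF D(2)]
  have md: "rel_comp C Y T Y (graph v1 F) Rd = F" using d(2) unfolding D(1) exreg_simps fst_conv by simp
  \<comment> \<open>A local value \<open>t\<close> of \<open>y\<close> under the section lies over
    \<open>y\<close>: \<open>F1\<close> and \<open>F2\<close> show that \<open>v1 \<cdot> t\<close>
    and \<open>y\<close> agree up to \<open>F\<close>. As \<open>v1 \<cdot> t\<close> is the value
    of \<open>v0 \<cdot> t\<close>, the latter is the wanted preimage.\<close>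
  obtain B e t where e: "so_mor C e" "e \<in> hom C B A" "t \<in> hom C B T" "in_rel C (y \<cdot> e) t Rd" "in_rel C t (y \<cdot> e) Sd"
    by (rule adj_total[OF D(2) y])
  have ye: "y \<cdot> e \<in> hom C B Y" using y e by simp
  have "in_rel C t (v1 \<cdot> t) (graph v1 F)" unfolding gm(2)[OF e(3) v1t[OF e(3)]] by (rule cong_refl[OF F v1t[OF e(3)]])
  from in_rel_compI'[OF rd(1) gm(1) ye v1t[OF e(3)] e(3,4) this]
  have F1: "in_rel C (y \<cdot> e) (v1 \<cdot> t) F" unfolding md .
  have "in_rel C (y \<cdot> e) (y \<cdot> e) (rel_comp C Y T Y (graph v1 F) Rd)" unfolding md by (rule cong_refl[OF F ye])
  then obtain B' e' t' where e': "so_mor C e'" "e' \<in> hom C B' B" "t' \<in> hom C B' T" "in_rel C ((y \<cdot> e) \<cdot> e') t' Rd"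
    "in_rel C t' ((y \<cdot> e) \<cdot> e') (graph v1 F)" by (rule in_rel_compE[OF _ rd(1) gm(1) ye ye])
  have h: "(y \<cdot> e) \<cdot> e' \<in> hom C B' Y" "t \<cdot> e' \<in> hom C B' T" "v1 \<cdot> (t \<cdot> e') = (v1 \<cdot> t) \<cdot> e'"
    using ye e(3) e' v(2) by (simp_all del: assoc) (simp)
  have "in_rel C (t \<cdot> e') t' K"
    by (rule adj_counit[OF D(2) h(1,2) e'(3) in_rel_comp[OF rd(2) e(3) ye e'(2) e(5)] e'(4)])
  then have "in_rel C (v1 \<cdot> (t \<cdot> e')) (v1 \<cdot> t') F" unfolding K(2)[OF h(2) e'(3)] .
  moreover have "in_rel C (v1 \<cdot> t') ((y \<cdot> e) \<cdot> e') F" using e'(5) unfolding gm(2)[OF e'(3) h(1)] .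
  ultimately have "in_rel C ((v1 \<cdot> t) \<cdot> e') ((y \<cdot> e) \<cdot> e') F"
    unfolding h(3)[symmetric] by (rule cong_trans[OF F v1t[OF h(2)] v1t[OF e'(3)] h(1)])
  then have F2: "in_rel C (v1 \<cdot> t) (y \<cdot> e) F" by (rule in_rel_local[OF cong_rel[OF F] v1t[OF e(3)] ye e'(1,2)])
  have x: "v0 \<cdot> t \<in> hom C B X" using v e by simp
  have "in_rel C (v0 \<cdot> t) (y \<cdot> e) R"
    by (rule bimod_right[OF bR x v1t[OF e(3)] ye in_rel_comp[OF R v(1,2) e(3) v(3)] F2])
  moreover have "in_rel C (y \<cdot> e) (v0 \<cdot> t) S"
    by (rule bimod_left[OF bS ye v1t[OF e(3)] x F1 in_rel_comp[OF S v(2,1) e(3) v(4)]])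
  ultimately show ?thesis using e(1,2) x by blast
qed

section \<open>Quotient morphisms and their comma objects\<close>

abbreviation quot :: "'a \<Rightarrow> 'b set \<Rightarrow> ('a, 'b) qarr" where
  "quot X E \<equiv> hat (X, ident_rel C X) (X, E) (Ident C X)"

lemma quot_hom: "cong X E \<Longrightarrow> quot X E \<in> hom (exreg C) (X, ident_rel C X) (X, E)"
  by (rule hat_ident_hom) (use cong_obj in auto)

text \<open>Precomposition with the quotient changes only the recorded source: a morphism out of
  \<open>(X, E)\<close> is a morphism out of \<open>(X, ident_rel C X)\<close> whose relation
  absorbs \<open>E\<close>.\<close>

lemma comp_quot:
  assumes b: "bimod X E Y F R"
  shows "rel_comp C X X Y R (graph (Ident C X) E) = R"
proof -
  have i: "Ident C X \<in> hom C X X" using cong_obj[OF bimod_cong(1)[OF b]] by simp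
  note g = graph[OF cong_rel[OF bimod_cong(1)[OF b]] i]
  show ?thesis
  proof (rule rel_eqI[OF is_rel_comp[OF g(1) bimod_rel[OF b]] bimod_rel[OF b]])
    fix A x y assume x: "x \<in> hom C A X" and y: "y \<in> hom C A Y"
    show "in_rel C x y (rel_comp C X X Y R (graph (Ident C X) E)) \<longleftrightarrow> in_rel C x y R"
      unfolding in_comp_graph[OF b i x y] using x by simp
  qed
qed

text \<open>By \<open>comp_quot\<close> the diagonal must have the very relation of
  \<open>u\<close>, with source congruence \<open>E\<close> in place of the trivial one. It has to
  be shown that this relation absorbs \<open>E\<close>; the relation of \<open>v\<close> does, and
  the \<open>ff\<close>-morphism \<open>m\<close> reflects this.\<close>

lemma quot_so:
  assumes E: "cong X E"
  shows "so_mor (exreg C) (quot X E)"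
proof (rule pos_category.so_morI[OF pos_category_exreg])
  show "quot X E \<in> Arr (exreg C)" using quot_hom[OF E] by simp
  fix m u v assume ff: "ff_mor (exreg C) m" and u: "u \<in> hom (exreg C) (Dom (exreg C) (quot X E)) (Dom (exreg C) m)"
    and v: "v \<in> hom (exreg C) (Cod (exreg C) (quot X E)) (Cod (exreg C) m)"
    and eq: "m \<cdot>\<^bsub>exreg C\<^esub> u = v \<cdot>\<^bsub>exreg C\<^esub> quot X E"
  have "m \<in> hom (exreg C) (Dom (exreg C) m) (Cod (exreg C) m)" using pos_category.ff_mor_arr[OF pos_category_exreg ff] by simp
  then obtain Z K Y F R S where m: "m = ((Z, K), R, (Y, F))" "adj Z K Y F R S" by (rule exreg_homE)
  let ?I = "ident_rel C X"
  obtain Ru Su where U: "u = ((X, ?I), Ru, (Z, K))" "adj X ?I Z K Ru Su"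
    using u unfolding m(1) hat_def exreg_simps exreg_hom_iff by blast
  obtain Rv Sv where V: "v = ((X, E), Rv, (Y, F))" "adj X E Y F Rv Sv"
    using v unfolding m(1) hat_def exreg_simps exreg_hom_iff by blast
  have mu: "rel_comp C X Z Y R Ru = Rv"
    using eq comp_quot[OF adj_bimod(1)[OF V(2)]] unfolding m(1) U(1) V(1) hat_def exreg_simps by simp
  note R = adj_rel(1)[OF m(2)] and S = adj_rel(2)[OF m(2)] and K = adj_cong(1)[OF m(2)]
  note ru = adj_rel[OF U(2)] and bu = adj_bimod[OF U(2)] and bv = adj_bimod[OF V(2)]
  \<comment> \<open>The value \<open>y\<close> of \<open>z\<close> under \<open>m\<close> moves the
    question to \<open>Rv\<close>, which absorbs \<open>E\<close>. This gives a point
    \<open>z'\<close> related to \<open>x\<close> whose value under \<open>m\<close> is below that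
    of \<open>z\<close>, and \<open>exreg_ff_kernel\<close> turns this into
    \<open>K\<close>.\<close>
  have left: "in_rel C x z Ru" if h: "x \<in> hom C A X" "x' \<in> hom C A X" "z \<in> hom C A Z" "in_rel C x x' E" "in_rel C x' z Ru"
    for A x x' z
  proof -
    obtain B d y where d: "so_mor C d" "d \<in> hom C B A" "y \<in> hom C B Y" "in_rel C (z \<cdot> d) y R" "in_rel C y (z \<cdot> d) S"
      by (rule adj_total[OF m(2) h(3)])
    have hd: "x \<cdot> d \<in> hom C B X" "x' \<cdot> d \<in> hom C B X" "z \<cdot> d \<in> hom C B Z" using h d by simp_all
    have "in_rel C (x' \<cdot> d) y Rv" unfolding mu[symmetric]
      by (rule in_rel_compI'[OF ru(1) R hd(2) d(3) hd(3) in_rel_comp[OF ru(1) h(2,3) d(2) h(5)] d(4)])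
    then have "in_rel C (x \<cdot> d) y (rel_comp C X Z Y R Ru)" unfolding mu
      by (rule bimod_left[OF bv(1) hd(1,2) d(3) in_rel_comp[OF cong_rel[OF E] h(1,2) d(2) h(4)]])
    then obtain B' d' z' where d': "so_mor C d'" "d' \<in> hom C B' B" "z' \<in> hom C B' Z" "in_rel C ((x \<cdot> d) \<cdot> d') z' Ru"
      "in_rel C z' (y \<cdot> d') R" by (rule in_rel_compE[OF _ ru(1) R hd(1) d(3)])
    have hd': "(x \<cdot> d) \<cdot> d' \<in> hom C B' X" "(z \<cdot> d) \<cdot> d' \<in> hom C B' Z" "y \<cdot> d' \<in> hom C B' Y"
      using hd d(3) d'(2) by (simp_all del: assoc)
    have "in_rel C z' ((z \<cdot> d) \<cdot> d') (rel_comp C Z Y Z S R)"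
      by (rule in_rel_compI'[OF R S d'(3) hd'(2,3) d'(5) in_rel_comp[OF S d(3) hd(3) d'(2) d(5)]])
    then have "in_rel C z' ((z \<cdot> d) \<cdot> d') K"
      by (rule exreg_ff_kernel[OF ff[unfolded m(1)] m(2) d'(3) hd'(2)])
    then have "in_rel C ((x \<cdot> d) \<cdot> d') ((z \<cdot> d) \<cdot> d') Ru" by (rule bimod_right[OF bu(1) hd'(1) d'(3) hd'(2) d'(4)])
    then have "in_rel C (x \<cdot> d) (z \<cdot> d) Ru" by (rule in_rel_local[OF ru(1) hd(1,3) d'(1,2)])
    then show "in_rel C x z Ru" by (rule in_rel_local[OF ru(1) h(1,3) d(1,2)])
  qed
  have right: "in_rel C z x' Su" if h: "z \<in> hom C A Z" "x \<in> hom C A X" "x' \<in> hom C A X" "in_rel C z x Su" "in_rel C x x' E"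
    for A x x' z
  proof -
    obtain B d w where d: "so_mor C d" "d \<in> hom C B A" "w \<in> hom C B Z" "in_rel C (x' \<cdot> d) w Ru" "in_rel C w (x' \<cdot> d) Su"
      by (rule adj_total[OF U(2) h(3)])
    have hd: "x \<cdot> d \<in> hom C B X" "x' \<cdot> d \<in> hom C B X" "z \<cdot> d \<in> hom C B Z" using h d by simp_all
    have "in_rel C (x \<cdot> d) w Ru" by (rule left[OF hd(1,2) d(3) in_rel_comp[OF cong_rel[OF E] h(2,3) d(2) h(5)] d(4)])
    then have "in_rel C (z \<cdot> d) w K" by (rule adj_counit[OF U(2) hd(1,3) d(3) in_rel_comp[OF ru(2) h(1,2) d(2) h(4)]])
    then have "in_rel C (z \<cdot> d) (x' \<cdot> d) Su" by (rule bimod_left[OF bu(2) hd(3) d(3) hd(2) _ d(5)])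
    then show ?thesis by (rule in_rel_local[OF ru(2) h(1,3) d(1,2)])
  qed
  have ad: "adj X E Z K Ru Su"
  proof (rule adjI)
    show "bimod X E Z K Ru" by (rule bimodI[OF E K ru(1) left bimod_right[OF bu(1)]])
    show "bimod Z K X E Su" by (rule bimodI[OF K E ru(2) bimod_left[OF bu(2)] right])
    show "\<exists>B e y. so_mor C e \<and> e \<in> hom C B A \<and> y \<in> hom C B Z \<and> in_rel C (x \<cdot> e) y Ru \<and> in_rel C y (x \<cdot> e) Su"
      if x: "x \<in> hom C A X" for A x
      using adj_total[OF U(2) x] by metis
  qed (rule adj_counit[OF U(2)])
  show "\<exists>d\<in>hom (exreg C) (Cod (exreg C) (quot X E)) (Dom (exreg C) m).
      d \<cdot>\<^bsub>exreg C\<^esub> quot X E = u \<and> m \<cdot>\<^bsub>exreg C\<^esub> d = v"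
  proof (intro bexI conjI)
    show "((X, E), Ru, (Z, K)) \<in> hom (exreg C) (Cod (exreg C) (quot X E)) (Dom (exreg C) m)"
      unfolding m(1) hat_def exreg_simps exreg_hom_iff using ad by blast
    show "((X, E), Ru, (Z, K)) \<cdot>\<^bsub>exreg C\<^esub> quot X E = u"
      using comp_quot[OF adj_bimod(1)[OF ad]] unfolding U(1) hat_def exreg_simps by simp
    show "m \<cdot>\<^bsub>exreg C\<^esub> ((X, E), Ru, (Z, K)) = v"
      unfolding m(1) V(1) exreg_simps fst_conv mu ..
  qed
qed

lemma quot_hat_le:
  assumes E: "cong X E" and z: "z \<in> hom C T X" "z' \<in> hom C T X" "in_rel C z z' E"
  shows "quot X E \<cdot>\<^bsub>exreg C\<^esub> hat (T, L) (X, ident_rel C X) z \<sqsubseteq>\<^bsub>exreg C\<^esub>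
    quot X E \<cdot>\<^bsub>exreg C\<^esub> hat (T, L) (X, ident_rel C X) z'"
proof -
  have iX: "Ident C X \<in> hom C X X" using cong_obj[OF E] by simp
  note aq = adj_graph_ident[OF E iX] and rE = cong_rel[OF E]
  have c: "in_rel C z z' (rel_comp C X X X (cograph (Ident C X) E) (graph (Ident C X) E))"
    by (rule in_rel_compI'[OF adj_rel[OF aq] z(1,2) z(2)])
      (use graph(2)[OF rE iX z(1,2)] cograph(2)[OF rE iX z(2,2)] z cong_refl[OF E z(2)] in simp_all)
  show ?thesis
    using comp_hat_le[OF aq z(1,2) c] unfolding hat_def[of "(X, ident_rel C X)" "(X, E)"] by simp
qed

text \<open>Membership of a pair in both \<open>R\<close> and \<open>S\<close> becomes an equation
  between morphisms. In this way solutions of systems of relations in \<open>C\<close> become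
  natural families in \<open>exreg C\<close>.\<close>

lemma comp_hat_eq:
  assumes a: "adj X E Y F R S" and f: "f \<in> hom C M X" and g: "g \<in> hom C M Y"
    and v: "in_rel C f g R" "in_rel C g f S"
  shows "((X, E), R, (Y, F)) \<cdot>\<^bsub>exreg C\<^esub> hat (M, L) (X, E) f = hat (M, L) (Y, F) g"
proof -
  note r = adj_rel[OF a] and b = adj_bimod(1)[OF a]
  note gf = graph[OF cong_rel[OF adj_cong(1)[OF a]] f] and gg = graph[OF cong_rel[OF adj_cong(2)[OF a]] g]
  have "rel_comp C M X Y R (graph f E) = graph g F"
  proof (rule rel_eqI[OF is_rel_comp[OF gf(1) r(1)] gg(1)])
    fix A t y assume t: "t \<in> hom C A M" and y: "y \<in> hom C A Y"
    have h: "f \<cdot> t \<in> hom C A X" "g \<cdot> t \<in> hom C A Y" using f g t by simp_all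
    show "in_rel C t y (rel_comp C M X Y R (graph f E)) \<longleftrightarrow> in_rel C t y (graph g F)"
      unfolding in_comp_graph[OF b f t y] gg(2)[OF t y]
      by (rule adj_val_iff(1)[OF a h y in_rel_comp[OF r(1) f g t v(1)] in_rel_comp[OF r(2) g f t v(2)]])
  qed
  then show ?thesis unfolding hat_def exreg_simps snd_conv fst_conv by simp
qed

lemma quot_hat:
  assumes E: "cong X E" and z: "z \<in> hom C T X"
  shows "quot X E \<cdot>\<^bsub>exreg C\<^esub> hat (T, L) (X, ident_rel C X) z = hat (T, L) (X, E) z"
proof -
  have iX: "Ident C X \<in> hom C X X" using cong_obj[OF E] by simp
  note rE = cong_rel[OF E]
  have "in_rel C z z (graph (Ident C X) E)" "in_rel C z z (cograph (Ident C X) E)"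
    using graph(2)[OF rE iX z z] cograph(2)[OF rE iX z z] z cong_refl[OF E z] by simp_all
  from comp_hat_eq[OF adj_graph_ident[OF E iX] z z this] show ?thesis
    unfolding hat_def[of "(X, ident_rel C X)" "(X, E)"] by simp
qed

text \<open>The apex is the generic pair of \<open>E\<close>. The mediating morphism of
  \<open>f\<close> and \<open>g\<close> has values \<open>t\<close> whose coordinates
  \<open>e0 \<cdot> t\<close> and \<open>e1 \<cdot> t\<close> are values of \<open>f\<close> and
  \<open>g\<close>; the inequality between the composites with the quotient enters in its
  totality.\<close>

lemma quot_comma:
  assumes E: "cong X E" and e: "e0 \<in> hom C T X" "e1 \<in> hom C T X" "jointly_order_mono C e0 e1" "in_rel C e0 e1 E"
    and univ: "\<And>A x y. \<lbrakk>x \<in> hom C A X; y \<in> hom C A X; in_rel C x y E\<rbrakk> \<Longrightarrow> \<exists>u\<in>hom C A T. e0 \<cdot> u = x \<and> e1 \<cdot> u = y"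
  shows "is_comma (exreg C) (quot X E) (quot X E)
    (hat (T, ident_rel C T) (X, ident_rel C X) e0) (hat (T, ident_rel C T) (X, ident_rel C X) e1)"
proof -
  let ?I = "ident_rel C X" and ?J = "ident_rel C T"
  have X: "X \<in> Obj C" and T: "T \<in> Obj C" using e by auto
  note I = cong_ident_rel[OF X] and J = cong_ident_rel[OF T]
  note rI = cong_rel[OF I] and rE = cong_rel[OF E]
  have iX: "Ident C X \<in> hom C X X" using X by simp
  have et: "e0 \<cdot> t \<in> hom C A X" "e1 \<cdot> t \<in> hom C A X" if "t \<in> hom C A T" for t A using e that by simp_all
  \<comment> \<open>The trivial congruence on \<open>T\<close> is the intersection of the two
    inverse images of that on \<open>X\<close>. This is the place of the joint order-monicity of the
    span in \<open>C\<close>.\<close>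
  have mono: "in_rel C t t' ?J \<longleftrightarrow> in_rel C (e0 \<cdot> t) (e0 \<cdot> t') ?I \<and> in_rel C (e1 \<cdot> t) (e1 \<cdot> t') ?I"
    if t: "t \<in> hom C A T" "t' \<in> hom C A T" for t t' A
  proof -
    have d: "Dom C e0 = T" using e by simp
    have "t \<sqsubseteq> t' \<longleftrightarrow> e0 \<cdot> t \<sqsubseteq> e0 \<cdot> t' \<and> e1 \<cdot> t \<sqsubseteq> e1 \<cdot> t'"
    proof
      assume "t \<sqsubseteq> t'"
      then show "e0 \<cdot> t \<sqsubseteq> e0 \<cdot> t' \<and> e1 \<cdot> t \<sqsubseteq> e1 \<cdot> t'"
        by (intro conjI comp_mono_right) (use t e in simp_all)
    next
      assume "e0 \<cdot> t \<sqsubseteq> e0 \<cdot> t' \<and> e1 \<cdot> t \<sqsubseteq> e1 \<cdot> t'"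
      then show "t \<sqsubseteq> t'" using jointly_order_monoD[OF e(3), of t t' A] t unfolding d by blast
    qed
    then show ?thesis
      unfolding ident_rel(2)[OF T t] ident_rel(2)[OF X et(1)[OF t(1)] et(1)[OF t(2)]] ident_rel(2)[OF X et(2)[OF t(1)] et(2)[OF t(2)]] .
  qed
  note h0 = hat_ident_hom[OF I e(1)] and h1 = hat_ident_hom[OF I e(2)]
  have le_jm: "rel_incl C Rg Rf"
    if f: "adj Z L T ?J Rf Sf" and g: "adj Z L T ?J Rg Sg"
      and le0: "rel_incl C (rel_comp C Z T X (graph e0 ?I) Rg) (rel_comp C Z T X (graph e0 ?I) Rf)"
      and le1: "rel_incl C (rel_comp C Z T X (graph e1 ?I) Rg) (rel_comp C Z T X (graph e1 ?I) Rf)"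
    for Z L Rf Sf Rg Sg
  proof (rule adj_leI[OF f g])
    note rf = adj_rel[OF f] and rg = adj_rel[OF g]
    \<comment> \<open>One coordinate at a time: the hypothesis moves \<open>ei \<cdot> t'\<close>
      from an upper bound for \<open>g\<close> to one for \<open>f\<close>, with a local witness
      \<open>w\<close>. The counit gives \<open>t \<sqsubseteq> w\<close> there, hence the
      comparison after \<open>ei\<close>.\<close>
    have one: "in_rel C (ei \<cdot> t) (ei \<cdot> t') ?I"
      if ei: "ei \<in> hom C T X" and le: "rel_incl C (rel_comp C Z T X (graph ei ?I) Rg) (rel_comp C Z T X (graph ei ?I) Rf)"
        and z: "z \<in> hom C A Z" and t: "t \<in> hom C A T" "in_rel C z t Rf" "in_rel C t z Sf"
        and t': "t' \<in> hom C A T" "in_rel C z t' Rg" for ei z A t t'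
    proof -
      note gi = graph[OF rI ei]
      have eit: "ei \<cdot> t \<in> hom C A X" "ei \<cdot> t' \<in> hom C A X" using ei t t' by simp_all
      have "in_rel C t' (ei \<cdot> t') (graph ei ?I)" unfolding gi(2)[OF t'(1) eit(2)] by (rule cong_refl[OF I eit(2)])
      then have "in_rel C z (ei \<cdot> t') (rel_comp C Z T X (graph ei ?I) Rg)"
        by (rule in_rel_compI'[OF rg(1) gi(1) z eit(2) t'])
      then have "in_rel C z (ei \<cdot> t') (rel_comp C Z T X (graph ei ?I) Rf)"
        by (rule rel_inclD[OF le is_rel_comp[OF rg(1) gi(1)] is_rel_comp[OF rf(1) gi(1)] z eit(2)])
      then obtain B d w where d: "so_mor C d" "d \<in> hom C B A" "w \<in> hom C B T" "in_rel C (z \<cdot> d) w Rf"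
        "in_rel C w ((ei \<cdot> t') \<cdot> d) (graph ei ?I)" by (rule in_rel_compE[OF _ rf(1) gi(1) z eit(2)])
      have hd: "z \<cdot> d \<in> hom C B Z" "t \<cdot> d \<in> hom C B T" "(ei \<cdot> t') \<cdot> d \<in> hom C B X" "(ei \<cdot> t) \<cdot> d = ei \<cdot> (t \<cdot> d)"
        "ei \<cdot> w \<in> hom C B X" "ei \<cdot> (t \<cdot> d) \<in> hom C B X"
        using z t t' d ei by simp_all
      have "in_rel C (t \<cdot> d) w ?J" by (rule adj_counit[OF f hd(1,2) d(3) in_rel_comp[OF rf(2) t(1) z d(2) t(3)] d(4)])
      then have "t \<cdot> d \<sqsubseteq> w" unfolding ident_rel(2)[OF T hd(2) d(3)] .
      then have "ei \<cdot> (t \<cdot> d) \<sqsubseteq> ei \<cdot> w" by (rule comp_mono_right) (use hd(2) d(3) ei in simp_all)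
      then have "in_rel C (ei \<cdot> (t \<cdot> d)) (ei \<cdot> w) ?I" unfolding ident_rel(2)[OF X hd(6,5)] .
      moreover have "in_rel C (ei \<cdot> w) ((ei \<cdot> t') \<cdot> d) ?I" using d(5) unfolding gi(2)[OF d(3) hd(3)] .
      ultimately have "in_rel C ((ei \<cdot> t) \<cdot> d) ((ei \<cdot> t') \<cdot> d) ?I"
        unfolding hd(4) by (rule cong_trans[OF I hd(6,5,3)])
      then show ?thesis by (rule in_rel_local[OF rI eit d(1,2)])
    qed
    fix A z assume z: "z \<in> hom C A Z"
    obtain B d t where d: "so_mor C d" "d \<in> hom C B A" "t \<in> hom C B T" "in_rel C (z \<cdot> d) t Rf" "in_rel C t (z \<cdot> d) Sf"
      by (rule adj_total[OF f z])
    have zd: "z \<cdot> d \<in> hom C B Z" using z d by simp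
    obtain B' d' t' where d': "so_mor C d'" "d' \<in> hom C B' B" "t' \<in> hom C B' T" "in_rel C ((z \<cdot> d) \<cdot> d') t' Rg" "in_rel C t' ((z \<cdot> d) \<cdot> d') Sg"
      by (rule adj_total[OF g zd])
    have hd: "(z \<cdot> d) \<cdot> d' \<in> hom C B' Z" "t \<cdot> d' \<in> hom C B' T" "(z \<cdot> d) \<cdot> d' = z \<cdot> (d \<cdot> d')"
      using z d d' by simp_all
    note i = in_rel_comp[OF rf(1) zd d(3) d'(2) d(4)] in_rel_comp[OF rf(2) d(3) zd d'(2) d(5)]
    have "in_rel C (t \<cdot> d') t' ?J"
      unfolding mono[OF hd(2) d'(3)]
      using one[OF e(1) le0 hd(1,2) i d'(3,4)] one[OF e(2) le1 hd(1,2) i d'(3,4)] by blast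
    then show "\<exists>B e y y'. so_mor C e \<and> e \<in> hom C B A \<and> y \<in> hom C B T \<and> y' \<in> hom C B T \<and>
       in_rel C (z \<cdot> e) y Rf \<and> in_rel C y' (z \<cdot> e) Sg \<and> in_rel C y y' ?J"
      using so_cover_comp[OF d(1,2) d'(1,2)] hd(2) d'(3) i(1) d'(5) unfolding hd(3) by blast
  qed
  have jm: "jointly_order_mono (exreg C) (hat (T, ?J) (X, ?I) e0) (hat (T, ?J) (X, ?I) e1)"
    unfolding jointly_order_mono_def
  proof (intro allI ballI impI, elim conjE)
    fix c f g assume "f \<in> hom (exreg C) c (Dom (exreg C) (hat (T, ?J) (X, ?I) e0))"
      "g \<in> hom (exreg C) c (Dom (exreg C) (hat (T, ?J) (X, ?I) e0))"
    then have fg: "f \<in> hom (exreg C) c (T, ?J)" "g \<in> hom (exreg C) c (T, ?J)" unfolding hat_def exreg_simps .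
    obtain Z L where c: "c = (Z, L)" by (cases c)
    obtain Rf Sf Rg Sg where f: "f = ((Z, L), Rf, (T, ?J))" "adj Z L T ?J Rf Sf"
      and g: "g = ((Z, L), Rg, (T, ?J))" "adj Z L T ?J Rg Sg" using fg unfolding c exreg_hom_iff by blast
    assume "hat (T, ?J) (X, ?I) e0 \<cdot>\<^bsub>exreg C\<^esub> f \<sqsubseteq>\<^bsub>exreg C\<^esub> hat (T, ?J) (X, ?I) e0 \<cdot>\<^bsub>exreg C\<^esub> g"
      "hat (T, ?J) (X, ?I) e1 \<cdot>\<^bsub>exreg C\<^esub> f \<sqsubseteq>\<^bsub>exreg C\<^esub> hat (T, ?J) (X, ?I) e1 \<cdot>\<^bsub>exreg C\<^esub> g"
    then show "f \<sqsubseteq>\<^bsub>exreg C\<^esub> g"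
      unfolding f(1) g(1) hat_def exreg_simps fst_conv snd_conv by (rule le_jm[OF f(2) g(2)])
  qed
  have sq: "quot X E \<cdot>\<^bsub>exreg C\<^esub> hat (T, ?J) (X, ?I) e0 \<sqsubseteq>\<^bsub>exreg C\<^esub> quot X E \<cdot>\<^bsub>exreg C\<^esub> hat (T, ?J) (X, ?I) e1"
    by (rule quot_hat_le[OF E e(1,2,4)])
  have "\<exists>u\<in>hom (exreg C) c (T, ?J). hat (T, ?J) (X, ?I) e0 \<cdot>\<^bsub>exreg C\<^esub> u = f \<and> hat (T, ?J) (X, ?I) e1 \<cdot>\<^bsub>exreg C\<^esub> u = g"
    if f: "f \<in> hom (exreg C) c (X, ?I)" and g: "g \<in> hom (exreg C) c (X, ?I)"
      and le: "quot X E \<cdot>\<^bsub>exreg C\<^esub> f \<sqsubseteq>\<^bsub>exreg C\<^esub> quot X E \<cdot>\<^bsub>exreg C\<^esub> g" for c f g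
  proof -
    obtain Z L where c: "c = (Z, L)" by (cases c)
    obtain Rf Sf Rg Sg where f: "f = ((Z, L), Rf, (X, ?I))" "adj Z L X ?I Rf Sf"
      and g: "g = ((Z, L), Rg, (X, ?I))" "adj Z L X ?I Rg Sg" using f g unfolding c exreg_hom_iff by blast
    note rf = adj_rel[OF f(2)] and rg = adj_rel[OF g(2)] and bf = adj_bimod[OF f(2)] and bg = adj_bimod[OF g(2)]
    have L: "cong Z L" by (rule adj_cong(1)[OF f(2)])
    have iZ: "Ident C Z \<in> hom C Z Z" using cong_obj[OF L] by simp
    note gq = graph[OF rE iX]
    have le': "rel_incl C (rel_comp C Z X X (graph (Ident C X) E) Rg) (rel_comp C Z X X (graph (Ident C X) E) Rf)"
      using le unfolding f(1) g(1) hat_def exreg_simps fst_conv snd_conv .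
    have pull: "\<exists>Q. is_rel Z T Q \<and> (\<forall>A. \<forall>z\<in>hom C A Z. \<forall>t\<in>hom C A T. in_rel C z t Q \<longleftrightarrow> in_rel C z (ei \<cdot> t) Ri)"
      if ei: "ei \<in> hom C T X" and Ri: "is_rel Z X Ri" for ei Ri
      by (rule rel_pull[OF Ri iZ ei]) (use comp_ident(2) in auto)
    have pull': "\<exists>Q. is_rel T Z Q \<and> (\<forall>A. \<forall>z\<in>hom C A Z. \<forall>t\<in>hom C A T. in_rel C t z Q \<longleftrightarrow> in_rel C (ei \<cdot> t) z Si)"
      if ei: "ei \<in> hom C T X" and Si: "is_rel X Z Si" for ei Si
      by (rule rel_pull[OF Si ei iZ]) (use comp_ident(2) in auto)
    obtain R0 where R0: "is_rel Z T R0" "\<And>A z t. \<lbrakk>z \<in> hom C A Z; t \<in> hom C A T\<rbrakk> \<Longrightarrow> in_rel C z t R0 \<longleftrightarrow> in_rel C z (e0 \<cdot> t) Rf"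
      using pull[OF e(1) rf(1)] by blast
    obtain R1 where R1: "is_rel Z T R1" "\<And>A z t. \<lbrakk>z \<in> hom C A Z; t \<in> hom C A T\<rbrakk> \<Longrightarrow> in_rel C z t R1 \<longleftrightarrow> in_rel C z (e1 \<cdot> t) Rg"
      using pull[OF e(2) rg(1)] by blast
    obtain S0 where S0: "is_rel T Z S0" "\<And>A z t. \<lbrakk>z \<in> hom C A Z; t \<in> hom C A T\<rbrakk> \<Longrightarrow> in_rel C t z S0 \<longleftrightarrow> in_rel C (e0 \<cdot> t) z Sf"
      using pull'[OF e(1) rf(2)] by blast
    obtain S1 where S1: "is_rel T Z S1" "\<And>A z t. \<lbrakk>z \<in> hom C A Z; t \<in> hom C A T\<rbrakk> \<Longrightarrow> in_rel C t z S1 \<longleftrightarrow> in_rel C (e1 \<cdot> t) z Sg"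
      using pull'[OF e(2) rg(2)] by blast
    obtain Ru where Ru: "is_rel Z T Ru" "\<And>A z t. \<lbrakk>z \<in> hom C A Z; t \<in> hom C A T\<rbrakk> \<Longrightarrow>
        in_rel C z t Ru \<longleftrightarrow> in_rel C z t R0 \<and> in_rel C z t R1" by (rule rel_inter[OF R0(1) R1(1)]) blast
    obtain Su where Su: "is_rel T Z Su" "\<And>A t z. \<lbrakk>t \<in> hom C A T; z \<in> hom C A Z\<rbrakk> \<Longrightarrow>
        in_rel C t z Su \<longleftrightarrow> in_rel C t z S0 \<and> in_rel C t z S1" by (rule rel_inter[OF S0(1) S1(1)]) blast
    have iRu: "in_rel C z t Ru \<longleftrightarrow> in_rel C z (e0 \<cdot> t) Rf \<and> in_rel C z (e1 \<cdot> t) Rg"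
      and iSu: "in_rel C t z Su \<longleftrightarrow> in_rel C (e0 \<cdot> t) z Sf \<and> in_rel C (e1 \<cdot> t) z Sg"
      if zt: "z \<in> hom C A Z" "t \<in> hom C A T" for z t A
      unfolding Ru(2)[OF zt] R0(2)[OF zt] R1(2)[OF zt] Su(2)[OF zt(2,1)] S0(2)[OF zt] S1(2)[OF zt] by (rule refl)+
    \<comment> \<open>With local values \<open>x\<close> for \<open>f\<close> and \<open>x'\<close>
      for \<open>g\<close>, the inequality of the composites says that \<open>x\<close> is below
      \<open>x'\<close> in \<open>E\<close>, so the pair factors through the span and the factor
      \<open>t\<close> is the value.\<close>
    have total: "\<exists>B d t. so_mor C d \<and> d \<in> hom C B A \<and> t \<in> hom C B T \<and> in_rel C (z \<cdot> d) t Ru \<and> in_rel C t (z \<cdot> d) Su"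
      if z: "z \<in> hom C A Z" for z A
    proof -
      obtain B d x where d: "so_mor C d" "d \<in> hom C B A" "x \<in> hom C B X" "in_rel C (z \<cdot> d) x Rf" "in_rel C x (z \<cdot> d) Sf"
        by (rule adj_total[OF f(2) z])
      have zd: "z \<cdot> d \<in> hom C B Z" using z d by simp
      obtain B' d' x' where d': "so_mor C d'" "d' \<in> hom C B' B" "x' \<in> hom C B' X"
        "in_rel C ((z \<cdot> d) \<cdot> d') x' Rg" "in_rel C x' ((z \<cdot> d) \<cdot> d') Sg"
        by (rule adj_total[OF g(2) zd])
      let ?z = "(z \<cdot> d) \<cdot> d'"
      have hd: "?z \<in> hom C B' Z" "x \<cdot> d' \<in> hom C B' X" "?z = z \<cdot> (d \<cdot> d')" using z d d' by simp_all
      note i = in_rel_comp[OF rf(1) zd d(3) d'(2) d(4)] in_rel_comp[OF rf(2) d(3) zd d'(2) d(5)]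
      have "in_rel C x' x' (graph (Ident C X) E)" using gq(2)[OF d'(3,3)] d'(3) cong_refl[OF E d'(3)] by simp
      then have "in_rel C ?z x' (rel_comp C Z X X (graph (Ident C X) E) Rg)"
        by (rule in_rel_compI'[OF rg(1) gq(1) hd(1) d'(3,3,4)])
      then have "in_rel C ?z x' (rel_comp C Z X X (graph (Ident C X) E) Rf)"
        by (rule rel_inclD[OF le' is_rel_comp[OF rg(1) gq(1)] is_rel_comp[OF rf(1) gq(1)] hd(1) d'(3)])
      then obtain D k x1 where k: "so_mor C k" "k \<in> hom C D B'" "x1 \<in> hom C D X" "in_rel C (?z \<cdot> k) x1 Rf"
        "in_rel C x1 (x' \<cdot> k) (graph (Ident C X) E)" by (rule in_rel_compE[OF _ rf(1) gq(1) hd(1) d'(3)])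
      have hk: "?z \<cdot> k \<in> hom C D Z" "(x \<cdot> d') \<cdot> k \<in> hom C D X" "x' \<cdot> k \<in> hom C D X"
        using hd(1,2) d'(3) k by (simp_all del: assoc)
      have "in_rel C ((x \<cdot> d') \<cdot> k) x1 ?I"
        by (rule adj_counit[OF f(2) hk(1,2) k(3) in_rel_comp[OF rf(2) hd(2,1) k(2) i(2)] k(4)])
      then have "in_rel C ((x \<cdot> d') \<cdot> k) x1 E" unfolding ident_rel(2)[OF X hk(2) k(3)] by (rule cong_le[OF E hk(2) k(3)])
      moreover have "in_rel C x1 (x' \<cdot> k) E" using k(3,5) gq(2)[OF k(3) hk(3)] by simp
      ultimately have "in_rel C ((x \<cdot> d') \<cdot> k) (x' \<cdot> k) E" by (rule cong_trans[OF E hk(2) k(3) hk(3)])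
      then have "in_rel C (x \<cdot> d') x' E" by (rule in_rel_local[OF rE hd(2) d'(3) k(1,2)])
      then obtain t where t: "t \<in> hom C B' T" "e0 \<cdot> t = x \<cdot> d'" "e1 \<cdot> t = x'" using univ[OF hd(2) d'(3)] by blast
      have "in_rel C ?z t Ru" "in_rel C t ?z Su"
        unfolding iRu[OF hd(1) t(1)] iSu[OF hd(1) t(1)] t(2,3) using i d'(4,5) by blast+
      then show ?thesis using so_cover_comp[OF d(1,2) d'(1,2)] t(1) unfolding hd(3) by blast
    qed
    have au: "adj Z L T ?J Ru Su"
    proof (rule adjI)
      show "bimod Z L T ?J Ru"
      proof (rule bimodI[OF L J Ru(1)])
        fix A z z' t assume h: "z \<in> hom C A Z" "z' \<in> hom C A Z" "t \<in> hom C A T" "in_rel C z z' L" "in_rel C z' t Ru"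
        show "in_rel C z t Ru" unfolding iRu[OF h(1,3)]
          using bimod_left[OF bf(1) h(1,2) et(1)[OF h(3)] h(4)] bimod_left[OF bg(1) h(1,2) et(2)[OF h(3)] h(4)]
            h(5)[unfolded iRu[OF h(2,3)]] by blast
      next
        fix A z t t' assume h: "z \<in> hom C A Z" "t \<in> hom C A T" "t' \<in> hom C A T" "in_rel C z t Ru" "in_rel C t t' ?J"
        show "in_rel C z t' Ru" unfolding iRu[OF h(1,3)]
          using bimod_right[OF bf(1) h(1) et(1)[OF h(2)] et(1)[OF h(3)]] bimod_right[OF bg(1) h(1) et(2)[OF h(2)] et(2)[OF h(3)]]
            h(4)[unfolded iRu[OF h(1,2)]] h(5)[unfolded mono[OF h(2,3)]] by blast
      qed
      show "bimod T ?J Z L Su"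
      proof (rule bimodI[OF J L Su(1)])
        fix A t t' z assume h: "t \<in> hom C A T" "t' \<in> hom C A T" "z \<in> hom C A Z" "in_rel C t t' ?J" "in_rel C t' z Su"
        show "in_rel C t z Su" unfolding iSu[OF h(3,1)]
          using bimod_left[OF bf(2) et(1)[OF h(1)] et(1)[OF h(2)] h(3)] bimod_left[OF bg(2) et(2)[OF h(1)] et(2)[OF h(2)] h(3)]
            h(5)[unfolded iSu[OF h(3,2)]] h(4)[unfolded mono[OF h(1,2)]] by blast
      next
        fix A t z z' assume h: "t \<in> hom C A T" "z \<in> hom C A Z" "z' \<in> hom C A Z" "in_rel C t z Su" "in_rel C z z' L"
        show "in_rel C t z' Su" unfolding iSu[OF h(3,1)]
          using bimod_right[OF bf(2) et(1)[OF h(1)] h(2,3) _ h(5)] bimod_right[OF bg(2) et(2)[OF h(1)] h(2,3) _ h(5)]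
            h(4)[unfolded iSu[OF h(2,1)]] by blast
      qed
      fix A z assume z: "z \<in> hom C A Z"
      show "\<exists>B e y. so_mor C e \<and> e \<in> hom C B A \<and> y \<in> hom C B T \<and> in_rel C (z \<cdot> e) y Ru \<and> in_rel C y (z \<cdot> e) Su"
        by (rule total[OF z])
    next
      fix A z t t' assume h: "z \<in> hom C A Z" "t \<in> hom C A T" "t' \<in> hom C A T" "in_rel C t z Su" "in_rel C z t' Ru"
      show "in_rel C t t' ?J" unfolding mono[OF h(2,3)]
        using adj_counit[OF f(2) h(1) et(1)[OF h(2)] et(1)[OF h(3)]] adj_counit[OF g(2) h(1) et(2)[OF h(2)] et(2)[OF h(3)]]
          h(4)[unfolded iSu[OF h(1,2)]] h(5)[unfolded iRu[OF h(1,3)]] by blast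
    qed
    have comp: "rel_comp C Z T X (graph ei ?I) Ru = Ri"
      if ei: "ei \<in> hom C T X" and ai: "adj Z L X ?I Ri Si"
        and i: "\<And>A z t. \<lbrakk>z \<in> hom C A Z; t \<in> hom C A T; in_rel C z t Ru; in_rel C t z Su\<rbrakk> \<Longrightarrow>
           in_rel C z (ei \<cdot> t) Ri \<and> in_rel C (ei \<cdot> t) z Si" for ei Ri Si
    proof (rule adj_eqI[OF adj_comp[OF au adj_graph_ident[OF I ei]] ai])
      fix A z assume z: "z \<in> hom C A Z"
      note gi = graph[OF rI ei] and ci = cograph[OF rI ei]
      obtain B d t where d: "so_mor C d" "d \<in> hom C B A" "t \<in> hom C B T" "in_rel C (z \<cdot> d) t Ru" "in_rel C t (z \<cdot> d) Su"
        using total[OF z] by blast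
      have zd: "z \<cdot> d \<in> hom C B Z" and eit: "ei \<cdot> t \<in> hom C B X" using z d ei by simp_all
      have 1: "in_rel C t (ei \<cdot> t) (graph ei ?I)" "in_rel C (ei \<cdot> t) t (cograph ei ?I)"
        unfolding gi(2)[OF d(3) eit] ci(2)[OF d(3) eit] by (rule cong_refl[OF I eit])+
      have "in_rel C (z \<cdot> d) (ei \<cdot> t) (rel_comp C Z T X (graph ei ?I) Ru)"
        by (rule in_rel_compI'[OF Ru(1) gi(1) zd eit d(3,4) 1(1)])
      moreover have "in_rel C (ei \<cdot> t) (z \<cdot> d) (rel_comp C X T Z Su (cograph ei ?I))"
        by (rule in_rel_compI'[OF ci(1) Su(1) eit zd d(3) 1(2) d(5)])
      ultimately show "\<exists>B e y. so_mor C e \<and> e \<in> hom C B A \<and> y \<in> hom C B X \<and>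
        in_rel C (z \<cdot> e) y (rel_comp C Z T X (graph ei ?I) Ru) \<and> in_rel C y (z \<cdot> e) (rel_comp C X T Z Su (cograph ei ?I)) \<and>
        in_rel C (z \<cdot> e) y Ri \<and> in_rel C y (z \<cdot> e) Si"
        using d(1,2) eit i[OF zd d(3,4,5)] by blast
    qed
    have "rel_comp C Z T X (graph e0 ?I) Ru = Rf"
      by (rule comp[OF e(1) f(2)]) (use iRu iSu in blast)
    moreover have "rel_comp C Z T X (graph e1 ?I) Ru = Rg"
      by (rule comp[OF e(2) g(2)]) (use iRu iSu in blast)
    moreover have "((Z, L), Ru, (T, ?J)) \<in> hom (exreg C) c (T, ?J)" unfolding c exreg_hom_iff using au by blast
    ultimately show ?thesis
      unfolding f(1) g(1) hat_def by (intro bexI[of _ "((Z, L), Ru, (T, ?J))"]) (simp_all only: exreg_simps fst_conv snd_conv)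
  qed
  then show ?thesis
    unfolding is_comma_def using h0 h1 jm sq by (simp add: hat_def exreg_simps del: in_hom_iff)
qed

end


section \<open>The image of relations under a regular functor\<close>

lemma regular_categoryI: "regular_cat C \<Longrightarrow> regular_category C"
  by (simp add: regular_category_def regular_category_axioms_def regular_cat_def)

locale regular_functor_pair = src: regular_category C + tgt: regular_category D
  for C :: "('o, 'm) pcat" and D :: "('p, 'n) pcat" +
  fixes F :: "('o, 'm, 'p, 'n) pfun"
  assumes regular_functor: "regular_functor C D F"
begin

abbreviation tgt_comp (infixr "\<bullet>" 70) where
  "g \<bullet> f \<equiv> g \<cdot>\<^bsub>D\<^esub> f"

abbreviation tgt_le (infix "\<preceq>" 50) where
  "f \<preceq> g \<equiv> f \<sqsubseteq>\<^bsub>D\<^esub> g"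

lemma F_pos: "pos_functor C D F" and F_lim: "preserves_finite_limits C D F"
  and F_so: "so_mor C e \<Longrightarrow> so_mor D (FArr F e)"
  using regular_functor by (simp_all add: regular_functor_def)

lemmas F_simps [simp] = pos_functor_simps(1-6)[OF F_pos]
lemmas F_mono = pos_functor_simps(7)[OF F_pos]

lemma F_hom: "f \<in> hom C X Y \<Longrightarrow> FArr F f \<in> hom D (FObj F X) (FObj F Y)"
  by simp

lemma F_comp_eq: "\<lbrakk>g \<cdot>\<^bsub>C\<^esub> f = k; f \<in> hom C X Y; g \<in> hom C Y Z\<rbrakk> \<Longrightarrow> FArr F g \<bullet> FArr F f = FArr F k"
  using pos_functor_simps(6)[OF F_pos, of f g] by simp

text \<open>Being \<open>ff\<close> is the inequality \<open>c0 \<sqsubseteq> c1\<close> between the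
  legs of the comma object of \<open>m\<close> with itself; both this comma object and the
  inequality are preserved.\<close>

lemma F_ff:
  assumes m: "ff_mor C m"
  shows "ff_mor D (FArr F m)"
proof -
  have ma: "m \<in> Arr C" using m by (rule src.ff_mor_arr)
  obtain c0 c1 where c: "is_comma C m m c0 c1" "c0 \<in> hom C (Dom C c0) (Dom C m)"
    "c1 \<in> hom C (Dom C c0) (Dom C m)" "m \<cdot>\<^bsub>C\<^esub> c0 \<sqsubseteq>\<^bsub>C\<^esub> m \<cdot>\<^bsub>C\<^esub> c1" by (rule src.comma_ex[OF ma ma refl])
  have "c0 \<sqsubseteq>\<^bsub>C\<^esub> c1" by (rule src.ff_morD[OF m c(4,2,3)])
  then have le: "FArr F c0 \<preceq> FArr F c1" by (rule F_mono[rotated 4]) (use c in simp_all)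
  have cm: "is_comma D (FArr F m) (FArr F m) (FArr F c0) (FArr F c1)"
    by (rule preserves_comma[OF src.pos_category_axioms tgt.pos_category_axioms F_pos F_lim ma ma refl c(1)])
  show ?thesis
    unfolding ff_mor_def
  proof (intro conjI allI ballI impI)
    show "FArr F m \<in> Arr D" using ma by simp
    fix Z u v assume uv: "u \<in> hom D Z (Dom D (FArr F m))" "v \<in> hom D Z (Dom D (FArr F m))"
      and "FArr F m \<bullet> u \<preceq> FArr F m \<bullet> v"
    then obtain w where w: "w \<in> hom D Z (Dom D (FArr F c0))" "FArr F c0 \<bullet> w = u" "FArr F c1 \<bullet> w = v"
      using tgt.is_commaE[OF cm uv] by metis
    have "FArr F c0 \<bullet> w \<preceq> FArr F c1 \<bullet> w"
      by (rule tgt.comp_mono_left[OF le]) (use w(1) c in simp_all)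
    then show "u \<preceq> v" unfolding w(2,3) .
  qed
qed

lemma F_product:
  assumes "X \<in> Obj C" "Y \<in> Obj C"
  shows "is_product D (FObj F X) (FObj F Y) (FArr F (proj0 C X Y)) (FArr F (proj1 C X Y))"
  by (rule preserves_product[OF src.pos_category_axioms tgt.pos_category_axioms F_pos F_lim src.finite_limits assms
        src.is_product_proj[OF assms]])

text \<open>The images of the chosen projections of \<open>C\<close> need not be the chosen ones of
  \<open>D\<close>, but they form a product; the image of the pairing is \<open>ff\<close> and can
  be tested against it.\<close>

lemma F_jointly_order_mono:
  assumes r: "r0 \<in> hom C T X" "r1 \<in> hom C T Y" "jointly_order_mono C r0 r1"
  shows "jointly_order_mono D (FArr F r0) (FArr F r1)"
  unfolding jointly_order_mono_def
proof (intro allI ballI impI, elim conjE)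
  have o: "X \<in> Obj C" "Y \<in> Obj C" using r by auto
  let ?m = "pairing C r0 r1" and ?p = "proj0 C X Y" and ?q = "proj1 C X Y"
  note p = src.pairing[OF r(1,2)] and ff = F_ff[OF src.ff_mor_pairing[OF r]]
  have ph: "?p \<in> hom C (prod_obj C X Y) X" "?q \<in> hom C (prod_obj C X Y) Y" using o by simp_all
  note Fm = F_comp_eq[OF p(2,1) ph(1)] F_comp_eq[OF p(3,1) ph(2)]
  note pr = F_product[OF o]
  fix A u v assume uv: "u \<in> hom D A (Dom D (FArr F r0))" "v \<in> hom D A (Dom D (FArr F r0))"
    and le: "FArr F r0 \<bullet> u \<preceq> FArr F r0 \<bullet> v" "FArr F r1 \<bullet> u \<preceq> FArr F r1 \<bullet> v"
  have uv': "u \<in> hom D A (FObj F T)" "v \<in> hom D A (FObj F T)" using uv r by simp_all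
  have e: "FArr F ?p \<bullet> (FArr F ?m \<bullet> w) = FArr F r0 \<bullet> w" "FArr F ?q \<bullet> (FArr F ?m \<bullet> w) = FArr F r1 \<bullet> w"
    if "w \<in> hom D A (FObj F T)" for w
    using tgt.assoc_eq[OF Fm(1), of w] tgt.assoc_eq[OF Fm(2), of w] that p(1) o by simp_all
  have j: "jointly_order_mono D (FArr F ?p) (FArr F ?q)" using pr by (simp add: is_product_def)
  have "FArr F ?m \<bullet> u \<preceq> FArr F ?m \<bullet> v"
    by (rule tgt.jointly_order_monoD[OF j, of _ _ A]) (unfold e[OF uv'(1)] e[OF uv'(2)], use le uv' p(1) o in simp_all)
  then show "u \<preceq> v" by (rule tgt.ff_morD[OF ff, where Z = A]) (use uv' p(1) in simp_all)
qed

text \<open>\<open>R'\<close> is \<open>F R\<close>, presented by the image of a span that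
  represents \<open>R\<close>. The span is part of the specification so that elements of
  \<open>R'\<close> can be unwound; its genericity in \<open>C\<close> is what places the images of
  elements of \<open>R\<close> in \<open>R'\<close>.\<close>

definition Fim_spec :: "'o \<Rightarrow> 'o \<Rightarrow> 'm set \<Rightarrow> 'n set \<Rightarrow> 'o \<Rightarrow> 'm \<Rightarrow> 'm \<Rightarrow> bool" where
  "Fim_spec X Y R R' T r0 r1 \<longleftrightarrow> r0 \<in> hom C T X \<and> r1 \<in> hom C T Y \<and> in_rel C r0 r1 R \<and>
     (\<forall>A. \<forall>x\<in>hom C A X. \<forall>y\<in>hom C A Y. in_rel C x y R \<longrightarrow> (\<exists>u\<in>hom C A T. r0 \<cdot>\<^bsub>C\<^esub> u = x \<and> r1 \<cdot>\<^bsub>C\<^esub> u = y)) \<and>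
     tgt.is_rel (FObj F X) (FObj F Y) R' \<and>
     (\<forall>A. \<forall>x\<in>hom D A (FObj F X). \<forall>y\<in>hom D A (FObj F Y). in_rel D x y R' \<longleftrightarrow>
        (\<exists>u\<in>hom D A (FObj F T). FArr F r0 \<bullet> u = x \<and> FArr F r1 \<bullet> u = y))"

definition Fim :: "'o \<Rightarrow> 'o \<Rightarrow> 'm set \<Rightarrow> 'n set" where
  "Fim X Y R = (SOME R'. \<exists>T r0 r1. Fim_spec X Y R R' T r0 r1)"

lemma Fim_span:
  assumes R: "src.is_rel X Y R"
  obtains T r0 r1 where "r0 \<in> hom C T X" "r1 \<in> hom C T Y" "in_rel C r0 r1 R"
    "\<And>A x y. \<lbrakk>x \<in> hom C A X; y \<in> hom C A Y; in_rel C x y R\<rbrakk> \<Longrightarrow> \<exists>u\<in>hom C A T. r0 \<cdot>\<^bsub>C\<^esub> u = x \<and> r1 \<cdot>\<^bsub>C\<^esub> u = y"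
    "tgt.is_rel (FObj F X) (FObj F Y) (Fim X Y R)"
    "\<And>A x y. \<lbrakk>x \<in> hom D A (FObj F X); y \<in> hom D A (FObj F Y)\<rbrakk> \<Longrightarrow> in_rel D x y (Fim X Y R) \<longleftrightarrow>
        (\<exists>u\<in>hom D A (FObj F T). FArr F r0 \<bullet> u = x \<and> FArr F r1 \<bullet> u = y)"
proof -
  obtain T r0 r1 where r: "r0 \<in> hom C T X" "r1 \<in> hom C T Y" "jointly_order_mono C r0 r1" "in_rel C r0 r1 R"
    "\<And>A x y. \<lbrakk>x \<in> hom C A X; y \<in> hom C A Y; in_rel C x y R\<rbrakk> \<Longrightarrow> \<exists>u\<in>hom C A T. r0 \<cdot>\<^bsub>C\<^esub> u = x \<and> r1 \<cdot>\<^bsub>C\<^esub> u = y"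
    by (rule src.rel_generic_span[OF R]) blast
  obtain R' where R': "tgt.is_rel (FObj F X) (FObj F Y) R'"
    "\<And>A x y. \<lbrakk>x \<in> hom D A (FObj F X); y \<in> hom D A (FObj F Y)\<rbrakk> \<Longrightarrow> in_rel D x y R' \<longleftrightarrow>
        (\<exists>u\<in>hom D A (FObj F T). FArr F r0 \<bullet> u = x \<and> FArr F r1 \<bullet> u = y)"
    by (rule tgt.span_rel[OF F_hom[OF r(1)] F_hom[OF r(2)] F_jointly_order_mono[OF r(1-3)]]) blast
  have "Fim_spec X Y R R' T r0 r1" unfolding Fim_spec_def using r R' by blast
  then have "\<exists>R' T r0 r1. Fim_spec X Y R R' T r0 r1" by blast
  from someI_ex[OF this] obtain T r0 r1 where "Fim_spec X Y R (Fim X Y R) T r0 r1" unfolding Fim_def by blast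
  then show thesis unfolding Fim_spec_def using that by blast
qed

lemma Fim_rel: "src.is_rel X Y R \<Longrightarrow> tgt.is_rel (FObj F X) (FObj F Y) (Fim X Y R)"
  by (rule Fim_span)

lemma Fim_arr:
  assumes R: "src.is_rel X Y R" and xy: "x \<in> hom C A X" "y \<in> hom C A Y" "in_rel C x y R"
  shows "in_rel D (FArr F x) (FArr F y) (Fim X Y R)"
proof -
  obtain T r0 r1 where r: "r0 \<in> hom C T X" "r1 \<in> hom C T Y"
    "\<And>A x y. \<lbrakk>x \<in> hom C A X; y \<in> hom C A Y; in_rel C x y R\<rbrakk> \<Longrightarrow> \<exists>u\<in>hom C A T. r0 \<cdot>\<^bsub>C\<^esub> u = x \<and> r1 \<cdot>\<^bsub>C\<^esub> u = y"
    and i: "\<And>A x y. \<lbrakk>x \<in> hom D A (FObj F X); y \<in> hom D A (FObj F Y)\<rbrakk> \<Longrightarrow> in_rel D x y (Fim X Y R) \<longleftrightarrow>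
        (\<exists>u\<in>hom D A (FObj F T). FArr F r0 \<bullet> u = x \<and> FArr F r1 \<bullet> u = y)" by (rule Fim_span[OF R]) blast
  obtain u where u: "u \<in> hom C A T" "r0 \<cdot>\<^bsub>C\<^esub> u = x" "r1 \<cdot>\<^bsub>C\<^esub> u = y" using r(3)[OF xy] by blast
  show ?thesis unfolding i[OF F_hom[OF xy(1)] F_hom[OF xy(2)]]
    using F_hom[OF u(1)] F_comp_eq[OF u(2,1) r(1)] F_comp_eq[OF u(3,1) r(2)] by blast
qed

lemma Fim_arr_comp:
  assumes "src.is_rel X Y R" "x \<in> hom C A X" "y \<in> hom C A Y" "in_rel C x y R" "u \<in> hom D B (FObj F A)"
  shows "in_rel D (FArr F x \<bullet> u) (FArr F y \<bullet> u) (Fim X Y R)"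
  by (rule tgt.in_rel_comp[OF Fim_rel[OF assms(1)] F_hom[OF assms(2)] F_hom[OF assms(3)] assms(5) Fim_arr[OF assms(1-4)]])

text \<open>The premises have a generic instance in \<open>C\<close>, on the pullback of the two
  spans, where the conclusion holds by \<open>cl\<close>. The pullback is preserved, so every
  instance in \<open>D\<close> factors through the image of the generic one. Transitivity, the
  bimodule laws and the counit all transfer in this form.\<close>

lemma Fim_comp_closed:
  assumes R: "src.is_rel X Y R" and S: "src.is_rel Y Z S" and T: "src.is_rel X Z T"
    and cl: "\<And>A x y z. \<lbrakk>x \<in> hom C A X; y \<in> hom C A Y; z \<in> hom C A Z; in_rel C x y R; in_rel C y z S\<rbrakk> \<Longrightarrow> in_rel C x z T"
    and xyz: "x \<in> hom D A (FObj F X)" "y \<in> hom D A (FObj F Y)" "z \<in> hom D A (FObj F Z)"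
    and xy: "in_rel D x y (Fim X Y R)" and yz: "in_rel D y z (Fim Y Z S)"
  shows "in_rel D x z (Fim X Z T)"
proof -
  obtain U r0 r1 where r: "r0 \<in> hom C U X" "r1 \<in> hom C U Y" "in_rel C r0 r1 R"
    and ir: "\<And>A x y. \<lbrakk>x \<in> hom D A (FObj F X); y \<in> hom D A (FObj F Y)\<rbrakk> \<Longrightarrow> in_rel D x y (Fim X Y R) \<longleftrightarrow>
        (\<exists>u\<in>hom D A (FObj F U). FArr F r0 \<bullet> u = x \<and> FArr F r1 \<bullet> u = y)" by (rule Fim_span[OF R]) blast
  obtain V s0 s1 where s: "s0 \<in> hom C V Y" "s1 \<in> hom C V Z" "in_rel C s0 s1 S"
    and iv: "\<And>A x y. \<lbrakk>x \<in> hom D A (FObj F Y); y \<in> hom D A (FObj F Z)\<rbrakk> \<Longrightarrow> in_rel D x y (Fim Y Z S) \<longleftrightarrow>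
        (\<exists>u\<in>hom D A (FObj F V). FArr F s0 \<bullet> u = x \<and> FArr F s1 \<bullet> u = y)" by (rule Fim_span[OF S]) blast
  have rs: "r1 \<in> Arr C" "s0 \<in> Arr C" "Cod C r1 = Cod C s0" using r s by simp_all
  obtain p q where "is_pullback C r1 s0 p q" "p \<in> hom C (Dom C p) (Dom C r1)" "q \<in> hom C (Dom C p) (Dom C s0)"
    "r1 \<cdot>\<^bsub>C\<^esub> p = s0 \<cdot>\<^bsub>C\<^esub> q" by (rule src.pullback_ex[OF rs])
  moreover have "Dom C r1 = U" "Dom C s0 = V" using r s by simp_all
  ultimately have pq: "is_pullback C r1 s0 p q" "p \<in> hom C (Dom C p) U" "q \<in> hom C (Dom C p) V"
    "r1 \<cdot>\<^bsub>C\<^esub> p = s0 \<cdot>\<^bsub>C\<^esub> q" by simp_all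
  let ?P = "Dom C p"
  have pb: "is_pullback D (FArr F r1) (FArr F s0) (FArr F p) (FArr F q)"
    by (rule preserves_pullback[OF src.pos_category_axioms tgt.pos_category_axioms F_pos F_lim rs pq(1)])
  have h: "r0 \<cdot>\<^bsub>C\<^esub> p \<in> hom C ?P X" "r1 \<cdot>\<^bsub>C\<^esub> p \<in> hom C ?P Y" "s1 \<cdot>\<^bsub>C\<^esub> q \<in> hom C ?P Z" using r s pq(2,3) by simp_all
  have t: "in_rel C (r0 \<cdot>\<^bsub>C\<^esub> p) (s1 \<cdot>\<^bsub>C\<^esub> q) T"
    by (rule cl[OF h src.in_rel_comp[OF R r(1,2) pq(2) r(3)]]) (unfold pq(4), rule src.in_rel_comp[OF S s(1,2) pq(3) s(3)])
  obtain u where u: "u \<in> hom D A (FObj F U)" "FArr F r0 \<bullet> u = x" "FArr F r1 \<bullet> u = y"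
    using xy unfolding ir[OF xyz(1,2)] by blast
  obtain v where v: "v \<in> hom D A (FObj F V)" "FArr F s0 \<bullet> v = y" "FArr F s1 \<bullet> v = z"
    using yz unfolding iv[OF xyz(2,3)] by blast
  have "u \<in> hom D A (Dom D (FArr F r1))" "v \<in> hom D A (Dom D (FArr F s0))" "FArr F r1 \<bullet> u = FArr F s0 \<bullet> v"
    using u v r s by simp_all
  then obtain w where "w \<in> hom D A (Dom D (FArr F p))" and w2: "FArr F p \<bullet> w = u" "FArr F q \<bullet> w = v"
    by (rule tgt.is_pullbackE[OF pb])
  then have w: "w \<in> hom D A (FObj F ?P)" using pq(2) by simp
  have "FArr F (r0 \<cdot>\<^bsub>C\<^esub> p) \<bullet> w = x" "FArr F (s1 \<cdot>\<^bsub>C\<^esub> q) \<bullet> w = z"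
    using u(2) v(3) w r s pq(2,3) unfolding w2[symmetric] by simp_all
  then show ?thesis using Fim_arr_comp[OF T h(1,3) t w] by simp
qed

text \<open>The generic comparable pair consists of the legs of the comma object of the identity,
  which \<open>F\<close> preserves.\<close>

lemma Fim_le:
  assumes E: "src.cong X E" and x: "x \<in> hom D A (FObj F X)" "x' \<in> hom D A (FObj F X)" "x \<preceq> x'"
  shows "in_rel D x x' (Fim X X E)"
proof -
  have X: "X \<in> Obj C" using E by (rule src.cong_obj)
  let ?i = "Ident C X"
  have i: "?i \<in> Arr C" "Dom C ?i = X" "Cod C ?i = X" using X by simp_all
  obtain c0 c1 where "is_comma C ?i ?i c0 c1" "c0 \<in> hom C (Dom C c0) (Dom C ?i)"
    "c1 \<in> hom C (Dom C c0) (Dom C ?i)" "?i \<cdot>\<^bsub>C\<^esub> c0 \<sqsubseteq>\<^bsub>C\<^esub> ?i \<cdot>\<^bsub>C\<^esub> c1" by (rule src.comma_ex[OF i(1) i(1) refl])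
  then have c: "is_comma C ?i ?i c0 c1" "c0 \<in> hom C (Dom C c0) X" "c1 \<in> hom C (Dom C c0) X" "c0 \<sqsubseteq>\<^bsub>C\<^esub> c1"
    using i by simp_all
  have cm: "is_comma D (FArr F ?i) (FArr F ?i) (FArr F c0) (FArr F c1)"
    by (rule preserves_comma[OF src.pos_category_axioms tgt.pos_category_axioms F_pos F_lim i(1) i(1) refl c(1)])
  have "x \<in> hom D A (Dom D (FArr F ?i))" "x' \<in> hom D A (Dom D (FArr F ?i))" "FArr F ?i \<bullet> x \<preceq> FArr F ?i \<bullet> x'"
    using x X by simp_all
  then obtain w where "w \<in> hom D A (Dom D (FArr F c0))" and w: "FArr F c0 \<bullet> w = x" "FArr F c1 \<bullet> w = x'"
    by (rule tgt.is_commaE[OF cm])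
  then have "w \<in> hom D A (FObj F (Dom C c0))" using c(2) by simp
  from Fim_arr_comp[OF src.cong_rel[OF E] c(2,3) src.cong_le[OF E c(2-4)] this] show ?thesis unfolding w .
qed

lemma Fim_cong:
  assumes E: "src.cong X E"
  shows "tgt.cong (FObj F X) (Fim X X E)"
proof (rule tgt.congI[OF Fim_rel[OF src.cong_rel[OF E]] Fim_le[OF E]])
  note e = src.cong_rel[OF E]
  show "in_rel D x x'' (Fim X X E)"
    if h: "x \<in> hom D A (FObj F X)" "x' \<in> hom D A (FObj F X)" "x'' \<in> hom D A (FObj F X)"
      "in_rel D x x' (Fim X X E)" "in_rel D x' x'' (Fim X X E)" for A x x' x''
    by (rule Fim_comp_closed[OF e e e src.cong_trans[OF E] h])
qed

lemma Fim_ident_rel: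
  assumes X: "X \<in> Obj C" and x: "x \<in> hom D A (FObj F X)" "x' \<in> hom D A (FObj F X)"
  shows "in_rel D x x' (Fim X X (ident_rel C X)) \<longleftrightarrow> x \<preceq> x'"
proof
  note I = src.ident_rel[OF X]
  assume i: "in_rel D x x' (Fim X X (ident_rel C X))"
  obtain T r0 r1 where r: "r0 \<in> hom C T X" "r1 \<in> hom C T X" "in_rel C r0 r1 (ident_rel C X)"
    and ir: "\<And>A x y. \<lbrakk>x \<in> hom D A (FObj F X); y \<in> hom D A (FObj F X)\<rbrakk> \<Longrightarrow> in_rel D x y (Fim X X (ident_rel C X)) \<longleftrightarrow>
        (\<exists>u\<in>hom D A (FObj F T). FArr F r0 \<bullet> u = x \<and> FArr F r1 \<bullet> u = y)" by (rule Fim_span[OF I(1)]) blast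
  obtain u where u: "u \<in> hom D A (FObj F T)" "FArr F r0 \<bullet> u = x" "FArr F r1 \<bullet> u = x'"
    using i unfolding ir[OF x] by blast
  have "r0 \<sqsubseteq>\<^bsub>C\<^esub> r1" using r(3) unfolding I(2)[OF r(1,2)] .
  then have "FArr F r0 \<preceq> FArr F r1" by (rule F_mono[rotated 4]) (use r in simp_all)
  then have "FArr F r0 \<bullet> u \<preceq> FArr F r1 \<bullet> u" by (rule tgt.comp_mono_left) (use r u(1) in simp_all)
  then show "x \<preceq> x'" unfolding u .
qed (rule Fim_le[OF src.cong_ident_rel[OF X] x])

lemma Fim_incl:
  assumes R: "src.is_rel X Y R" and S: "src.is_rel X Y S" and le: "rel_incl C R S"
    and xy: "x \<in> hom D A (FObj F X)" "y \<in> hom D A (FObj F Y)" "in_rel D x y (Fim X Y R)"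
  shows "in_rel D x y (Fim X Y S)"
proof -
  obtain T r0 r1 where r: "r0 \<in> hom C T X" "r1 \<in> hom C T Y" "in_rel C r0 r1 R"
    and ir: "\<And>A x y. \<lbrakk>x \<in> hom D A (FObj F X); y \<in> hom D A (FObj F Y)\<rbrakk> \<Longrightarrow> in_rel D x y (Fim X Y R) \<longleftrightarrow>
        (\<exists>u\<in>hom D A (FObj F T). FArr F r0 \<bullet> u = x \<and> FArr F r1 \<bullet> u = y)" by (rule Fim_span[OF R]) blast
  obtain u where u: "u \<in> hom D A (FObj F T)" "FArr F r0 \<bullet> u = x" "FArr F r1 \<bullet> u = y"
    using xy(3) unfolding ir[OF xy(1,2)] by blast
  from Fim_arr_comp[OF S r(1,2) src.rel_inclD[OF le R S r] u(1)] show ?thesis unfolding u .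
qed

text \<open>All clauses but totality are instances of \<open>Fim_comp_closed\<close>. For totality,
  the generic element of \<open>X\<close> has a value on a cover \<open>d\<close> in
  \<open>C\<close>; since \<open>FArr F d\<close> is \<open>so\<close>, an element of
  \<open>FObj F X\<close> lifts along it locally, and the image of that value can be used.\<close>

lemma Fim_adj:
  assumes a: "src.adj X E Y G R S"
  shows "tgt.adj (FObj F X) (Fim X X E) (FObj F Y) (Fim Y Y G) (Fim X Y R) (Fim Y X S)"
proof (rule tgt.adjI)
  note r = src.adj_rel[OF a] and E = src.adj_cong(1)[OF a] and G = src.adj_cong(2)[OF a] and b = src.adj_bimod[OF a]
  note e = src.cong_rel[OF E] and g = src.cong_rel[OF G]
  show "tgt.bimod (FObj F X) (Fim X X E) (FObj F Y) (Fim Y Y G) (Fim X Y R)"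
    by (rule tgt.bimodI[OF Fim_cong[OF E] Fim_cong[OF G] Fim_rel[OF r(1)]
          Fim_comp_closed[OF e r(1) r(1) src.bimod_left[OF b(1)]] Fim_comp_closed[OF r(1) g r(1) src.bimod_right[OF b(1)]]])
  show "tgt.bimod (FObj F Y) (Fim Y Y G) (FObj F X) (Fim X X E) (Fim Y X S)"
    by (rule tgt.bimodI[OF Fim_cong[OF G] Fim_cong[OF E] Fim_rel[OF r(2)]
          Fim_comp_closed[OF g r(2) r(2) src.bimod_left[OF b(2)]] Fim_comp_closed[OF r(2) e r(2) src.bimod_right[OF b(2)]]])
  show "in_rel D y y' (Fim Y Y G)"
    if h: "x \<in> hom D A (FObj F X)" "y \<in> hom D A (FObj F Y)" "y' \<in> hom D A (FObj F Y)" "in_rel D y x (Fim Y X S)" "in_rel D x y' (Fim X Y R)"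
    for A x y y'
    by (rule Fim_comp_closed[OF r(2,1) g _ h(2,1,3,4,5)]) (rule src.adj_counit[OF a])
  fix A x assume x: "x \<in> hom D A (FObj F X)"
  have X: "X \<in> Obj C" using E by (rule src.cong_obj)
  then have i: "Ident C X \<in> hom C X X" by simp
  obtain B d y where "so_mor C d" "d \<in> hom C B X" "y \<in> hom C B Y" "in_rel C (Ident C X \<cdot>\<^bsub>C\<^esub> d) y R" "in_rel C y (Ident C X \<cdot>\<^bsub>C\<^esub> d) S"
    by (rule src.adj_total[OF a i])
  then have d: "so_mor C d" "d \<in> hom C B X" "y \<in> hom C B Y" "in_rel C d y R" "in_rel C y d S" by simp_all
  have "x \<in> hom D A (Cod D (FArr F d))" using x d(2) by simp
  then obtain A' e' w where w: "so_mor D e'" "e' \<in> hom D A' A" "w \<in> hom D A' (Dom D (FArr F d))" "FArr F d \<bullet> w = x \<bullet> e'"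
    by (rule tgt.so_pullback_lift[OF F_so[OF d(1)]])
  then have w': "w \<in> hom D A' (FObj F B)" using d(2) by simp
  have "FArr F y \<bullet> w \<in> hom D A' (FObj F Y)" using d(3) w' by simp
  then show "\<exists>B e y. so_mor D e \<and> e \<in> hom D B A \<and> y \<in> hom D B (FObj F Y) \<and> in_rel D (x \<bullet> e) y (Fim X Y R) \<and> in_rel D y (x \<bullet> e) (Fim Y X S)"
    using Fim_arr_comp[OF r(1) d(2,3,4) w'] Fim_arr_comp[OF r(2) d(3,2,5) w'] w(1,2) unfolding w(4) by blast
qed

text \<open>Weak limits in \<open>C\<close> of finite systems of relations, whose weak universal property is preserved by \<open>F\<close>.
  They replace the finite limits of the exact completion, which are never constructed.\<close>

lemma generic_tuple:
  assumes "finite I" "\<And>i. i \<in> I \<Longrightarrow> X i \<in> Obj C"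
  shows "\<exists>M \<pi>. M \<in> Obj C \<and> (\<forall>i\<in>I. \<pi> i \<in> hom C M (X i)) \<and>
    (\<forall>A a. A \<in> Obj D \<longrightarrow> (\<forall>i\<in>I. a i \<in> hom D A (FObj F (X i))) \<longrightarrow>
       (\<exists>u\<in>hom D A (FObj F M). \<forall>i\<in>I. FArr F (\<pi> i) \<bullet> u = a i))"
  using assms
proof (induction I rule: finite_induct)
  case empty
  obtain T where T: "is_terminal C T" by (rule src.terminal_exists[OF src.finite_limits])
  have "is_terminal D (FObj F T)"
    by (rule preserves_terminal[OF src.pos_category_axioms tgt.pos_category_axioms F_lim T])
  then have "\<exists>u\<in>hom D A (FObj F T). \<forall>i\<in>{}. FArr F (undefined i) \<bullet> u = a i" if "A \<in> Obj D" for A a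
    using that unfolding is_terminal_def by blast
  moreover have "T \<in> Obj C" using T by (simp add: is_terminal_def)
  ultimately show ?case by (intro exI[of _ T] exI[of _ undefined] conjI allI impI) simp_all
next
  case (insert k I)
  then obtain M \<pi> where M: "M \<in> Obj C" "\<And>i. i \<in> I \<Longrightarrow> \<pi> i \<in> hom C M (X i)"
    and u: "\<And>A a. A \<in> Obj D \<Longrightarrow> (\<forall>i\<in>I. a i \<in> hom D A (FObj F (X i))) \<Longrightarrow>
       \<exists>u\<in>hom D A (FObj F M). \<forall>i\<in>I. FArr F (\<pi> i) \<bullet> u = a i" by blast
  have Xk: "X k \<in> Obj C" using insert.prems by simp
  let ?P = "prod_obj C M (X k)" and ?p = "proj0 C M (X k)" and ?q = "proj1 C M (X k)"
  let ?\<pi> = "\<lambda>i. if i = k then ?q else \<pi> i \<cdot>\<^bsub>C\<^esub> ?p"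
  have pq: "?p \<in> hom C ?P M" "?q \<in> hom C ?P (X k)" using M(1) Xk by simp_all
  have "?P \<in> Obj C" using M(1) Xk by simp
  moreover have "\<forall>i\<in>insert k I. ?\<pi> i \<in> hom C ?P (X i)"
  proof
    fix i assume "i \<in> insert k I"
    then show "?\<pi> i \<in> hom C ?P (X i)" using pq M(2)[of i] by (cases "i = k") simp_all
  qed
  moreover have "\<exists>u\<in>hom D A (FObj F ?P). \<forall>i\<in>insert k I. FArr F (?\<pi> i) \<bullet> u = a i"
    if A: "A \<in> Obj D" and a: "\<forall>i\<in>insert k I. a i \<in> hom D A (FObj F (X i))" for A a
  proof -
    have aI: "\<forall>i\<in>I. a i \<in> hom D A (FObj F (X i))" and ak: "a k \<in> hom D A (FObj F (X k))" using a by blast+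
    obtain u where u: "u \<in> hom D A (FObj F M)" "\<forall>i\<in>I. FArr F (\<pi> i) \<bullet> u = a i" using u[OF A aI] by blast
    obtain w where "w \<in> hom D A (Dom D (FArr F ?p))" and w2: "FArr F ?p \<bullet> w = u" "FArr F ?q \<bullet> w = a k"
      by (rule tgt.is_productE[OF F_product[OF M(1) Xk] u(1) ak])
    then have w: "w \<in> hom D A (FObj F ?P)" using pq(1) by simp
    have "FArr F (?\<pi> i) \<bullet> w = a i" if i: "i \<in> insert k I" for i
    proof (cases "i = k")
      case False
      then have iI: "i \<in> I" using i by blast
      have "FArr F (\<pi> i \<cdot>\<^bsub>C\<^esub> ?p) \<bullet> w = FArr F (\<pi> i) \<bullet> (FArr F ?p \<bullet> w)"
        using M(2)[OF iI] pq w by simp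
      then show ?thesis using False u(2) iI w2(1) by simp
    qed (simp add: w2)
    then show ?thesis using w by blast
  qed
  ultimately show ?case by (intro exI[of _ ?P] exI[of _ ?\<pi>] conjI allI impI) blast+
qed

text \<open>Each further constraint is imposed by pulling the current tuple back against the span of
  its relation, a pullback that \<open>F\<close> preserves. The universal property is stated in
  \<open>D\<close>, where the elements to be factored live.\<close>

lemma generic_solution:
  assumes "finite \<Phi>" "finite I" "\<And>i. i \<in> I \<Longrightarrow> X i \<in> Obj C"
    "\<And>i k R. (i, k, R) \<in> \<Phi> \<Longrightarrow> i \<in> I \<and> k \<in> I \<and> src.is_rel (X i) (X k) R"
  shows "\<exists>M \<pi>. M \<in> Obj C \<and> (\<forall>i\<in>I. \<pi> i \<in> hom C M (X i)) \<and> (\<forall>(i, k, R)\<in>\<Phi>. in_rel C (\<pi> i) (\<pi> k) R) \<and>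
    (\<forall>A a. A \<in> Obj D \<longrightarrow> (\<forall>i\<in>I. a i \<in> hom D A (FObj F (X i))) \<longrightarrow>
       (\<forall>(i, k, R)\<in>\<Phi>. in_rel D (a i) (a k) (Fim (X i) (X k) R)) \<longrightarrow>
       (\<exists>u\<in>hom D A (FObj F M). \<forall>i\<in>I. FArr F (\<pi> i) \<bullet> u = a i))"
  using assms(1,4)
proof (induction \<Phi> rule: finite_induct)
  case empty
  then show ?case using generic_tuple[OF assms(2,3)] by simp
next
  case (insert c \<Phi>)
  obtain i0 k0 R where c: "c = (i0, k0, R)" by (cases c)
  have ik: "i0 \<in> I" "k0 \<in> I" and R: "src.is_rel (X i0) (X k0) R" using insert.prems[of i0 k0 R] c by blast+
  obtain M \<pi> where M: "M \<in> Obj C" "\<And>i. i \<in> I \<Longrightarrow> \<pi> i \<in> hom C M (X i)" "\<forall>(i, k, R)\<in>\<Phi>. in_rel C (\<pi> i) (\<pi> k) R"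
    and ex: "\<And>A a. A \<in> Obj D \<Longrightarrow> (\<forall>i\<in>I. a i \<in> hom D A (FObj F (X i))) \<Longrightarrow>
       (\<forall>(i, k, R)\<in>\<Phi>. in_rel D (a i) (a k) (Fim (X i) (X k) R)) \<Longrightarrow>
       \<exists>u\<in>hom D A (FObj F M). \<forall>i\<in>I. FArr F (\<pi> i) \<bullet> u = a i"
  proof -
    have "\<exists>M \<pi>. M \<in> Obj C \<and> (\<forall>i\<in>I. \<pi> i \<in> hom C M (X i)) \<and> (\<forall>(i, k, R)\<in>\<Phi>. in_rel C (\<pi> i) (\<pi> k) R) \<and>
      (\<forall>A a. A \<in> Obj D \<longrightarrow> (\<forall>i\<in>I. a i \<in> hom D A (FObj F (X i))) \<longrightarrow>
         (\<forall>(i, k, R)\<in>\<Phi>. in_rel D (a i) (a k) (Fim (X i) (X k) R)) \<longrightarrow>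
         (\<exists>u\<in>hom D A (FObj F M). \<forall>i\<in>I. FArr F (\<pi> i) \<bullet> u = a i))"
      by (rule insert.IH) (rule insert.prems, rule insertI2)
    then show thesis by (elim exE conjE) (rule that, blast+)
  qed
  obtain T r0 r1 where r: "r0 \<in> hom C T (X i0)" "r1 \<in> hom C T (X k0)" "in_rel C r0 r1 R"
    and ir: "\<And>A x y. \<lbrakk>x \<in> hom D A (FObj F (X i0)); y \<in> hom D A (FObj F (X k0))\<rbrakk> \<Longrightarrow> in_rel D x y (Fim (X i0) (X k0) R) \<longleftrightarrow>
        (\<exists>u\<in>hom D A (FObj F T). FArr F r0 \<bullet> u = x \<and> FArr F r1 \<bullet> u = y)" by (rule Fim_span[OF R]) blast
  have o: "X i0 \<in> Obj C" "X k0 \<in> Obj C" using assms(3) ik by blast+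
  let ?m = "pairing C (\<pi> i0) (\<pi> k0)" and ?r = "pairing C r0 r1"
  let ?p0 = "proj0 C (X i0) (X k0)" and ?p1 = "proj1 C (X i0) (X k0)" and ?XX = "prod_obj C (X i0) (X k0)"
  have ph: "?p0 \<in> hom C ?XX (X i0)" "?p1 \<in> hom C ?XX (X k0)" using o by simp_all
  note m = src.pairing[OF M(2)[OF ik(1)] M(2)[OF ik(2)]] and rr = src.pairing[OF r(1,2)]
  have mr: "?m \<in> Arr C" "?r \<in> Arr C" "Cod C ?m = Cod C ?r" using m(1) rr(1) by simp_all
  obtain p q where "is_pullback C ?m ?r p q" "p \<in> hom C (Dom C p) (Dom C ?m)" "q \<in> hom C (Dom C p) (Dom C ?r)"
    "?m \<cdot>\<^bsub>C\<^esub> p = ?r \<cdot>\<^bsub>C\<^esub> q" by (rule src.pullback_ex[OF mr])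
  then have pq: "is_pullback C ?m ?r p q" "p \<in> hom C (Dom C p) M" "q \<in> hom C (Dom C p) T" "?m \<cdot>\<^bsub>C\<^esub> p = ?r \<cdot>\<^bsub>C\<^esub> q"
    using m(1) rr(1) by simp_all
  let ?P = "Dom C p"
  have pb: "is_pullback D (FArr F ?m) (FArr F ?r) (FArr F p) (FArr F q)"
    by (rule preserves_pullback[OF src.pos_category_axioms tgt.pos_category_axioms F_pos F_lim mr pq(1)])
  have pp: "\<pi> i \<cdot>\<^bsub>C\<^esub> p \<in> hom C ?P (X i)" if "i \<in> I" for i using M(2)[OF that] pq(2) by simp
  have "\<pi> i0 \<cdot>\<^bsub>C\<^esub> p = r0 \<cdot>\<^bsub>C\<^esub> q" "\<pi> k0 \<cdot>\<^bsub>C\<^esub> p = r1 \<cdot>\<^bsub>C\<^esub> q"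
  proof -
    have "?p0 \<cdot>\<^bsub>C\<^esub> (?m \<cdot>\<^bsub>C\<^esub> p) = \<pi> i0 \<cdot>\<^bsub>C\<^esub> p" "?p1 \<cdot>\<^bsub>C\<^esub> (?m \<cdot>\<^bsub>C\<^esub> p) = \<pi> k0 \<cdot>\<^bsub>C\<^esub> p"
      using src.assoc_eq[OF m(2), of p] src.assoc_eq[OF m(3), of p] m(1) pq(2) o by simp_all
    moreover have "?p0 \<cdot>\<^bsub>C\<^esub> (?r \<cdot>\<^bsub>C\<^esub> q) = r0 \<cdot>\<^bsub>C\<^esub> q" "?p1 \<cdot>\<^bsub>C\<^esub> (?r \<cdot>\<^bsub>C\<^esub> q) = r1 \<cdot>\<^bsub>C\<^esub> q"
      using src.assoc_eq[OF rr(2), of q] src.assoc_eq[OF rr(3), of q] rr(1) pq(3) o by simp_all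
    ultimately show "\<pi> i0 \<cdot>\<^bsub>C\<^esub> p = r0 \<cdot>\<^bsub>C\<^esub> q" "\<pi> k0 \<cdot>\<^bsub>C\<^esub> p = r1 \<cdot>\<^bsub>C\<^esub> q" using pq(4) by simp_all
  qed
  then have new: "in_rel C (\<pi> i0 \<cdot>\<^bsub>C\<^esub> p) (\<pi> k0 \<cdot>\<^bsub>C\<^esub> p) R" using src.in_rel_comp[OF R r(1,2) pq(3) r(3)] by simp
  have old: "in_rel C (\<pi> i \<cdot>\<^bsub>C\<^esub> p) (\<pi> k \<cdot>\<^bsub>C\<^esub> p) S" if s: "(i, k, S) \<in> \<Phi>" for i k S
  proof -
    have h: "i \<in> I" "k \<in> I" "src.is_rel (X i) (X k) S" using insert.prems[OF insertI2[OF s]] by blast+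
    have "in_rel C (\<pi> i) (\<pi> k) S" using M(3) s by blast
    then show ?thesis by (rule src.in_rel_comp[OF h(3) M(2)[OF h(1)] M(2)[OF h(2)] pq(2)])
  qed
  have "\<exists>u\<in>hom D A (FObj F ?P). \<forall>i\<in>I. FArr F (\<pi> i \<cdot>\<^bsub>C\<^esub> p) \<bullet> u = a i"
    if A: "A \<in> Obj D" and a: "\<forall>i\<in>I. a i \<in> hom D A (FObj F (X i))"
      and aa: "\<forall>(i, k, R)\<in>insert c \<Phi>. in_rel D (a i) (a k) (Fim (X i) (X k) R)" for A a
  proof -
    obtain u where u: "u \<in> hom D A (FObj F M)" "\<And>i. i \<in> I \<Longrightarrow> FArr F (\<pi> i) \<bullet> u = a i"
      using ex[OF A a] aa by blast
    have "in_rel D (a i0) (a k0) (Fim (X i0) (X k0) R)" using aa c by blast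
    then obtain v where v: "v \<in> hom D A (FObj F T)" "FArr F r0 \<bullet> v = a i0" "FArr F r1 \<bullet> v = a k0"
      using ir[of "a i0" A "a k0"] a ik by blast
    have j: "jointly_order_mono D (FArr F ?p0) (FArr F ?p1)" using F_product[OF o] by (simp add: is_product_def)
    note Fm = F_comp_eq[OF m(2,1) ph(1)] F_comp_eq[OF m(3,1) ph(2)]
    note Fr = F_comp_eq[OF rr(2,1) ph(1)] F_comp_eq[OF rr(3,1) ph(2)]
    have "FArr F ?m \<bullet> u = FArr F ?r \<bullet> v"
    proof (rule tgt.jointly_order_mono_eq[OF j, of _ _ A])
      have 1: "FArr F ?p0 \<bullet> (FArr F ?m \<bullet> u) = a i0" "FArr F ?p1 \<bullet> (FArr F ?m \<bullet> u) = a k0"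
        using tgt.assoc_eq[OF Fm(1), of u] tgt.assoc_eq[OF Fm(2), of u] u(1) u(2)[OF ik(1)] u(2)[OF ik(2)] m(1) o by simp_all
      have 2: "FArr F ?p0 \<bullet> (FArr F ?r \<bullet> v) = a i0" "FArr F ?p1 \<bullet> (FArr F ?r \<bullet> v) = a k0"
        using tgt.assoc_eq[OF Fr(1), of v] tgt.assoc_eq[OF Fr(2), of v] v rr(1) o by simp_all
      show "FArr F ?p0 \<bullet> (FArr F ?m \<bullet> u) = FArr F ?p0 \<bullet> (FArr F ?r \<bullet> v)"
        "FArr F ?p1 \<bullet> (FArr F ?m \<bullet> u) = FArr F ?p1 \<bullet> (FArr F ?r \<bullet> v)"
        unfolding 1 2 by (rule refl)+
    qed (use u(1) v(1) m(1) rr(1) o in simp_all)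
    moreover have "u \<in> hom D A (Dom D (FArr F ?m))" "v \<in> hom D A (Dom D (FArr F ?r))"
      using u(1) v(1) m(1) rr(1) by simp_all
    ultimately obtain w where "w \<in> hom D A (Dom D (FArr F p))" and w2: "FArr F p \<bullet> w = u"
      using tgt.is_pullbackE[OF pb, of u A v] by metis
    then have w: "w \<in> hom D A (FObj F ?P)" using pq(2) by simp
    have "FArr F (\<pi> i \<cdot>\<^bsub>C\<^esub> p) \<bullet> w = a i" if i: "i \<in> I" for i
    proof -
      have "FArr F (\<pi> i \<cdot>\<^bsub>C\<^esub> p) \<bullet> w = FArr F (\<pi> i) \<bullet> (FArr F p \<bullet> w)"
        using M(2)[OF i] pq(2) w by simp
      then show ?thesis unfolding w2 u(2)[OF i] .
    qed
    then show ?thesis using w by blast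
  qed
  moreover have "?P \<in> Obj C" using pq(2) by auto
  moreover have "\<forall>(i, k, S)\<in>insert c \<Phi>. in_rel C (\<pi> i \<cdot>\<^bsub>C\<^esub> p) (\<pi> k \<cdot>\<^bsub>C\<^esub> p) S" using new old c by blast
  ultimately show ?case using pp by (intro exI[of _ ?P] exI[of _ "\<lambda>i. \<pi> i \<cdot>\<^bsub>C\<^esub> p"]) blast
qed

end


section \<open>The induced functor on the exact completion\<close>

locale exact_functor_pair = regular_functor_pair +
  assumes exact: "exact_cat D"
begin

text \<open>An \<open>so\<close>-morphism with order kernel \<open>F E\<close>; by
  \<open>so_descent\<close> these conditions determine it up to isomorphism.\<close>

definition is_quotient :: "'a \<times> 'b set \<Rightarrow> 'd \<Rightarrow> bool" where
  "is_quotient a q \<longleftrightarrow> so_mor D q \<and> Dom D q = FObj F (fst a) \<and>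
     (\<forall>A. \<forall>x\<in>hom D A (FObj F (fst a)). \<forall>x'\<in>hom D A (FObj F (fst a)).
        in_rel D x x' (Fim (fst a) (fst a) (snd a)) \<longleftrightarrow> q \<bullet> x \<preceq> q \<bullet> x')"

definition qm :: "'a \<times> 'b set \<Rightarrow> 'd" where
  "qm a = (SOME q. is_quotient a q)"

abbreviation bar_obj :: "'a \<times> 'b set \<Rightarrow> 'c" where
  "bar_obj a \<equiv> Cod D (qm a)"

text \<open>Exactness provides some morphism with kernel \<open>F E\<close>. Its
  \<open>so\<close>-part has the same kernel, because the \<open>ff\<close>-part preserves and
  reflects the order.\<close>

lemma qm_quotient:
  assumes E: "src.cong X E"
  shows "is_quotient (X, E) (qm (X, E))"
proof -
  have "tgt.cong (FObj F X) (Fim X X E)" by (rule Fim_cong[OF E])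
  then obtain f where f: "f \<in> Arr D" "Dom D f = FObj F X" "Fim X X E = comma_rel D f f"
    using exact unfolding exact_cat_def effective_def tgt.cong_def by blast
  obtain e m where em: "so_mor D e" "ff_mor D m" "Cod D e = Dom D m" "f = m \<bullet> e" "Dom D e = Dom D f"
    by (rule tgt.so_ff_factor[OF f(1)])
  have a: "e \<in> Arr D" "m \<in> Arr D" using em by (simp_all add: tgt.so_mor_arr tgt.ff_mor_arr)
  have fh: "f \<in> hom D (FObj F X) (Cod D f)" using f by simp
  have "in_rel D x x' (Fim X X E) \<longleftrightarrow> e \<bullet> x \<preceq> e \<bullet> x'"
    if x: "x \<in> hom D A (FObj F X)" "x' \<in> hom D A (FObj F X)" for A x x'
  proof -
    have ex: "e \<bullet> x \<in> hom D A (Dom D m)" "e \<bullet> x' \<in> hom D A (Dom D m)" using x a em f by simp_all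
    have "f \<bullet> x = m \<bullet> (e \<bullet> x)" "f \<bullet> x' = m \<bullet> (e \<bullet> x')"
      using x a em(3,5) f(2) unfolding em(4) by simp_all
    moreover have "m \<bullet> (e \<bullet> x) \<preceq> m \<bullet> (e \<bullet> x') \<longleftrightarrow> e \<bullet> x \<preceq> e \<bullet> x'"
    proof
      assume "e \<bullet> x \<preceq> e \<bullet> x'"
      then show "m \<bullet> (e \<bullet> x) \<preceq> m \<bullet> (e \<bullet> x')"
        by (rule tgt.comp_mono_right) (use ex a in simp_all)
    qed (rule tgt.ff_morD[OF em(2) _ ex])
    ultimately show ?thesis unfolding f(3) tgt.in_comma_rel[OF fh fh x] by simp
  qed
  then have "is_quotient (X, E) e" unfolding is_quotient_def using em f by simp
  then show ?thesis unfolding qm_def by (rule someI)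
qed

lemma qm:
  assumes E: "src.cong X E"
  shows "so_mor D (qm (X, E))" "qm (X, E) \<in> hom D (FObj F X) (bar_obj (X, E))"
    and qm_le: "\<lbrakk>x \<in> hom D A (FObj F X); x' \<in> hom D A (FObj F X)\<rbrakk> \<Longrightarrow>
      qm (X, E) \<bullet> x \<preceq> qm (X, E) \<bullet> x' \<longleftrightarrow> in_rel D x x' (Fim X X E)"
  using qm_quotient[OF E] unfolding is_quotient_def by (simp_all add: tgt.so_mor_arr)

lemma qm_comp_hom: "\<lbrakk>src.cong X E; x \<in> hom D A (FObj F X)\<rbrakk> \<Longrightarrow> qm (X, E) \<bullet> x \<in> hom D A (bar_obj (X, E))"
  using qm(2)[of X E] by simp

lemma qm_eq:
  assumes E: "src.cong X E" and x: "x \<in> hom D A (FObj F X)" "x' \<in> hom D A (FObj F X)"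
    and i: "in_rel D x x' (Fim X X E)" "in_rel D x' x (Fim X X E)"
  shows "qm (X, E) \<bullet> x = qm (X, E) \<bullet> x'"
proof (rule tgt.le_antisym)
  show "qm (X, E) \<bullet> x \<preceq> qm (X, E) \<bullet> x'" "qm (X, E) \<bullet> x' \<preceq> qm (X, E) \<bullet> x"
    using qm_le[OF E x] qm_le[OF E x(2,1)] i by blast+
qed (use qm_comp_hom[OF E x(1)] qm_comp_hom[OF E x(2)] in simp_all)

lemma qm_lift:
  assumes E: "src.cong X E" and u: "u \<in> hom D A (bar_obj (X, E))"
  obtains B e x where "so_mor D e" "e \<in> hom D B A" "x \<in> hom D B (FObj F X)" "qm (X, E) \<bullet> x = u \<bullet> e"
proof -
  have "Dom D (qm (X, E)) = FObj F X" using qm(2)[OF E] by simp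
  then show thesis using tgt.so_pullback_lift[OF qm(1)[OF E] u] that by metis
qed

text \<open>An arrow of \<open>exreg C\<close> does not carry its right adjoint, so the condition
  ranges over all of them; by \<open>adj_unique\<close> there is only one.\<close>

definition is_bar_arr :: "('a, 'b) qarr \<Rightarrow> 'd \<Rightarrow> bool" where
  "is_bar_arr f h \<longleftrightarrow> (case f of (a, R, b) \<Rightarrow> h \<in> hom D (bar_obj a) (bar_obj b) \<and>
     (\<forall>S. src.adj (fst a) (snd a) (fst b) (snd b) R S \<longrightarrow>
       (\<forall>A. \<forall>x\<in>hom D A (FObj F (fst a)). \<forall>y\<in>hom D A (FObj F (fst b)).
         in_rel D x y (Fim (fst a) (fst b) R) \<longrightarrow> in_rel D y x (Fim (fst b) (fst a) S) \<longrightarrow>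
         h \<bullet> (qm a \<bullet> x) = qm b \<bullet> y)))"

definition bar_arr :: "('a, 'b) qarr \<Rightarrow> 'd" where
  "bar_arr f = (SOME h. is_bar_arr f h)"

text \<open>The span of values in \<open>C\<close> gives a cover of the source quotient by
  \<open>FObj F T\<close> and a map from there to the target quotient; the induced arrow is obtained
  by descent along this cover.\<close>

lemma is_bar_arr_bar_arr:
  assumes a: "src.adj X E Y G R S"
  shows "is_bar_arr ((X, E), R, (Y, G)) (bar_arr ((X, E), R, (Y, G)))"
proof -
  note E = src.adj_cong(1)[OF a] and G = src.adj_cong(2)[OF a] and r = src.adj_rel[OF a] and fa = Fim_adj[OF a]
  note fb = tgt.adj_bimod[OF fa] and qE = qm[OF E] and qG = qm[OF G]
  obtain T v0 v1 where v: "v0 \<in> hom C T X" "v1 \<in> hom C T Y" "in_rel C v0 v1 R" "in_rel C v1 v0 S" "so_mor C v0"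
    by (rule src.adj_val_span[OF a]) blast
  let ?v0 = "FArr F v0" and ?v1 = "FArr F v1" and ?p = "qm (X, E)" and ?q = "qm (Y, G)"
  have Fv: "?v0 \<in> hom D (FObj F T) (FObj F X)" "?v1 \<in> hom D (FObj F T) (FObj F Y)" using v by simp_all
  let ?e = "?p \<bullet> ?v0" and ?f = "?q \<bullet> ?v1"
  have eh: "?e \<in> hom D (FObj F T) (bar_obj (X, E))" and fh: "?f \<in> hom D (FObj F T) (bar_obj (Y, G))"
    using qE(2) qG(2) Fv by simp_all
  have so0: "so_mor D ?v0" by (rule F_so[OF v(5)])
  have so: "so_mor D ?e" by (rule tgt.so_mor_comp[OF so0 qE(1)]) (use Fv qE(2) in simp)
  have dE: "Dom D ?e = FObj F T" "Cod D ?e = bar_obj (X, E)" using eh by simp_all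
  \<comment> \<open>A comparison of the \<open>v0\<close>-images modulo \<open>F E\<close> is
    absorbed by \<open>F R\<close>, and \<open>v1\<close> picks values, so the counit compares the
    \<open>v1\<close>-images modulo \<open>F G\<close>.\<close>
  have ker: "?f \<bullet> s \<preceq> ?f \<bullet> t"
    if s: "s \<in> hom D A (FObj F T)" and t: "t \<in> hom D A (FObj F T)" and le: "?e \<bullet> s \<preceq> ?e \<bullet> t" for A s t
  proof -
    have h0: "?v0 \<bullet> s \<in> hom D A (FObj F X)" "?v0 \<bullet> t \<in> hom D A (FObj F X)"
      and h1: "?v1 \<bullet> s \<in> hom D A (FObj F Y)" "?v1 \<bullet> t \<in> hom D A (FObj F Y)" using Fv s t by simp_all
    have "?p \<bullet> (?v0 \<bullet> s) \<preceq> ?p \<bullet> (?v0 \<bullet> t)" using le s t Fv qE(2) by simp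
    then have "in_rel D (?v0 \<bullet> s) (?v0 \<bullet> t) (Fim X X E)" unfolding qE(3)[OF h0] .
    then have "in_rel D (?v0 \<bullet> s) (?v1 \<bullet> t) (Fim X Y R)"
      by (rule tgt.bimod_left[OF fb(1) h0 h1(2) _ Fim_arr_comp[OF r(1) v(1,2,3) t]])
    then have "in_rel D (?v1 \<bullet> s) (?v1 \<bullet> t) (Fim Y Y G)"
      by (rule tgt.adj_counit[OF fa h0(1) h1 Fim_arr_comp[OF r(2) v(2,1,4) s]])
    then have "?q \<bullet> (?v1 \<bullet> s) \<preceq> ?q \<bullet> (?v1 \<bullet> t)" unfolding qG(3)[OF h1] .
    then show ?thesis using s t Fv qG(2) by simp
  qed
  obtain h where h: "h \<in> hom D (bar_obj (X, E)) (bar_obj (Y, G))" "h \<bullet> ?e = ?f"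
    by (rule tgt.so_descent[OF so, of ?f "bar_obj (Y, G)", unfolded dE, OF fh ker])
  \<comment> \<open>By construction \<open>h\<close> is known on the values of the span only. A
    given \<open>x\<close> lifts to the span on a cover, and there its given value \<open>y\<close>
    agrees with the one from the span up to \<open>F G\<close>.\<close>
  have "h \<bullet> (?p \<bullet> x) = ?q \<bullet> y"
    if a': "src.adj X E Y G R S'" and x: "x \<in> hom D A (FObj F X)" and y: "y \<in> hom D A (FObj F Y)"
      and xy: "in_rel D x y (Fim X Y R)" and yx: "in_rel D y x (Fim Y X S')" for S' A x y
  proof -
    have S': "S' = S" by (rule src.adj_unique[OF a' a])
    have "x \<in> hom D A (Cod D ?v0)" using x Fv by simp
    then obtain B e t where "so_mor D e" "e \<in> hom D B A" "t \<in> hom D B (Dom D ?v0)" "?v0 \<bullet> t = x \<bullet> e"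
      by (rule tgt.so_pullback_lift[OF so0])
    then have e: "so_mor D e" "e \<in> hom D B A" "t \<in> hom D B (FObj F T)" "?v0 \<bullet> t = x \<bullet> e" using Fv by simp_all
    have he: "x \<bullet> e \<in> hom D B (FObj F X)" "y \<bullet> e \<in> hom D B (FObj F Y)" "?v1 \<bullet> t \<in> hom D B (FObj F Y)"
      using x y e Fv by simp_all
    note i = tgt.in_rel_comp[OF Fim_rel[OF r(1)] x y e(2) xy] tgt.in_rel_comp[OF Fim_rel[OF r(2)] y x e(2) yx[unfolded S']]
      Fim_arr_comp[OF r(1) v(1,2,3) e(3), unfolded e(4)] Fim_arr_comp[OF r(2) v(2,1,4) e(3), unfolded e(4)]
    have "?q \<bullet> (?v1 \<bullet> t) = ?q \<bullet> (y \<bullet> e)"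
      by (rule qm_eq[OF G he(3,2) tgt.adj_counit[OF fa he(1,3,2) i(4,1)] tgt.adj_counit[OF fa he(1,2,3) i(2,3)]])
    moreover have "?f \<bullet> t = ?q \<bullet> (?v1 \<bullet> t)" using e(3) Fv qG(2) by simp
    moreover have "?f \<bullet> t = h \<bullet> (?p \<bullet> (x \<bullet> e))"
    proof -
      have "?f \<bullet> t = (h \<bullet> ?e) \<bullet> t" unfolding h(2) ..
      also have "\<dots> = h \<bullet> (?p \<bullet> (?v0 \<bullet> t))" using h(1) e(3) Fv qE(2) by simp
      finally show ?thesis unfolding e(4) .
    qed
    ultimately have "(h \<bullet> (?p \<bullet> x)) \<bullet> e = (?q \<bullet> y) \<bullet> e"
      using h(1) x y e(2) qE(2) qG(2) by simp
    then show ?thesis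
      by (rule tgt.so_epi[OF e(1), of _ "bar_obj (Y, G)", rotated 2]) (use h(1) x y e(2) qE(2) qG(2) in simp_all)
  qed
  then have "is_bar_arr ((X, E), R, (Y, G)) h" unfolding is_bar_arr_def using h(1) by simp
  then show ?thesis unfolding bar_arr_def by (rule someI)
qed

lemma bar_arr:
  assumes a: "src.adj X E Y G R S"
  shows "bar_arr ((X, E), R, (Y, G)) \<in> hom D (bar_obj (X, E)) (bar_obj (Y, G))"
    and bar_arr_val: "\<lbrakk>x \<in> hom D A (FObj F X); y \<in> hom D A (FObj F Y); in_rel D x y (Fim X Y R); in_rel D y x (Fim Y X S)\<rbrakk>
      \<Longrightarrow> bar_arr ((X, E), R, (Y, G)) \<bullet> (qm (X, E) \<bullet> x) = qm (Y, G) \<bullet> y"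
  using is_bar_arr_bar_arr[OF a] a unfolding is_bar_arr_def prod.case fst_conv snd_conv by blast+

text \<open>On a cover \<open>x\<close> has a value \<open>z\<close>. There each side becomes a
  comparison of \<open>z\<close> with \<open>y\<close> modulo \<open>F G\<close>, by
  \<open>adj_val_iff\<close> and the kernel of the quotient, and both sides are insensitive to the
  cover.\<close>

lemma bar_arr_le_iff:
  assumes a: "src.adj X E Y G R S" and x: "x \<in> hom D A (FObj F X)" and y: "y \<in> hom D A (FObj F Y)"
  shows "bar_arr ((X, E), R, (Y, G)) \<bullet> (qm (X, E) \<bullet> x) \<preceq> qm (Y, G) \<bullet> y \<longleftrightarrow> in_rel D x y (Fim X Y R)" (is "?l1 \<longleftrightarrow> _")
    and "qm (Y, G) \<bullet> y \<preceq> bar_arr ((X, E), R, (Y, G)) \<bullet> (qm (X, E) \<bullet> x) \<longleftrightarrow> in_rel D y x (Fim Y X S)" (is "?l2 \<longleftrightarrow> _")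
proof -
  note E = src.adj_cong(1)[OF a] and G = src.adj_cong(2)[OF a] and r = src.adj_rel[OF a] and fa = Fim_adj[OF a]
  note qE = qm[OF E] and qG = qm[OF G] and b = bar_arr[OF a]
  let ?h = "bar_arr ((X, E), R, (Y, G))" and ?p = "qm (X, E)" and ?q = "qm (Y, G)"
  obtain B e z where e: "so_mor D e" "e \<in> hom D B A" "z \<in> hom D B (FObj F Y)" "in_rel D (x \<bullet> e) z (Fim X Y R)"
    "in_rel D z (x \<bullet> e) (Fim Y X S)" by (rule tgt.adj_total[OF fa x])
  have he: "x \<bullet> e \<in> hom D B (FObj F X)" "y \<bullet> e \<in> hom D B (FObj F Y)" using x y e by simp_all
  have hx: "?h \<bullet> (?p \<bullet> x) \<in> hom D A (bar_obj (Y, G))" "?q \<bullet> y \<in> hom D A (bar_obj (Y, G))"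
    using b(1) qE(2) qG(2) x y by simp_all
  have "?h \<bullet> (?p \<bullet> (x \<bullet> e)) = ?q \<bullet> z" by (rule b(2)[OF he(1) e(3,4,5)])
  then have hz: "(?h \<bullet> (?p \<bullet> x)) \<bullet> e = ?q \<bullet> z" and qy: "(?q \<bullet> y) \<bullet> e = ?q \<bullet> (y \<bullet> e)"
    using b(1) qE(2) qG(2) x y e(2) by simp_all
  have cover: "u \<preceq> v \<longleftrightarrow> u \<bullet> e \<preceq> v \<bullet> e" if uv: "u \<in> hom D A Z" "v \<in> hom D A Z" for u v Z
  proof
    assume "u \<preceq> v"
    then show "u \<bullet> e \<preceq> v \<bullet> e" by (rule tgt.comp_mono_left) (use uv e(2) in simp_all)
  next
    assume "u \<bullet> e \<preceq> v \<bullet> e"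
    then show "u \<preceq> v" by (rule tgt.so_order_epi[OF e(1), of _ Z, rotated 2]) (use uv e(2) in simp_all)
  qed
  have local: "in_rel D u v Q \<longleftrightarrow> in_rel D (u \<bullet> e) (v \<bullet> e) Q" if "tgt.is_rel U V Q" "u \<in> hom D A U" "v \<in> hom D A V" for U V Q u v
    using tgt.in_rel_comp[OF that e(2)] tgt.in_rel_local[OF that e(1,2)] by blast
  show "?l1 \<longleftrightarrow> in_rel D x y (Fim X Y R)"
    unfolding cover[OF hx] hz qy qG(3)[OF e(3) he(2)] local[OF Fim_rel[OF r(1)] x y]
    using tgt.adj_val_iff(1)[OF fa he(1) e(3) he(2) e(4,5)] by blast
  show "?l2 \<longleftrightarrow> in_rel D y x (Fim Y X S)"
    unfolding cover[OF hx(2,1)] hz qy qG(3)[OF he(2) e(3)] local[OF Fim_rel[OF r(2)] y x]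
    using tgt.adj_val_iff(2)[OF fa he(1) e(3) he(2) e(4,5)] by blast
qed

lemma bar_arr_eqI:
  assumes a: "src.adj X E Y G R S" and h: "h \<in> hom D (bar_obj (X, E)) Z" "h' \<in> hom D (bar_obj (X, E)) Z"
    and e: "so_mor D e" "e \<in> hom D B (FObj F X)" and eq: "h \<bullet> (qm (X, E) \<bullet> e) = h' \<bullet> (qm (X, E) \<bullet> e)"
  shows "h = h'"
proof -
  note q = qm[OF src.adj_cong(1)[OF a]]
  have so: "so_mor D (qm (X, E) \<bullet> e)" by (rule tgt.so_mor_comp[OF e(1) q(1)]) (use e(2) q(2) in simp)
  show ?thesis by (rule tgt.so_epi[OF so _ _ eq]) (use h e(2) q(2) in simp_all)
qed

definition bar :: "('a \<times> 'b set, ('a, 'b) qarr, 'c, 'd) pfun" where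
  "bar = \<lparr>FObj = bar_obj, FArr = bar_arr\<rparr>"

lemma bar_arr_hom: "f \<in> hom (exreg C) a b \<Longrightarrow> bar_arr f \<in> hom D (bar_obj a) (bar_obj b)"
  by (erule src.exreg_homE) (use bar_arr(1) in simp)

lemma F_ident_elem: "X \<in> Obj C \<Longrightarrow> Ident D (FObj F X) \<in> hom D (FObj F X) (FObj F X)"
  by simp

lemma bar_arr_ident:
  assumes E: "src.cong X E"
  shows "bar_arr ((X, E), E, (X, E)) = Ident D (bar_obj (X, E))"
proof -
  note a = src.adj_ident[OF E] and q = qm[OF E]
  have X: "X \<in> Obj C" using E by (rule src.cong_obj)
  note i = F_ident_elem[OF X]
  have r: "in_rel D (Ident D (FObj F X)) (Ident D (FObj F X)) (Fim X X E)" by (rule tgt.cong_refl[OF Fim_cong[OF E] i])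
  have so: "so_mor D (Ident D (FObj F X))" by (rule tgt.so_mor_ident) (use X in simp)
  show ?thesis
    by (rule bar_arr_eqI[OF a bar_arr(1)[OF a] _ so i]) (unfold bar_arr_val[OF a i i r r], use q(2) X in simp_all)
qed

text \<open>The generic element of \<open>FObj F X\<close> has a value \<open>y\<close> on a cover,
  and \<open>y\<close> has a value \<open>z\<close> on a further one. Both sides send the class of
  the restricted generic element to the class of \<open>z\<close>.\<close>

lemma bar_arr_comp:
  assumes a: "src.adj X E Y G R S" and a': "src.adj Y G Z H R' S'"
  shows "bar_arr ((X, E), rel_comp C X Y Z R' R, (Z, H)) = bar_arr ((Y, G), R', (Z, H)) \<bullet> bar_arr ((X, E), R, (Y, G))"
proof -
  note c = src.adj_comp[OF a a'] and r = src.adj_rel[OF a] and r' = src.adj_rel[OF a'] and fa = Fim_adj[OF a] and fa' = Fim_adj[OF a']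
  note b = bar_arr[OF a] and b' = bar_arr[OF a'] and bc = bar_arr[OF c]
  note q = qm[OF src.adj_cong(1)[OF a]]
  have X: "X \<in> Obj C" by (rule src.cong_obj[OF src.adj_cong(1)[OF a]])
  let ?i = "Ident D (FObj F X)"
  note i = F_ident_elem[OF X]
  obtain B e y where "so_mor D e" "e \<in> hom D B (FObj F X)" "y \<in> hom D B (FObj F Y)" "in_rel D (?i \<bullet> e) y (Fim X Y R)"
    "in_rel D y (?i \<bullet> e) (Fim Y X S)" by (rule tgt.adj_total[OF fa i])
  then have e: "so_mor D e" "e \<in> hom D B (FObj F X)" "y \<in> hom D B (FObj F Y)" "in_rel D e y (Fim X Y R)" "in_rel D y e (Fim Y X S)"
    by simp_all
  obtain B' e' z where e': "so_mor D e'" "e' \<in> hom D B' B" "z \<in> hom D B' (FObj F Z)" "in_rel D (y \<bullet> e') z (Fim Y Z R')"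
    "in_rel D z (y \<bullet> e') (Fim Z Y S')" by (rule tgt.adj_total[OF fa' e(3)])
  let ?e = "e \<bullet> e'" and ?y = "y \<bullet> e'"
  have he: "so_mor D ?e" "?e \<in> hom D B' (FObj F X)" and hy: "?y \<in> hom D B' (FObj F Y)"
    using tgt.so_cover_comp[OF e(1,2) e'(1,2)] e(3) e'(2) by simp_all
  note v = tgt.in_rel_comp[OF Fim_rel[OF r(1)] e(2,3) e'(2) e(4)] tgt.in_rel_comp[OF Fim_rel[OF r(2)] e(3,2) e'(2) e(5)]
  have "in_rel D ?e z (Fim X Z (rel_comp C X Y Z R' R))"
    by (rule Fim_comp_closed[OF r(1) r'(1) src.adj_rel(1)[OF c] _ he(2) hy e'(3) v(1) e'(4)])
      (rule src.in_rel_compI'[OF r(1) r'(1)])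
  moreover have "in_rel D z ?e (Fim Z X (rel_comp C Z Y X S S'))"
    by (rule Fim_comp_closed[OF r'(2) r(2) src.adj_rel(2)[OF c] _ e'(3) hy he(2) e'(5) v(2)])
      (rule src.in_rel_compI'[OF r'(2) r(2)])
  ultimately have 1: "bar_arr ((X, E), rel_comp C X Y Z R' R, (Z, H)) \<bullet> (qm (X, E) \<bullet> ?e) = qm (Z, H) \<bullet> z"
    by (rule bc(2)[OF he(2) e'(3)])
  have "bar_arr ((X, E), R, (Y, G)) \<bullet> (qm (X, E) \<bullet> ?e) = qm (Y, G) \<bullet> ?y" by (rule b(2)[OF he(2) hy v])
  moreover have "bar_arr ((Y, G), R', (Z, H)) \<bullet> (qm (Y, G) \<bullet> ?y) = qm (Z, H) \<bullet> z" by (rule b'(2)[OF hy e'(3,4,5)])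
  moreover have "qm (X, E) \<bullet> ?e \<in> hom D B' (bar_obj (X, E))" using he(2) q(2) by simp
  ultimately have 2: "(bar_arr ((Y, G), R', (Z, H)) \<bullet> bar_arr ((X, E), R, (Y, G))) \<bullet> (qm (X, E) \<bullet> ?e) = qm (Z, H) \<bullet> z"
    using b(1) b'(1) tgt.assoc[of "qm (X, E) \<bullet> ?e" "bar_arr ((X, E), R, (Y, G))" "bar_arr ((Y, G), R', (Z, H))"]
    by simp
  show ?thesis
    by (rule bar_arr_eqI[OF c bc(1) _ he]) (use b(1) b'(1) 1 2 in simp_all)
qed

lemma bar_arr_mono:
  assumes a: "src.adj X E Y G R S" and a': "src.adj X E Y G R' S'" and le: "rel_incl C R' R"
  shows "bar_arr ((X, E), R, (Y, G)) \<preceq> bar_arr ((X, E), R', (Y, G))"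
proof -
  note r = src.adj_rel[OF a] and r' = src.adj_rel[OF a'] and fa' = Fim_adj[OF a'] and b = bar_arr[OF a] and b' = bar_arr[OF a']
  note q = qm[OF src.adj_cong(1)[OF a]]
  have X: "X \<in> Obj C" by (rule src.cong_obj[OF src.adj_cong(1)[OF a]])
  let ?i = "Ident D (FObj F X)"
  note i = F_ident_elem[OF X]
  obtain B e y where "so_mor D e" "e \<in> hom D B (FObj F X)" "y \<in> hom D B (FObj F Y)" "in_rel D (?i \<bullet> e) y (Fim X Y R')"
    "in_rel D y (?i \<bullet> e) (Fim Y X S')" by (rule tgt.adj_total[OF fa' i])
  then have e: "so_mor D e" "e \<in> hom D B (FObj F X)" "y \<in> hom D B (FObj F Y)" "in_rel D e y (Fim X Y R')" "in_rel D y e (Fim Y X S')"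
    by simp_all
  have "in_rel D e y (Fim X Y R)" by (rule Fim_incl[OF r'(1) r(1) le e(2,3,4)])
  then have "bar_arr ((X, E), R, (Y, G)) \<bullet> (qm (X, E) \<bullet> e) \<preceq> qm (Y, G) \<bullet> y" unfolding bar_arr_le_iff(1)[OF a e(2,3)] .
  then have le: "bar_arr ((X, E), R, (Y, G)) \<bullet> (qm (X, E) \<bullet> e) \<preceq> bar_arr ((X, E), R', (Y, G)) \<bullet> (qm (X, E) \<bullet> e)"
    unfolding b'(2)[OF e(2-5)] .
  have so: "so_mor D (qm (X, E) \<bullet> e)" by (rule tgt.so_mor_comp[OF e(1) q(1)]) (use e(2) q(2) in simp)
  show ?thesis by (rule tgt.so_order_epi[OF so _ _ le]) (use b(1) b'(1) e(2) q(2) in simp_all)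
qed

lemma bar_simps [simp]: "FObj bar a = bar_obj a" "FArr bar f = bar_arr f"
  by (simp_all add: bar_def)

lemma bar_functor: "pos_functor (exreg C) D bar"
  unfolding pos_functor_def bar_simps
proof (intro conjI ballI allI)
  fix a assume "a \<in> Obj (exreg C)"
  then obtain X E where a: "a = (X, E)" and E: "src.cong X E" unfolding src.exreg_simps by blast
  show "bar_obj a \<in> Obj D" unfolding a using qm(2)[OF E] by simp
  show "bar_arr (Ident (exreg C) a) = Ident D (bar_obj a)" unfolding a src.exreg_simps by (rule bar_arr_ident[OF E])
next
  fix a b f assume "f \<in> hom (exreg C) a b"
  then show "bar_arr f \<in> hom D (bar_obj a) (bar_obj b)" by (rule bar_arr_hom)
next
  fix a b c f g assume f: "f \<in> hom (exreg C) a b" and g: "g \<in> hom (exreg C) b c"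
  obtain X E Y G Z H where abc: "a = (X, E)" "b = (Y, G)" "c = (Z, H)" by (cases a, cases b, cases c)
  obtain R S where fR: "f = ((X, E), R, (Y, G))" "src.adj X E Y G R S" using f unfolding abc src.exreg_hom_iff by blast
  obtain R' S' where gR: "g = ((Y, G), R', (Z, H))" "src.adj Y G Z H R' S'" using g unfolding abc src.exreg_hom_iff by blast
  show "bar_arr (g \<cdot>\<^bsub>exreg C\<^esub> f) = bar_arr g \<bullet> bar_arr f"
    unfolding fR(1) gR(1) src.exreg_simps fst_conv by (rule bar_arr_comp[OF fR(2) gR(2)])
next
  fix a b :: "'a \<times> 'b set"
  obtain X E Y G where ab: "a = (X, E)" "b = (Y, G)" by (cases a, cases b)
  show "monotone_on (hom (exreg C) a b) (Le (exreg C)) (Le D) bar_arr"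
  proof (rule monotone_onI)
    fix f g assume f: "f \<in> hom (exreg C) a b" and g: "g \<in> hom (exreg C) a b" and le: "f \<sqsubseteq>\<^bsub>exreg C\<^esub> g"
    obtain R S where fR: "f = ((X, E), R, (Y, G))" "src.adj X E Y G R S" using f unfolding ab src.exreg_hom_iff by blast
    obtain R' S' where gR: "g = ((X, E), R', (Y, G))" "src.adj X E Y G R' S'" using g unfolding ab src.exreg_hom_iff by blast
    show "bar_arr f \<preceq> bar_arr g"
      unfolding fR(1) gR(1)
      by (rule bar_arr_mono[OF fR(2) gR(2)]) (use le in \<open>unfold fR(1) gR(1) src.exreg_simps\<close>)
  qed
qed

text \<open>In \<open>C\<close> the arrow \<open>f\<close> is a value of \<open>Ident C X\<close>
  without any cover; this pair is carried along \<open>F\<close> and restricted to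
  \<open>u\<close>.\<close>

lemma bar_hat:
  assumes K: "src.cong X K" and G: "src.cong Y G" and f: "f \<in> hom C X Y" and a: "src.adj X K Y G (src.graph f G) (src.cograph f G)"
    and u: "u \<in> hom D A (FObj F X)"
  shows "bar_arr (src.hat (X, K) (Y, G) f) \<bullet> (qm (X, K) \<bullet> u) = qm (Y, G) \<bullet> (FArr F f \<bullet> u)"
proof -
  have X: "X \<in> Obj C" by (rule src.cong_obj[OF K])
  then have i: "Ident C X \<in> hom C X X" by simp
  note r = src.adj_rel[OF a] and g = src.cong_rel[OF G]
  have "f \<cdot>\<^bsub>C\<^esub> Ident C X = f" using f by simp
  then have v: "in_rel C (Ident C X) f (src.graph f G)" "in_rel C f (Ident C X) (src.cograph f G)"
    using src.graph(2)[OF g f i f] src.cograph(2)[OF g f i f] src.cong_refl[OF G f] by simp_all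
  have "in_rel D (FArr F (Ident C X) \<bullet> u) (FArr F f \<bullet> u) (Fim X Y (src.graph f G))"
    by (rule Fim_arr_comp[OF r(1) i f v(1) u])
  moreover have "in_rel D (FArr F f \<bullet> u) (FArr F (Ident C X) \<bullet> u) (Fim Y X (src.cograph f G))"
    by (rule Fim_arr_comp[OF r(2) f i v(2) u])
  moreover have "FArr F (Ident C X) \<bullet> u = u" using X u by simp
  moreover have "FArr F f \<bullet> u \<in> hom D A (FObj F Y)" using f u by simp
  ultimately show ?thesis unfolding src.hat_def snd_conv using bar_arr_val[OF a u] by simp
qed


section \<open>Preservation of \<open>so\<close>-morphisms and finite limits\<close>

text \<open>By surjectivity, the generic element of \<open>Y\<close> is on a cover \<open>e\<close>
  the value of some \<open>x\<close>. Hence \<open>bar_arr f\<close> followed after the class of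
  \<open>x\<close> is the composite of the two \<open>so\<close>-morphisms \<open>FArr F e\<close>
  and \<open>qm (Y, G)\<close>, and \<open>so_mor_cancel\<close> applies.\<close>

lemma bar_so:
  assumes f: "so_mor (exreg C) f"
  shows "so_mor D (bar_arr f)"
proof -
  have "f \<in> hom (exreg C) (Dom (exreg C) f) (Cod (exreg C) f)"
    using pos_category.so_mor_arr[OF src.pos_category_exreg f] by simp
  then obtain X E Y G R S where fR: "f = ((X, E), R, (Y, G))" and a: "src.adj X E Y G R S" by (rule src.exreg_homE)
  note r = src.adj_rel[OF a] and E = src.adj_cong(1)[OF a] and G = src.adj_cong(2)[OF a]
  have iY: "Ident C Y \<in> hom C Y Y" using src.cong_obj[OF G] by simp
  obtain B e x where "so_mor C e" "e \<in> hom C B Y" "x \<in> hom C B X" "in_rel C x (Ident C Y \<cdot>\<^bsub>C\<^esub> e) R" "in_rel C (Ident C Y \<cdot>\<^bsub>C\<^esub> e) x S"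
    using src.exreg_so_surj[OF f[unfolded fR] a iY] by blast
  then have e: "so_mor C e" "e \<in> hom C B Y" "x \<in> hom C B X" "in_rel C x e R" "in_rel C e x S" by simp_all
  have h: "FArr F e \<in> hom D (FObj F B) (FObj F Y)" "FArr F x \<in> hom D (FObj F B) (FObj F X)" using e by simp_all
  have eq: "bar_arr f \<bullet> (qm (X, E) \<bullet> FArr F x) = qm (Y, G) \<bullet> FArr F e"
    unfolding fR by (rule bar_arr_val[OF a h(2,1) Fim_arr[OF r(1) e(3,2,4)] Fim_arr[OF r(2) e(2,3,5)]])
  have "so_mor D (bar_arr f \<bullet> (qm (X, E) \<bullet> FArr F x))"
    unfolding eq by (rule tgt.so_mor_comp[OF F_so[OF e(1)] qm(1)[OF G]]) (use h qm(2)[OF G] in simp)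
  then show ?thesis
    by (rule tgt.so_mor_cancel) (use bar_arr(1)[OF a] h qm(2)[OF E] in \<open>simp_all add: fR\<close>)
qed

text \<open>Joint order-monicity of a finite family in the exact completion is a statement about relations in
  \<open>C\<close>: the congruence on the common domain is the intersection of the kernels.\<close>

lemma bar_jointly_mono:
  assumes I: "finite I" and K: "src.cong Z K"
    and a: "\<And>i. i \<in> I \<Longrightarrow> src.adj Z K (X i) (E i) (R i) (S i)"
    and jm: "\<And>T z z'. \<lbrakk>z \<in> hom C T Z; z' \<in> hom C T Z;
      \<And>i. i \<in> I \<Longrightarrow> in_rel C z z' (rel_comp C Z (X i) Z (S i) (R i))\<rbrakk> \<Longrightarrow> in_rel C z z' K"
    and u: "u \<in> hom D A (bar_obj (Z, K))" and v: "v \<in> hom D A (bar_obj (Z, K))"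
    and le: "\<And>i. i \<in> I \<Longrightarrow> bar_arr ((Z, K), R i, (X i, E i)) \<bullet> u \<preceq> bar_arr ((Z, K), R i, (X i, E i)) \<bullet> v"
  shows "u \<preceq> v"
proof -
  note q = qm[OF K]
  let ?q = "qm (Z, K)"
  have Z: "Z \<in> Obj C" by (rule src.cong_obj[OF K])
  obtain B1 e1 z where e1: "so_mor D e1" "e1 \<in> hom D B1 A" "z \<in> hom D B1 (FObj F Z)" "?q \<bullet> z = u \<bullet> e1"
    by (rule qm_lift[OF K u])
  have "v \<bullet> e1 \<in> hom D B1 (bar_obj (Z, K))" using v e1 by simp
  then obtain B e2 z2 where e2: "so_mor D e2" "e2 \<in> hom D B B1" "z2 \<in> hom D B (FObj F Z)" "?q \<bullet> z2 = (v \<bullet> e1) \<bullet> e2"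
    by (rule qm_lift[OF K])
  let ?e = "e1 \<bullet> e2" and ?z1 = "z \<bullet> e2"
  have e: "so_mor D ?e" "?e \<in> hom D B A" and z1: "?z1 \<in> hom D B (FObj F Z)"
    using tgt.so_cover_comp[OF e1(1,2) e2(1,2)] e1(3) e2(2) by simp_all
  have qz1: "?q \<bullet> ?z1 = u \<bullet> ?e" and qz2: "?q \<bullet> z2 = v \<bullet> ?e"
    using tgt.assoc_eq[OF e1(4), of e2] e1 e2 u v q(2) by simp_all
  let ?N = "\<lambda>i. rel_comp C Z (X i) Z (S i) (R i)"
  have N: "src.is_rel Z Z (?N i)" if "i \<in> I" for i
    by (rule src.is_rel_comp[OF src.adj_rel[OF a[OF that]]])
  \<comment> \<open>With a local value \<open>y\<close> of the lift of \<open>u\<close>, the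
    hypothesis on \<open>u\<close> and \<open>v\<close> says that \<open>y\<close> is below the
    value of the lift of \<open>v\<close>; so \<open>y\<close> is an intermediate point for the
    kernel.\<close>
  have zN: "in_rel D ?z1 z2 (Fim Z Z (?N i))" if i: "i \<in> I" for i
  proof -
    note r = src.adj_rel[OF a[OF i]] and fa = Fim_adj[OF a[OF i]] and b = bar_arr[OF a[OF i]]
    let ?h = "bar_arr ((Z, K), R i, (X i, E i))"
    obtain B' d y where d: "so_mor D d" "d \<in> hom D B' B" "y \<in> hom D B' (FObj F (X i))"
      "in_rel D (?z1 \<bullet> d) y (Fim Z (X i) (R i))" "in_rel D y (?z1 \<bullet> d) (Fim (X i) Z (S i))"
      by (rule tgt.adj_total[OF fa z1])
    have h: "?z1 \<bullet> d \<in> hom D B' (FObj F Z)" "z2 \<bullet> d \<in> hom D B' (FObj F Z)" and ed: "?e \<bullet> d \<in> hom D B' A"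
      using z1 e2(3) d(2) e(2) by (simp_all del: tgt.assoc)
    have w: "?q \<bullet> (?z1 \<bullet> d) = u \<bullet> (?e \<bullet> d)" "?q \<bullet> (z2 \<bullet> d) = v \<bullet> (?e \<bullet> d)"
      using tgt.assoc_eq[OF qz1, of d] tgt.assoc_eq[OF qz2, of d] z1 e2(3) d(2) e(2) u v q(2) by (simp_all del: tgt.assoc add: tgt.assoc[of d ?e])
    have "(?h \<bullet> u) \<bullet> (?e \<bullet> d) \<preceq> (?h \<bullet> v) \<bullet> (?e \<bullet> d)"
      by (rule tgt.comp_mono_left[OF le[OF i]]) (use b(1) u v ed in \<open>simp_all del: tgt.assoc\<close>)
    then have "?h \<bullet> (?q \<bullet> (?z1 \<bullet> d)) \<preceq> ?h \<bullet> (?q \<bullet> (z2 \<bullet> d))"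
      unfolding w using tgt.assoc[of "?e \<bullet> d" u ?h] tgt.assoc[of "?e \<bullet> d" v ?h] b(1) u v ed by (simp del: tgt.assoc)
    then have yz: "in_rel D y (z2 \<bullet> d) (Fim (X i) Z (S i))"
      unfolding b(2)[OF h(1) d(3,4,5)] bar_arr_le_iff(2)[OF a[OF i] h(2) d(3)] .
    have "in_rel D (?z1 \<bullet> d) (z2 \<bullet> d) (Fim Z Z (?N i))"
      by (rule Fim_comp_closed[OF r N[OF i] _ h(1) d(3) h(2) d(4) yz]) (rule src.in_rel_compI'[OF r])
    then show ?thesis by (rule tgt.in_rel_local[OF Fim_rel[OF N[OF i]] z1 e2(3) d(1,2)])
  qed
  \<comment> \<open>Two unknowns in \<open>Z\<close>, indexed \<open>0\<close> and \<open>1\<close>,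
    subject to all kernels at once. The hypothesis \<open>jm\<close> applies to their generic
    solution and places it in \<open>K\<close>, and the pair of lifts factors through its
    image.\<close>
  let ?\<Phi> = "(\<lambda>i. (0::nat, 1::nat, ?N i)) ` I"
  have "\<exists>M \<pi>. M \<in> Obj C \<and> (\<forall>i\<in>{0, 1}. \<pi> i \<in> hom C M Z) \<and> (\<forall>(i, k, R)\<in>?\<Phi>. in_rel C (\<pi> i) (\<pi> k) R) \<and>
    (\<forall>A a. A \<in> Obj D \<longrightarrow> (\<forall>i\<in>{0, 1}. a i \<in> hom D A (FObj F Z)) \<longrightarrow>
       (\<forall>(i, k, R)\<in>?\<Phi>. in_rel D (a i) (a k) (Fim Z Z R)) \<longrightarrow>
       (\<exists>u\<in>hom D A (FObj F M). \<forall>i\<in>{0, 1}. FArr F (\<pi> i) \<bullet> u = a i))"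
    by (rule generic_solution) (use I Z N in auto)
  then obtain M and \<pi> :: "nat \<Rightarrow> 'b" where M0: "\<forall>i\<in>{0, 1}. \<pi> i \<in> hom C M Z"
    "\<forall>(i, k, R)\<in>?\<Phi>. in_rel C (\<pi> i) (\<pi> k) R"
    "\<forall>A a. A \<in> Obj D \<longrightarrow> (\<forall>i\<in>{0, 1}. a i \<in> hom D A (FObj F Z)) \<longrightarrow>
       (\<forall>(i, k, R)\<in>?\<Phi>. in_rel D (a i) (a k) (Fim Z Z R)) \<longrightarrow>
       (\<exists>u\<in>hom D A (FObj F M). \<forall>i\<in>{0, 1}. FArr F (\<pi> i) \<bullet> u = a i)"
    by (elim exE conjE)
  have M: "\<pi> 0 \<in> hom C M Z" "\<pi> 1 \<in> hom C M Z" using M0(1) by simp_all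
  note ex = M0(3)[THEN spec, THEN spec, THEN mp, THEN mp, THEN mp]
  have "in_rel C (\<pi> 0) (\<pi> 1) (?N i)" if "i \<in> I" for i
    using bspec[OF M0(2) imageI[OF that]] by simp
  then have "in_rel C (\<pi> 0) (\<pi> 1) K" by (rule jm[OF M(1,2)])
  note \<pi>K = Fim_arr_comp[OF src.cong_rel[OF K] M(1,2) this]
  let ?a = "\<lambda>i::nat. if i = 0 then ?z1 else z2"
  have "\<exists>w\<in>hom D B (FObj F M). \<forall>i\<in>{0, 1}. FArr F (\<pi> i) \<bullet> w = ?a i"
  proof (rule ex)
    show "B \<in> Obj D" using z1 by auto
    show "\<forall>i\<in>{0, 1}. ?a i \<in> hom D B (FObj F Z)" using z1 e2(3) by simp
    show "\<forall>(i, k, R)\<in>?\<Phi>. in_rel D (?a i) (?a k) (Fim Z Z R)" using zN by simp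
  qed
  then obtain w where w: "w \<in> hom D B (FObj F M)" "FArr F (\<pi> 0) \<bullet> w = ?z1" "FArr F (\<pi> 1) \<bullet> w = z2"
    by auto
  have "?q \<bullet> ?z1 \<preceq> ?q \<bullet> z2" unfolding q(3)[OF z1 e2(3)] using \<pi>K[OF w(1)] unfolding w(2,3) .
  then have ule: "u \<bullet> ?e \<preceq> v \<bullet> ?e" unfolding qz1 qz2 .
  show ?thesis by (rule tgt.so_order_epi[OF e(1) _ _ ule]) (use e(2) u v in simp_all)
qed

text \<open>Finiteness allows all members to be lifted on one common cover: covers are composed, and
  the lifts already found are restricted.\<close>

lemma lift_family:
  assumes "finite I" "\<And>i. i \<in> I \<Longrightarrow> src.cong (X i) (E i)" "\<And>i. i \<in> I \<Longrightarrow> c i \<in> hom D A (bar_obj (X i, E i))" "A \<in> Obj D"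
  shows "\<exists>B e a. so_mor D e \<and> e \<in> hom D B A \<and>
    (\<forall>i\<in>I. a i \<in> hom D B (FObj F (X i)) \<and> qm (X i, E i) \<bullet> a i = c i \<bullet> e)"
  using assms
proof (induction I rule: finite_induct)
  case empty
  then show ?case using tgt.so_mor_ident[of A] tgt.ident_arr[of A] by (intro exI[of _ A] exI[of _ "Ident D A"]) simp
next
  case (insert k I)
  have "\<exists>B e a. so_mor D e \<and> e \<in> hom D B A \<and>
    (\<forall>i\<in>I. a i \<in> hom D B (FObj F (X i)) \<and> qm (X i, E i) \<bullet> a i = c i \<bullet> e)"
    by (rule insert.IH) (use insert.prems in blast)+
  then obtain B e a where e: "so_mor D e" "e \<in> hom D B A"
    and a: "\<And>i. i \<in> I \<Longrightarrow> a i \<in> hom D B (FObj F (X i))" "\<And>i. i \<in> I \<Longrightarrow> qm (X i, E i) \<bullet> a i = c i \<bullet> e" by blast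
  have cong: "src.cong (X i) (E i)" and ch: "c i \<in> hom D A (bar_obj (X i, E i))" if "i \<in> insert k I" for i
    using insert.prems that by blast+
  have "c k \<bullet> e \<in> hom D B (bar_obj (X k, E k))" using ch[of k] e(2) by simp
  then obtain B' e' x where e': "so_mor D e'" "e' \<in> hom D B' B" "x \<in> hom D B' (FObj F (X k))"
    "qm (X k, E k) \<bullet> x = (c k \<bullet> e) \<bullet> e'" by (rule qm_lift[OF cong[OF insertI1]])
  let ?a = "\<lambda>i. if i = k then x else a i \<bullet> e'"
  have "?a i \<in> hom D B' (FObj F (X i)) \<and> qm (X i, E i) \<bullet> ?a i = c i \<bullet> (e \<bullet> e')" if i: "i \<in> insert k I" for i
  proof (cases "i = k")
    case True
    then show ?thesis using e' e(2) ch[of k] by simp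
  next
    case False
    then have iI: "i \<in> I" using i by blast
    show ?thesis
      using tgt.assoc_eq[OF a(2)[OF iI], of e'] a(1)[OF iI] e'(2) e(2) ch[OF i] qm(2)[OF cong[OF i]] False by simp
  qed
  then show ?case using tgt.so_cover_comp[OF e e'(1,2)]
    by (intro exI[of _ B'] exI[of _ "e \<bullet> e'"] exI[of _ ?a]) blast
qed

lemma bar_limits: "preserves_finite_limits (exreg C) D bar"
  unfolding preserves_finite_limits_def
proof (intro allI impI, elim conjE)
  fix J :: "(nat, nat) pcat" and W :: "(nat, nat, nat) weight" and \<Delta> L l
  assume fw: "finite_weight J W" and \<Delta>: "pos_functor J (exreg C) \<Delta>" and lim: "weighted_limit J W (exreg C) \<Delta> L l"
  have J: "pos_category J" and W: "pos_weight J W" and fin: "finite (Obj J)" "finite (Arr J)" "\<And>j. j \<in> Obj J \<Longrightarrow> finite (WEl W j)"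
    using fw unfolding finite_weight_def by blast+
  note ex = src.pos_category_exreg and \<Delta>s = pos_functor_simps[OF \<Delta>] and bs = pos_functor_simps[OF bar_functor, unfolded bar_simps]
  have Jo: "Dom J \<alpha> \<in> Obj J" "Cod J \<alpha> \<in> Obj J" "\<alpha> \<in> hom J (Dom J \<alpha>) (Cod J \<alpha>)" if "\<alpha> \<in> Arr J" for \<alpha>
    using that pos_category.dom_obj[OF J] pos_category.cod_obj[OF J] by simp_all
  have act: "WAct W \<alpha> x \<in> WEl W (Cod J \<alpha>)" if "\<alpha> \<in> Arr J" "x \<in> WEl W (Dom J \<alpha>)" for \<alpha> x
    using W Jo(3)[OF that(1)] that(2) unfolding pos_weight_def by blast
  have cyl: "cylinder J W (exreg C) \<Delta> L l"
    and univ: "\<And>A c. cylinder J W (exreg C) \<Delta> A c \<Longrightarrow>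
        \<exists>u\<in>hom (exreg C) A L. \<forall>j\<in>Obj J. \<forall>x\<in>WEl W j. l j x \<cdot>\<^bsub>exreg C\<^esub> u = c j x"
    and ljm: "\<And>A u v. u\<in>hom (exreg C) A L \<Longrightarrow> v\<in>hom (exreg C) A L \<Longrightarrow>
        (\<forall>j\<in>Obj J. \<forall>x\<in>WEl W j. l j x \<cdot>\<^bsub>exreg C\<^esub> u \<sqsubseteq>\<^bsub>exreg C\<^esub> l j x \<cdot>\<^bsub>exreg C\<^esub> v) \<Longrightarrow> u \<sqsubseteq>\<^bsub>exreg C\<^esub> v"
    using lim unfolding weighted_limit_def by blast+
  \<comment> \<open>The unknowns are indexed by pairs \<open>(j, x)\<close>, because a cylinder has
    one component for each weight element; the object depends on \<open>j\<close> alone, which is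
    recorded in \<open>ind\<close>.\<close>
  define X :: "nat \<times> nat \<Rightarrow> 'a" where "X i = fst (FObj \<Delta> (fst i))" for i
  define E :: "nat \<times> nat \<Rightarrow> 'b set" where "E i = snd (FObj \<Delta> (fst i))" for i
  have XE: "FObj \<Delta> j = (X (j, x), E (j, x))" for j x unfolding X_def E_def by simp
  let ?I = "Sigma (Obj J) (WEl W)"
  have I: "finite ?I" using fin by blast
  have cXE: "src.cong (X i) (E i)" if "i \<in> ?I" for i
  proof -
    have "FObj \<Delta> (fst i) \<in> Obj (exreg C)" using that by (intro \<Delta>s(1)) auto
    then show ?thesis unfolding X_def E_def src.exreg_simps by (simp add: case_prod_beta)
  qed
  obtain Z K where L: "L = (Z, K)" by (cases L)
  have K: "src.cong Z K" using cyl unfolding cylinder_def L src.exreg_simps by blast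
  have lh: "l j x \<in> hom (exreg C) L (FObj \<Delta> j)" if "j \<in> Obj J" "x \<in> WEl W j" for j x
    using cyl that unfolding cylinder_def by blast
  have "\<exists>R S. l (fst i) (snd i) = ((Z, K), R, (X i, E i)) \<and> src.adj Z K (X i) (E i) R S" if i: "i \<in> ?I" for i
  proof -
    obtain j x where jx: "i = (j, x)" "j \<in> Obj J" "x \<in> WEl W j" using i by blast
    show ?thesis using lh[OF jx(2,3)] unfolding jx(1) XE[of j x] L src.exreg_hom_iff fst_conv snd_conv .
  qed
  then obtain R S where l: "\<And>i. i \<in> ?I \<Longrightarrow> l (fst i) (snd i) = ((Z, K), R i, (X i, E i))"
    and la: "\<And>i. i \<in> ?I \<Longrightarrow> src.adj Z K (X i) (E i) (R i) (S i)" by metis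
  have lR: "l j x = ((Z, K), R (j, x), (X (j, x), E (j, x)))" if "j \<in> Obj J" "x \<in> WEl W j" for j x
    using l[of "(j, x)"] that by simp
  \<comment> \<open>Joint order-monicity of the limit cone, tested on the objects
    \<open>(T, ident_rel C T)\<close>, becomes a statement about elements of relations in
    \<open>C\<close>, the form required by \<open>bar_jointly_mono\<close>.\<close>
  have jm: "in_rel C z z' K"
    if z: "z \<in> hom C T Z" "z' \<in> hom C T Z" and N: "\<And>i. i \<in> ?I \<Longrightarrow> in_rel C z z' (rel_comp C Z (X i) Z (S i) (R i))" for T z z'
  proof -
    let ?T = "(T, ident_rel C T)"
    have "src.hat ?T (Z, K) z \<sqsubseteq>\<^bsub>exreg C\<^esub> src.hat ?T (Z, K) z'"
    proof (rule ljm[of _ ?T, unfolded L])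
      show "\<forall>j\<in>Obj J. \<forall>x\<in>WEl W j. l j x \<cdot>\<^bsub>exreg C\<^esub> src.hat ?T (Z, K) z \<sqsubseteq>\<^bsub>exreg C\<^esub> l j x \<cdot>\<^bsub>exreg C\<^esub> src.hat ?T (Z, K) z'"
      proof (intro ballI)
        fix j x assume jx: "j \<in> Obj J" "x \<in> WEl W j"
        then have i: "(j, x) \<in> ?I" by blast
        show "l j x \<cdot>\<^bsub>exreg C\<^esub> src.hat ?T (Z, K) z \<sqsubseteq>\<^bsub>exreg C\<^esub> l j x \<cdot>\<^bsub>exreg C\<^esub> src.hat ?T (Z, K) z'"
          unfolding lR[OF jx] by (rule src.comp_hat_le[OF la[OF i] z N[OF i]])
      qed
    qed (rule src.hat_ident_hom[OF K z(1)], rule src.hat_ident_hom[OF K z(2)])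
    then show ?thesis unfolding src.hat_le_iff[OF K z] .
  qed
  have mono: "u \<preceq> v" if u: "u \<in> hom D A (bar_obj L)" and v: "v \<in> hom D A (bar_obj L)"
    and le: "\<And>j x. j \<in> Obj J \<Longrightarrow> x \<in> WEl W j \<Longrightarrow> bar_arr (l j x) \<bullet> u \<preceq> bar_arr (l j x) \<bullet> v" for u v A
  proof (rule bar_jointly_mono[OF I K la jm u[unfolded L] v[unfolded L]])
    fix i assume "i \<in> ?I"
    then obtain j x where jx: "i = (j, x)" "j \<in> Obj J" "x \<in> WEl W j" by blast
    show "bar_arr ((Z, K), R i, (X i, E i)) \<bullet> u \<preceq> bar_arr ((Z, K), R i, (X i, E i)) \<bullet> v"
      using le[OF jx(2,3)] unfolding lR[OF jx(2,3)] jx(1) .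
  qed
  \<comment> \<open>The \<open>0\<close> is a placeholder for a weight element; \<open>ind\<close>
    exchanges it for any other, as \<open>Q\<close> and \<open>P\<close> below do.\<close>
  have "\<exists>Q P. FArr \<Delta> \<alpha> = ((X (Dom J \<alpha>, 0), E (Dom J \<alpha>, 0)), Q, (X (Cod J \<alpha>, 0), E (Cod J \<alpha>, 0))) \<and>
      src.adj (X (Dom J \<alpha>, 0)) (E (Dom J \<alpha>, 0)) (X (Cod J \<alpha>, 0)) (E (Cod J \<alpha>, 0)) Q P" if \<alpha>: "\<alpha> \<in> Arr J" for \<alpha>
  proof -
    have "FArr \<Delta> \<alpha> \<in> hom (exreg C) (FObj \<Delta> (Dom J \<alpha>)) (FObj \<Delta> (Cod J \<alpha>))" using \<alpha> by (simp add: \<Delta>s)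
    then show ?thesis unfolding XE[of "Dom J \<alpha>" 0] XE[of "Cod J \<alpha>" 0] src.exreg_hom_iff .
  qed
  then obtain Q P where Q0: "\<And>\<alpha>. \<alpha> \<in> Arr J \<Longrightarrow> FArr \<Delta> \<alpha> = ((X (Dom J \<alpha>, 0), E (Dom J \<alpha>, 0)), Q \<alpha>, (X (Cod J \<alpha>, 0), E (Cod J \<alpha>, 0)))"
    and P0: "\<And>\<alpha>. \<alpha> \<in> Arr J \<Longrightarrow> src.adj (X (Dom J \<alpha>, 0)) (E (Dom J \<alpha>, 0)) (X (Cod J \<alpha>, 0)) (E (Cod J \<alpha>, 0)) (Q \<alpha>) (P \<alpha>)" by metis
  have ind: "X (j, x) = X (j, y)" "E (j, x) = E (j, y)" for j x y unfolding X_def E_def by simp_all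
  have Q: "FArr \<Delta> \<alpha> = ((X (Dom J \<alpha>, x), E (Dom J \<alpha>, x)), Q \<alpha>, (X (Cod J \<alpha>, y), E (Cod J \<alpha>, y)))"
    and P: "src.adj (X (Dom J \<alpha>, x)) (E (Dom J \<alpha>, x)) (X (Cod J \<alpha>, y)) (E (Cod J \<alpha>, y)) (Q \<alpha>) (P \<alpha>)" if "\<alpha> \<in> Arr J" for \<alpha> x y
    using Q0[OF that] P0[OF that] unfolding ind[of _ x 0] ind[of _ y 0] .
  \<comment> \<open>The constraints are the cylinder axioms: \<open>?\<Phi>1\<close> is monotonicity
    in the weight, and naturality along an arrow is split into its two inequalities, expressed by
    \<open>Q\<close> in \<open>?\<Phi>2\<close> and by its right adjoint \<open>P\<close> in
    \<open>?\<Phi>3\<close>.\<close>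
  let ?\<Phi>1 = "(\<lambda>(j, x, y). ((j, x), (j, y), E (j, x))) ` {(j, x, y). (j, x) \<in> ?I \<and> (j, y) \<in> ?I \<and> WLe W j x y}"
  let ?A = "Sigma (Arr J) (\<lambda>\<alpha>. WEl W (Dom J \<alpha>))"
  let ?\<Phi>2 = "(\<lambda>(\<alpha>, x). ((Dom J \<alpha>, x), (Cod J \<alpha>, WAct W \<alpha> x), Q \<alpha>)) ` ?A"
  let ?\<Phi>3 = "(\<lambda>(\<alpha>, x). ((Cod J \<alpha>, WAct W \<alpha> x), (Dom J \<alpha>, x), P \<alpha>)) ` ?A"
  let ?\<Phi> = "?\<Phi>1 \<union> ?\<Phi>2 \<union> ?\<Phi>3"
  have "finite {(j, x, y). (j, x) \<in> ?I \<and> (j, y) \<in> ?I \<and> WLe W j x y}"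
  proof (rule finite_subset)
    show "{(j, x, y). (j, x) \<in> ?I \<and> (j, y) \<in> ?I \<and> WLe W j x y} \<subseteq> Sigma (Obj J) (\<lambda>j. WEl W j \<times> WEl W j)" by blast
    show "finite (Sigma (Obj J) (\<lambda>j. WEl W j \<times> WEl W j))" using fin by blast
  qed
  moreover have "finite ?A" using fin Jo(1) by blast
  ultimately have \<Phi>fin: "finite ?\<Phi>" by blast
  have \<Phi>cases: "(\<exists>j x y. i = (j, x) \<and> k = (j, y) \<and> T = E (j, x) \<and> (j, x) \<in> ?I \<and> (j, y) \<in> ?I \<and> WLe W j x y) \<or>
      (\<exists>\<alpha> x. \<alpha> \<in> Arr J \<and> x \<in> WEl W (Dom J \<alpha>) \<and> i = (Dom J \<alpha>, x) \<and> k = (Cod J \<alpha>, WAct W \<alpha> x) \<and> T = Q \<alpha>) \<or>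
      (\<exists>\<alpha> x. \<alpha> \<in> Arr J \<and> x \<in> WEl W (Dom J \<alpha>) \<and> k = (Dom J \<alpha>, x) \<and> i = (Cod J \<alpha>, WAct W \<alpha> x) \<and> T = P \<alpha>)"
    if "(i, k, T) \<in> ?\<Phi>" for i k T
    using that unfolding Un_iff
  proof (elim disjE)
    assume "(i, k, T) \<in> ?\<Phi>1"
    then show ?thesis by - (rule disjI1, auto)
  next
    assume "(i, k, T) \<in> ?\<Phi>2"
    then show ?thesis by - (rule disjI2, rule disjI1, auto)
  next
    assume "(i, k, T) \<in> ?\<Phi>3"
    then show ?thesis by - (rule disjI2, rule disjI2, auto)
  qed
  have \<Phi>I: "(j, x) \<in> ?I \<Longrightarrow> (j, y) \<in> ?I \<Longrightarrow> WLe W j x y \<Longrightarrow> ((j, x), (j, y), E (j, x)) \<in> ?\<Phi>"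
    "\<alpha> \<in> Arr J \<Longrightarrow> x \<in> WEl W (Dom J \<alpha>) \<Longrightarrow> ((Dom J \<alpha>, x), (Cod J \<alpha>, WAct W \<alpha> x), Q \<alpha>) \<in> ?\<Phi>"
    "\<alpha> \<in> Arr J \<Longrightarrow> x \<in> WEl W (Dom J \<alpha>) \<Longrightarrow> ((Cod J \<alpha>, WAct W \<alpha> x), (Dom J \<alpha>, x), P \<alpha>) \<in> ?\<Phi>" for j x y \<alpha>
    by (rule UnI1, rule UnI1, rule image_eqI[of _ _ "(j, x, y)"], simp, simp)
      (rule UnI1, rule UnI2, rule image_eqI[of _ _ "(\<alpha>, x)"], simp, simp,
       rule UnI2, rule image_eqI[of _ _ "(\<alpha>, x)"], simp, simp)
  have \<Phi>rel: "i \<in> ?I \<and> k \<in> ?I \<and> src.is_rel (X i) (X k) T" if "(i, k, T) \<in> ?\<Phi>" for i k T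
  proof -
    consider j x y where "i = (j, x)" "k = (j, y)" "T = E (j, x)" "(j, x) \<in> ?I" "(j, y) \<in> ?I"
      | \<alpha> x where "\<alpha> \<in> Arr J" "x \<in> WEl W (Dom J \<alpha>)" "i = (Dom J \<alpha>, x)" "k = (Cod J \<alpha>, WAct W \<alpha> x)" "T = Q \<alpha>"
      | \<alpha> x where "\<alpha> \<in> Arr J" "x \<in> WEl W (Dom J \<alpha>)" "k = (Dom J \<alpha>, x)" "i = (Cod J \<alpha>, WAct W \<alpha> x)" "T = P \<alpha>"
      using \<Phi>cases[OF \<open>(i, k, T) \<in> ?\<Phi>\<close>] by blast
    then show ?thesis
    proof cases
      case 1
      then show ?thesis using src.cong_rel[OF cXE[OF 1(4)]] ind(1)[of j x y] by simp
    next
      case 2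
      then show ?thesis using src.adj_rel(1)[OF P[OF 2(1)]] act[OF 2(1,2)] Jo[OF 2(1)] by simp
    next
      case 3
      then show ?thesis using src.adj_rel(2)[OF P[OF 3(1)]] act[OF 3(1,2)] Jo[OF 3(1)] by simp
    qed
  qed
  have "\<exists>M \<pi>. M \<in> Obj C \<and> (\<forall>i\<in>?I. \<pi> i \<in> hom C M (X i)) \<and> (\<forall>(i, k, R)\<in>?\<Phi>. in_rel C (\<pi> i) (\<pi> k) R) \<and>
    (\<forall>A a. A \<in> Obj D \<longrightarrow> (\<forall>i\<in>?I. a i \<in> hom D A (FObj F (X i))) \<longrightarrow>
       (\<forall>(i, k, R)\<in>?\<Phi>. in_rel D (a i) (a k) (Fim (X i) (X k) R)) \<longrightarrow>
       (\<exists>u\<in>hom D A (FObj F M). \<forall>i\<in>?I. FArr F (\<pi> i) \<bullet> u = a i))"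
    by (rule generic_solution[OF \<Phi>fin I src.cong_obj[OF cXE] \<Phi>rel])
  then obtain M \<pi> where M0: "M \<in> Obj C" "\<forall>i\<in>?I. \<pi> i \<in> hom C M (X i)" "\<forall>(i, k, R)\<in>?\<Phi>. in_rel C (\<pi> i) (\<pi> k) R"
    "\<forall>A a. A \<in> Obj D \<longrightarrow> (\<forall>i\<in>?I. a i \<in> hom D A (FObj F (X i))) \<longrightarrow>
       (\<forall>(i, k, R)\<in>?\<Phi>. in_rel D (a i) (a k) (Fim (X i) (X k) R)) \<longrightarrow>
       (\<exists>u\<in>hom D A (FObj F M). \<forall>i\<in>?I. FArr F (\<pi> i) \<bullet> u = a i)"
    by (elim exE conjE)
  note M = M0(1) bspec[OF M0(2)] M0(3) and ex' = M0(4)[THEN spec, THEN spec, THEN mp, THEN mp, THEN mp]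
  have M1: "in_rel C (\<pi> (j, x)) (\<pi> (j, y)) (E (j, x))" if "(j, x) \<in> ?I" "(j, y) \<in> ?I" "WLe W j x y" for j x y
    using bspec[OF M(3) \<Phi>I(1)[OF that]] by simp
  have M2: "in_rel C (\<pi> (Dom J \<alpha>, x)) (\<pi> (Cod J \<alpha>, WAct W \<alpha> x)) (Q \<alpha>)"
    and M3: "in_rel C (\<pi> (Cod J \<alpha>, WAct W \<alpha> x)) (\<pi> (Dom J \<alpha>, x)) (P \<alpha>)" if "\<alpha> \<in> Arr J" "x \<in> WEl W (Dom J \<alpha>)" for \<alpha> x
    using bspec[OF M(3) \<Phi>I(2)[OF that]] bspec[OF M(3) \<Phi>I(3)[OF that]] by simp_all
  let ?M = "(M, ident_rel C M)"
  let ?m = "\<lambda>j x. src.hat ?M (X (j, x), E (j, x)) (\<pi> (j, x))"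
  have mcyl: "cylinder J W (exreg C) \<Delta> ?M ?m"
    unfolding cylinder_def
  proof (intro conjI ballI allI)
    show "?M \<in> Obj (exreg C)" unfolding src.exreg_simps using src.cong_ident_rel[OF M(1)] by blast
    show "?m j x \<in> hom (exreg C) ?M (FObj \<Delta> j)" if jx: "j \<in> Obj J" "x \<in> WEl W j" for j x
    proof -
      have i: "(j, x) \<in> ?I" using jx by blast
      show ?thesis unfolding XE[of j x] by (rule src.hat_ident_hom[OF cXE[OF i] M(2)[OF i]])
    qed
    show "monotone_on (WEl W j) (WLe W j) (Le (exreg C)) (?m j)" if j: "j \<in> Obj J" for j
    proof (rule monotone_onI)
      fix x y assume xy: "x \<in> WEl W j" "y \<in> WEl W j" "WLe W j x y"
      have i: "(j, x) \<in> ?I" "(j, y) \<in> ?I" using j xy by blast+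
      have h: "\<pi> (j, y) \<in> hom C M (X (j, x))" using M(2)[OF i(2)] unfolding ind(1)[of j y x] .
      show "?m j x \<sqsubseteq>\<^bsub>exreg C\<^esub> ?m j y"
        unfolding ind[of j y x] src.hat_le_iff[OF cXE[OF i(1)] M(2)[OF i(1)] h] by (rule M1[OF i xy(3)])
    qed
    show "FArr \<Delta> \<alpha> \<cdot>\<^bsub>exreg C\<^esub> ?m i x = ?m j (WAct W \<alpha> x)" if \<alpha>: "\<alpha> \<in> hom J i j" and x: "x \<in> WEl W i" for i j \<alpha> x
    proof -
      have h: "\<alpha> \<in> Arr J" "i = Dom J \<alpha>" "j = Cod J \<alpha>" using \<alpha> by simp_all
      have x': "x \<in> WEl W (Dom J \<alpha>)" using x h by simp
      have i: "(Dom J \<alpha>, x) \<in> ?I" "(Cod J \<alpha>, WAct W \<alpha> x) \<in> ?I" using x' act[OF h(1) x'] Jo[OF h(1)] by blast+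
      show ?thesis unfolding h(2,3) Q[OF h(1), of x "WAct W \<alpha> x"]
        by (rule src.comp_hat_eq[OF P[OF h(1)] M(2)[OF i(1)] M(2)[OF i(2)] M2[OF h(1) x'] M3[OF h(1) x']])
    qed
  qed
  obtain w where w: "w \<in> hom (exreg C) ?M L" "\<forall>j\<in>Obj J. \<forall>x\<in>WEl W j. l j x \<cdot>\<^bsub>exreg C\<^esub> w = ?m j x"
    using univ[OF mcyl] by blast
  have IM: "src.cong M (ident_rel C M)" by (rule src.cong_ident_rel[OF M(1)])
  have bl: "bar_arr (l j x) \<in> hom D (bar_obj L) (bar_obj (X (j, x), E (j, x)))" if "j \<in> Obj J" "x \<in> WEl W j" for j x
    using bar_arr_hom[OF lh[OF that]] unfolding XE[of j x] .
  have factor: "\<exists>u\<in>hom D A (bar_obj L). \<forall>j\<in>Obj J. \<forall>x\<in>WEl W j. bar_arr (l j x) \<bullet> u = c j x"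
    if c: "cylinder J W D (bar \<circ>\<^sub>F \<Delta>) A c" for A c
  proof -
    have A: "A \<in> Obj D" and ch: "\<And>j x. j \<in> Obj J \<Longrightarrow> x \<in> WEl W j \<Longrightarrow> c j x \<in> hom D A (bar_obj (FObj \<Delta> j))"
      and cm: "\<And>j. j \<in> Obj J \<Longrightarrow> monotone_on (WEl W j) (WLe W j) (Le D) (c j)"
      and cn: "\<And>i j \<alpha> x. \<alpha> \<in> hom J i j \<Longrightarrow> x \<in> WEl W i \<Longrightarrow> bar_arr (FArr \<Delta> \<alpha>) \<bullet> c i x = c j (WAct W \<alpha> x)"
      using c unfolding cylinder_def fcomp_def by simp_all
    let ?c = "\<lambda>i. c (fst i) (snd i)"
    have ch': "?c i \<in> hom D A (bar_obj (X i, E i))" if "i \<in> ?I" for i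
      using ch[of "fst i" "snd i"] that XE[of "fst i" "snd i"] by auto
    have "\<exists>B e a. so_mor D e \<and> e \<in> hom D B A \<and>
        (\<forall>i\<in>?I. a i \<in> hom D B (FObj F (X i)) \<and> qm (X i, E i) \<bullet> a i = ?c i \<bullet> e)"
      by (rule lift_family[OF I cXE ch' A])
    then obtain B e a where e: "so_mor D e" "e \<in> hom D B A" and a0: "\<And>i. i \<in> ?I \<Longrightarrow> a i \<in> hom D B (FObj F (X i))"
      and qa: "\<And>i. i \<in> ?I \<Longrightarrow> qm (X i, E i) \<bullet> a i = ?c i \<bullet> e"
      by blast
    \<comment> \<open>Monotonicity of \<open>c\<close> translates through the kernel of the
      quotient. For an arrow, naturality makes the two classes equal, so both inequalities hold by
      reflexivity, and \<open>bar_arr_le_iff\<close> turns them into membership for \<open>Q\<close>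
      and \<open>P\<close>.\<close>
    have sol: "in_rel D (a i) (a k) (Fim (X i) (X k) T)" if "(i, k, T) \<in> ?\<Phi>" for i k T
    proof -
      have act_eq: "bar_arr ((X (Dom J \<alpha>, x), E (Dom J \<alpha>, x)), Q \<alpha>, (X (Cod J \<alpha>, WAct W \<alpha> x), E (Cod J \<alpha>, WAct W \<alpha> x))) \<bullet>
          (qm (X (Dom J \<alpha>, x), E (Dom J \<alpha>, x)) \<bullet> a (Dom J \<alpha>, x)) =
          qm (X (Cod J \<alpha>, WAct W \<alpha> x), E (Cod J \<alpha>, WAct W \<alpha> x)) \<bullet> a (Cod J \<alpha>, WAct W \<alpha> x)"
        (is "?b \<bullet> _ = _")
        and act_I: "(Dom J \<alpha>, x) \<in> ?I" "(Cod J \<alpha>, WAct W \<alpha> x) \<in> ?I"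
        if \<alpha>: "\<alpha> \<in> Arr J" "x \<in> WEl W (Dom J \<alpha>)" for \<alpha> x
      proof -
        show i: "(Dom J \<alpha>, x) \<in> ?I" "(Cod J \<alpha>, WAct W \<alpha> x) \<in> ?I" using \<alpha> act[OF \<alpha>] Jo[OF \<alpha>(1)] by blast+
        have "?b \<bullet> c (Dom J \<alpha>) x = c (Cod J \<alpha>) (WAct W \<alpha> x)"
          using cn[OF Jo(3)[OF \<alpha>(1)] \<alpha>(2)] unfolding Q[OF \<alpha>(1), of x "WAct W \<alpha> x"] .
        then have "?b \<bullet> (c (Dom J \<alpha>) x \<bullet> e) = c (Cod J \<alpha>) (WAct W \<alpha> x) \<bullet> e"
          by (rule tgt.assoc_eq) (use ch'[OF i(1)] bar_arr(1)[OF P[OF \<alpha>(1), of x "WAct W \<alpha> x"]] e(2) in simp_all)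
        then show "?b \<bullet> (qm (X (Dom J \<alpha>, x), E (Dom J \<alpha>, x)) \<bullet> a (Dom J \<alpha>, x)) =
          qm (X (Cod J \<alpha>, WAct W \<alpha> x), E (Cod J \<alpha>, WAct W \<alpha> x)) \<bullet> a (Cod J \<alpha>, WAct W \<alpha> x)"
          unfolding qa[OF i(1)] qa[OF i(2)] fst_conv snd_conv .
      qed
      consider j x y where "i = (j, x)" "k = (j, y)" "T = E (j, x)" "(j, x) \<in> ?I" "(j, y) \<in> ?I" "WLe W j x y"
        | \<alpha> x where "\<alpha> \<in> Arr J" "x \<in> WEl W (Dom J \<alpha>)" "i = (Dom J \<alpha>, x)" "k = (Cod J \<alpha>, WAct W \<alpha> x)" "T = Q \<alpha>"
        | \<alpha> x where "\<alpha> \<in> Arr J" "x \<in> WEl W (Dom J \<alpha>)" "k = (Dom J \<alpha>, x)" "i = (Cod J \<alpha>, WAct W \<alpha> x)" "T = P \<alpha>"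
        using \<Phi>cases[OF \<open>(i, k, T) \<in> ?\<Phi>\<close>] by blast
      then show ?thesis
      proof cases
        case 1
        have jx: "j \<in> Obj J" "x \<in> WEl W j" "y \<in> WEl W j" using 1(4,5) by blast+
        have ay: "a (j, y) \<in> hom D B (FObj F (X (j, x)))" using a0[OF 1(5)] unfolding ind(1)[of j y x] .
        have "c j x \<preceq> c j y" by (rule monotone_onD[OF cm[OF jx(1)] jx(2,3) 1(6)])
        then have "c j x \<bullet> e \<preceq> c j y \<bullet> e"
          by (rule tgt.comp_mono_left) (use ch[OF jx(1,2)] ch[OF jx(1,3)] e(2) in simp_all)
        then have "qm (X (j, x), E (j, x)) \<bullet> a (j, x) \<preceq> qm (X (j, x), E (j, x)) \<bullet> a (j, y)"
          using qa[OF 1(4)] qa[OF 1(5)] unfolding ind[of j y x] by simp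
        then show ?thesis
          unfolding qm_le[OF cXE[OF 1(4)] a0[OF 1(4)] ay] 1(1-3) ind(1)[of j y x] .
      next
        case 2
        note i = act_I[OF 2(1,2)] and p = P[OF 2(1), of x "WAct W \<alpha> x"]
        have "qm (X (Cod J \<alpha>, WAct W \<alpha> x), E (Cod J \<alpha>, WAct W \<alpha> x)) \<bullet> a (Cod J \<alpha>, WAct W \<alpha> x) \<in> Arr D"
          using qm_comp_hom[OF cXE[OF i(2)] a0[OF i(2)]] by simp
        from tgt.le_refl[OF this] show ?thesis
          unfolding 2(3-5) bar_arr_le_iff(1)[OF p a0[OF i(1)] a0[OF i(2)], symmetric] act_eq[OF 2(1,2)] .
      next
        case 3
        note i = act_I[OF 3(1,2)] and p = P[OF 3(1), of x "WAct W \<alpha> x"]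
        have "qm (X (Cod J \<alpha>, WAct W \<alpha> x), E (Cod J \<alpha>, WAct W \<alpha> x)) \<bullet> a (Cod J \<alpha>, WAct W \<alpha> x) \<in> Arr D"
          using qm_comp_hom[OF cXE[OF i(2)] a0[OF i(2)]] by simp
        from tgt.le_refl[OF this] show ?thesis
          unfolding 3(3-5) bar_arr_le_iff(2)[OF p a0[OF i(1)] a0[OF i(2)], symmetric] act_eq[OF 3(1,2)] .
      qed
    qed
    have B: "B \<in> Obj D" using e(2) by auto
    have "\<exists>u\<in>hom D B (FObj F M). \<forall>i\<in>?I. FArr F (\<pi> i) \<bullet> u = a i"
    proof (rule ex'[OF B])
      show "\<forall>(i, k, T)\<in>?\<Phi>. in_rel D (a i) (a k) (Fim (X i) (X k) T)"
      proof
        fix s assume s: "s \<in> ?\<Phi>"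
        obtain i k T where ikT: "s = (i, k, T)" by (cases s)
        show "case s of (i, k, T) \<Rightarrow> in_rel D (a i) (a k) (Fim (X i) (X k) T)"
          unfolding ikT prod.case by (rule sol[OF s[unfolded ikT]])
      qed
    qed (use a0 in blast)
    then obtain u where u: "u \<in> hom D B (FObj F M)" "\<And>i. i \<in> ?I \<Longrightarrow> FArr F (\<pi> i) \<bullet> u = a i" by blast
    let ?q = "qm ?M \<bullet> u"
    have qh: "?q \<in> hom D B (bar_obj ?M)" by (rule qm_comp_hom[OF IM u(1)])
    have bw: "bar_arr w \<in> hom D (bar_obj ?M) (bar_obj L)" by (rule bar_arr_hom[OF w(1)])
    let ?v = "bar_arr w \<bullet> ?q"
    have v: "?v \<in> hom D B (bar_obj L)" using bw qh by simp
    have lv: "bar_arr (l j x) \<bullet> ?v = c j x \<bullet> e" if jx: "j \<in> Obj J" "x \<in> WEl W j" for j x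
    proof -
      have i: "(j, x) \<in> ?I" using jx by blast
      have "bar_arr (l j x \<cdot>\<^bsub>exreg C\<^esub> w) = bar_arr (l j x) \<bullet> bar_arr w"
        by (rule bs(6)) (use lh[OF jx] w(1) in simp_all)
      then have "bar_arr (l j x) \<bullet> ?v = bar_arr (?m j x) \<bullet> ?q"
        using tgt.assoc[of ?q "bar_arr w" "bar_arr (l j x)"] w(2) jx bl[OF jx] bw qh by (simp del: tgt.assoc)
      also have "\<dots> = qm (X (j, x), E (j, x)) \<bullet> (FArr F (\<pi> (j, x)) \<bullet> u)"
        by (rule bar_hat[OF IM cXE[OF i] M(2)[OF i] src.adj_graph_ident[OF cXE[OF i] M(2)[OF i]] u(1)])
      also have "\<dots> = c j x \<bullet> e" unfolding u(2)[OF i] qa[OF i] by simp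
      finally show ?thesis .
    qed
    have de: "Dom D e = B" "Cod D e = A" using e(2) by simp_all
    \<comment> \<open>The candidate \<open>?v\<close> lives on the cover \<open>B\<close>. Composed
      with the cone it is \<open>c j x \<bullet> e\<close>, which depends on an element only through
      \<open>e\<close>; since the image of the cone is jointly order-monic, the same holds for
      \<open>?v\<close>, and descent gives the arrow out of \<open>A\<close>.\<close>
    have ker: "?v \<bullet> s \<preceq> ?v \<bullet> t" if s: "s \<in> hom D T B" and t: "t \<in> hom D T B" and le: "e \<bullet> s \<preceq> e \<bullet> t" for T s t
    proof (rule mono)
      show "?v \<bullet> s \<in> hom D T (bar_obj L)" "?v \<bullet> t \<in> hom D T (bar_obj L)" using v s t by (simp_all del: tgt.assoc)
      fix j x assume jx: "j \<in> Obj J" "x \<in> WEl W j"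
      have cj: "c j x \<in> hom D A (bar_obj (X (j, x), E (j, x)))" using ch[OF jx] unfolding XE[of j x] .
      have eq: "bar_arr (l j x) \<bullet> (?v \<bullet> r) = c j x \<bullet> (e \<bullet> r)" if r: "r \<in> hom D T B" for r
        using tgt.assoc_eq[OF lv[OF jx], of r] v r bl[OF jx] cj e(2) tgt.assoc[of r e "c j x"] by (simp del: tgt.assoc)
      show "bar_arr (l j x) \<bullet> (?v \<bullet> s) \<preceq> bar_arr (l j x) \<bullet> (?v \<bullet> t)"
        unfolding eq[OF s] eq[OF t] by (rule tgt.comp_mono_right[OF le]) (use s t e(2) cj in simp_all)
    qed
    obtain g where g: "g \<in> hom D A (bar_obj L)" "g \<bullet> e = ?v"
      by (rule tgt.so_descent[OF e(1), of ?v "bar_obj L", unfolded de, OF v ker])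
    have "bar_arr (l j x) \<bullet> g = c j x" if jx: "j \<in> Obj J" "x \<in> WEl W j" for j x
    proof -
      have cj: "c j x \<in> hom D A (bar_obj (X (j, x), E (j, x)))" using ch[OF jx] unfolding XE[of j x] .
      have "(bar_arr (l j x) \<bullet> g) \<bullet> e = c j x \<bullet> e"
        using lv[OF jx] g bl[OF jx] e(2) by simp
      then show ?thesis
        by (rule tgt.so_epi[OF e(1), of _ "bar_obj (X (j, x), E (j, x))", unfolded de, rotated 2]) (use g(1) bl[OF jx] cj in simp_all)
    qed
    then show ?thesis using g(1) by blast
  qed
  have "cylinder J W D (bar \<circ>\<^sub>F \<Delta>) (FObj bar L) (\<lambda>j x. FArr bar (l j x))"
    by (rule functor_cylinder[OF ex J bar_functor \<Delta> cyl])
  then show "weighted_limit J W D (bar \<circ>\<^sub>F \<Delta>) (FObj bar L) (\<lambda>j x. FArr bar (l j x))"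
    unfolding weighted_limit_def bar_simps
  proof (intro conjI allI impI ballI)
    show "\<exists>u\<in>hom D A (bar_obj L). \<forall>j\<in>Obj J. \<forall>x\<in>WEl W j. bar_arr (l j x) \<bullet> u = c j x"
      if "cylinder J W D (bar \<circ>\<^sub>F \<Delta>) A c" for A c
      by (rule factor[OF that])
    show "u \<preceq> v" if "u \<in> hom D A (bar_obj L)" "v \<in> hom D A (bar_obj L)"
      "\<forall>j\<in>Obj J. \<forall>x\<in>WEl W j. bar_arr (l j x) \<bullet> u \<preceq> bar_arr (l j x) \<bullet> v" for A u v
      by (rule mono[OF that(1,2)]) (use that(3) in blast)
  qed
qed

lemma bar_regular: "regular_functor (exreg C) D bar"
  unfolding regular_functor_def bar_simps using bar_functor bar_limits bar_so by blast


section \<open>Uniqueness\<close>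

text \<open>\<open>F\<close> turns the trivial congruence into the order of \<open>FObj F X\<close>,
  so the quotient has trivial kernel and is \<open>ff\<close> as well as \<open>so\<close>.\<close>

lemma qm_ident_iso:
  assumes X: "X \<in> Obj C"
  shows "is_iso D (qm (X, ident_rel C X))"
proof (rule tgt.so_ff_iso)
  have I: "src.cong X (ident_rel C X)" by (rule src.cong_ident_rel[OF X])
  note q = qm[OF I]
  show "so_mor D (qm (X, ident_rel C X))" by (rule q(1))
  show "ff_mor D (qm (X, ident_rel C X))"
    unfolding ff_mor_def
  proof (intro conjI allI ballI impI)
    show "qm (X, ident_rel C X) \<in> Arr D" using q(2) by simp
    have d: "Dom D (qm (X, ident_rel C X)) = FObj F X" using q(2) by simp
    fix Z u v assume uv: "u \<in> hom D Z (Dom D (qm (X, ident_rel C X)))" "v \<in> hom D Z (Dom D (qm (X, ident_rel C X)))"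
      and le: "qm (X, ident_rel C X) \<bullet> u \<preceq> qm (X, ident_rel C X) \<bullet> v"
    note uv' = uv[unfolded d]
    show "u \<preceq> v" using le unfolding q(3)[OF uv'] Fim_ident_rel[OF X uv'] .
  qed
qed

text \<open>The comparison is the inverse of the quotient of \<open>FObj F X\<close> by the trivial
  congruence; its naturality is the value of \<open>bar\<close> on \<open>hat\<close> at the generic
  element.\<close>

lemma bar_Gam: "functors_iso C D (bar \<circ>\<^sub>F Gam C) F"
proof -
  let ?q = "\<lambda>X. qm (X, ident_rel C X)" and ?I = "\<lambda>X. (X, ident_rel C X)"
  have "\<exists>r. r \<in> hom D (bar_obj (?I X)) (FObj F X) \<and> is_iso D r \<and> r \<bullet> ?q X = Ident D (FObj F X) \<and>
      ?q X \<bullet> r = Ident D (bar_obj (?I X))" if X: "X \<in> Obj C" for X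
  proof -
    have d: "Dom D (?q X) = FObj F X" using qm(2)[OF src.cong_ident_rel[OF X]] by simp
    show ?thesis using tgt.is_isoE[OF qm_ident_iso[OF X]] unfolding d by metis
  qed
  then obtain r where r: "\<And>X. X \<in> Obj C \<Longrightarrow> r X \<in> hom D (bar_obj (?I X)) (FObj F X)" "\<And>X. X \<in> Obj C \<Longrightarrow> is_iso D (r X)"
    "\<And>X. X \<in> Obj C \<Longrightarrow> r X \<bullet> ?q X = Ident D (FObj F X)" "\<And>X. X \<in> Obj C \<Longrightarrow> ?q X \<bullet> r X = Ident D (bar_obj (?I X))"
    by metis
  have nat: "r Y \<bullet> bar_arr (FArr (Gam C) f) = FArr F f \<bullet> r X" if f: "f \<in> hom C X Y" for f X Y
  proof -
    have o: "X \<in> Obj C" "Y \<in> Obj C" using f by auto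
    note IX = src.cong_ident_rel[OF o(1)] and IY = src.cong_ident_rel[OF o(2)]
    let ?b = "bar_arr (src.hat (?I X) (?I Y) f)"
    note i = F_ident_elem[OF o(1)] and qX = qm(2)[OF IX] and qY = qm(2)[OF IY] and a = src.adj_graph_ident[OF IY f]
    have bh: "?b \<in> hom D (bar_obj (?I X)) (bar_obj (?I Y))" by (rule bar_arr_hom[OF src.hat_ident_hom[OF IY f]])
    have Ff: "FArr F f \<in> hom D (FObj F X) (FObj F Y)" by (rule F_hom[OF f])
    have "?b \<bullet> ?q X = ?q Y \<bullet> FArr F f"
      using bar_hat[OF IX IY f a i] qX Ff by simp
    then have "?b \<bullet> (?q X \<bullet> r X) = (?q Y \<bullet> FArr F f) \<bullet> r X"
      by (rule tgt.assoc_eq) (use bh qX r(1)[OF o(1)] in simp_all)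
    then have "?b = ?q Y \<bullet> (FArr F f \<bullet> r X)"
      using bh qY Ff r(1)[OF o(1)] unfolding r(4)[OF o(1)] by simp
    then have "r Y \<bullet> ?b = FArr F f \<bullet> r X"
      using tgt.assoc_eq[OF r(3)[OF o(2)], of "FArr F f \<bullet> r X"] Ff qY r(1)[OF o(1)] r(1)[OF o(2)] by simp
    then show ?thesis unfolding src.Gam_hat[OF f] .
  qed
  have o: "FObj (bar \<circ>\<^sub>F Gam C) X = bar_obj (?I X)" "FArr (bar \<circ>\<^sub>F Gam C) f = bar_arr (FArr (Gam C) f)" for X f
    by (simp_all add: fcomp_def Gam_def)
  show ?thesis unfolding functors_iso_def o using r(1,2) nat by blast
qed

text \<open>Any regular \<open>H\<close> extending \<open>F\<close> sends \<open>quot X E\<close> to an \<open>so\<close>-morphism, with the same kernel as \<open>qm (X, E)\<close>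
  because \<open>H\<close> preserves the comma object of \<open>quot X E\<close> with itself.\<close>

lemma bar_unique:
  assumes H: "regular_functor (exreg C) D H" and HF: "functors_iso C D (H \<circ>\<^sub>F Gam C) F"
  shows "functors_iso (exreg C) D H bar"
proof -
  let ?I = "\<lambda>X. (X, ident_rel C X)"
  have Hp: "pos_functor (exreg C) D H" and Hl: "preserves_finite_limits (exreg C) D H"
    and Hs: "\<And>e. so_mor (exreg C) e \<Longrightarrow> so_mor D (FArr H e)"
    using H unfolding regular_functor_def by blast+
  note Hsimps = pos_functor_simps[OF Hp]
  have Hh: "FArr H f \<in> hom D (FObj H a) (FObj H b)" if "f \<in> hom (exreg C) a b" for f a b
    using that by (simp add: Hsimps)
  define \<Gamma> where "\<Gamma> X Y f = FArr H (src.hat (?I X) (?I Y) f)" for X Y f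
  have o: "FObj (H \<circ>\<^sub>F Gam C) X = FObj H (?I X)" "FArr (H \<circ>\<^sub>F Gam C) f = FArr H (FArr (Gam C) f)" for X f
    by (simp_all add: fcomp_def Gam_def)
  obtain \<zeta> where "\<forall>X\<in>Obj C. \<zeta> X \<in> hom D (FObj H (?I X)) (FObj F X) \<and> is_iso D (\<zeta> X)"
    and \<zeta>0: "\<forall>X Y. \<forall>f\<in>hom C X Y. \<zeta> Y \<bullet> FArr H (FArr (Gam C) f) = FArr F f \<bullet> \<zeta> X"
    using HF unfolding functors_iso_def o by blast
  then have \<zeta>h: "\<And>X. X \<in> Obj C \<Longrightarrow> \<zeta> X \<in> hom D (FObj H (?I X)) (FObj F X)" and \<zeta>i: "\<And>X. X \<in> Obj C \<Longrightarrow> is_iso D (\<zeta> X)"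
    by blast+
  have \<Gamma>h: "\<Gamma> X Y f \<in> hom D (FObj H (?I X)) (FObj H (?I Y))"
    and \<zeta>n: "\<zeta> Y \<bullet> \<Gamma> X Y f = FArr F f \<bullet> \<zeta> X" if f: "f \<in> hom C X Y" for X Y f
  proof -
    have Y: "Y \<in> Obj C" using f by auto
    show "\<Gamma> X Y f \<in> hom D (FObj H (?I X)) (FObj H (?I Y))"
      unfolding \<Gamma>_def by (rule Hh[OF src.hat_ident_hom[OF src.cong_ident_rel[OF Y] f]])
    have "\<zeta> Y \<bullet> FArr H (FArr (Gam C) f) = FArr F f \<bullet> \<zeta> X" using \<zeta>0 f by blast
    then show "\<zeta> Y \<bullet> \<Gamma> X Y f = FArr F f \<bullet> \<zeta> X" unfolding \<Gamma>_def src.Gam_hat[OF f] .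
  qed
  define p where "p a = FArr H (src.quot (fst a) (snd a))" for a
  have ph: "p (X, E) \<in> hom D (FObj H (?I X)) (FObj H (X, E))" and pso: "so_mor D (p (X, E))" if E: "src.cong X E" for X E
    unfolding p_def using Hh[OF src.quot_hom[OF E]] Hs[OF src.quot_so[OF E]] by simp_all
  have p\<Gamma>: "p (X, E) \<bullet> \<Gamma> T X z = FArr H (src.hat (?I T) (X, E) z)" if E: "src.cong X E" and z: "z \<in> hom C T X" for X E T z
  proof -
    have X: "X \<in> Obj C" by (rule src.cong_obj[OF E])
    have "FArr H (src.quot X E \<cdot>\<^bsub>exreg C\<^esub> src.hat (?I T) (?I X) z) = FArr H (src.quot X E) \<bullet> FArr H (src.hat (?I T) (?I X) z)"
      by (rule Hsimps(6)) (use src.quot_hom[OF E] src.hat_ident_hom[OF src.cong_ident_rel[OF X] z] in simp_all)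
    then show ?thesis unfolding p_def \<Gamma>_def src.quot_hat[OF E z] by simp
  qed
  \<comment> \<open>Forward, the preserved comma object factors the pair through the generic pair of
    \<open>E\<close>, which \<open>\<zeta>\<close> carries from \<open>H\<close> to
    \<open>F\<close>. Backward, \<open>H\<close> is monotone on the inequality that the quotient
    imposes on the generic pair, and \<open>\<zeta>\<close> transports the factorization
    back.\<close>
  have ker: "p (X, E) \<bullet> s \<preceq> p (X, E) \<bullet> t \<longleftrightarrow> in_rel D (\<zeta> X \<bullet> s) (\<zeta> X \<bullet> t) (Fim X X E)"
    if E: "src.cong X E" and s: "s \<in> hom D A (FObj H (?I X))" and t: "t \<in> hom D A (FObj H (?I X))" for X E A s t
  proof
    have X: "X \<in> Obj C" by (rule src.cong_obj[OF E])
    note rE = src.cong_rel[OF E] and zX = \<zeta>h[OF X]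
    assume le: "p (X, E) \<bullet> s \<preceq> p (X, E) \<bullet> t"
    obtain T e0 e1 where e: "e0 \<in> hom C T X" "e1 \<in> hom C T X" "jointly_order_mono C e0 e1" "in_rel C e0 e1 E"
      and u: "\<And>A x y. \<lbrakk>x \<in> hom C A X; y \<in> hom C A X; in_rel C x y E\<rbrakk> \<Longrightarrow> \<exists>u\<in>hom C A T. e0 \<cdot>\<^bsub>C\<^esub> u = x \<and> e1 \<cdot>\<^bsub>C\<^esub> u = y"
      by (rule src.rel_generic_span[OF rE]) blast
    have T: "T \<in> Obj C" using e by auto
    have qa: "src.quot X E \<in> Arr (exreg C)" using src.quot_hom[OF E] by simp
    have "is_comma D (p (X, E)) (p (X, E)) (\<Gamma> T X e0) (\<Gamma> T X e1)"
      using preserves_comma[OF src.pos_category_exreg tgt.pos_category_axioms Hp Hl qa qa refl src.quot_comma[OF E e u]]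
      unfolding p_def \<Gamma>_def by simp
    moreover have "s \<in> hom D A (Dom D (p (X, E)))" "t \<in> hom D A (Dom D (p (X, E)))" using s t ph[OF E] by simp_all
    ultimately obtain w where "w \<in> hom D A (Dom D (\<Gamma> T X e0))" and w2: "\<Gamma> T X e0 \<bullet> w = s" "\<Gamma> T X e1 \<bullet> w = t"
      using tgt.is_commaE le by metis
    then have w: "w \<in> hom D A (FObj H (?I T))" using \<Gamma>h[OF e(1)] by simp
    have "\<zeta> X \<bullet> (\<Gamma> T X ei \<bullet> w) = FArr F ei \<bullet> (\<zeta> T \<bullet> w)" if ei: "ei \<in> hom C T X" for ei
      using tgt.assoc_eq[OF \<zeta>n[OF ei], of w] \<Gamma>h[OF ei] w zX \<zeta>h[OF T] F_hom[OF ei] by simp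
    moreover have "\<zeta> T \<bullet> w \<in> hom D A (FObj F T)" using \<zeta>h[OF T] w by simp
    ultimately show "in_rel D (\<zeta> X \<bullet> s) (\<zeta> X \<bullet> t) (Fim X X E)"
      using Fim_arr_comp[OF rE e(1,2,4)] e(1,2) unfolding w2[symmetric] by simp
  next
    have X: "X \<in> Obj C" by (rule src.cong_obj[OF E])
    note rE = src.cong_rel[OF E] and zX = \<zeta>h[OF X]
    have zs: "\<zeta> X \<bullet> s \<in> hom D A (FObj F X)" "\<zeta> X \<bullet> t \<in> hom D A (FObj F X)" using zX s t by simp_all
    assume i: "in_rel D (\<zeta> X \<bullet> s) (\<zeta> X \<bullet> t) (Fim X X E)"
    obtain T r0 r1 where r: "r0 \<in> hom C T X" "r1 \<in> hom C T X" "in_rel C r0 r1 E"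
      and ir: "\<And>A x y. \<lbrakk>x \<in> hom D A (FObj F X); y \<in> hom D A (FObj F X)\<rbrakk> \<Longrightarrow> in_rel D x y (Fim X X E) \<longleftrightarrow>
        (\<exists>u\<in>hom D A (FObj F T). FArr F r0 \<bullet> u = x \<and> FArr F r1 \<bullet> u = y)" by (rule Fim_span[OF rE]) blast
    obtain u where u: "u \<in> hom D A (FObj F T)" "FArr F r0 \<bullet> u = \<zeta> X \<bullet> s" "FArr F r1 \<bullet> u = \<zeta> X \<bullet> t"
      using i unfolding ir[OF zs] by blast
    have T: "T \<in> Obj C" using r by auto
    obtain k where k: "k \<in> hom D (FObj F X) (FObj H (?I X))" "k \<bullet> \<zeta> X = Ident D (FObj H (?I X))"
      using tgt.is_isoE[OF \<zeta>i[OF X]] zX by (metis in_hom_iff)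
    obtain m where m: "m \<in> hom D (FObj F T) (FObj H (?I T))" "\<zeta> T \<bullet> m = Ident D (FObj F T)"
      using tgt.is_isoE[OF \<zeta>i[OF T]] \<zeta>h[OF T] by (metis in_hom_iff)
    have mu: "m \<bullet> u \<in> hom D A (FObj H (?I T))" using m(1) u(1) by simp
    have \<Gamma>m: "\<Gamma> T X ri \<bullet> (m \<bullet> u) = v"
      if ri: "ri \<in> hom C T X" and v: "v \<in> hom D A (FObj H (?I X))" and eq: "FArr F ri \<bullet> u = \<zeta> X \<bullet> v" for ri v
    proof -
      have "\<zeta> X \<bullet> (\<Gamma> T X ri \<bullet> (m \<bullet> u)) = FArr F ri \<bullet> (\<zeta> T \<bullet> (m \<bullet> u))"
        using tgt.assoc_eq[OF \<zeta>n[OF ri], of "m \<bullet> u"] \<Gamma>h[OF ri] mu zX \<zeta>h[OF T] F_hom[OF ri] by simp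
      also have "\<zeta> T \<bullet> (m \<bullet> u) = u" using tgt.assoc_eq[OF m(2), of u] m(1) u(1) \<zeta>h[OF T] by simp
      finally have z: "\<zeta> X \<bullet> (\<Gamma> T X ri \<bullet> (m \<bullet> u)) = \<zeta> X \<bullet> v" unfolding eq .
      have gh: "\<Gamma> T X ri \<bullet> (m \<bullet> u) \<in> hom D A (FObj H (?I X))" using \<Gamma>h[OF ri] mu by simp
      have "k \<bullet> (\<zeta> X \<bullet> x) = x" if "x \<in> hom D A (FObj H (?I X))" for x
        using tgt.assoc_eq[OF k(2), of x] that k(1) zX by simp
      from this[OF gh] this[OF v] show ?thesis unfolding z by simp
    qed
    have lh: "FArr H (src.hat (?I T) (X, E) r0) \<preceq> FArr H (src.hat (?I T) (X, E) r1)"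
    proof (rule Hsimps(7))
      show "src.hat (?I T) (X, E) r0 \<sqsubseteq>\<^bsub>exreg C\<^esub> src.hat (?I T) (X, E) r1" unfolding src.hat_le_iff[OF E r(1,2)] by (rule r(3))
    qed (use src.hat_ident_hom[OF E r(1)] src.hat_ident_hom[OF E r(2)] in simp_all)
    have "(p (X, E) \<bullet> \<Gamma> T X r0) \<bullet> (m \<bullet> u) \<preceq> (p (X, E) \<bullet> \<Gamma> T X r1) \<bullet> (m \<bullet> u)"
      unfolding p\<Gamma>[OF E r(1)] p\<Gamma>[OF E r(2)]
      by (rule tgt.comp_mono_left[OF lh]) (use Hh[OF src.hat_ident_hom[OF E r(1)]] Hh[OF src.hat_ident_hom[OF E r(2)]] mu in \<open>simp_all del: tgt.assoc\<close>)
    moreover have "(p (X, E) \<bullet> \<Gamma> T X ri) \<bullet> (m \<bullet> u) = p (X, E) \<bullet> (\<Gamma> T X ri \<bullet> (m \<bullet> u))" if "ri \<in> hom C T X" for ri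
      by (rule tgt.assoc) (use mu ph[OF E] \<Gamma>h[OF that] in simp_all)
    ultimately show "p (X, E) \<bullet> s \<preceq> p (X, E) \<bullet> t"
      using r(1,2) \<Gamma>m[OF r(1) s u(2)] \<Gamma>m[OF r(2) t u(3)] by simp
  qed
  \<comment> \<open>Up to the isomorphism \<open>\<zeta> X\<close>, the two
    \<open>so\<close>-morphisms \<open>p (X, E)\<close> and \<open>qm (X, E)\<close> have the same
    kernel. Descent gives one comparison arrow, which is \<open>so\<close> by cancellation and
    \<open>ff\<close> because kernels agree on lifts.\<close>
  have "\<exists>\<theta>. \<theta> \<in> hom D (FObj H (X, E)) (bar_obj (X, E)) \<and> is_iso D \<theta> \<and> \<theta> \<bullet> p (X, E) = qm (X, E) \<bullet> \<zeta> X"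
    if E: "src.cong X E" for X E
  proof -
    have X: "X \<in> Obj C" by (rule src.cong_obj[OF E])
    note q = qm[OF E] and P = ph[OF E] and zX = \<zeta>h[OF X]
    let ?p = "p (X, E)" and ?q = "qm (X, E)"
    have dp: "Dom D ?p = FObj H (?I X)" "Cod D ?p = FObj H (X, E)" using P by simp_all
    have qz: "?q \<bullet> \<zeta> X \<in> hom D (FObj H (?I X)) (bar_obj (X, E))" using q(2) zX by simp
    have zs: "\<zeta> X \<bullet> s \<in> hom D A (FObj F X)" if "s \<in> hom D A (FObj H (?I X))" for s A using zX that by simp
    have qzs: "(?q \<bullet> \<zeta> X) \<bullet> s = ?q \<bullet> (\<zeta> X \<bullet> s)" if "s \<in> hom D A (FObj H (?I X))" for s A using zX q(2) that by simp
    have k: "(?q \<bullet> \<zeta> X) \<bullet> s \<preceq> (?q \<bullet> \<zeta> X) \<bullet> t \<longleftrightarrow> ?p \<bullet> s \<preceq> ?p \<bullet> t"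
      if st: "s \<in> hom D A (FObj H (?I X))" "t \<in> hom D A (FObj H (?I X))" for s t A
      unfolding ker[OF E st] qzs[OF st(1)] qzs[OF st(2)] q(3)[OF zs[OF st(1)] zs[OF st(2)]] ..
    obtain \<theta> where \<theta>: "\<theta> \<in> hom D (FObj H (X, E)) (bar_obj (X, E))" "\<theta> \<bullet> ?p = ?q \<bullet> \<zeta> X"
      by (rule tgt.so_descent[OF pso[OF E], of "?q \<bullet> \<zeta> X" "bar_obj (X, E)", unfolded dp, OF qz iffD2[OF k]])
    have "so_mor D (?q \<bullet> \<zeta> X)"
      by (rule tgt.so_mor_comp[OF tgt.so_mor_iso[OF \<zeta>i[OF X]] q(1)]) (use zX q(2) in simp)
    then have so: "so_mor D \<theta>" unfolding \<theta>(2)[symmetric] by (rule tgt.so_mor_cancel) (use \<theta>(1) P in simp_all)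
    have "ff_mor D \<theta>"
      unfolding ff_mor_def
    proof (intro conjI allI ballI impI)
      show "\<theta> \<in> Arr D" using \<theta>(1) by simp
      fix A u v assume "u \<in> hom D A (Dom D \<theta>)" "v \<in> hom D A (Dom D \<theta>)" and le: "\<theta> \<bullet> u \<preceq> \<theta> \<bullet> v"
      then have u: "u \<in> hom D A (Cod D ?p)" and v: "v \<in> hom D A (Cod D ?p)" using \<theta>(1) dp by simp_all
      obtain B1 e1 s1 where e1: "so_mor D e1" "e1 \<in> hom D B1 A" "s1 \<in> hom D B1 (Dom D ?p)" "?p \<bullet> s1 = u \<bullet> e1"
        by (rule tgt.so_pullback_lift[OF pso[OF E] u])
      have "v \<bullet> e1 \<in> hom D B1 (Cod D ?p)" using v e1(2) by simp
      then obtain B e2 t where e2: "so_mor D e2" "e2 \<in> hom D B B1" "t \<in> hom D B (Dom D ?p)" "?p \<bullet> t = (v \<bullet> e1) \<bullet> e2"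
        by (rule tgt.so_pullback_lift[OF pso[OF E]])
      let ?e = "e1 \<bullet> e2" and ?s = "s1 \<bullet> e2"
      note e = tgt.so_cover_comp[OF e1(1,2) e2(1,2)]
      have st: "?s \<in> hom D B (FObj H (?I X))" "t \<in> hom D B (FObj H (?I X))" using e1(3) e2(2,3) dp by simp_all
      have ps: "?p \<bullet> ?s = u \<bullet> ?e" and pt: "?p \<bullet> t = v \<bullet> ?e"
        using tgt.assoc_eq[OF e1(4), of e2] e1(2,3) e2 u v P by simp_all
      have "(\<theta> \<bullet> u) \<bullet> ?e \<preceq> (\<theta> \<bullet> v) \<bullet> ?e"
        by (rule tgt.comp_mono_left[OF le]) (use \<theta>(1) u v e(2) dp in \<open>simp_all del: tgt.assoc\<close>)
      then have "\<theta> \<bullet> (?p \<bullet> ?s) \<preceq> \<theta> \<bullet> (?p \<bullet> t)"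
        unfolding ps pt using tgt.assoc[of ?e u \<theta>] tgt.assoc[of ?e v \<theta>] \<theta>(1) u v e(2) dp by (simp del: tgt.assoc)
      moreover have "\<theta> \<bullet> (?p \<bullet> x) = (?q \<bullet> \<zeta> X) \<bullet> x" if "x \<in> hom D B (FObj H (?I X))" for x
        by (rule tgt.assoc_eq[OF \<theta>(2)]) (use \<theta>(1) P that in simp_all)
      ultimately have "?p \<bullet> ?s \<preceq> ?p \<bullet> t" using k[OF st] st by simp
      then have uv: "u \<bullet> ?e \<preceq> v \<bullet> ?e" unfolding ps pt .
      show "u \<preceq> v" by (rule tgt.so_order_epi[OF e(1) _ _ uv]) (use u v e(2) in simp_all)
    qed
    then show ?thesis using tgt.so_ff_iso[OF so] \<theta> by blast
  qed
  then obtain \<theta> where \<theta>: "\<And>X E. src.cong X E \<Longrightarrow> \<theta> (X, E) \<in> hom D (FObj H (X, E)) (bar_obj (X, E))"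
    "\<And>X E. src.cong X E \<Longrightarrow> is_iso D (\<theta> (X, E))"
    "\<And>X E. src.cong X E \<Longrightarrow> \<theta> (X, E) \<bullet> p (X, E) = qm (X, E) \<bullet> \<zeta> X"
  proof -
    assume ex: "\<And>X E. src.cong X E \<Longrightarrow> \<exists>\<theta>. \<theta> \<in> hom D (FObj H (X, E)) (bar_obj (X, E)) \<and> is_iso D \<theta> \<and>
      \<theta> \<bullet> p (X, E) = qm (X, E) \<bullet> \<zeta> X"
    \<comment> \<open>The choice is made over the pair \<open>a\<close>, so that
      \<open>\<theta>\<close> is a single function on objects as \<open>functors_iso\<close>
      requires.\<close>
    let ?P = "\<lambda>a \<theta>. \<theta> \<in> hom D (FObj H a) (bar_obj a) \<and> is_iso D \<theta> \<and> \<theta> \<bullet> p a = qm a \<bullet> \<zeta> (fst a)"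
    assume thesis: "\<And>\<theta>. (\<And>X E. src.cong X E \<Longrightarrow> \<theta> (X, E) \<in> hom D (FObj H (X, E)) (bar_obj (X, E))) \<Longrightarrow>
      (\<And>X E. src.cong X E \<Longrightarrow> is_iso D (\<theta> (X, E))) \<Longrightarrow>
      (\<And>X E. src.cong X E \<Longrightarrow> \<theta> (X, E) \<bullet> p (X, E) = qm (X, E) \<bullet> \<zeta> X) \<Longrightarrow> thesis"
    have "?P (X, E) (SOME \<theta>. ?P (X, E) \<theta>)" if "src.cong X E" for X E
      by (rule someI_ex) (use ex[OF that] in \<open>simp only: fst_conv\<close>)
    then show thesis by (intro thesis[of "\<lambda>a. SOME \<theta>. ?P a \<theta>"]) (simp_all only: fst_conv)
  qed
  have nat: "\<theta> (Y, G) \<bullet> FArr H ((X, E), R, (Y, G)) = bar_arr ((X, E), R, (Y, G)) \<bullet> \<theta> (X, E)"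
    if a: "src.adj X E Y G R S" for X E Y G R S
  proof -
    let ?f = "((X, E), R, (Y, G))"
    note E = src.adj_cong(1)[OF a] and G = src.adj_cong(2)[OF a] and r = src.adj_rel[OF a]
    have oX: "X \<in> Obj C" and oY: "Y \<in> Obj C" using src.cong_obj E G by blast+
    have fh: "?f \<in> hom (exreg C) (X, E) (Y, G)" unfolding src.exreg_hom_iff using a by blast
    obtain T v0 v1 where v: "v0 \<in> hom C T X" "v1 \<in> hom C T Y" "in_rel C v0 v1 R" "in_rel C v1 v0 S" "so_mor C v0"
      by (rule src.adj_val_span[OF a]) blast
    have oT: "T \<in> Obj C" using v by auto
    note zX = \<zeta>h[OF oX] and zY = \<zeta>h[OF oY] and zT = \<zeta>h[OF oT] and P = ph[OF E] and P' = ph[OF G] and q = qm[OF E] and q' = qm[OF G]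
      and g0 = \<Gamma>h[OF v(1)] and g1 = \<Gamma>h[OF v(2)] and F0 = F_hom[OF v(1)] and F1 = F_hom[OF v(2)] and b = bar_arr(1)[OF a]
      and t = \<theta>(1)[OF E] and t' = \<theta>(1)[OF G] and Hf = Hh[OF fh]
    let ?g0 = "\<Gamma> T X v0" and ?g1 = "\<Gamma> T Y v1"
    have pg: "p (X, E) \<bullet> ?g0 \<in> hom D (FObj H (?I T)) (FObj H (X, E))" using P g0 by simp
    obtain k where k: "k \<in> hom D (FObj F X) (FObj H (?I X))" "k \<bullet> \<zeta> X = Ident D (FObj H (?I X))" "is_iso D k"
      using tgt.is_isoE[OF \<zeta>i[OF oX]] zX by (metis in_hom_iff)
    \<comment> \<open>Naturality exhibits \<open>?g0\<close> as \<open>FArr F v0\<close> composed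
      with isomorphisms on both sides, so it is \<open>so\<close> because \<open>v0\<close>
      is.\<close>
    have "k \<bullet> (FArr F v0 \<bullet> \<zeta> T) = ?g0"
      unfolding \<zeta>n[OF v(1), symmetric] using tgt.assoc_eq[OF k(2), of ?g0] k(1) zX g0 by simp
    moreover have "so_mor D (FArr F v0 \<bullet> \<zeta> T)"
      by (rule tgt.so_mor_comp[OF tgt.so_mor_iso[OF \<zeta>i[OF oT]] F_so[OF v(5)]]) (use zT F0 in simp)
    ultimately have "so_mor D ?g0"
      using tgt.so_mor_comp[of "FArr F v0 \<bullet> \<zeta> T" k] tgt.so_mor_iso[OF k(3)] k(1) zT F0 by simp
    then have so: "so_mor D (p (X, E) \<bullet> ?g0)"
      by (rule tgt.so_mor_comp[OF _ pso[OF E]]) (use g0 P in simp)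
    have "FArr H (?f \<cdot>\<^bsub>exreg C\<^esub> src.hat (?I T) (X, E) v0) = FArr H ?f \<bullet> FArr H (src.hat (?I T) (X, E) v0)"
      by (rule Hsimps(6)) (use fh src.hat_ident_hom[OF E v(1)] in simp_all)
    then have 1: "FArr H ?f \<bullet> (p (X, E) \<bullet> ?g0) = p (Y, G) \<bullet> ?g1"
      unfolding src.comp_hat_eq[OF a v(1-4)] p\<Gamma>[OF E v(1)] p\<Gamma>[OF G v(2)] by simp
    have 2: "bar_arr ?f \<bullet> (qm (X, E) \<bullet> FArr F v0) = qm (Y, G) \<bullet> FArr F v1"
      by (rule bar_arr_val[OF a F0 F1 Fim_arr[OF r(1) v(1,2,3)] Fim_arr[OF r(2) v(2,1,4)]])
    \<comment> \<open>Both sides of the naturality square are compared on the cover given by the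
      span of values: there \<open>H\<close> and \<open>bar\<close> act by passing from
      \<open>v0\<close> to \<open>v1\<close>, and \<open>\<zeta>\<close> relates the two
      computations.\<close>
    have "(\<theta> (Y, G) \<bullet> FArr H ?f) \<bullet> (p (X, E) \<bullet> ?g0) = \<theta> (Y, G) \<bullet> (p (Y, G) \<bullet> ?g1)"
      unfolding 1[symmetric] by (rule tgt.assoc) (use pg Hf t' in simp_all)
    also have "\<dots> = (qm (Y, G) \<bullet> \<zeta> Y) \<bullet> ?g1"
      by (rule tgt.assoc_eq[OF \<theta>(3)[OF G]]) (use P' t' g1 in simp_all)
    also have "\<dots> = (qm (Y, G) \<bullet> FArr F v1) \<bullet> \<zeta> T"
      using \<zeta>n[OF v(2)] q'(2) zY g1 F1 zT by simp
    also have "\<dots> = bar_arr ?f \<bullet> (qm (X, E) \<bullet> (FArr F v0 \<bullet> \<zeta> T))"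
      unfolding 2[symmetric] using b q(2) F0 zT by simp
    also have "\<dots> = bar_arr ?f \<bullet> ((\<theta> (X, E) \<bullet> p (X, E)) \<bullet> ?g0)"
      unfolding \<zeta>n[OF v(1), symmetric] \<theta>(3)[OF E] using q(2) zX g0 by simp
    also have "\<dots> = (bar_arr ?f \<bullet> \<theta> (X, E)) \<bullet> (p (X, E) \<bullet> ?g0)" using b t P g0 by simp
    finally have eq: "(\<theta> (Y, G) \<bullet> FArr H ?f) \<bullet> (p (X, E) \<bullet> ?g0) = (bar_arr ?f \<bullet> \<theta> (X, E)) \<bullet> (p (X, E) \<bullet> ?g0)" .
    show ?thesis
      by (rule tgt.so_epi[OF so _ _ eq, of "bar_obj (Y, G)"]) (use pg t t' b Hf in simp_all)
  qed
  show ?thesis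
    unfolding functors_iso_def bar_simps
  proof (intro exI[of _ \<theta>] conjI ballI allI)
    fix a assume "a \<in> Obj (exreg C)"
    then obtain X E where a: "a = (X, E)" "src.cong X E" unfolding src.exreg_simps by blast
    show "\<theta> a \<in> hom D (FObj H a) (bar_obj a)" "is_iso D (\<theta> a)" unfolding a(1) by (rule \<theta>(1)[OF a(2)], rule \<theta>(2)[OF a(2)])
  next
    fix a b f assume f: "f \<in> hom (exreg C) a b"
    obtain X E Y G R S where fR: "a = (X, E)" "b = (Y, G)" "f = ((X, E), R, (Y, G))" "src.adj X E Y G R S"
      using f by (rule src.exreg_homE)
    show "\<theta> b \<bullet> FArr H f = bar_arr f \<bullet> \<theta> a" unfolding fR(1-3) by (rule nat[OF fR(4)])
  qed
qed

end

theorem theorem4p19: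
  fixes E :: "('o, 'm) pcat" and \<F> :: "('p, 'n) pcat" and F :: "('o, 'm, 'p, 'n) pfun"
  assumes "regular_cat E"
    and "exact_cat \<F>"
    and "regular_functor E \<F> F"
  shows "\<exists>F'. regular_functor (exreg E) \<F> F' \<and> functors_iso E \<F> (F' \<circ>\<^sub>F Gam E) F \<and>
           (\<forall>G. regular_functor (exreg E) \<F> G \<and> functors_iso E \<F> (G \<circ>\<^sub>F Gam E) F \<longrightarrow>
                functors_iso (exreg E) \<F> G F')"
proof -
  have "regular_category E" "regular_category \<F>"
    using assms(1,2) by (simp_all add: regular_categoryI exact_cat_def)
  then interpret exact_functor_pair E \<F> F
    using assms(2,3)
    by (simp add: exact_functor_pair_def exact_functor_pair_axioms_def regular_functor_pair_def regular_functor_pair_axioms_def)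
  show ?thesis using bar_regular bar_Gam bar_unique by blast
qed

end
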